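(* Let $\alpha$ be a positive real algebraic irrational number and let $b\geq 2$ be an integer. Then $\alpha$ is normal to base $b$ if and only if for every integer $k\geq 0$, \[ \lim_{N\to \infty}\frac{1}{\log N} \sum_{1\leq |n|\leq N} \zeta\left(-k+\frac{2\pi in}{\log b}\right) \frac{e^{2\pi i n \log \alpha /\log b}}{n^{k+1}}= 0, \] where $n$ runs over integers and $N$ over positive integers.
   Context: $\zeta$ is the Riemann zeta function (analytically continued). For a positive irrational number $x$ and an integer $b\ge 2$, let $x=\sum_{i=-m}^\infty c_i b^{-i}$ be the $b$-adic expansion of $x$, with digits $c_i\in\{0,1,\ldots,b-1\}$. For $l\in\mathbb{Z}_{\ge 0}$ and $a\in\{0,\ldots,b-1\}$ put $A_b(l;a,x)=\#\{i\in[0,l]: c_i=a\}$. The number $x$ is simply normal to base $b$ if $\lim_{l\to\infty}A_b(l;a,x)/l=1/b$ for all $a\in\{0,1,\ldots,b-1\}$. The number $x$ is normal to base $b$ if it is simply normal to base $b^k$ for every integer $k\ge 1$. *)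

theory Defs
  imports "HOL-Complex_Analysis.Complex_Analysis" "HOL-Computational_Algebra.Computational_Algebra"
begin

(* The Riemann zeta function as the analytic continuation of its Dirichlet series to the plane
   without the pole 1. By the identity theorem this determines every value except the one at 1,
   which is left arbitrary. *)
definition zeta :: "complex \<Rightarrow> complex" where
  "zeta = (SOME f. f holomorphic_on (- {1}) \<and>
     (\<forall>s. 1 < Re s \<longrightarrow> (\<lambda>n. 1 / of_nat (Suc n) powr s) sums f s))"

(* x is the sum of c i * b^(-i) over all i >= -m; the summation index is j = i + m.
   Digits with i < -m are irrelevant. *)
definition adic_expansion :: "nat \<Rightarrow> real \<Rightarrow> nat \<Rightarrow> (int \<Rightarrow> nat) \<Rightarrow> bool" where
  "adic_expansion b x m c \<longleftrightarrow>
     (\<forall>i \<ge> - int m. c i < b) \<and>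
     (\<lambda>j. real (c (int j - int m)) * real b powi (- (int j - int m))) sums x"

definition digit_count :: "(int \<Rightarrow> nat) \<Rightarrow> nat \<Rightarrow> nat \<Rightarrow> nat" where
  "digit_count c l a = card {i \<in> {0..int l}. c i = a}"

(* Meant for positive irrational x and b >= 2. The expansion is then unique (up to leading zeros),
   so the existential quantifier merely names its digits. *)
definition simply_normal :: "nat \<Rightarrow> real \<Rightarrow> bool" where
  "simply_normal b x \<longleftrightarrow>
     (\<exists>m c. adic_expansion b x m c \<and>
        (\<forall>a<b. (\<lambda>l. real (digit_count c l a) / real l) \<longlonglongrightarrow> 1 / real b))"

definition normal_to_base :: "nat \<Rightarrow> real \<Rightarrow> bool" where
  "normal_to_base b x \<longleftrightarrow> (\<forall>k\<ge>1. simply_normal (b ^ k) x)"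

end

theory Submission
  imports Defs "HOL-Real_Asymp.Real_Asymp"
begin

text \<open>
  Let \<open>P k\<close> be the 1-periodic Bernoulli function \<open>B_k({x}) / k!\<close> (\<open>pbern k\<close> below), and write
  \<open>\<alpha> = a * b ^ r\<close> with \<open>0 < a \<le> 1\<close>. By Euler-Maclaurin summation, zeta on the line
  \<open>Re s = - k\<close> is the Mellin transform of \<open>P (k + 1)\<close>, up to an elementary regularisation at the
  origin that is negligible here. At \<open>s = - k + 2 pi i n / log b\<close> the Mellin integral
  splits into pieces of multiplicative length \<open>b\<close>, so that each summand becomes a sum over the scales \<open>j\<close>
  of the \<open>n\<close>-th Fourier coefficients of \<open>u \<mapsto> P (k + 1) (a * b ^ (j + u))\<close>, and summation over
  \<open>1 \<le> \<bar>n\<bar> \<le> N\<close> produces the Dirichlet kernel. Scales with \<open>b ^ j\<close> well below \<open>N\<close> contribute almost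
  \<open>P (k + 1) (a * b ^ j)\<close>, scales well above \<open>N\<close> contribute almost nothing, and the transition range has only
  \<open>O(log log N)\<close> scales, each contributing \<open>O((log N) powr (3/4))\<close> by a second derivative test. Up to
  a nonzero factor, the limit for \<open>k\<close> is therefore the limit of the averages of \<open>P (k + 1)\<close> along the
  orbit \<open>b ^ j * \<alpha>\<close>; for the discontinuous sawtooth \<open>P 1\<close> one also needs that this orbit is rarely close
  to an integer, which normality provides.

  Normality makes the averages of all polynomials in the fractional part converge to their integrals, and
  the \<open>P k\<close> have mean zero. Conversely, every polynomial \<open>p\<close> with \<open>p 0 = p 1\<close> is a constant plus a
  combination of the \<open>P k\<close> with \<open>k \<ge> 2\<close>, so by Weierstrass approximation all exponential averages vanish.
  A mean square argument carries this over to the orbit under \<open>b ^ r\<close>, which is therefore equidistributed.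
\<close>

section \<open>Oscillatory integrals\<close>

text \<open>The Dirichlet kernel has an integral norm of order \<open>log N\<close>, so a trivial
  estimate of the transition scales gives \<open>log N * log log N\<close>, more than the division
  by \<open>log N\<close> absorbs. Hence the Fourier series of \<open>P k\<close> is cut at
  \<open>H\<close> modes: against the kernel a mode costs \<open>O(1)\<close>, uniformly in
  \<open>N\<close> and the scale, and the remainder, small in mean, costs
  \<open>log N / sqrt H\<close>. With \<open>H\<close> near \<open>sqrt (log N)\<close> this leaves
  the exponent \<open>3/4\<close>. The power of \<open>n\<close> in the statement cancels the
  Pochhammer symbol from Euler-Maclaurin summation only to leading order. The relative error
  \<open>O(1/n)\<close> is harmless: for \<open>k \<ge> 1\<close> its cofactor tends to
  \<open>0\<close>, and for \<open>k = 0\<close> there is no error. Summing \<open>n\<close>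
  together with \<open>- n\<close> keeps the contribution of the origin bounded. The normalisation
  \<open>a \<le> 1\<close> is free, since a power of \<open>b\<close> changes no summand; it places
  the lower end of the first piece below \<open>1\<close>, where \<open>P k\<close> is a polynomial
  and can be integrated formally down to the origin.\<close>

lemma norm_integral_decreasing_weight_le:
  fixes f :: "real \<Rightarrow> 'a::euclidean_space" and w w' :: "real \<Rightarrow> real"
  assumes pq: "p \<le> q" and f: "continuous_on {p..q} f"
    and w: "\<And>x. x \<in> {p..q} \<Longrightarrow> (w has_real_derivative w' x) (at x)"
    and w': "\<And>x. x \<in> {p..q} \<Longrightarrow> w' x \<le> 0" and wq: "w q \<ge> 0"
    and B: "\<And>x. x \<in> {p..q} \<Longrightarrow> norm (integral {p..x} f) \<le> B"
  shows "norm (integral {p..q} (\<lambda>x. w x *\<^sub>R f x)) \<le> B * w p"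
proof -
  define F where "F x = integral {p..x} f" for x
  have wd: "(w has_vector_derivative w' x) (at x within {p..q})" if "x \<in> {p..q}" for x
    using w[OF that] has_real_derivative_iff_has_vector_derivative has_vector_derivative_at_within by blast
  have dF: "(F has_vector_derivative f x) (at x within {p..q})" if "x \<in> {p..q}" for x
    unfolding F_def using integral_has_vector_derivative[OF f that] .
  have wc: "continuous_on {p..q} w"
    using wd by (meson continuous_on_eq_continuous_within has_vector_derivative_continuous)
  have i1: "(\<lambda>x. w x *\<^sub>R f x) integrable_on {p..q}"
    by (intro integrable_continuous_interval continuous_intros wc f)
  have ftc: "((\<lambda>x. w x *\<^sub>R f x + w' x *\<^sub>R F x) has_integral (w q *\<^sub>R F q - w p *\<^sub>R F p)) {p..q}"
    using fundamental_theorem_of_calculus[OF pq, of "\<lambda>x. w x *\<^sub>R F x" "\<lambda>x. w x *\<^sub>R f x + w' x *\<^sub>R F x"]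
      has_vector_derivative_scaleR[OF wd[unfolded has_real_derivative_iff_has_vector_derivative[symmetric]] dF] by blast
  have Fp: "F p = 0" by (simp add: F_def)
  have i2: "((\<lambda>x. w' x *\<^sub>R F x) has_integral (w q *\<^sub>R F q - integral {p..q} (\<lambda>x. w x *\<^sub>R f x))) {p..q}"
    using has_integral_diff[OF ftc integrable_integral[OF i1]] by (simp add: Fp)
  have i3: "((\<lambda>x. w' x) has_integral (w q - w p)) {p..q}"
    using fundamental_theorem_of_calculus[OF pq wd] .
  have i4: "((\<lambda>x. B * (- w' x)) has_integral (B * (- (w q - w p)))) {p..q}"
    by (intro has_integral_mult_right has_integral_neg i3)
  \<comment> \<open>\<open>F\<close> is bounded by \<open>B\<close>, and the total variation of the
    nonincreasing \<open>w\<close> is \<open>w p - w q\<close>. Together with the boundary term at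
    \<open>q\<close> this collapses to \<open>B * w p\<close>, a vector-valued form of the second
    mean value theorem.\<close>
  have "norm (integral {p..q} (\<lambda>x. w' x *\<^sub>R F x)) \<le> integral {p..q} (\<lambda>x. B * (- w' x))"
  proof (rule integral_norm_bound_integral)
    show "(\<lambda>x. w' x *\<^sub>R F x) integrable_on {p..q}" using i2 by blast
    show "(\<lambda>x. B * (- w' x)) integrable_on {p..q}" using i4 by blast
    fix x assume x: "x \<in> {p..q}"
    have "norm (w' x *\<^sub>R F x) = (- w' x) * norm (F x)" using w'[OF x] by simp
    also have "\<dots> \<le> (- w' x) * B" using w'[OF x] B[OF x] by (intro mult_left_mono) (auto simp: F_def)
    finally show "norm (w' x *\<^sub>R F x) \<le> B * (- w' x)" by (simp add: mult_ac)
  qed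
  also have "\<dots> = B * (w p - w q)" using integral_unique[OF i4] by (simp add: algebra_simps)
  finally have A: "norm (w q *\<^sub>R F q - integral {p..q} (\<lambda>x. w x *\<^sub>R f x)) \<le> B * (w p - w q)"
    using i2 by (simp add: integral_unique)
  have "norm (w q *\<^sub>R F q) \<le> w q * B" using wq B[of q] pq by (simp add: F_def mult_left_mono)
  moreover have "norm (integral {p..q} (\<lambda>x. w x *\<^sub>R f x)) \<le> norm (w q *\<^sub>R F q) + norm (w q *\<^sub>R F q - integral {p..q} (\<lambda>x. w x *\<^sub>R f x))"
    by (metis norm_minus_commute norm_triangle_sub)
  ultimately show ?thesis using A by (simp add: algebra_simps)
qed

lemma norm_integral_le_length:
  fixes f :: "real \<Rightarrow> 'a::euclidean_space"
  assumes "p \<le> q" "f integrable_on {p..q}" "\<And>x. x \<in> {p..q} \<Longrightarrow> norm (f x) \<le> B"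
  shows "norm (integral {p..q} f) \<le> B * (q - p)"
  using integral_norm_bound_integral[of f "{p..q}" "\<lambda>_. B"] assms
  by (simp add: mult.commute integrable_const_ivl)

lemma has_vector_derivative_cis:
  assumes "(\<psi> has_real_derivative d) (at x within T)"
  shows "((\<lambda>x. cis (\<psi> x)) has_vector_derivative (of_real d * \<i> * cis (\<psi> x))) (at x within T)"
proof -
  have "((\<lambda>x. \<i> * of_real (\<psi> x)) has_vector_derivative (\<i> * of_real d)) (at x within T)"
    using assms by (intro has_vector_derivative_mult_right has_vector_derivative_of_real)
      (simp add: has_real_derivative_iff_has_vector_derivative)
  from field_vector_diff_chain_within[OF this DERIV_exp[THEN has_field_derivative_at_within]]
  show ?thesis by (simp add: o_def cis_conv_exp mult_ac)
qed

text \<open>The integrand is \<open>1 / \<psi>'\<close> times \<open>\<psi>' * cis \<psi>\<close>.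
  The second factor has the primitive \<open>- \<i> * cis \<psi>\<close>, whose increments have norm
  at most \<open>2\<close>; the first is a positive nonincreasing weight because
  \<open>\<psi>''\<close> is nonnegative.\<close>

lemma van_der_Corput_first:
  fixes \<psi> \<psi>' \<psi>'' :: "real \<Rightarrow> real"
  assumes pq: "p \<le> q" and \<mu>: "\<mu> > 0" "\<psi>' p \<ge> \<mu>"
    and d1: "\<And>x. x \<in> {p..q} \<Longrightarrow> (\<psi> has_real_derivative \<psi>' x) (at x)"
    and d2: "\<And>x. x \<in> {p..q} \<Longrightarrow> (\<psi>' has_real_derivative \<psi>'' x) (at x)"
    and c: "\<And>x. x \<in> {p..q} \<Longrightarrow> \<psi>'' x \<ge> 0"
  shows "norm (integral {p..q} (\<lambda>x. cis (\<psi> x))) \<le> 2 / \<mu>"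
proof -
  have mono: "\<psi>' x \<ge> \<mu>" if "x \<in> {p..q}" for x
    using DERIV_nonneg_imp_nondecreasing[of p x \<psi>'] d2 c that \<mu>(2) by (smt (verit) atLeastAtMost_iff)
  have ne: "\<psi>' x \<noteq> 0" if "x \<in> {p..q}" for x using mono[OF that] \<mu> by auto
  have c1: "continuous_on {p..q} \<psi>" using d1 by (meson DERIV_isCont continuous_at_imp_continuous_on)
  have c2: "continuous_on {p..q} \<psi>'" using d2 by (meson DERIV_isCont continuous_at_imp_continuous_on)
  have cisd: "((\<lambda>x. - \<i> * cis (\<psi> x)) has_vector_derivative (\<psi>' x *\<^sub>R cis (\<psi> x))) (at x within T)"
    if "x \<in> {p..q}" for x T
    using has_vector_derivative_mult_right[OF has_vector_derivative_cis[OF d1[OF that, THEN has_field_derivative_at_within]], of "- \<i>" T]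
    by (simp add: scaleR_conv_of_real algebra_simps)
  have "norm (integral {p..q} (\<lambda>x. inverse (\<psi>' x) *\<^sub>R (\<psi>' x *\<^sub>R cis (\<psi> x)))) \<le> 2 * inverse (\<psi>' p)"
  proof (rule norm_integral_decreasing_weight_le[OF pq, where w' = "\<lambda>x. - (inverse (\<psi>' x) * \<psi>'' x * inverse (\<psi>' x))"])
    show "continuous_on {p..q} (\<lambda>x. \<psi>' x *\<^sub>R cis (\<psi> x))"
      by (intro continuous_intros c1 c2)
    show "((\<lambda>x. inverse (\<psi>' x)) has_real_derivative - (inverse (\<psi>' x) * \<psi>'' x * inverse (\<psi>' x))) (at x)" if "x \<in> {p..q}" for x
      using DERIV_inverse_fun[OF d2[OF that] ne[OF that]] by (simp add: mult_ac)
    show "- (inverse (\<psi>' x) * \<psi>'' x * inverse (\<psi>' x)) \<le> 0" if "x \<in> {p..q}" for x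
      using c[OF that] mono[OF that] \<mu> by simp
    show "0 \<le> inverse (\<psi>' q)" using mono[of q] \<mu> pq by simp
    fix x assume x: "x \<in> {p..q}"
    have "((\<lambda>x. \<psi>' x *\<^sub>R cis (\<psi> x)) has_integral (- \<i> * cis (\<psi> x) - (- \<i> * cis (\<psi> p)))) {p..x}"
      using x by (intro fundamental_theorem_of_calculus cisd) auto
    then have "norm (integral {p..x} (\<lambda>x. \<psi>' x *\<^sub>R cis (\<psi> x))) = norm (- \<i> * cis (\<psi> x) - (- \<i> * cis (\<psi> p)))"
      by (simp add: integral_unique)
    also have "\<dots> \<le> norm (- \<i> * cis (\<psi> x)) + norm (- \<i> * cis (\<psi> p))"
      by norm
    also have "\<dots> = 2" by (simp add: norm_mult)
    finally show "norm (integral {p..x} (\<lambda>x. \<psi>' x *\<^sub>R cis (\<psi> x))) \<le> 2" .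
  qed
  also have "integral {p..q} (\<lambda>x. inverse (\<psi>' x) *\<^sub>R (\<psi>' x *\<^sub>R cis (\<psi> x))) = integral {p..q} (\<lambda>x. cis (\<psi> x))"
    by (rule integral_cong) (simp add: ne)
  also have "2 * inverse (\<psi>' p) \<le> 2 / \<mu>" using \<mu> by (simp add: field_simps)
  finally show ?thesis .
qed

text \<open>The length \<open>1 / sqrt l\<close> balances the trivial bound near \<open>p\<close>
  against the first derivative test beyond it, where the growth of \<open>\<psi>'\<close> has made
  it at least \<open>sqrt l\<close>.\<close>

lemma van_der_Corput_half:
  fixes \<psi> \<psi>' \<psi>'' :: "real \<Rightarrow> real"
  assumes pq: "p \<le> q" and l: "l > 0" "\<psi>' p \<ge> 0"
    and d1: "\<And>x. x \<in> {p..q} \<Longrightarrow> (\<psi> has_real_derivative \<psi>' x) (at x)"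
    and d2: "\<And>x. x \<in> {p..q} \<Longrightarrow> (\<psi>' has_real_derivative \<psi>'' x) (at x)"
    and c: "\<And>x. x \<in> {p..q} \<Longrightarrow> \<psi>'' x \<ge> l"
  shows "norm (integral {p..q} (\<lambda>x. cis (\<psi> x))) \<le> 3 / sqrt l"
proof -
  define d where "d = 1 / sqrt l"
  have d0: "d > 0" using l by (simp add: d_def)
  have c1: "continuous_on {p..q} \<psi>" using d1 by (meson DERIV_isCont continuous_at_imp_continuous_on)
  have int: "(\<lambda>x. cis (\<psi> x)) integrable_on {u..v}" if "p \<le> u" "v \<le> q" for u v
    using that by (intro integrable_continuous_interval continuous_intros continuous_on_subset[OF c1]) auto
  show ?thesis
  proof (cases "q \<le> p + d")
    case True
    have "norm (integral {p..q} (\<lambda>x. cis (\<psi> x))) \<le> 1 * (q - p)"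
      by (rule norm_integral_le_length[OF pq int]) auto
    also have "\<dots> \<le> d" using True by simp
    finally have "norm (integral {p..q} (\<lambda>x. cis (\<psi> x))) \<le> d" .
    moreover have "d \<le> 3 / sqrt l" unfolding d_def using l by (intro divide_right_mono) auto
    ultimately show ?thesis by linarith
  next
    case False
    then have pd: "p + d \<in> {p..q}" using d0 by simp
    have "\<psi>' (p + d) - \<psi>' p \<ge> l * d"
    proof -
      have "\<exists>z. p < z \<and> z < p + d \<and> \<psi>' (p + d) - \<psi>' p = (p + d - p) * \<psi>'' z"
        using pd d0 by (intro MVT2 d2) auto
      then obtain z where z: "p < z" "z < p + d" "\<psi>' (p + d) - \<psi>' p = d * \<psi>'' z" by auto
      then have "\<psi>'' z \<ge> l" using pd by (intro c) auto
      then show ?thesis using z d0 by (simp add: mult.commute)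
    qed
    then have ge: "\<psi>' (p + d) \<ge> l * d" using l by simp
    have "norm (integral {p+d..q} (\<lambda>x. cis (\<psi> x))) \<le> 2 / (l * d)"
      by (rule van_der_Corput_first[where \<psi>' = \<psi>' and \<psi>'' = \<psi>''])
         (use pd ge l d0 d1 d2 c in \<open>auto intro: order_trans[OF less_imp_le]\<close>)
    also have "\<dots> = 2 / sqrt l" using l by (simp add: d_def real_div_sqrt)
    finally have A: "norm (integral {p+d..q} (\<lambda>x. cis (\<psi> x))) \<le> 2 / sqrt l" .
    have B: "norm (integral {p..p+d} (\<lambda>x. cis (\<psi> x))) \<le> 1 * (p + d - p)"
      by (rule norm_integral_le_length) (use pd d0 int[of p "p+d"] in auto)
    have "integral {p..q} (\<lambda>x. cis (\<psi> x)) = integral {p..p+d} (\<lambda>x. cis (\<psi> x)) + integral {p+d..q} (\<lambda>x. cis (\<psi> x))"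
      using Henstock_Kurzweil_Integration.integral_combine[of p "p+d" q "\<lambda>x. cis (\<psi> x)"] pd int[of p q] by simp
    then have "norm (integral {p..q} (\<lambda>x. cis (\<psi> x))) \<le> norm (integral {p..p+d} (\<lambda>x. cis (\<psi> x))) + norm (integral {p+d..q} (\<lambda>x. cis (\<psi> x)))"
      by (metis norm_triangle_ineq)
    then show ?thesis using A B by (simp add: d_def)
  qed
qed

text \<open>Since \<open>\<psi>'\<close> increases, it changes sign at most once, and the interval
  is cut there. The right part is the one-sided case; the left part becomes one after the reflection
  \<open>x \<mapsto> - x\<close>.\<close>

lemma van_der_Corput_second:
  fixes \<psi> \<psi>' \<psi>'' :: "real \<Rightarrow> real"
  assumes pq: "p \<le> q" and l: "l > 0"
    and d1: "\<And>x. x \<in> {p..q} \<Longrightarrow> (\<psi> has_real_derivative \<psi>' x) (at x)"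
    and d2: "\<And>x. x \<in> {p..q} \<Longrightarrow> (\<psi>' has_real_derivative \<psi>'' x) (at x)"
    and c: "\<And>x. x \<in> {p..q} \<Longrightarrow> \<psi>'' x \<ge> l"
  shows "norm (integral {p..q} (\<lambda>x. cis (\<psi> x))) \<le> 6 / sqrt l"
proof -
  have right: "norm (integral {u..q} (\<lambda>x. cis (\<psi> x))) \<le> 3 / sqrt l" if "u \<in> {p..q}" "\<psi>' u \<ge> 0" for u
    by (rule van_der_Corput_half[where \<psi>' = \<psi>' and \<psi>'' = \<psi>'']) (use that l d1 d2 c in auto)
  have left: "norm (integral {p..u} (\<lambda>x. cis (\<psi> x))) \<le> 3 / sqrt l" if u: "u \<in> {p..q}" "\<psi>' u \<le> 0" for u
  proof -
    have "norm (integral {-u..-p} (\<lambda>x. cis (\<psi> (- x)))) \<le> 3 / sqrt l"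
    proof (rule van_der_Corput_half[where \<psi>' = "\<lambda>x. - \<psi>' (- x)" and \<psi>'' = "\<lambda>x. \<psi>'' (- x)"])
      show "((\<lambda>x. \<psi> (- x)) has_real_derivative - \<psi>' (- x)) (at x)" if "x \<in> {-u..-p}" for x
        using DERIV_mirror[of \<psi> "\<psi>' (- x)" x] d1[of "- x"] that u by auto
      show "((\<lambda>x. - \<psi>' (- x)) has_real_derivative \<psi>'' (- x)) (at x)" if "x \<in> {-u..-p}" for x
        using DERIV_minus[OF DERIV_mirror[THEN iffD1, of \<psi>' "\<psi>'' (- x)" x]] d2[of "- x"] that u by auto
    qed (use that l c in auto)
    then show ?thesis using Henstock_Kurzweil_Integration.integral_reflect_real[of u p "\<lambda>x. cis (\<psi> x)"] by simp
  qed
  have le36: "3 / sqrt l \<le> 6 / sqrt l" using l by (intro divide_right_mono) auto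
  consider "\<psi>' p \<ge> 0" | "\<psi>' q \<le> 0" | "\<psi>' p < 0" "\<psi>' q > 0" by linarith
  then show ?thesis
  proof cases
    case 1 then show ?thesis using right[of p] pq le36 by auto
  next
    case 2 then show ?thesis using left[of q] pq le36 by auto
  next
    case 3
    have "\<exists>u\<ge>p. u \<le> q \<and> \<psi>' u = 0"
      using 3 pq d2 by (intro IVT) (auto intro: DERIV_isCont)
    then obtain u where u: "u \<in> {p..q}" "\<psi>' u = 0" by auto
    have c1: "continuous_on {p..q} \<psi>" using d1 by (meson DERIV_isCont continuous_at_imp_continuous_on)
    have "integral {p..q} (\<lambda>x. cis (\<psi> x)) = integral {p..u} (\<lambda>x. cis (\<psi> x)) + integral {u..q} (\<lambda>x. cis (\<psi> x))"
      using u by (intro Henstock_Kurzweil_Integration.integral_combine[symmetric] integrable_continuous_interval continuous_intros c1) auto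
    then have "norm (integral {p..q} (\<lambda>x. cis (\<psi> x))) \<le> norm (integral {p..u} (\<lambda>x. cis (\<psi> x))) + norm (integral {u..q} (\<lambda>x. cis (\<psi> x)))"
      by (metis norm_triangle_ineq)
    then show ?thesis using left[of u] right[of u] u by auto
  qed
qed

section \<open>The Dirichlet kernel\<close>

definition dker :: "nat \<Rightarrow> real \<Rightarrow> real" where
  "dker N u = 1 + 2 * (\<Sum>n=1..N. cos (2 * pi * real n * u))"

lemma continuous_on_dker [continuous_intros]: "continuous_on S (dker N)"
  unfolding dker_def by (intro continuous_intros)

lemma dker_integrable: "dker N integrable_on {p..q}"
  by (intro integrable_continuous_interval continuous_intros)

lemma dker_minus [simp]: "dker N (- u) = dker N u"
  by (simp add: dker_def)

lemma sin_mult_dker: "sin (pi * u) * dker N u = sin ((2 * real N + 1) * pi * u)"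
proof (induction N)
  case (Suc N)
  have "sin (pi * u) * dker (Suc N) u = sin (pi * u) * dker N u + 2 * sin (pi * u) * cos (2 * pi * real (Suc N) * u)"
    by (simp add: dker_def algebra_simps)
  also have "2 * sin (pi * u) * cos (2 * pi * real (Suc N) * u) = sin ((2 * real (Suc N) + 1) * pi * u) - sin ((2 * real N + 1) * pi * u)"
    using sin_times_cos[of "pi * u" "2 * pi * real (Suc N) * u"] sin_minus[of "(2 * real N + 1) * pi * u"]
    by (simp add: algebra_simps)
  finally show ?case using Suc by simp
qed (simp add: dker_def)

text \<open>Jordan's inequality: the concave sine lies above its chord over
  \<open>[0, pi / 2]\<close>.\<close>

lemma sin_pi_ge:
  assumes "0 \<le> u" "u \<le> 1/2"
  shows "2 * u \<le> sin (pi * u)"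
proof -
  have "convex_on {0..pi/2} (\<lambda>x. - sin x)"
    by (rule f''_ge0_imp_convex[where f' = "\<lambda>x. - cos x" and f'' = "\<lambda>x. sin x"])
      (auto intro!: derivative_eq_intros sin_ge_zero)
  from convex_onD[OF this, of "2 * u" 0 "pi / 2"] show ?thesis
    using assms by (simp add: field_simps)
qed

lemma abs_dker_le: "\<bar>dker N u\<bar> \<le> 2 * real N + 1"
proof -
  have "\<bar>\<Sum>n=1..N. cos (2 * pi * real n * u)\<bar> \<le> (\<Sum>n=1..N. 1)"
    by (rule sum_abs[THEN order_trans], rule sum_mono) simp
  then show ?thesis by (simp add: dker_def)
qed

lemma dker_eq:
  assumes "0 < u" "u \<le> 1/2"
  shows "dker N u = inverse (sin (pi * u)) * sin ((2 * real N + 1) * pi * u)"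
  using sin_mult_dker[of u N] sin_pi_ge[of u] assms by (simp add: field_simps)

lemma abs_dker_le_inverse:
  assumes "u \<noteq> 0" "\<bar>u\<bar> \<le> 1/2"
  shows "\<bar>dker N u\<bar> \<le> 1 / (2 * \<bar>u\<bar>)"
proof -
  have *: "\<bar>dker N u\<bar> \<le> 1 / (2 * u)" if "0 < u" "u \<le> 1/2" for u
  proof -
    have "\<bar>dker N u\<bar> = inverse (sin (pi * u)) * \<bar>sin ((2 * real N + 1) * pi * u)\<bar>"
      using sin_pi_ge[of u] that by (simp add: dker_eq abs_mult)
    also have "\<dots> \<le> inverse (2 * u) * 1"
      using sin_pi_ge[of u] that by (intro mult_mono le_imp_inverse_le) auto
    finally show ?thesis by (simp add: field_simps)
  qed
  from *[of "\<bar>u\<bar>"] assms show ?thesis by (cases "u \<ge> 0") auto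
qed

text \<open>The weight \<open>1 / sin (pi * u)\<close> decreases and is at most
  \<open>1 / (2 * p)\<close> at \<open>p\<close>, so dividing by the sine costs only this factor
  once the partial integrals of \<open>f\<close> are controlled.\<close>

lemma norm_integral_over_sin_le:
  fixes f :: "real \<Rightarrow> 'a::euclidean_space"
  assumes p: "0 < p" "p \<le> q" "q \<le> 1/2" and f: "continuous_on {p..q} f"
    and B: "\<And>x. x \<in> {p..q} \<Longrightarrow> norm (integral {p..x} f) \<le> B"
  shows "norm (integral {p..q} (\<lambda>u. inverse (sin (pi * u)) *\<^sub>R f u)) \<le> B / (2 * p)"
proof -
  have s: "sin (pi * u) > 0" if "u \<in> {p..q}" for u using sin_pi_ge[of u] that p by auto
  have "norm (integral {p..q} (\<lambda>u. inverse (sin (pi * u)) *\<^sub>R f u)) \<le> B * inverse (sin (pi * p))"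
  proof (rule norm_integral_decreasing_weight_le[OF p(2) f, where w' = "\<lambda>u. - (inverse (sin (pi * u)) * (cos (pi * u) * pi) * inverse (sin (pi * u)))"])
    fix u assume u: "u \<in> {p..q}"
    show "((\<lambda>u. inverse (sin (pi * u))) has_real_derivative - (inverse (sin (pi * u)) * (cos (pi * u) * pi) * inverse (sin (pi * u)))) (at u)"
      using s[OF u] by (auto intro!: derivative_eq_intros)
    have "pi * u \<le> pi * (1/2)" "pi * u \<ge> 0" using u p by (auto intro!: mult_left_mono)
    then have "cos (pi * u) \<ge> 0" using pi_gt_zero by (intro cos_ge_zero) linarith+
    then show "- (inverse (sin (pi * u)) * (cos (pi * u) * pi) * inverse (sin (pi * u))) \<le> 0"
      using s[OF u] by simp
  qed (use s[of q] p B in auto)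
  also have "\<dots> \<le> B * inverse (2 * p)"
    using sin_pi_ge[of p] p B[of p] by (intro mult_left_mono le_imp_inverse_le) (auto intro: order_trans[OF norm_ge_zero])
  finally show ?thesis by (simp add: field_simps)
qed

lemma abs_integral_sin_over_sin_le_inverse:
  assumes p: "0 < p" "p \<le> q" "q \<le> 1/2" and A: "A > 0"
  shows "\<bar>integral {p..q} (\<lambda>u. inverse (sin (pi * u)) * sin (A * u))\<bar> \<le> 1 / (A * p)"
proof -
  have "norm (integral {p..q} (\<lambda>u. inverse (sin (pi * u)) *\<^sub>R sin (A * u))) \<le> (2 / A) / (2 * p)"
  proof (rule norm_integral_over_sin_le[OF p])
    fix x assume x: "x \<in> {p..q}"
    have "((\<lambda>u. sin (A * u)) has_integral (- cos (A * x) / A - (- cos (A * p) / A))) {p..x}"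
      using x A by (intro fundamental_theorem_of_calculus)
        (auto intro!: derivative_eq_intros simp flip: has_real_derivative_iff_has_vector_derivative)
    then have "norm (integral {p..x} (\<lambda>u. sin (A * u))) = \<bar>cos (A * p) - cos (A * x)\<bar> / A"
      using A by (simp add: integral_unique abs_divide flip: diff_divide_distrib)
    also have "\<dots> \<le> 2 / A"
    proof (rule divide_right_mono)
      show "\<bar>cos (A * p) - cos (A * x)\<bar> \<le> 2"
        using cos_le_one[of "A * p"] cos_le_one[of "A * x"] cos_ge_minus_one[of "A * p"] cos_ge_minus_one[of "A * x"] by linarith
    qed (use A in simp)
    finally show "norm (integral {p..x} (\<lambda>u. sin (A * u))) \<le> 2 / A" .
  qed (intro continuous_intros)
  then show ?thesis by (simp add: field_simps)
qed

text \<open>For positive \<open>A\<close> the integrand is at most \<open>A / 2\<close> in size up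
  to \<open>1 / A\<close>, and beyond that point the oscillation takes over; negative
  \<open>A\<close> only changes the sign. Arbitrary frequencies occur because a further oscillating
  factor shifts that of the Dirichlet kernel.\<close>

lemma abs_integral_sin_over_sin_le:
  assumes p: "0 < p" "p \<le> q" "q \<le> 1/2"
  shows "\<bar>integral {p..q} (\<lambda>u. inverse (sin (pi * u)) * sin (A * u))\<bar> \<le> 3/2"
proof -
  have s: "sin (pi * u) > 0" if "u \<in> {p..q}" for u using sin_pi_ge[of u] that p by auto
  have pos: "\<bar>integral {p..q} (\<lambda>u. inverse (sin (pi * u)) * sin (A * u))\<bar> \<le> 3/2" if A: "A > 0" for A
  proof -
    let ?f = "\<lambda>u. inverse (sin (pi * u)) * sin (A * u)"
    have int: "?f integrable_on {u..v}" if "p \<le> u" "v \<le> q" for u v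
      using that s by (intro integrable_continuous_interval continuous_intros) (auto simp: less_imp_neq[symmetric])
    have small: "\<bar>integral {p..r} ?f\<bar> \<le> 1/2" if r: "p \<le> r" "r \<le> q" "r \<le> 1/A" for r
    proof -
      have "norm (integral {p..r} ?f) \<le> (A / 2) * (r - p)"
      proof (rule norm_integral_le_length[OF r(1) int])
        fix u assume u: "u \<in> {p..r}"
        have "norm (?f u) = inverse (sin (pi * u)) * \<bar>sin (A * u)\<bar>"
          using s[of u] u r by (simp add: abs_mult)
        also have "\<dots> \<le> inverse (2 * u) * (A * u)"
          using sin_pi_ge[of u] u r p A abs_sin_x_le_abs_x[of "A * u"]
          by (intro mult_mono le_imp_inverse_le) (auto simp: abs_mult)
        also have "\<dots> = A / 2" using u p by (simp add: field_simps)
        finally show "norm (?f u) \<le> A / 2" .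
      qed (use r in auto)
      also have "\<dots> \<le> (A / 2) * (1 / A)" using r A p by (intro mult_left_mono) auto
      finally show ?thesis using A by simp
    qed
    have large: "\<bar>integral {r..q} ?f\<bar> \<le> 1" if r: "r \<ge> 1/A" "r \<ge> p" "r \<le> q" for r
    proof -
      have "\<bar>integral {r..q} ?f\<bar> \<le> 1 / (A * r)"
        by (rule abs_integral_sin_over_sin_le_inverse) (use r p A in auto)
      also have "\<dots> \<le> 1" using r A by (simp add: field_simps)
      finally show ?thesis .
    qed
    consider "q \<le> 1/A" | "p \<ge> 1/A" | "p < 1/A" "1/A < q" by linarith
    then show ?thesis
    proof cases
      case 1 then show ?thesis using small[of q] p by simp
    next
      case 2 then show ?thesis using large[of p] p by simp
    next
      case 3
      then have "integral {p..q} ?f = integral {p..1/A} ?f + integral {1/A..q} ?f"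
        by (intro Henstock_Kurzweil_Integration.integral_combine[symmetric] int) auto
      then show ?thesis using small[of "1/A"] large[of "1/A"] 3 by linarith
    qed
  qed
  consider "A > 0" | "A = 0" | "A < 0" by linarith
  then show ?thesis
  proof cases
    case 3
    have "(\<lambda>u. inverse (sin (pi * u)) * sin (A * u)) = (\<lambda>u. - (inverse (sin (pi * u)) * sin ((- A) * u)))"
      by simp
    then show ?thesis using pos[of "- A"] 3 by (simp only: Henstock_Kurzweil_Integration.integral_neg abs_minus_cancel)
  qed (use pos in auto)
qed

lemma integral_dker_eq:
  assumes p: "0 < p" "q \<le> 1/2"
  shows "integral {p..q} (dker N) = integral {p..q} (\<lambda>u. inverse (sin (pi * u)) * sin (((2 * real N + 1) * pi) * u))"
  by (rule integral_cong) (use p dker_eq in auto)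

lemma abs_integral_dker_le:
  assumes "0 < u" "u \<le> 1/2"
  shows "\<bar>integral {u..1/2} (dker N)\<bar> \<le> 3/2"
  using abs_integral_sin_over_sin_le[of u "1/2"] assms by (simp add: integral_dker_eq)

lemma abs_integral_dker_le_inverse:
  assumes "0 < u" "u \<le> 1/2"
  shows "\<bar>integral {u..1/2} (dker N)\<bar> \<le> 1 / ((2 * real N + 1) * u)"
proof -
  have "\<bar>integral {u..1/2} (dker N)\<bar> \<le> 1 / (((2 * real N + 1) * pi) * u)"
    using abs_integral_sin_over_sin_le_inverse[of u "1/2" "(2 * real N + 1) * pi"] assms by (simp add: integral_dker_eq)
  also have "\<dots> \<le> 1 / ((2 * real N + 1) * u)"
    using assms pi_ge_two by (intro divide_left_mono mult_right_mono) (auto intro!: mult_pos_pos)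
  finally show ?thesis .
qed

lemma has_integral_dker:
  assumes "p \<le> q"
  shows "(dker N has_integral ((q + (\<Sum>n=1..N. sin (2 * pi * real n * q) / (pi * real n))) -
    (p + (\<Sum>n=1..N. sin (2 * pi * real n * p) / (pi * real n))))) {p..q}"
proof (rule fundamental_theorem_of_calculus[OF assms])
  fix x
  have "((\<lambda>q. q + (\<Sum>n=1..N. sin (2 * pi * real n * q) / (pi * real n))) has_real_derivative
      1 + (\<Sum>n=1..N. 2 * cos (2 * pi * real n * x))) (at x within {p..q})"
  proof (intro DERIV_add DERIV_ident DERIV_sum)
    fix n assume "n \<in> {1..N}"
    then show "((\<lambda>q. sin (2 * pi * real n * q) / (pi * real n)) has_real_derivative 2 * cos (2 * pi * real n * x)) (at x within {p..q})"
      by (auto intro!: derivative_eq_intros simp: field_simps)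
  qed
  then show "((\<lambda>q. q + (\<Sum>n=1..N. sin (2 * pi * real n * q) / (pi * real n))) has_vector_derivative dker N x) (at x within {p..q})"
    by (simp only: dker_def sum_distrib_left has_real_derivative_iff_has_vector_derivative)
qed

lemma integral_dker_half: "integral {0..1/2} (dker N) = 1/2"
  using integral_unique[OF has_integral_dker[of 0 "1/2" N]] by simp

lemma integral_dker_zero_le:
  assumes "0 \<le> u" "u \<le> 1/2"
  shows "\<bar>integral {u..1/2} (dker N)\<bar> \<le> 3/2"
  using abs_integral_dker_le[of u N] integral_dker_half[of N] assms by (cases "u = 0") auto

section \<open>Exponential modes against the Dirichlet kernel\<close>

text \<open>The constant of the second derivative test for the phase
  \<open>2 * pi * X * exp (l * u)\<close> on \<open>\<bar>u\<bar> \<le> 1 / 2\<close>, with the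
  factor \<open>1 / sqrt X\<close> split off.\<close>

definition vdC_const :: "real \<Rightarrow> real" where
  "vdC_const l = 6 / sqrt (2 * pi * l\<^sup>2 * exp (- \<bar>l\<bar> / 2))"

text \<open>The linear term \<open>A * u\<close> leaves the second derivative of the phase
  untouched, so the estimate is uniform in \<open>A\<close>. This lets the frequencies of the
  Dirichlet kernel, or a character, be absorbed into the phase.\<close>

lemma norm_integral_cis_exp_le:
  fixes l X A :: real
  assumes l: "l \<noteq> 0" and X: "X > 0" and pq: "- (1/2) \<le> p" "p \<le> q" "q \<le> 1/2"
  shows "norm (integral {p..q} (\<lambda>u. cis (2 * pi * X * exp (l * u) + A * u))) \<le> vdC_const l / sqrt X"
proof -
  have "norm (integral {p..q} (\<lambda>u. cis (2 * pi * X * exp (l * u) + A * u))) \<le> 6 / sqrt (2 * pi * l\<^sup>2 * exp (- \<bar>l\<bar> / 2) * X)"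
  proof (rule van_der_Corput_second[where \<psi>' = "\<lambda>u. 2 * pi * X * l * exp (l * u) + A" and \<psi>'' = "\<lambda>u. 2 * pi * X * l\<^sup>2 * exp (l * u)"])
    fix u assume u: "u \<in> {p..q}"
    have "\<bar>l * u\<bar> \<le> \<bar>l\<bar> * (1/2)" unfolding abs_mult using u pq by (intro mult_left_mono) auto
    then have "exp (- \<bar>l\<bar> / 2) \<le> exp (l * u)" by simp
    then have "2 * pi * X * l\<^sup>2 * exp (- \<bar>l\<bar> / 2) \<le> 2 * pi * X * l\<^sup>2 * exp (l * u)"
      using X by (intro mult_left_mono) auto
    then show "2 * pi * l\<^sup>2 * exp (- \<bar>l\<bar> / 2) * X \<le> 2 * pi * X * l\<^sup>2 * exp (l * u)"
      by (simp only: mult_ac)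
    show "((\<lambda>u. 2 * pi * X * exp (l * u) + A * u) has_real_derivative 2 * pi * X * l * exp (l * u) + A) (at u)"
      by (auto intro!: derivative_eq_intros)
    show "((\<lambda>u. 2 * pi * X * l * exp (l * u) + A) has_real_derivative 2 * pi * X * l\<^sup>2 * exp (l * u)) (at u)"
      by (auto intro!: derivative_eq_intros simp: power2_eq_square)
  next
    show "0 < 2 * pi * l\<^sup>2 * exp (- \<bar>l\<bar> / 2) * X" using l X by (intro mult_pos_pos) auto
  qed (use pq in auto)
  then show ?thesis by (simp add: vdC_const_def real_sqrt_mult)
qed

lemma abs_exp_minus_linear_le: "\<bar>exp y - 1 - y\<bar> \<le> y\<^sup>2 * exp \<bar>y\<bar>" for y :: real
proof -
  have "\<exists>z. \<bar>z\<bar> \<le> \<bar>y\<bar> \<and> exp y = 1 + y + exp z / 2 * y\<^sup>2"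
    using Maclaurin_exp_le[of y 2] by (auto simp: numeral_2_eq_2)
  then obtain z where z: "\<bar>z\<bar> \<le> \<bar>y\<bar>" "exp y = 1 + y + exp z / 2 * y\<^sup>2" by blast
  have "\<bar>exp y - 1 - y\<bar> = exp z / 2 * y\<^sup>2" using z by simp
  also have "exp z \<le> exp \<bar>y\<bar>" using z by simp
  then have "exp z / 2 * y\<^sup>2 \<le> exp \<bar>y\<bar> * y\<^sup>2"
    using exp_ge_zero[of z] by (intro mult_right_mono) (linarith, simp)
  finally show ?thesis by (simp add: mult.commute)
qed

lemma norm_cis_diff_le: "norm (cis x - cis y) \<le> \<bar>x - y\<bar>"
proof -
  have "cis x - cis y = cis y * (cis (x - y) - 1)" by (simp add: algebra_simps cis_mult)
  then have "norm (cis x - cis y) = norm (exp (\<i> * of_real (x - y)) - 1)"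
    by (simp add: norm_mult cis_conv_exp)
  also have "\<dots> = 2 * \<bar>sin ((x - y) / 2)\<bar>" by (rule dist_exp_i_1)
  also have "\<dots> \<le> \<bar>x - y\<bar>" using abs_sin_x_le_abs_x[of "(x - y) / 2"] by simp
  finally show ?thesis .
qed


lemma integral_symmetric_interval:
  fixes f :: "real \<Rightarrow> 'a::euclidean_space"
  assumes "d \<ge> 0" "f integrable_on {-d..d}"
  shows "integral {-d..d} f = integral {0..d} (\<lambda>u. f u + f (- u))"
proof -
  have 1: "f integrable_on {0..d}" "f integrable_on {-d..0}"
    using assms by (auto intro: integrable_on_subinterval)
  have 2: "(\<lambda>u. f (- u)) integrable_on {0..d}"
    using Henstock_Kurzweil_Integration.integrable_reflect_real[where f = f and a = "-d" and b = 0, THEN iffD2, OF 1(2)] by (simp only: minus_zero minus_minus)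
  have "integral {-d..d} f = integral {-d..0} f + integral {0..d} f"
    using assms by (intro Henstock_Kurzweil_Integration.integral_combine[symmetric]) auto
  also have "integral {-d..0} f = integral {0..d} (\<lambda>u. f (- u))"
    using Henstock_Kurzweil_Integration.integral_reflect_real[of "d" 0 "\<lambda>u. f (- u)"] by simp
  finally show ?thesis using 1 2 by (simp add: Henstock_Kurzweil_Integration.integral_add add.commute)
qed

text \<open>The product of the kernel's sine with the cosine is a half sum of two sines, to which
  the frequency-uniform bound applies. Only the initial piece of length at most
  \<open>1 / (2 * real N + 1)\<close>, where the kernel is largest, is estimated trivially.\<close>

lemma abs_integral_dker_cos_le:
  assumes d: "0 \<le> d" "d \<le> 1/2"
  shows "\<bar>integral {0..d} (\<lambda>u. dker N u * cos (a * u))\<bar> \<le> 5/2"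
proof -
  let ?f = "\<lambda>u. dker N u * cos (a * u)"
  define p where "p = min d (1 / (2 * real N + 1))"
  have p: "0 \<le> p" "p \<le> d" "p \<le> 1 / (2 * real N + 1)" using d by (auto simp: p_def)
  have int: "?f integrable_on {u..v}" for u v
    by (intro integrable_continuous_interval continuous_intros)
  have "norm (integral {0..p} ?f) \<le> (2 * real N + 1) * (p - 0)"
    by (rule norm_integral_le_length[OF p(1) int])
       (use abs_dker_le[of N] in \<open>auto simp: abs_mult intro: order_trans[OF mult_left_le]\<close>)
  also have "\<dots> \<le> 1" using p(3) by (simp add: field_simps)
  finally have A: "\<bar>integral {0..p} ?f\<bar> \<le> 1" by simp
  have B: "\<bar>integral {p..d} ?f\<bar> \<le> 3/2"
  proof (cases "p = d")
    case False
    then have p0: "p > 0" "p = 1 / (2 * real N + 1)" using p d by (auto simp: p_def min_def split: if_splits)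
    have sc: "sin (M * u) * cos (a * u) = (sin ((M + a) * u) + sin ((M - a) * u)) / 2" for M u
      by (simp add: distrib_right left_diff_distrib sin_add sin_diff)
    let ?M = "(2 * real N + 1) * pi"
    let ?g = "\<lambda>A u. inverse (sin (pi * u)) * sin (A * u)"
    have s: "sin (pi * u) > 0" if "u \<in> {p..d}" for u using sin_pi_ge[of u] that p0(1) d by auto
    have gi: "?g A integrable_on {p..d}" for A
      using s by (intro integrable_continuous_interval continuous_intros) (auto simp: less_imp_neq[symmetric])
    have "integral {p..d} ?f = integral {p..d} (\<lambda>u. (?g (?M + a) u + ?g (?M - a) u) * (1/2))"
    proof (rule integral_cong)
      fix u assume u: "u \<in> {p..d}"
      have "dker N u = inverse (sin (pi * u)) * sin (?M * u)"
        using dker_eq[of u N] u p0(1) d by simp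
      then have "dker N u * cos (a * u) = inverse (sin (pi * u)) * (sin (?M * u) * cos (a * u))"
        by (simp only: mult.assoc)
      also have "\<dots> = inverse (sin (pi * u)) * ((sin ((?M + a) * u) + sin ((?M - a) * u)) / 2)"
        by (simp only: sc)
      also have "\<dots> = (?g (?M + a) u + ?g (?M - a) u) * (1/2)"
        by (simp only: distrib_left times_divide_eq_right mult_1_right)
      finally show "dker N u * cos (a * u) = (?g (?M + a) u + ?g (?M - a) u) * (1/2)" .
    qed
    also have "\<dots> = (integral {p..d} (?g (?M + a)) + integral {p..d} (?g (?M - a))) * (1/2)"
      using gi by (simp add: Henstock_Kurzweil_Integration.integral_add)
    finally show ?thesis
      using abs_integral_sin_over_sin_le[of p d "?M + a"] abs_integral_sin_over_sin_le[of p d "?M - a"] p0 p d by simp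
  qed simp
  have "integral {0..d} ?f = integral {0..p} ?f + integral {p..d} ?f"
    using p by (intro Henstock_Kurzweil_Integration.integral_combine[symmetric] int) auto
  then show ?thesis using A B by linarith
qed

text \<open>The interval is symmetric and the kernel even, so only the even part
  \<open>cos (a * u)\<close> of the linear phase survives.\<close>

lemma norm_integral_dker_cis_linear_le:
  assumes d: "0 \<le> d" "d \<le> 1/2"
  shows "norm (integral {-d..d} (\<lambda>u. dker N u *\<^sub>R cis (c + a * u))) \<le> 5"
proof -
  have "integral {-d..d} (\<lambda>u. dker N u *\<^sub>R cis (c + a * u)) =
      integral {0..d} (\<lambda>u. dker N u *\<^sub>R cis (c + a * u) + dker N (- u) *\<^sub>R cis (c + a * (- u)))"
    by (intro integral_symmetric_interval d integrable_continuous_interval continuous_intros)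
  also have "\<dots> = integral {0..d} (\<lambda>u. (2 * cis c) * complex_of_real (dker N u * cos (a * u)))"
  proof (rule integral_cong)
    fix u
    have "cis (c + a * u) + cis (c + a * (- u)) = cis c * (cis (a * u) + cis (- (a * u)))"
      by (simp add: cis_mult algebra_simps)
    also have "cis (a * u) + cis (- (a * u)) = 2 * of_real (cos (a * u))"
      by (simp add: complex_eq_iff)
    finally show "dker N u *\<^sub>R cis (c + a * u) + dker N (- u) *\<^sub>R cis (c + a * (- u)) = (2 * cis c) * complex_of_real (dker N u * cos (a * u))"
      by (simp add: scaleR_conv_of_real flip: distrib_left)
  qed
  also have "\<dots> = (2 * cis c) * of_real (integral {0..d} (\<lambda>u. dker N u * cos (a * u)))"
  proof -
    have "((\<lambda>u. complex_of_real (dker N u * cos (a * u))) has_integral of_real (integral {0..d} (\<lambda>u. dker N u * cos (a * u)))) {0..d}"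
      by (intro has_integral_of_real integrable_integral integrable_continuous_interval continuous_intros)
    from has_integral_mult_right[OF this] show ?thesis by (rule integral_unique)
  qed
  finally show ?thesis using abs_integral_dker_cos_le[OF d, of N a] by (simp add: norm_mult)
qed

definition mode_const :: "real \<Rightarrow> real" where
  "mode_const l = vdC_const l + 2 * pi * l\<^sup>2 * exp (\<bar>l\<bar>) + 5"

text \<open>The kernel's sine splits into two exponentials, each absorbed into the linear term of
  the phase. The second derivative test saves \<open>sqrt X\<close>, and the division by the sine
  loses it again, because the cut is at \<open>1 / sqrt X\<close>.\<close>

lemma norm_integral_dker_cis_exp_tail_le:
  fixes l X :: real
  assumes l: "l \<noteq> 0" and X: "X \<ge> 4"
  shows "norm (integral {1 / sqrt X..1/2} (\<lambda>u. dker N u *\<^sub>R cis (2 * pi * X * exp (l * u)))) \<le> vdC_const l / 2"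
proof -
  define d where "d = 1 / sqrt X"
  have sX: "sqrt X \<ge> 2" using X by (simp add: real_le_rsqrt)
  have d: "d > 0" "d \<le> 1/2"
    using X sX divide_left_mono[of 2 "sqrt X" 1] by (auto simp: d_def)
  let ?M = "(2 * real N + 1) * pi"
  let ?h = "\<lambda>u. sin (?M * u) *\<^sub>R cis (2 * pi * X * exp (l * u))"
  have "norm (integral {d..1/2} (\<lambda>u. inverse (sin (pi * u)) *\<^sub>R ?h u)) \<le> (vdC_const l / sqrt X) / (2 * d)"
  proof (rule norm_integral_over_sin_le)
    fix x assume x: "x \<in> {d..1/2}"
    let ?c = "\<lambda>A u. cis (2 * pi * X * exp (l * u) + A * u)"
    have ci: "?c A integrable_on {d..x}" for A
      by (intro integrable_continuous_interval continuous_intros)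
    have "integral {d..x} ?h = integral {d..x} (\<lambda>u. (- \<i> / 2) * (?c ?M u - ?c (- ?M) u))"
    proof (rule integral_cong)
      fix u
      have "?c ?M u - ?c (- ?M) u = cis (2 * pi * X * exp (l * u)) * (cis (?M * u) - cis (- (?M * u)))"
        by (simp only: right_diff_distrib cis_mult mult_minus_left)
      also have "cis (?M * u) - cis (- (?M * u)) = 2 * \<i> * of_real (sin (?M * u))"
        by (simp add: complex_eq_iff)
      also have "cis (2 * pi * X * exp (l * u)) * (2 * \<i> * of_real (sin (?M * u))) = 2 * (\<i> * ?h u)"
        by (simp add: scaleR_conv_of_real mult_ac)
      finally show "?h u = (- \<i> / 2) * (?c ?M u - ?c (- ?M) u)"
        by simp
    qed
    also have "\<dots> = (- \<i> / 2) * (integral {d..x} (?c ?M) - integral {d..x} (?c (- ?M)))"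
      using ci by (simp only: integral_mult_right Henstock_Kurzweil_Integration.integral_diff)
    finally have "norm (integral {d..x} ?h) = (1/2) * norm (integral {d..x} (?c ?M) - integral {d..x} (?c (- ?M)))"
      by (simp add: norm_mult norm_divide)
    also have "\<dots> \<le> (1/2) * (norm (integral {d..x} (?c ?M)) + norm (integral {d..x} (?c (- ?M))))"
      by (intro mult_left_mono norm_triangle_ineq4) auto
    also have "\<dots> \<le> (1/2) * (vdC_const l / sqrt X + vdC_const l / sqrt X)"
      using x d X l by (intro mult_left_mono add_mono norm_integral_cis_exp_le) auto
    finally show "norm (integral {d..x} ?h) \<le> vdC_const l / sqrt X" by simp
  qed (use d in \<open>auto intro!: continuous_intros\<close>)
  also have "integral {d..1/2} (\<lambda>u. inverse (sin (pi * u)) *\<^sub>R ?h u) = integral {d..1/2} (\<lambda>u. dker N u *\<^sub>R cis (2 * pi * X * exp (l * u)))"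
    by (rule integral_cong) (use d dker_eq in auto)
  also have "(vdC_const l / sqrt X) / (2 * d) = vdC_const l / 2"
    using X by (simp add: d_def)
  finally show ?thesis by (simp add: d_def)
qed

text \<open>Inside \<open>\<bar>u\<bar> \<le> 1 / sqrt X\<close> the phase is replaced by its
  linearisation: the error is of order \<open>X * u\<^sup>2\<close>, the kernel is at most
  \<open>1 / (2 * \<bar>u\<bar>)\<close>, and the product has a bounded integral. The point is
  uniformity in both \<open>N\<close> and \<open>X\<close>.\<close>

lemma norm_integral_dker_cis_exp_le:
  fixes l X :: real
  assumes l: "l \<noteq> 0" and X: "X \<ge> 4"
  shows "norm (integral {-(1/2)..1/2} (\<lambda>u. dker N u *\<^sub>R cis (2 * pi * X * exp (l * u)))) \<le> mode_const l"
proof -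
  define d where "d = 1 / sqrt X"
  have sX: "sqrt X \<ge> 2" using X by (simp add: real_le_rsqrt)
  have d: "d > 0" "d \<le> 1/2"
    using X sX divide_left_mono[of 2 "sqrt X" 1] by (auto simp: d_def)
  have dX: "X * d * d = 1" using X by (simp add: d_def)
  let ?f = "\<lambda>u. dker N u *\<^sub>R cis (2 * pi * X * exp (l * u))"
  let ?g = "\<lambda>u. dker N u *\<^sub>R cis (2 * pi * X + (2 * pi * X * l) * u)"
  have fi: "?f integrable_on {u..v}" and gi: "?g integrable_on {u..v}" for u v
    by (intro integrable_continuous_interval continuous_intros)+
  have R: "norm (integral {d..1/2} ?f) \<le> vdC_const l / 2"
    using norm_integral_dker_cis_exp_tail_le[OF l X, of N] by (simp add: d_def)
  have "integral {-(1/2)..-d} ?f = integral {d..1/2} (\<lambda>u. ?f (- u))"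
    using Henstock_Kurzweil_Integration.integral_reflect_real[of "1/2" d "\<lambda>u. ?f (- u)"] by simp
  also have "norm \<dots> \<le> vdC_const l / 2"
    using norm_integral_dker_cis_exp_tail_le[of "- l" X N] l X by (simp add: d_def vdC_const_def)
  finally have L: "norm (integral {-(1/2)..-d} ?f) \<le> vdC_const l / 2" .
  have "norm (integral {-d..d} (\<lambda>u. ?f u - ?g u)) \<le> (pi * X * l\<^sup>2 * exp \<bar>l\<bar> * d) * (d - (- d))"
  proof (rule norm_integral_le_length)
    show "(\<lambda>u. ?f u - ?g u) integrable_on {-d..d}" by (intro integrable_diff fi gi)
    fix u assume u: "u \<in> {-d..d}"
    show "norm (?f u - ?g u) \<le> pi * X * l\<^sup>2 * exp \<bar>l\<bar> * d"
    proof (cases "u = 0")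
      case True
      then show ?thesis using X d by simp
    next
      case False
      have lu: "\<bar>l * u\<bar> \<le> \<bar>l\<bar>" unfolding abs_mult using u d by (intro mult_left_le) auto
      have "norm (?f u - ?g u) = \<bar>dker N u\<bar> * norm (cis (2 * pi * X * exp (l * u)) - cis (2 * pi * X + (2 * pi * X * l) * u))"
        by (simp flip: scaleR_diff_right)
      also have "\<dots> \<le> (1 / (2 * \<bar>u\<bar>)) * (2 * pi * X * ((l * u)\<^sup>2 * exp \<bar>l\<bar>))"
      proof (intro mult_mono)
        show "\<bar>dker N u\<bar> \<le> 1 / (2 * \<bar>u\<bar>)" using False u d by (intro abs_dker_le_inverse) auto
        have "norm (cis (2 * pi * X * exp (l * u)) - cis (2 * pi * X + (2 * pi * X * l) * u))
            \<le> \<bar>2 * pi * X * exp (l * u) - (2 * pi * X + (2 * pi * X * l) * u)\<bar>"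
          by (rule norm_cis_diff_le)
        also have "\<dots> = 2 * pi * X * \<bar>exp (l * u) - 1 - l * u\<bar>"
        proof -
          have "2 * pi * X * exp (l * u) - (2 * pi * X + (2 * pi * X * l) * u) = 2 * pi * X * (exp (l * u) - 1 - l * u)"
            by (simp add: algebra_simps)
          then show ?thesis using X by (simp add: abs_mult)
        qed
        also have "\<dots> \<le> 2 * pi * X * ((l * u)\<^sup>2 * exp \<bar>l * u\<bar>)"
          using X by (intro mult_left_mono abs_exp_minus_linear_le) auto
        also have "\<dots> \<le> 2 * pi * X * ((l * u)\<^sup>2 * exp \<bar>l\<bar>)"
          using X lu by (intro mult_left_mono) auto
        finally show "norm (cis (2 * pi * X * exp (l * u)) - cis (2 * pi * X + (2 * pi * X * l) * u)) \<le> 2 * pi * X * ((l * u)\<^sup>2 * exp \<bar>l\<bar>)" .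
      qed (use False in auto)
      also have "\<dots> = pi * X * l\<^sup>2 * exp \<bar>l\<bar> * (u\<^sup>2 / \<bar>u\<bar>)" by (simp add: power_mult_distrib)
      also have "u\<^sup>2 / \<bar>u\<bar> = \<bar>u\<bar>" using False by (simp add: power2_eq_square abs_if)
      also have "pi * X * l\<^sup>2 * exp \<bar>l\<bar> * \<bar>u\<bar> \<le> pi * X * l\<^sup>2 * exp \<bar>l\<bar> * d"
        using u X by (intro mult_left_mono) auto
      finally show ?thesis .
    qed
  qed (use d in auto)
  also have "\<dots> = 2 * pi * l\<^sup>2 * exp \<bar>l\<bar> * (X * d * d)" by (simp add: algebra_simps)
  also have "\<dots> = 2 * pi * l\<^sup>2 * exp \<bar>l\<bar>" by (simp add: dX)
  finally have D: "norm (integral {-d..d} ?f - integral {-d..d} ?g) \<le> 2 * pi * l\<^sup>2 * exp \<bar>l\<bar>"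
    using fi gi by (simp add: Henstock_Kurzweil_Integration.integral_diff)
  have G: "norm (integral {-d..d} ?g) \<le> 5"
    using d by (intro norm_integral_dker_cis_linear_le) auto
  have "integral {-(1/2)..1/2} ?f = integral {-(1/2)..-d} ?f + integral {-d..1/2} ?f"
    using d by (intro Henstock_Kurzweil_Integration.integral_combine[symmetric] fi) auto
  also have "integral {-d..1/2} ?f = integral {-d..d} ?f + integral {d..1/2} ?f"
    using d by (intro Henstock_Kurzweil_Integration.integral_combine[symmetric] fi) auto
  finally have "integral {-(1/2)..1/2} ?f = integral {-(1/2)..-d} ?f + ((integral {-d..d} ?f - integral {-d..d} ?g) + integral {-d..d} ?g) + integral {d..1/2} ?f"
    by simp
  also have "norm \<dots> \<le> vdC_const l / 2 + (2 * pi * l\<^sup>2 * exp \<bar>l\<bar> + 5) + vdC_const l / 2"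
    by (intro norm_triangle_mono R L D G)
  finally show ?thesis by (simp add: mode_const_def)
qed

section \<open>Periodic Bernoulli functions\<close>

definition poly_primitive :: "real poly \<Rightarrow> real poly" where
  "poly_primitive p = (\<Sum>i\<le>degree p. monom (coeff p i / real (Suc i)) (Suc i))"

lemma pderiv_sum: "pderiv (\<Sum>i\<in>A. f i) = (\<Sum>i\<in>A. pderiv (f i))"
  by (induction A rule: infinite_finite_induct) (simp_all add: pderiv_add)

lemma pderiv_poly_primitive [simp]: "pderiv (poly_primitive p) = p"
proof -
  have "pderiv (poly_primitive p) = (\<Sum>i\<le>degree p. monom (coeff p i) i)"
    unfolding poly_primitive_def pderiv_sum
    by (intro sum.cong refl) (simp add: pderiv_monom del: of_nat_Suc)
  then show ?thesis by (simp add: poly_as_sum_of_monoms)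
qed

lemma poly_primitive_0 [simp]: "poly (poly_primitive p) 0 = 0"
  by (simp add: poly_primitive_def poly_sum poly_monom)

text \<open>These are the Bernoulli polynomials divided by \<open>k!\<close>: each is the primitive of its predecessor
  whose mean over the unit interval vanishes.\<close>
fun bern :: "nat \<Rightarrow> real poly" where
  "bern 0 = 1"
| "bern (Suc k) = poly_primitive (bern k) - [: poly (poly_primitive (poly_primitive (bern k))) 1 :]"

lemma pderiv_bern [simp]: "pderiv (bern (Suc k)) = bern k"
  by (simp add: pderiv_diff pderiv_pCons)

lemma bern_1: "bern (Suc 0) = [: - 1/2, 1 :]"
  by (simp add: poly_primitive_def monom_altdef one_pCons)

lemma has_integral_poly_pderiv:
  "a \<le> b \<Longrightarrow> (poly (pderiv p) has_integral (poly p b - poly p a)) {a..b}" for p :: "real poly"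
  by (intro fundamental_theorem_of_calculus)
     (auto simp flip: has_real_derivative_iff_has_vector_derivative intro: has_field_derivative_at_within)

lemma has_integral_bern_unit: "k \<ge> 1 \<Longrightarrow> (poly (bern k) has_integral 0) {0..1}"
proof (cases k)
  case (Suc j)
  let ?c = "poly (poly_primitive (poly_primitive (bern j))) 1"
  have "pderiv (poly_primitive (poly_primitive (bern j)) - [:0, ?c:]) = bern k"
    by (simp add: Suc pderiv_diff pderiv_pCons)
  then show ?thesis
    using has_integral_poly_pderiv[of 0 1 "poly_primitive (poly_primitive (bern j)) - [:0, ?c:]"] by simp
qed simp

text \<open>The increment over the unit interval is the integral of the predecessor, which has mean
  zero from index \<open>1\<close> on.\<close>

lemma bern_0_eq_bern_1:
  assumes "k \<ge> 2"
  shows "poly (bern k) 1 = poly (bern k) 0"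
proof -
  obtain j where j: "k = Suc j" "j \<ge> 1" using assms by (cases k) auto
  have "(poly (pderiv (bern k)) has_integral (poly (bern k) 1 - poly (bern k) 0)) {0..1}"
    by (rule has_integral_poly_pderiv) simp
  moreover have "pderiv (bern k) = bern j" unfolding j(1) by (rule pderiv_bern)
  ultimately have "(poly (bern j) has_integral (poly (bern k) 1 - poly (bern k) 0)) {0..1}" by simp
  from has_integral_unique[OF this has_integral_bern_unit[OF j(2)]] show ?thesis by simp
qed

declare bern.simps(2) [simp del]

definition pbern :: "nat \<Rightarrow> real \<Rightarrow> real" where
  "pbern k x = poly (bern k) (frac x)"

lemma pbern_add_int [simp]: "pbern k (x + of_int n) = pbern k x"
  by (simp add: pbern_def frac_def)

lemma pbern_bounded: "\<exists>C>0. \<forall>x. \<bar>pbern k x\<bar> \<le> C"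
proof -
  have "compact (poly (bern k) ` {0..1})"
    by (intro compact_continuous_image continuous_intros) auto
  then obtain C where C: "C > 0" "\<forall>y \<in> poly (bern k) ` {0..1}. norm y \<le> C"
    using bounded_pos compact_imp_bounded by metis
  have "\<bar>pbern k x\<bar> \<le> C" for x
    using C(2) frac_ge_0[of x] frac_lt_1[of x] by (force simp: pbern_def)
  then show ?thesis using C by blast
qed

text \<open>Only the existence of a bound matters; a chosen constant lets later estimates be written
  as explicit expressions.\<close>

definition pbern_bound :: "nat \<Rightarrow> real" where
  "pbern_bound k = (SOME C. C > 0 \<and> (\<forall>x. \<bar>pbern k x\<bar> \<le> C))"

lemma pbern_bound: "pbern_bound k > 0" "\<bar>pbern k x\<bar> \<le> pbern_bound k"
  using someI_ex[OF pbern_bounded[of k]] by (auto simp: pbern_bound_def)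

lemma borel_measurable_pbern [measurable]: "pbern k \<in> borel_measurable borel"
proof -
  have [measurable]: "poly (bern k) \<in> borel_measurable borel"
    by (intro borel_measurable_continuous_onI continuous_intros)
  show ?thesis unfolding pbern_def frac_def by measurable
qed

lemma has_real_derivative_frac:
  assumes "x \<notin> \<int>"
  shows "(frac has_real_derivative 1) (at x)"
proof (rule has_field_derivative_transform_within_open[where f = "\<lambda>y. y - of_int \<lfloor>x\<rfloor>" and S = "{of_int \<lfloor>x\<rfloor> <..< of_int \<lfloor>x\<rfloor> + 1}"])
  show "((\<lambda>y. y - of_int \<lfloor>x\<rfloor>) has_real_derivative 1) (at x)"
    by (auto intro!: derivative_eq_intros)
  show "x \<in> {real_of_int \<lfloor>x\<rfloor> <..< real_of_int \<lfloor>x\<rfloor> + 1}"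
  proof -
    have "x \<noteq> real_of_int \<lfloor>x\<rfloor>" using assms Ints_of_int by metis
    then have "real_of_int \<lfloor>x\<rfloor> < x" using of_int_floor_le[of x] by (metis order_le_less)
    then show ?thesis using floor_correct[of x] by simp
  qed
  show "y - real_of_int \<lfloor>x\<rfloor> = frac y" if "y \<in> {real_of_int \<lfloor>x\<rfloor> <..< real_of_int \<lfloor>x\<rfloor> + 1}" for y
    using that floor_unique[of "\<lfloor>x\<rfloor>" y] by (simp add: frac_def)
qed auto

lemma has_real_derivative_pbern:
  assumes "x \<notin> \<int>"
  shows "(pbern (Suc k) has_real_derivative pbern k x) (at x)"
  unfolding pbern_def[abs_def]
  using DERIV_chain2[OF poly_DERIV has_real_derivative_frac[OF assms], of "bern (Suc k)"]
  by (simp)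

text \<open>From index \<open>2\<close> on the end values of the polynomial agree, so points in
  different cells are joined through the integer above one and the integer below the other. With
  whole periods removed, this path is no longer than \<open>\<bar>x - y\<bar>\<close>.\<close>

lemma pbern_lipschitz:
  assumes k: "k \<ge> 1"
  shows "\<exists>K. \<forall>x y. \<bar>pbern (Suc k) x - pbern (Suc k) y\<bar> \<le> K * \<bar>x - y\<bar>"
proof -
  let ?p = "poly (bern (Suc k))"
  have "compact (poly (bern k) ` {0..1})"
    by (intro compact_continuous_image continuous_intros) auto
  then obtain C where C: "C > 0" "\<forall>y \<in> poly (bern k) ` {0..1}. norm y \<le> C"
    using bounded_pos compact_imp_bounded by metis
  have lip: "\<bar>?p s - ?p t\<bar> \<le> C * \<bar>s - t\<bar>" if "s \<in> {0..1}" "t \<in> {0..1}" for s t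
  proof -
    have "norm (?p s - ?p t) \<le> C * norm (s - t)"
    proof (rule field_differentiable_bound[where S = "{0..1}" and f' = "poly (bern k)"])
      show "(?p has_field_derivative poly (bern k) z) (at z within {0..1})" for z
        using poly_DERIV[of "bern (Suc k)" z] unfolding pderiv_bern by (rule has_field_derivative_at_within)
    qed (use C that in auto)
    then show ?thesis by simp
  qed
  have e: "?p 1 = ?p 0" using k by (intro bern_0_eq_bern_1) auto
  have *: "\<bar>pbern (Suc k) x - pbern (Suc k) y\<bar> \<le> C * (y - x)" if xy: "x \<le> y" for x y
  proof (cases "\<lfloor>x\<rfloor> = \<lfloor>y\<rfloor>")
    case True
    then have "frac x - frac y = x - y" by (simp add: frac_def)
    then show ?thesis using lip[of "frac x" "frac y"] frac_ge_0[of x] frac_lt_1[of x] frac_ge_0[of y] frac_lt_1[of y] xy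
      by (simp add: pbern_def)
  next
    case False
    then have f: "\<lfloor>x\<rfloor> + 1 \<le> \<lfloor>y\<rfloor>" using floor_mono[OF xy] by simp
    have "real_of_int \<lfloor>x\<rfloor> + 1 \<le> real_of_int \<lfloor>y\<rfloor>" using f by linarith
    then have d: "(1 - frac x) + frac y \<le> y - x" by (simp add: frac_def)
    have "\<bar>?p (frac x) - ?p 1\<bar> \<le> C * (1 - frac x)" "\<bar>?p 0 - ?p (frac y)\<bar> \<le> C * frac y"
      using lip[of "frac x" 1] lip[of 0 "frac y"] frac_ge_0[of x] frac_lt_1[of x] frac_ge_0[of y] frac_lt_1[of y]
      by (simp_all add: less_imp_le)
    then have "\<bar>?p (frac x) - ?p (frac y)\<bar> \<le> C * ((1 - frac x) + frac y)"
      using e by (simp add: distrib_left)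
    also have "\<dots> \<le> C * (y - x)" using d C by (intro mult_left_mono) auto
    finally show ?thesis by (simp add: pbern_def)
  qed
  have "\<bar>pbern (Suc k) x - pbern (Suc k) y\<bar> \<le> C * \<bar>x - y\<bar>" for x y
    using *[of x y] *[of y x] by (cases "x \<le> y") (auto simp: abs_minus_commute)
  then show ?thesis by (intro exI[of _ C] allI)
qed

lemma continuous_on_pbern:
  assumes k: "k \<ge> 2" and g: "continuous_on S g"
  shows "continuous_on S (\<lambda>x. pbern k (g x))"
proof -
  obtain j where j: "k = Suc j" "j \<ge> 1" using k by (cases k) auto
  obtain K where K: "\<And>x y. \<bar>pbern k x - pbern k y\<bar> \<le> K * \<bar>x - y\<bar>"
    using pbern_lipschitz[OF j(2)] unfolding j(1)[symmetric] by auto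
  have "K-lipschitz_on UNIV (pbern k)"
  proof (rule lipschitz_onI)
    show "0 \<le> K" using order_trans[OF abs_ge_zero K[of 1 0]] by simp
  qed (use K in \<open>auto simp: dist_real_def\<close>)
  then have "continuous_on UNIV (pbern k)" by (rule lipschitz_on_continuous_on)
  then show ?thesis by (rule continuous_on_compose2[OF _ g]) auto
qed

lemma integrable_bounded_borel:
  fixes f :: "real \<Rightarrow> 'a::euclidean_space"
  assumes "f \<in> borel_measurable borel" "\<And>x. x \<in> {a..b} \<Longrightarrow> norm (f x) \<le> B"
  shows "f integrable_on {a..b}"
proof (rule measurable_bounded_by_integrable_imp_integrable[where g = "\<lambda>_. B"])
  have "f \<in> borel_measurable lebesgue"
    using assms(1) by (intro measurable_completion) simp
  then show "f \<in> borel_measurable (lebesgue_on {a..b})" by (rule measurable_restrict_space1)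
qed (use assms in \<open>auto simp: integrable_const_ivl\<close>)

section \<open>Truncated Fourier series of the periodic Bernoulli functions\<close>

text \<open>Symmetric partial sum of the Fourier series of \<open>pbern k\<close> for
  \<open>k \<ge> 1\<close>: the coefficient at \<open>m \<noteq> 0\<close> is
  \<open>- 1 / (2 * pi * \<i> * m) ^ k\<close>, the one at \<open>0\<close> vanishes.\<close>

definition bern_modes :: "nat \<Rightarrow> nat \<Rightarrow> real \<Rightarrow> complex" where
  "bern_modes k H x = - (\<Sum>m\<in>{- int H..int H} - {0}. cis (2 * pi * of_int m * x) / (2 * pi * \<i> * of_int m) ^ k)"

lemma continuous_on_bern_modes [continuous_intros]:
  "continuous_on S g \<Longrightarrow> continuous_on S (\<lambda>x. bern_modes k H (g x))"
  unfolding bern_modes_def by (intro continuous_intros) auto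

lemma sum_symmetric_int:
  fixes f :: "int \<Rightarrow> 'a::comm_monoid_add"
  shows "(\<Sum>m\<in>{- int H..int H} - {0}. f m) = (\<Sum>m=1..H. f (int m) + f (- int m))"
proof -
  have "{- int H..int H} - {0} = int ` {1..H} \<union> (\<lambda>m. - int m) ` {1..H}"
  proof (intro equalityI subsetI)
    fix m assume m: "m \<in> {- int H..int H} - {0}"
    show "m \<in> int ` {1..H} \<union> (\<lambda>m. - int m) ` {1..H}"
    proof (cases "m > 0")
      case True then show ?thesis using m by (intro UnI1 image_eqI[of _ _ "nat m"]) auto
    next
      case False then show ?thesis using m by (intro UnI2 image_eqI[of _ _ "nat (- m)"]) auto
    qed
  qed auto
  then have "(\<Sum>m\<in>{- int H..int H} - {0}. f m) = sum f (int ` {1..H}) + sum f ((\<lambda>m. - int m) ` {1..H})"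
    by (simp only:) (rule sum.union_disjoint, auto)
  also have "sum f (int ` {1..H}) = (\<Sum>m=1..H. f (int m))" by (subst sum.reindex) (auto simp: inj_on_def)
  also have "sum f ((\<lambda>m. - int m) ` {1..H}) = (\<Sum>m=1..H. f (- int m))" by (subst sum.reindex) (auto simp: inj_on_def)
  finally show ?thesis by (simp add: sum.distrib)
qed

lemma bern_modes_1: "bern_modes (Suc 0) H x = - of_real (\<Sum>m=1..H. sin (2 * pi * real m * x) / (pi * real m))"
proof -
  have "cis (2 * pi * real m * x) / (2 * pi * \<i> * of_nat m) + cis (2 * pi * (- real m) * x) / (2 * pi * \<i> * - of_nat m)
     = of_real (sin (2 * pi * real m * x) / (pi * real m))" if "m \<ge> 1" for m
  proof -
    have "cis (2 * pi * real m * x) / (2 * pi * \<i> * of_nat m) + cis (2 * pi * (- real m) * x) / (2 * pi * \<i> * - of_nat m)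
       = (cis (2 * pi * real m * x) - cis (- (2 * pi * real m * x))) / (2 * pi * \<i> * of_nat m)"
      by (simp add: diff_divide_distrib)
    also have "cis (2 * pi * real m * x) - cis (- (2 * pi * real m * x)) = 2 * \<i> * of_real (sin (2 * pi * real m * x))"
      by (simp add: complex_eq_iff)
    finally show ?thesis using that by (simp add: field_simps)
  qed
  then show ?thesis unfolding bern_modes_def sum_symmetric_int of_real_sum by (intro arg_cong[where f = uminus] sum.cong) auto
qed


lemma has_vector_derivative_bern_modes:
  "(bern_modes (Suc k) H has_vector_derivative bern_modes k H x) (at x within S)"
  unfolding bern_modes_def[abs_def]
proof (intro has_vector_derivative_minus has_vector_derivative_sum)
  fix m assume m: "m \<in> {- int H..int H} - {0}"
  have "((\<lambda>x. 2 * pi * of_int m * x) has_real_derivative 2 * pi * of_int m) (at x within S)"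
    by (auto intro!: derivative_eq_intros)
  from has_vector_derivative_divide[OF has_vector_derivative_cis[OF this], of "(2 * pi * \<i> * of_int m) ^ Suc k"]
  have "((\<lambda>x. cis (2 * pi * of_int m * x) / (2 * pi * \<i> * of_int m) ^ Suc k) has_vector_derivative
      complex_of_real (2 * pi * of_int m) * \<i> * cis (2 * pi * of_int m * x) / (2 * pi * \<i> * of_int m) ^ Suc k) (at x within S)" .
  moreover have "complex_of_real (2 * pi * of_int m) * \<i> * cis (2 * pi * of_int m * x) / (2 * pi * \<i> * of_int m) ^ Suc k
     = cis (2 * pi * of_int m * x) / (2 * pi * \<i> * of_int m) ^ k"
    using m by (simp add: field_simps)
  ultimately show "((\<lambda>x. cis (2 * pi * of_int m * x) / (2 * pi * \<i> * of_int m) ^ Suc k) has_vector_derivative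
      cis (2 * pi * of_int m * x) / (2 * pi * \<i> * of_int m) ^ k) (at x within S)" by simp
qed

lemma bern_modes_add_int [simp]: "bern_modes k H (x + of_int n) = bern_modes k H x"
proof -
  have "cis (2 * pi * of_int m * (x + of_int n)) = cis (2 * pi * of_int m * x)" for m
  proof -
    have "cis (2 * pi * of_int m * (x + of_int n)) = cis (2 * pi * of_int m * x) * cis (2 * pi * of_int (m * n))"
      by (simp add: cis_mult algebra_simps)
    also have "cis (2 * pi * of_int (m * n)) = 1" by (rule cis_multiple_2pi) simp
    finally show ?thesis by simp
  qed
  then show ?thesis by (simp add: bern_modes_def)
qed

definition bern_rem :: "nat \<Rightarrow> nat \<Rightarrow> real \<Rightarrow> complex" where
  "bern_rem k H x = of_real (pbern k x) - bern_modes k H x"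

lemma bern_rem_add_int [simp]: "bern_rem k H (x + of_int n) = bern_rem k H x"
  by (simp add: bern_rem_def)

lemma borel_measurable_bern_rem [measurable]: "bern_rem k H \<in> borel_measurable borel"
proof -
  have [measurable]: "bern_modes k H \<in> borel_measurable borel"
    by (intro borel_measurable_continuous_onI continuous_intros)
  show ?thesis unfolding bern_rem_def by measurable
qed

lemma norm_bern_modes_le:
  assumes "k \<ge> 1" shows "norm (bern_modes k H x) \<le> 2 * real H"
proof -
  have "norm (bern_modes k H x) \<le> (\<Sum>m\<in>{- int H..int H} - {0}. norm (cis (2 * pi * of_int m * x) / (2 * pi * \<i> * of_int m) ^ k))"
    by (simp only: bern_modes_def norm_minus_cancel) (rule norm_sum)
  also have "\<dots> \<le> (\<Sum>m\<in>{- int H..int H} - {0}. 1)"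
  proof (intro sum_mono)
    fix m assume m: "m \<in> {- int H..int H} - {0}"
    have "1 \<le> 2 * pi * \<bar>real_of_int m\<bar>"
      using m pi_ge_two mult_mono[of 1 "2 * pi" 1 "\<bar>real_of_int m\<bar>"] by auto
    then show "norm (cis (2 * pi * of_int m * x) / (2 * pi * \<i> * of_int m) ^ k) \<le> 1"
      by (simp add: norm_divide norm_power norm_mult one_le_power)
  qed
  also have "\<dots> = 2 * real H" by (simp add: card_Diff_singleton)
  finally show ?thesis .
qed

lemma norm_bern_rem_le:
  assumes "k \<ge> 1" shows "norm (bern_rem k H x) \<le> pbern_bound k + 2 * real H"
  unfolding bern_rem_def using norm_bern_modes_le[OF assms, of H x] pbern_bound(2)[of k x]
  by (intro norm_triangle_le_diff) simp

lemma integrable_bern_rem: "k \<ge> 1 \<Longrightarrow> bern_rem k H integrable_on {a..b}"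
  and integrable_norm_bern_rem: "k \<ge> 1 \<Longrightarrow> (\<lambda>x. norm (bern_rem k H x)) integrable_on {a..b}"
  by (rule integrable_bounded_borel[where B = "pbern_bound k + 2 * real H"], measurable, simp add: norm_bern_rem_le)+

lemma bern_rem_1_eq:
  assumes "0 \<le> x" "x < 1"
  shows "bern_rem (Suc 0) H x = of_real (x - 1/2 + (\<Sum>m=1..H. sin (2 * pi * real m * x) / (pi * real m)))"
proof -
  have "frac x = x" using assms by (simp add: frac_eq)
  then show ?thesis by (simp add: bern_rem_def bern_modes_1 pbern_def bern_1)
qed

text \<open>Up to a linear term the partial Fourier sum of the sawtooth is the primitive of the
  Dirichlet kernel, so the remainder is a tail integral of the kernel and inherits its
  bounds.\<close>

lemma bern_rem_1_half:
  assumes "0 \<le> x" "x \<le> 1/2"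
  shows "bern_rem (Suc 0) H x = - of_real (integral {x..1/2} (dker H))"
proof -
  have "integral {x..1/2} (dker H) = 1/2 - (x + (\<Sum>m=1..H. sin (2 * pi * real m * x) / (pi * real m)))"
    using integral_unique[OF has_integral_dker[OF assms(2), of H]] by simp
  then show ?thesis using assms by (simp only: bern_rem_1_eq) simp
qed

lemma bern_rem_1_reflect:
  assumes "0 < x" "x < 1"
  shows "bern_rem (Suc 0) H (1 - x) = - bern_rem (Suc 0) H x"
proof -
  have "sin (2 * pi * real m * (1 - x)) = - sin (2 * pi * real m * x)" for m
  proof -
    have "sin (2 * pi * real m * (1 - x)) = sin (2 * pi * of_int (int m) - 2 * pi * real m * x)"
      by (simp add: algebra_simps)
    then show ?thesis by (simp only: sin_diff sin_int_2pin cos_int_2pin)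
  qed
  then show ?thesis using assms by (simp add: bern_rem_1_eq sum_negf)
qed

lemma norm_bern_rem_1_le_inverse:
  assumes "0 < d" "d \<le> x" "x \<le> 1 - d"
  shows "norm (bern_rem (Suc 0) H x) \<le> 1 / ((2 * real H + 1) * d)"
proof -
  have *: "norm (bern_rem (Suc 0) H y) \<le> 1 / ((2 * real H + 1) * d)" if "d \<le> y" "y \<le> 1/2" for y
  proof -
    have "norm (bern_rem (Suc 0) H y) \<le> 1 / ((2 * real H + 1) * y)"
      using abs_integral_dker_le_inverse[of y H] that assms by (simp add: bern_rem_1_half)
    also have "\<dots> \<le> 1 / ((2 * real H + 1) * d)"
      using that assms by (intro divide_left_mono mult_left_mono mult_pos_pos) auto
    finally show ?thesis .
  qed
  show ?thesis
    using *[of x] *[of "1 - x"] bern_rem_1_reflect[of x H] assms by (cases "x \<le> 1/2") auto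
qed

text \<open>Near the jump the remainder does not become small as \<open>H\<close> grows, but it
  stays bounded.\<close>

lemma norm_bern_rem_1_le:
  assumes "0 \<le> x" "x \<le> 1"
  shows "norm (bern_rem (Suc 0) H x) \<le> 3/2"
proof -
  have *: "norm (bern_rem (Suc 0) H y) \<le> 3/2" if "0 \<le> y" "y \<le> 1/2" for y
    using integral_dker_zero_le[of y H] that by (simp add: bern_rem_1_half)
  have "bern_rem (Suc 0) H 1 = bern_rem (Suc 0) H 0" using bern_rem_add_int[of "Suc 0" H 0 1] by simp
  then show ?thesis
    using *[of x] *[of "1 - x"] bern_rem_1_reflect[of x H] assms by (cases "x \<le> 1/2"; cases "x = 1") auto
qed

lemma has_integral_bern_rem_unit:
  assumes "k \<ge> 1" shows "(bern_rem k H has_integral 0) {0..1}"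
proof -
  have "(pbern k has_integral 0) {0..1}"
  proof (rule has_integral_spike_finite[OF _ _ has_integral_bern_unit[OF assms]])
    show "pbern k x = poly (bern k) x" if "x \<in> {0..1} - {1}" for x
      using that by (simp add: pbern_def frac_eq[THEN iffD2])
  qed auto
  then have 1: "((\<lambda>x. complex_of_real (pbern k x)) has_integral of_real 0) {0..1}"
    by (rule has_integral_of_real)
  have "(bern_modes k H has_integral (bern_modes (Suc k) H 1 - bern_modes (Suc k) H 0)) {0..1}"
    by (intro fundamental_theorem_of_calculus has_vector_derivative_bern_modes) auto
  then have 2: "(bern_modes k H has_integral 0) {0..1}"
    using bern_modes_add_int[of "Suc k" H 0 1] by simp
  from has_integral_diff[OF 1 2] show ?thesis by (simp add: bern_rem_def[abs_def])
qed

text \<open>\<open>bern_rem (Suc k) H\<close> is a primitive of \<open>bern_rem k H\<close> on the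
  unit interval and has mean zero. Each of its values is thus the mean of differences of values, and
  every difference is at most the integral of the norm of \<open>bern_rem k H\<close>.\<close>

lemma norm_bern_rem_Suc_le_integral:
  assumes k: "k \<ge> 1" and x: "x \<in> {0..1}"
  shows "norm (bern_rem (Suc k) H x) \<le> integral {0..1} (\<lambda>x. norm (bern_rem k H x))"
proof -
  let ?I = "integral {0..1} (\<lambda>x. norm (bern_rem k H x))"
  have diff: "norm (bern_rem (Suc k) H x - bern_rem (Suc k) H y) \<le> ?I" if "0 \<le> y" "y \<le> x" "x \<le> 1" for x y
  proof -
    have "(bern_rem k H has_integral (bern_rem (Suc k) H x - bern_rem (Suc k) H y)) {y..x}"
    proof (rule fundamental_theorem_of_calculus_interior)
      show "continuous_on {y..x} (bern_rem (Suc k) H)"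
        unfolding bern_rem_def using k by (intro continuous_intros continuous_on_pbern) auto
      fix t assume t: "t \<in> {y<..<x}"
      have "t \<notin> \<int>"
      proof
        assume "t \<in> \<int>"
        then obtain n where "t = of_int n" by (elim Ints_cases)
        then have "0 < real_of_int n" "real_of_int n < 1" using t that by auto
        then show False by simp
      qed
      from has_real_derivative_pbern[OF this, of k]
      show "(bern_rem (Suc k) H has_vector_derivative bern_rem k H t) (at t)"
        unfolding bern_rem_def[abs_def]
        by (intro has_vector_derivative_diff has_vector_derivative_bern_modes has_vector_derivative_of_real)
           (simp add: has_real_derivative_iff_has_vector_derivative)
    qed (use that in auto)
    then have "norm (bern_rem (Suc k) H x - bern_rem (Suc k) H y) = norm (integral {y..x} (bern_rem k H))"
      by (simp add: integral_unique)
    also have "\<dots> \<le> integral {y..x} (\<lambda>t. norm (bern_rem k H t))"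
      using k by (intro integral_norm_bound_integral integrable_bern_rem integrable_norm_bern_rem) auto
    also have "\<dots> \<le> ?I"
      using k that by (intro integral_subset_le integrable_norm_bern_rem) auto
    finally show ?thesis .
  qed
  have le: "norm (bern_rem (Suc k) H x) \<le> ?I" if x: "x \<in> {0..1}" for x
  proof -
    have c: "((\<lambda>y. bern_rem (Suc k) H x - bern_rem (Suc k) H y) has_integral (bern_rem (Suc k) H x - 0)) {0..1}"
      using has_integral_diff[OF has_integral_const_real[of "bern_rem (Suc k) H x" 0 1] has_integral_bern_rem_unit[of "Suc k" H]]
      by simp
    then have "norm (bern_rem (Suc k) H x) = norm (integral {0..1} (\<lambda>y. bern_rem (Suc k) H x - bern_rem (Suc k) H y))"
      by (simp add: integral_unique)
    also have "\<dots> \<le> ?I * (1 - 0)"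
    proof (rule norm_integral_le_length)
      show "(\<lambda>y. bern_rem (Suc k) H x - bern_rem (Suc k) H y) integrable_on {0..1}" using c by blast
      show "norm (bern_rem (Suc k) H x - bern_rem (Suc k) H y) \<le> ?I" if "y \<in> {0..1}" for y
        using diff[of y x] diff[of x y] x that by (cases "y \<le> x") (auto simp: norm_minus_commute)
    qed simp
    finally show ?thesis by simp
  qed
  show ?thesis by (rule le[OF x])
qed

text \<open>For \<open>k = 1\<close> pieces of length \<open>d\<close> at the jump are estimated by
  boundedness, and elsewhere the remainder is at most \<open>1 / (2 * real H * d)\<close>. The bound
  passes to higher \<open>k\<close> through the sup norm.\<close>

lemma integral_norm_bern_rem_le:
  assumes H: "H \<ge> 1" and k: "k \<ge> 1"
  shows "integral {0..1} (\<lambda>x. norm (bern_rem k H x)) \<le> 4 / sqrt (real H)"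
  using k
proof (induction k rule: dec_induct)
  case base
  let ?f = "\<lambda>x. norm (bern_rem 1 H x)"
  \<comment> \<open>The order \<open>1 / sqrt (real H)\<close> balances the two
    contributions.\<close>
  define d where "d = 1 / (2 * sqrt (real H))"
  have sH: "sqrt (real H) \<ge> 1" using H by simp
  have "d > 0" using H by (simp add: d_def)
  moreover have "d \<le> 1/2" using sH divide_left_mono[of 1 "sqrt (real H)" "1/2"] by (simp add: d_def)
  ultimately have d: "d > 0" "d \<le> 1/2" .
  have int: "?f integrable_on {a..b}" for a b using integrable_norm_bern_rem[of 1] by simp
  have 1: "norm (integral {0..d} ?f) \<le> (3/2) * (d - 0)"
    using d int norm_bern_rem_1_le[of _ H] by (intro norm_integral_le_length) auto
  have 2: "norm (integral {1-d..1} ?f) \<le> (3/2) * (1 - (1 - d))"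
    using d int norm_bern_rem_1_le[of _ H] by (intro norm_integral_le_length) auto
  have 3: "norm (integral {d..1-d} ?f) \<le> (1 / ((2 * real H + 1) * d)) * ((1 - d) - d)"
    using d int norm_bern_rem_1_le_inverse[of d _ H] by (intro norm_integral_le_length) auto
  also have "\<dots> \<le> (1 / ((2 * real H + 1) * d)) * 1" using d by (intro mult_left_mono) auto
  also have "\<dots> \<le> 1 / (2 * real H * d)" using d H by (simp add: divide_left_mono)
  also have "\<dots> = 1 / sqrt (real H)" using H by (simp add: d_def real_div_sqrt)
  finally have 3: "integral {d..1-d} ?f \<le> 1 / sqrt (real H)" by simp
  have "integral {0..1} ?f = integral {0..d} ?f + integral {d..1} ?f"
    using d by (intro Henstock_Kurzweil_Integration.integral_combine[symmetric] int) auto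
  also have "integral {d..1} ?f = integral {d..1-d} ?f + integral {1-d..1} ?f"
    using d by (intro Henstock_Kurzweil_Integration.integral_combine[symmetric] int) auto
  finally have "integral {0..1} ?f \<le> 3 * d + 1 / sqrt (real H)" using 1 2 3 by simp
  also have "\<dots> = (5/2) / sqrt (real H)" by (simp add: d_def)
  also have "\<dots> \<le> 4 / sqrt (real H)" by (intro divide_right_mono) auto
  finally show ?case .
next
  case (step k)
  have "norm (integral {0..1} (\<lambda>x. norm (bern_rem (Suc k) H x))) \<le> integral {0..1} (\<lambda>x. norm (bern_rem k H x)) * (1 - 0)"
    using norm_bern_rem_Suc_le_integral[OF step.hyps(1)] by (intro norm_integral_le_length integrable_norm_bern_rem) auto
  then show ?case using step.IH by simp
qed

lemma norm_bern_rem_Suc_le: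
  assumes "k \<ge> 1" "H \<ge> 1"
  shows "norm (bern_rem (Suc k) H x) \<le> 4 / sqrt (real H)"
proof -
  have "bern_rem (Suc k) H x = bern_rem (Suc k) H (frac x)"
    using bern_rem_add_int[of "Suc k" H "frac x" "\<lfloor>x\<rfloor>"] by (simp add: frac_def)
  then have "norm (bern_rem (Suc k) H x) \<le> integral {0..1} (\<lambda>x. norm (bern_rem k H x))"
    using norm_bern_rem_Suc_le_integral[OF assms(1), of "frac x" H] frac_lt_1[of x] by simp
  also have "\<dots> \<le> 4 / sqrt (real H)" by (rule integral_norm_bern_rem_le[OF assms(2,1)])
  finally show ?thesis .
qed

section \<open>Means of periodic functions along exponential curves\<close>

text \<open>Enlarging the interval to integer end points adds less than \<open>2\<close> to its
  length, and full periods contribute the mean exactly.\<close>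

lemma integral_periodic_le:
  fixes g :: "real \<Rightarrow> real"
  assumes int: "\<And>a b. g integrable_on {a..b}" and nn: "\<And>x. 0 \<le> g x"
    and per: "\<And>x (n::int). g (x + of_int n) = g x" and ab: "a \<le> b"
  shows "integral {a..b} g \<le> (b - a + 2) * integral {0..1} g"
proof -
  have unit: "integral {of_int n..of_int n + 1} g = integral {0..1} g" for n :: int
  proof -
    have "g \<circ> (+) (of_int n) = g" using per by (auto simp: add.commute)
    then show ?thesis using integral_shift_Icc_real[of 0 1 g "of_int n"] by (simp add: add.commute)
  qed
  have block: "integral {of_int n..of_int n + real K} g = real K * integral {0..1} g" for n K
  proof (induction K)
    case (Suc K)
    have "integral {of_int n..of_int n + real (Suc K)} g = integral {of_int n..of_int n + real K} g
        + integral {of_int n + real K..of_int n + real (Suc K)} g"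
      by (intro Henstock_Kurzweil_Integration.integral_combine[symmetric] int) auto
    also have "integral {of_int n + real K..of_int n + real (Suc K)} g = integral {0..1} g"
      using unit[of "n + int K"] by (simp add: algebra_simps)
    finally show ?case using Suc by (simp add: algebra_simps)
  qed simp
  define K where "K = nat (\<lceil>b\<rceil> - \<lfloor>a\<rfloor>)"
  have "\<lfloor>a\<rfloor> \<le> \<lceil>b\<rceil>" using ab by linarith
  then have K: "real K = of_int \<lceil>b\<rceil> - of_int \<lfloor>a\<rfloor>" by (simp add: K_def)
  have "integral {a..b} g \<le> integral {of_int \<lfloor>a\<rfloor>..of_int \<lfloor>a\<rfloor> + real K} g"
  proof (rule integral_subset_le[OF _ int int])
    show "{a..b} \<subseteq> {of_int \<lfloor>a\<rfloor>..of_int \<lfloor>a\<rfloor> + real K}"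
      unfolding K atLeastatMost_subset_iff by linarith
  qed (use nn in auto)
  also have "\<dots> = real K * integral {0..1} g" by (rule block)
  also have "\<dots> \<le> (b - a + 2) * integral {0..1} g"
  proof (rule mult_right_mono)
    show "real K \<le> b - a + 2" unfolding K by linarith
    show "integral {0..1} g \<ge> 0" by (intro Henstock_Kurzweil_Integration.integral_nonneg int nn)
  qed
  finally show ?thesis .
qed

definition expave_const :: "real \<Rightarrow> real" where
  "expave_const l = 2 * exp l + 2 * exp (l / 2) / l"

text \<open>Substituting \<open>y = X * exp (l * u)\<close> gives an integral of \<open>g\<close>
  over an interval of length \<open>O(X * V)\<close> with a density of order \<open>1 / X\<close>.
  The term \<open>1 / X\<close> pays for the incomplete periods at the ends and is felt only on
  short windows.\<close>

lemma integral_exp_periodic_le: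
  fixes g :: "real \<Rightarrow> real"
  assumes g: "g \<in> borel_measurable borel" and B: "\<And>x. g x \<le> B" and nn: "\<And>x. 0 \<le> g x"
    and per: "\<And>x (n::int). g (x + of_int n) = g x"
    and l: "l > 0" and X: "X > 0" and V: "0 \<le> V" "V \<le> 1/2"
  shows "integral {-V..V} (\<lambda>u. g (X * exp (l * u))) \<le> expave_const l * (V + 1 / X) * integral {0..1} g"
proof -
  note g [measurable]
  have gi: "g integrable_on {a..b}" for a b
    by (rule integrable_bounded_borel[where B = B]) (use B nn in auto)
  have I0: "integral {0..1} g \<ge> 0" by (intro Henstock_Kurzweil_Integration.integral_nonneg gi nn)
  let ?\<phi> = "\<lambda>u. X * exp (l * u)"
  let ?\<phi>' = "\<lambda>u. X * (l * exp (l * u))"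
  have img: "?\<phi> ` {-V..V} = {X * exp (- (l * V))..X * exp (l * V)}"
  proof (intro equalityI subsetI)
    fix y assume y: "y \<in> {X * exp (- (l * V))..X * exp (l * V)}"
    have y0: "y > 0" using y X by (auto intro: less_le_trans[of 0 "X * exp (- (l * V))"])
    have "exp (- (l * V)) \<le> y / X" "y / X \<le> exp (l * V)" using y X by (auto simp: field_simps)
    then have "exp (- (l * V)) \<le> exp (ln (y / X))" "exp (ln (y / X)) \<le> exp (l * V)"
      using y0 X by simp_all
    then have "- (l * V) \<le> ln (y / X)" "ln (y / X) \<le> l * V"
      by (simp_all only: exp_le_cancel_iff)
    then have "ln (y / X) / l \<in> {-V..V}" using l by (auto simp: field_simps)
    moreover have "y = ?\<phi> (ln (y / X) / l)" using y0 X l by simp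
    ultimately show "y \<in> ?\<phi> ` {-V..V}" by blast
  next
    fix y assume "y \<in> ?\<phi> ` {-V..V}"
    then obtain u where u: "u \<in> {-V..V}" "y = ?\<phi> u" by blast
    have "l * (- V) \<le> l * u" "l * u \<le> l * V"
      by (rule mult_left_mono; use u l in simp)+
    then show "y \<in> {X * exp (- (l * V))..X * exp (l * V)}" using X u by auto
  qed
  have cov: "(\<lambda>u. \<bar>?\<phi>' u\<bar> * g (?\<phi> u)) absolutely_integrable_on {-V..V} \<and>
      integral {-V..V} (\<lambda>u. \<bar>?\<phi>' u\<bar> * g (?\<phi> u)) = integral (?\<phi> ` {-V..V}) g"
  proof -
    have "g absolutely_integrable_on ?\<phi> ` {-V..V}"
      unfolding img using gi nn by (auto intro!: nonnegative_absolutely_integrable_1)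
    moreover have "inj_on ?\<phi> {-V..V}" using X l by (auto simp: inj_on_def)
    moreover have "(?\<phi> has_real_derivative ?\<phi>' u) (at u within {-V..V})" for u
      by (auto intro!: derivative_eq_intros)
    ultimately show ?thesis
      using has_absolute_integral_change_of_variables_1'[of "{-V..V}" ?\<phi> ?\<phi>' g "integral (?\<phi> ` {-V..V}) g"] by simp
  qed
  have gpi: "(\<lambda>u. g (?\<phi> u)) integrable_on {-V..V}"
    by (rule integrable_bounded_borel[where B = B], measurable) (use B nn in auto)
  have "X * l * exp (- (l / 2)) * integral {-V..V} (\<lambda>u. g (?\<phi> u)) = integral {-V..V} (\<lambda>u. X * l * exp (- (l / 2)) * g (?\<phi> u))"
    by simp
  also have "\<dots> \<le> integral {-V..V} (\<lambda>u. \<bar>?\<phi>' u\<bar> * g (?\<phi> u))"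
  proof (rule integral_le)
    show "(\<lambda>u. \<bar>?\<phi>' u\<bar> * g (?\<phi> u)) integrable_on {-V..V}"
      using cov set_lebesgue_integral_eq_integral(1) by blast
    fix u assume u: "u \<in> {-V..V}"
    have "l * (- (1/2)) \<le> l * u" using u V l by (intro mult_left_mono) auto
    then have "exp (- (l / 2)) \<le> exp (l * u)" by simp
    then have "X * l * exp (- (l / 2)) \<le> \<bar>?\<phi>' u\<bar>" using X l by simp
    then show "X * l * exp (- (l / 2)) * g (?\<phi> u) \<le> \<bar>?\<phi>' u\<bar> * g (?\<phi> u)"
      using nn by (intro mult_right_mono)
  qed (use gpi in \<open>simp add: integrable_on_mult_right\<close>)
  also have "\<dots> = integral {X * exp (- (l * V))..X * exp (l * V)} g"
    using cov img by simp
  also have "\<dots> \<le> (X * exp (l * V) - X * exp (- (l * V)) + 2) * integral {0..1} g"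
    by (intro integral_periodic_le gi nn per) (use X l V in auto)
  also have "\<dots> \<le> (2 * X * l * exp (l / 2) * V + 2) * integral {0..1} g"
  proof (intro mult_right_mono I0 add_right_mono)
    have "1 - exp (- (2 * (l * V))) \<le> 2 * (l * V)"
      using exp_ge_add_one_self[of "- (2 * (l * V))"] by simp
    then have "exp (l * V) * (1 - exp (- (2 * (l * V)))) \<le> exp (l / 2) * (2 * (l * V))"
      using V l by (intro mult_mono) auto
    moreover have "exp (l * V) * (1 - exp (- (2 * (l * V)))) = exp (l * V) - exp (- (l * V))"
      by (simp add: right_diff_distrib flip: exp_add)
    ultimately have "exp (l * V) - exp (- (l * V)) \<le> exp (l / 2) * (2 * (l * V))" by linarith
    then have "X * (exp (l * V) - exp (- (l * V))) \<le> X * (exp (l / 2) * (2 * (l * V)))"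
      using X by (intro mult_left_mono) auto
    then show "X * exp (l * V) - X * exp (- (l * V)) \<le> 2 * X * l * exp (l / 2) * V"
      by (simp add: algebra_simps)
  qed
  finally have "integral {-V..V} (\<lambda>u. g (?\<phi> u)) \<le> (2 * X * l * exp (l / 2) * V + 2) * integral {0..1} g / (X * l * exp (- (l / 2)))"
    using X l by (simp add: field_simps)
  also have "\<dots> = (2 * exp l * V + 2 * exp (l / 2) / l * (1 / X)) * integral {0..1} g"
    using X l by (simp add: field_simps exp_minus flip: exp_add)
  also have "\<dots> \<le> (expave_const l * (V + 1 / X)) * integral {0..1} g"
  proof (intro mult_right_mono I0)
    have "2 * exp l * V + 2 * exp (l / 2) / l * (1 / X) \<le> expave_const l * V + expave_const l * (1 / X)"
      unfolding expave_const_def using X l V by (intro add_mono mult_right_mono) auto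
    then show "2 * exp l * V + 2 * exp (l / 2) / l * (1 / X) \<le> expave_const l * (V + 1 / X)"
      by (simp only: distrib_left)
  qed
  finally show ?thesis .
qed

text \<open>A layer-cake majorant: the decay \<open>1 / (2 * \<bar>u\<bar>)\<close> and the cap
  \<open>2 * real N + 1\<close> are turned into a sum of indicators of nested symmetric intervals,
  over which means of periodic functions are already under control.\<close>

lemma abs_dker_le_layers:
  assumes "\<bar>u\<bar> \<le> 1/2"
  shows "\<bar>dker N u\<bar> \<le> 1 + (\<Sum>i=1..2*N+1. if \<bar>u\<bar> \<le> 1 / (2 * real i) then 1 else 0)"
proof -
  let ?S = "{i \<in> {1..2*N+1}. \<bar>u\<bar> \<le> 1 / (2 * real i)}"
  have "(\<Sum>i=1..2*N+1. if \<bar>u\<bar> \<le> 1 / (2 * real i) then 1 else (0::real)) = real (card ?S)"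
    by (subst sum.inter_filter[symmetric]) auto
  moreover have "\<bar>dker N u\<bar> \<le> 1 + real (card ?S)"
  proof (cases "\<bar>u\<bar> \<le> 1 / (2 * real (2*N+1))")
    case True
    have "?S = {1..2*N+1}"
    proof (intro equalityI subsetI)
      fix i assume i: "i \<in> {1..2*N+1}"
      have "1 / (2 * real (2*N+1)) \<le> 1 / (2 * real i)" using i by (intro divide_left_mono) auto
      then show "i \<in> ?S" using i True by auto
    qed auto
    then show ?thesis using abs_dker_le[of N u] by simp
  next
    case False
    then have u: "\<bar>u\<bar> > 0" using order_trans[of 0 "1 / (2 * real (2*N+1))" "\<bar>u\<bar>"] by (smt (verit) divide_nonneg_nonneg of_nat_0_le_iff)
    define t where "t = nat \<lfloor>1 / (2 * \<bar>u\<bar>)\<rfloor>"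
    have t: "real t \<le> 1 / (2 * \<bar>u\<bar>)" "1 / (2 * \<bar>u\<bar>) \<le> 1 + real t"
      unfolding t_def using u by (auto simp: of_nat_nat) linarith+
    have "1 / (2 * \<bar>u\<bar>) < real (2 * N + 1)" using False u by (simp add: field_simps)
    with t have "t \<le> 2 * N + 1" by linarith
    have "{1..t} \<subseteq> ?S"
    proof
      fix i assume i: "i \<in> {1..t}"
      then have "real i \<le> 1 / (2 * \<bar>u\<bar>)" using t by (meson atLeastAtMost_iff of_nat_mono order_trans)
      then have "\<bar>u\<bar> \<le> 1 / (2 * real i)" using u i by (simp add: field_simps)
      then show "i \<in> ?S" using i \<open>t \<le> 2 * N + 1\<close> by auto
    qed
    then have "card {1..t} \<le> card ?S" by (intro card_mono) auto
    then have "real t \<le> real (card ?S)" by simp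
    moreover have "\<bar>dker N u\<bar> \<le> 1 / (2 * \<bar>u\<bar>)" using u assms by (intro abs_dker_le_inverse) auto
    ultimately show ?thesis using t by linarith
  qed
  ultimately show ?thesis by simp
qed


lemma sum_inverse_le_ln: "(\<Sum>i=1..Suc n. 1 / real i) \<le> 1 + ln (real (Suc n))"
proof (induction n)
  case (Suc n)
  have "1 / real (Suc (Suc n)) \<le> ln (real (Suc (Suc n))) - ln (real (Suc n))"
  proof -
    have "ln (real (Suc n) / real (Suc (Suc n))) \<le> real (Suc n) / real (Suc (Suc n)) - 1"
      by (intro ln_le_minus_one) simp
    also have "\<dots> = - (1 / real (Suc (Suc n)))" by (simp add: field_simps)
    finally show ?thesis by (simp add: ln_div)
  qed
  then show ?case using Suc by simp
qed simp

text \<open>The window estimate is summed over the layers: the half lengths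
  \<open>1 / (2 * real i)\<close> add up to a logarithm, the end corrections to a multiple of
  \<open>N / X\<close>. The latter is of at most logarithmic order once \<open>X\<close> is at least
  of order \<open>N / ln N\<close>.\<close>

lemma integral_dker_exp_periodic_le:
  fixes g :: "real \<Rightarrow> real"
  assumes g: "g \<in> borel_measurable borel" and B: "\<And>x. g x \<le> B" and nn: "\<And>x. 0 \<le> g x"
    and per: "\<And>x (n::int). g (x + of_int n) = g x"
    and l: "l > 0" and X: "X > 0"
  shows "integral {-(1/2)..1/2} (\<lambda>u. \<bar>dker N u\<bar> * g (X * exp (l * u)))
    \<le> expave_const l * (1 + ln (2 * real N + 1) + (2 * real N + 2) / X) * integral {0..1} g"
proof -
  note g [measurable]
  let ?g = "\<lambda>u. g (X * exp (l * u))"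
  let ?I = "integral {0..1} g"
  have gi: "?g integrable_on {a..b}" for a b
    by (rule integrable_bounded_borel[where B = B], measurable) (use B nn in auto)
  have [measurable]: "dker N \<in> borel_measurable borel"
    by (intro borel_measurable_continuous_onI continuous_intros)
  have B0: "B \<ge> 0" using order_trans[OF nn B] .
  have dgi: "(\<lambda>u. \<bar>dker N u\<bar> * ?g u) integrable_on {a..b}" for a b
    by (rule integrable_bounded_borel[where B = "(2 * real N + 1) * B"], measurable)
       (use B nn B0 abs_dker_le[of N] in \<open>auto simp: abs_mult intro!: mult_mono\<close>)
  have ind: "((\<lambda>u. if \<bar>u\<bar> \<le> 1 / (2 * real i) then ?g u else 0) has_integral (integral {-(1 / (2 * real i))..1 / (2 * real i)} ?g)) {-(1/2)..1/2}"
    if "i \<ge> 1" for i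
  proof -
    have "1 / (2 * real i) \<le> 1 / 2" using that by (intro divide_left_mono) auto
    then have "((\<lambda>u. if u \<in> {-(1 / (2 * real i))..1 / (2 * real i)} then ?g u else 0) has_integral (integral {-(1 / (2 * real i))..1 / (2 * real i)} ?g)) {-(1/2)..1/2}"
      by (subst has_integral_restrict) (auto intro!: integrable_integral gi)
    moreover have "(\<lambda>u. if u \<in> {-(1 / (2 * real i))..1 / (2 * real i)} then ?g u else 0) = (\<lambda>u. if \<bar>u\<bar> \<le> 1 / (2 * real i) then ?g u else 0)"
      by (auto simp: fun_eq_iff abs_le_iff)
    ultimately show ?thesis by simp
  qed
  have tot: "((\<lambda>u. ?g u + (\<Sum>i=1..2*N+1. if \<bar>u\<bar> \<le> 1 / (2 * real i) then ?g u else 0)) has_integral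
      (integral {-(1/2)..1/2} ?g + (\<Sum>i=1..2*N+1. integral {-(1 / (2 * real i))..1 / (2 * real i)} ?g))) {-(1/2)..1/2}"
    by (intro has_integral_add has_integral_sum ind integrable_integral gi) auto
  have "integral {-(1/2)..1/2} (\<lambda>u. \<bar>dker N u\<bar> * ?g u) \<le> integral {-(1/2)..1/2} (\<lambda>u. ?g u + (\<Sum>i=1..2*N+1. if \<bar>u\<bar> \<le> 1 / (2 * real i) then ?g u else 0))"
  proof (rule integral_le[OF dgi])
    fix u :: real assume u: "u \<in> {-(1/2)..1/2}"
    have "\<bar>dker N u\<bar> * ?g u \<le> (1 + (\<Sum>i=1..2*N+1. if \<bar>u\<bar> \<le> 1 / (2 * real i) then 1 else 0)) * ?g u"
      using u by (intro mult_right_mono abs_dker_le_layers nn) auto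
    also have "\<dots> = ?g u + (\<Sum>i=1..2*N+1. if \<bar>u\<bar> \<le> 1 / (2 * real i) then ?g u else 0)"
      unfolding distrib_right sum_distrib_right by (simp, intro sum.cong) auto
    finally show "\<bar>dker N u\<bar> * ?g u \<le> ?g u + (\<Sum>i=1..2*N+1. if \<bar>u\<bar> \<le> 1 / (2 * real i) then ?g u else 0)" .
  qed (use tot in blast)
  also have "\<dots> = integral {-(1/2)..1/2} ?g + (\<Sum>i=1..2*N+1. integral {-(1 / (2 * real i))..1 / (2 * real i)} ?g)"
    using tot by (rule integral_unique)
  also have "\<dots> \<le> expave_const l * (1/2 + 1 / X) * ?I + (\<Sum>i=1..2*N+1. expave_const l * (1 / (2 * real i) + 1 / X) * ?I)"
  proof (intro add_mono sum_mono integral_exp_periodic_le[OF g B nn per l X])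
    fix i assume "i \<in> {1..2*N+1}"
    then show "1 / (2 * real i) \<le> 1 / 2" by (intro divide_left_mono) auto
  qed auto
  also have "\<dots> = expave_const l * ((1/2 + 1 / X) + (\<Sum>i=1..2*N+1. (1 / (2 * real i) + 1 / X))) * ?I"
    by (simp only: distrib_left distrib_right sum_distrib_left sum_distrib_right mult.assoc)
  also have "\<dots> \<le> expave_const l * (1 + ln (2 * real N + 1) + (2 * real N + 2) / X) * ?I"
  proof (intro mult_right_mono mult_left_mono)
    have "(\<Sum>i=1..n. (1 / (2 * real i) + 1 / X)) = (1/2) * (\<Sum>i=1..n. 1 / real i) + real n / X" for n
      by (simp add: sum.distrib sum_distrib_left)
    from this[of "2 * N + 1"]
    have "(\<Sum>i=1..2*N+1. (1 / (2 * real i) + 1 / X)) = (1/2) * (\<Sum>i=1..2*N+1. 1 / real i) + (2 * real N + 1) / X"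
      by (simp only: of_nat_add of_nat_mult of_nat_numeral of_nat_1)
    also have "(\<Sum>i=1..2*N+1. 1 / real i) \<le> 1 + ln (2 * real N + 1)"
      using sum_inverse_le_ln[of "2 * N"] by (simp add: add.commute)
    finally have "(1/2 + 1 / X) + (\<Sum>i=1..2*N+1. (1 / (2 * real i) + 1 / X)) \<le> 1/2 + (1/2) * (1 + ln (2 * real N + 1)) + (1 / X + (2 * real N + 1) / X)"
      by simp
    also have "1 / X + (2 * real N + 1) / X = (2 * real N + 2) / X" by (simp add: add_divide_distrib)
    finally have "(1/2 + 1 / X) + (\<Sum>i=1..2*N+1. (1 / (2 * real i) + 1 / X)) \<le> 1/2 + (1/2) * (1 + ln (2 * real N + 1)) + (2 * real N + 2) / X" .
    moreover have "0 \<le> ln (2 * real N + 1)" by simp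
    moreover have "a \<le> 1 + L + d" if "a \<le> 1/2 + (1/2) * (1 + L) + d" "0 \<le> L" for a L d :: real
      using that by (simp add: field_simps)
    ultimately show "(1/2 + 1 / X) + (\<Sum>i=1..2*N+1. (1 / (2 * real i) + 1 / X)) \<le> 1 + ln (2 * real N + 1) + (2 * real N + 2) / X"
      by blast
    show "0 \<le> ?I" by (intro Henstock_Kurzweil_Integration.integral_nonneg nn integrable_bounded_borel[OF g, of _ _ B]) (use B nn in auto)
    show "0 \<le> expave_const l" using l by (simp add: expave_const_def)
  qed
  finally show ?thesis .
qed

section \<open>Periodic Bernoulli functions against oscillating weights\<close>

text \<open>Truncation principle: the \<open>2 * H\<close> modes have coefficients of modulus at
  most \<open>1\<close> and are tested against the weight one by one, while the Fourier remainder is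
  estimated in absolute value. The weight will be the Dirichlet kernel or a single
  character.\<close>

lemma norm_integral_weight_pbern_le:
  fixes w :: "real \<Rightarrow> complex"
  assumes k: "k \<ge> 1" and H: "H \<ge> 1" and w: "continuous_on {-(1/2)..1/2} w"
    and M: "\<And>m. m \<noteq> 0 \<Longrightarrow> norm (integral {-(1/2)..1/2} (\<lambda>u. w u * cis (2 * pi * of_int m * (X * exp (l * u))))) \<le> M"
    and R: "integral {-(1/2)..1/2} (\<lambda>u. norm (w u) * norm (bern_rem k H (X * exp (l * u)))) \<le> R"
  shows "norm (integral {-(1/2)..1/2} (\<lambda>u. w u * of_real (pbern k (X * exp (l * u))))) \<le> 2 * real H * M + R"
proof -
  let ?e = "\<lambda>u. X * exp (l * u)"
  let ?J = "{-(1/2)..1/2::real}"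
  let ?t = "\<lambda>m. integral ?J (\<lambda>u. w u * cis (2 * pi * of_int m * ?e u))"
  have ti: "(\<lambda>u. w u * cis (2 * pi * of_int m * ?e u)) integrable_on ?J" for m :: int
    by (intro integrable_continuous_interval continuous_intros w)
  have hi: "((\<lambda>u. \<Sum>m\<in>{- int H..int H} - {0}. w u * cis (2 * pi * of_int m * ?e u) / (2 * pi * \<i> * of_int m) ^ k)
      has_integral (\<Sum>m\<in>{- int H..int H} - {0}. ?t m / (2 * pi * \<i> * of_int m) ^ k)) ?J"
    by (intro has_integral_sum has_integral_divide integrable_integral ti) auto
  have e: "(\<lambda>u. w u * bern_modes k H (?e u)) = (\<lambda>u. - (\<Sum>m\<in>{- int H..int H} - {0}. w u * cis (2 * pi * of_int m * ?e u) / (2 * pi * \<i> * of_int m) ^ k))"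
    by (simp add: bern_modes_def sum_distrib_left)
  have mi: "(\<lambda>u. w u * bern_modes k H (?e u)) integrable_on ?J"
    by (intro integrable_continuous_interval continuous_intros w)
  have "integral ?J (\<lambda>u. w u * bern_modes k H (?e u)) = - (\<Sum>m\<in>{- int H..int H} - {0}. ?t m / (2 * pi * \<i> * of_int m) ^ k)"
    unfolding e by (rule integral_unique[OF has_integral_neg[OF hi]])
  then have "norm (integral ?J (\<lambda>u. w u * bern_modes k H (?e u))) \<le> (\<Sum>m\<in>{- int H..int H} - {0}. norm (?t m / (2 * pi * \<i> * of_int m) ^ k))"
    by (simp only: norm_minus_cancel norm_sum)
  also have "\<dots> \<le> (\<Sum>m\<in>{- int H..int H} - {0}. M)"
  proof (intro sum_mono)
    fix m assume m: "m \<in> {- int H..int H} - {0}"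
    have "1 \<le> 2 * pi * \<bar>real_of_int m\<bar>"
      using m pi_ge_two mult_mono[of 1 "2 * pi" 1 "\<bar>real_of_int m\<bar>"] by auto
    then have "1 \<le> norm ((2 * pi * \<i> * of_int m) ^ k)"
      by (simp add: norm_power norm_mult one_le_power)
    from divide_left_mono[OF this, of "norm (?t m)"]
    have "norm (?t m) / norm ((2 * pi * \<i> * of_int m) ^ k) \<le> norm (?t m) / 1"
      using \<open>1 \<le> norm _\<close> by (simp only: norm_ge_zero mult_1)
    also have "\<dots> \<le> M" using M[of m] m by simp
    finally show "norm (?t m / (2 * pi * \<i> * of_int m) ^ k) \<le> M" by (simp only: norm_divide)
  qed
  also have "\<dots> = 2 * real H * M" by (simp add: card_Diff_singleton)
  finally have A: "norm (integral ?J (\<lambda>u. w u * bern_modes k H (?e u))) \<le> 2 * real H * M" .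
  obtain W where W: "\<And>u. u \<in> ?J \<Longrightarrow> norm (w u) \<le> W"
  proof -
    have "compact (w ` ?J)" by (intro compact_continuous_image w) auto
    then obtain C where "\<forall>y \<in> w ` ?J. norm y \<le> C" using compact_imp_bounded bounded_iff by metis
    then show ?thesis by (intro that[of C]) auto
  qed
  have wm: "(\<lambda>u. w u * bern_rem k H (?e u)) integrable_on ?J \<and> (\<lambda>u. norm (w u) * norm (bern_rem k H (?e u))) integrable_on ?J"
  proof -
    \<comment> \<open>The weight is known to be continuous only on the interval; its extension by
      zero is a Borel function on the line, to which the integrability criterion applies.\<close>
    define w' where "w' u = (if u \<in> ?J then w u else 0)" for u
    have [measurable]: "w' \<in> borel_measurable borel"
      unfolding w'_def[abs_def] by (intro borel_measurable_continuous_on_if w) auto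
    have b: "norm (w' u) * norm (bern_rem k H (?e u)) \<le> W * (pbern_bound k + 2 * real H)" if "u \<in> ?J" for u
      using W[OF that] norm_bern_rem_le[OF k, of H "?e u"] that
      by (intro mult_mono) (auto simp: w'_def intro: order_trans[OF norm_ge_zero])
    have "(\<lambda>u. w' u * bern_rem k H (?e u)) integrable_on ?J"
      by (rule integrable_bounded_borel[where B = "W * (pbern_bound k + 2 * real H)"], measurable) (use b in \<open>auto simp: norm_mult\<close>)
    moreover have "(\<lambda>u. norm (w' u) * norm (bern_rem k H (?e u))) integrable_on ?J"
      by (rule integrable_bounded_borel[where B = "W * (pbern_bound k + 2 * real H)"], measurable) (use b in auto)
    moreover have "(\<lambda>u. w u * bern_rem k H (?e u)) integrable_on ?J \<longleftrightarrow> (\<lambda>u. w' u * bern_rem k H (?e u)) integrable_on ?J"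
      by (rule integrable_cong) (simp add: w'_def)
    moreover have "(\<lambda>u. norm (w u) * norm (bern_rem k H (?e u))) integrable_on ?J \<longleftrightarrow> (\<lambda>u. norm (w' u) * norm (bern_rem k H (?e u))) integrable_on ?J"
      by (rule integrable_cong) (simp add: w'_def)
    ultimately show ?thesis by blast
  qed
  have "norm (integral ?J (\<lambda>u. w u * bern_rem k H (?e u))) \<le> integral ?J (\<lambda>u. norm (w u) * norm (bern_rem k H (?e u)))"
    using wm by (intro integral_norm_bound_integral) (auto simp: norm_mult)
  also note R
  finally have B: "norm (integral ?J (\<lambda>u. w u * bern_rem k H (?e u))) \<le> R" .
  have "integral ?J (\<lambda>u. w u * of_real (pbern k (?e u))) = integral ?J (\<lambda>u. w u * bern_modes k H (?e u) + w u * bern_rem k H (?e u))"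
    by (simp add: bern_rem_def algebra_simps)
  also have "\<dots> = integral ?J (\<lambda>u. w u * bern_modes k H (?e u)) + integral ?J (\<lambda>u. w u * bern_rem k H (?e u))"
    using mi wm by (intro Henstock_Kurzweil_Integration.integral_add) auto
  finally show ?thesis using norm_triangle_mono[OF A B] by simp
qed


lemma integral_complex_of_real:
  fixes f :: "real \<Rightarrow> real"
  assumes "f integrable_on S"
  shows "integral S (\<lambda>x. complex_of_real (f x)) = of_real (integral S f)"
  by (intro integral_unique has_integral_of_real integrable_integral assms)

lemma norm_integral_cnj:
  fixes f :: "real \<Rightarrow> complex"
  assumes "f integrable_on S"
  shows "norm (integral S (\<lambda>x. cnj (f x))) = norm (integral S f)"
proof -
  have "integral S (\<lambda>x. cnj (f x)) = cnj (integral S f)"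
    using has_integral_cnj[of f "integral S f" S] assms
    by (intro integral_unique) (simp add: o_def integrable_integral)
  then show ?thesis by simp
qed

lemma norm_bern_rem_bounds:
  assumes "k \<ge> 1"
  shows "(\<lambda>x. norm (bern_rem k H x)) \<in> borel_measurable borel"
    "norm (bern_rem k H x) \<le> pbern_bound k + 2 * real H" "0 \<le> norm (bern_rem k H x)"
    "norm (bern_rem k H (x + of_int n)) = norm (bern_rem k H x)"
proof -
  show "(\<lambda>x. norm (bern_rem k H x)) \<in> borel_measurable borel" by measurable
qed (use norm_bern_rem_le[OF assms] in auto)

lemma pbern_dker_integrable:
  "(\<lambda>u. pbern k (X * exp (l * u)) * dker N u) integrable_on {a..b}"
proof -
  have [measurable]: "dker N \<in> borel_measurable borel"
    by (intro borel_measurable_continuous_onI continuous_intros)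
  show ?thesis
    by (rule integrable_bounded_borel[where B = "pbern_bound k * (2 * real N + 1)"], measurable)
       (use pbern_bound(2)[of k] less_imp_le[OF pbern_bound(1)[of k]] abs_dker_le[of N] in \<open>auto simp: abs_mult intro!: mult_mono\<close>)
qed

lemma abs_integral_pbern_dker_le:
  assumes k: "k \<ge> 1" and H: "H \<ge> 1" and X: "X \<ge> 4" and l: "l > 0"
  shows "\<bar>integral {-(1/2)..1/2} (\<lambda>u. pbern k (X * exp (l * u)) * dker N u)\<bar>
    \<le> 2 * real H * mode_const l + expave_const l * (1 + ln (2 * real N + 1) + (2 * real N + 2) / X) * (4 / sqrt (real H))"
proof -
  let ?J = "{-(1/2)..1/2::real}"
  have "norm (integral ?J (\<lambda>u. complex_of_real (dker N u) * of_real (pbern k (X * exp (l * u)))))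
    \<le> 2 * real H * mode_const l + expave_const l * (1 + ln (2 * real N + 1) + (2 * real N + 2) / X) * (4 / sqrt (real H))"
  proof (rule norm_integral_weight_pbern_le[OF k H])
    show "continuous_on ?J (\<lambda>u. complex_of_real (dker N u))" by (intro continuous_intros)
    have pos: "norm (integral ?J (\<lambda>u. complex_of_real (dker N u) * cis (2 * pi * of_int m * (X * exp (l * u))))) \<le> mode_const l"
      if m: "m > 0" for m :: int
    proof -
      have "4 * 1 \<le> X * of_int m" using m X by (intro mult_mono) auto
      then have "4 \<le> of_int m * X" by (simp add: mult.commute)
      from norm_integral_dker_cis_exp_le[OF _ this, of l N] l show ?thesis
        by (simp add: scaleR_conv_of_real mult.assoc)
    qed
    fix m :: int assume m: "m \<noteq> 0"
    show "norm (integral ?J (\<lambda>u. complex_of_real (dker N u) * cis (2 * pi * of_int m * (X * exp (l * u))))) \<le> mode_const l"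
    proof (cases "m > 0")
      case False
      \<comment> \<open>The kernel is real, so the integrals for negative modes are complex
        conjugates of those for positive ones.\<close>
      let ?f = "\<lambda>u. of_real (dker N u) * cis (2 * pi * of_int (- m) * (X * exp (l * u)))"
      have "?f integrable_on ?J" by (intro integrable_continuous_interval continuous_intros)
      from norm_integral_cnj[OF this] pos[of "- m"] m False show ?thesis by (simp add: cis_cnj)
    qed (rule pos)
  next
    have "integral ?J (\<lambda>u. \<bar>dker N u\<bar> * norm (bern_rem k H (X * exp (l * u))))
      \<le> expave_const l * (1 + ln (2 * real N + 1) + (2 * real N + 2) / X) * integral {0..1} (\<lambda>x. norm (bern_rem k H x))"
      using X by (intro integral_dker_exp_periodic_le[OF norm_bern_rem_bounds[OF k] l]) auto
    also have "\<dots> \<le> expave_const l * (1 + ln (2 * real N + 1) + (2 * real N + 2) / X) * (4 / sqrt (real H))"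
      using X l by (intro mult_left_mono integral_norm_bern_rem_le H k mult_nonneg_nonneg)
        (auto simp: expave_const_def intro!: add_nonneg_nonneg)
    finally show "integral ?J (\<lambda>u. norm (complex_of_real (dker N u)) * norm (bern_rem k H (X * exp (l * u)))) \<le> \<dots>" by simp
  qed
  also have "integral ?J (\<lambda>u. complex_of_real (dker N u) * of_real (pbern k (X * exp (l * u))))
      = of_real (integral ?J (\<lambda>u. pbern k (X * exp (l * u)) * dker N u))"
    using integral_complex_of_real[OF pbern_dker_integrable[of k X l N "-(1/2)" "1/2"]] by (simp add: mult.commute)
  finally show ?thesis by simp
qed

text \<open>For fixed \<open>H\<close> the first term tends to \<open>0\<close> as \<open>X\<close>
  grows, uniformly in the frequency \<open>A\<close>; the second is small for large
  \<open>H\<close>. Conjugation reverses \<open>A\<close> along with the mode, so the positive modes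
  are treated for all \<open>A\<close> at once.\<close>

lemma norm_integral_pbern_cis_le:
  assumes k: "k \<ge> 1" and H: "H \<ge> 1" and X: "X \<ge> 1" and l: "l > 0"
  shows "norm (integral {-(1/2)..1/2} (\<lambda>u. cis (A * u) * of_real (pbern k (X * exp (l * u)))))
    \<le> 2 * real H * (vdC_const l / sqrt X) + expave_const l * (3/2) * (4 / sqrt (real H))"
proof (rule norm_integral_weight_pbern_le[OF k H])
  let ?J = "{-(1/2)..1/2::real}"
  show "continuous_on ?J (\<lambda>u. cis (A * u))" by (intro continuous_intros)
  have V0: "vdC_const l \<ge> 0" using l by (simp add: vdC_const_def)
  have pos: "norm (integral ?J (\<lambda>u. cis (A * u) * cis (2 * pi * of_int m * (X * exp (l * u))))) \<le> vdC_const l / sqrt X"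
    if m: "m > 0" for m :: int and A
  proof -
    have "X * 1 \<le> X * of_int m" using m X by (intro mult_left_mono) auto
    then have mX: "X \<le> of_int m * X" by (simp add: mult.commute)
    have "norm (integral ?J (\<lambda>u. cis (2 * pi * (of_int m * X) * exp (l * u) + A * u))) \<le> vdC_const l / sqrt (of_int m * X)"
      using l X mX by (intro norm_integral_cis_exp_le) auto
    also have "\<dots> \<le> vdC_const l / sqrt X"
      using V0 X mX by (intro divide_left_mono) auto
    finally show ?thesis by (simp add: cis_mult algebra_simps)
  qed
  fix m :: int assume m: "m \<noteq> 0"
  show "norm (integral ?J (\<lambda>u. cis (A * u) * cis (2 * pi * of_int m * (X * exp (l * u))))) \<le> vdC_const l / sqrt X"
  proof (cases "m > 0")
    case False
    let ?f = "\<lambda>u. cis (- A * u) * cis (2 * pi * of_int (- m) * (X * exp (l * u)))"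
    have "?f integrable_on ?J" by (intro integrable_continuous_interval continuous_intros)
    from norm_integral_cnj[OF this] pos[of "- m" "- A"] m False show ?thesis by (simp add: cis_cnj)
  qed (rule pos)
next
  let ?J = "{-(1/2)..1/2::real}"
  have "integral ?J (\<lambda>u. norm (bern_rem k H (X * exp (l * u))))
      \<le> expave_const l * (1/2 + 1/X) * integral {0..1} (\<lambda>x. norm (bern_rem k H x))"
    using X by (intro integral_exp_periodic_le[OF norm_bern_rem_bounds[OF k] l]) auto
  also have "\<dots> \<le> expave_const l * (3/2) * (4 / sqrt (real H))"
  proof (intro mult_mono order_refl integral_norm_bern_rem_le H k)
    have "1 / X \<le> 1" using X by simp
    then show "1/2 + 1/X \<le> 3/2" by linarith
    show "0 \<le> expave_const l" using l by (simp add: expave_const_def)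
    show "0 \<le> expave_const l * (3/2)" using l by (simp add: expave_const_def)
    show "0 \<le> integral {0..1} (\<lambda>x. norm (bern_rem k H x))"
      using k by (intro Henstock_Kurzweil_Integration.integral_nonneg integrable_norm_bern_rem) auto
  qed (use X in auto)
  finally show "integral ?J (\<lambda>u. norm (cis (A * u)) * norm (bern_rem k H (X * exp (l * u)))) \<le> \<dots>" by simp
qed

section \<open>Integration by parts against the periodic Bernoulli functions\<close>

text \<open>Differentiability of the periodic function can fail only at these points, and the
  fundamental theorem of calculus tolerates finitely many of them.\<close>

lemma finite_exp_Ints:
  fixes X l :: real
  assumes X: "X > 0" and l: "l \<noteq> 0"
  shows "finite {u \<in> {a..b}. X * exp (l * u) \<in> \<int>}"
proof -
  define R where "R = X * exp (\<bar>l\<bar> * max \<bar>a\<bar> \<bar>b\<bar>)"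
  have "{u \<in> {a..b}. X * exp (l * u) \<in> \<int>} \<subseteq> (\<lambda>n. ln (of_int n / X) / l) ` {0..\<lceil>R\<rceil>}"
  proof
    fix u assume u: "u \<in> {u \<in> {a..b}. X * exp (l * u) \<in> \<int>}"
    then obtain n where n: "X * exp (l * u) = of_int n" by (auto elim: Ints_cases)
    have "l * u \<le> \<bar>l\<bar> * \<bar>u\<bar>" using abs_ge_self[of "l * u"] by (simp only: abs_mult)
    also have "\<dots> \<le> \<bar>l\<bar> * max \<bar>a\<bar> \<bar>b\<bar>" using u by (intro mult_left_mono) auto
    finally have "of_int n \<le> R" unfolding R_def n[symmetric] using X by simp
    moreover have "of_int n > (0::real)" unfolding n[symmetric] using X by simp
    moreover have "u = ln (of_int n / X) / l" unfolding n[symmetric] using X l by simp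
    moreover have "n \<le> \<lceil>R\<rceil>" using calculation(1) by linarith
    ultimately show "u \<in> (\<lambda>n. ln (of_int n / X) / l) ` {0..\<lceil>R\<rceil>}"
      by (intro image_eqI[of _ _ n]) auto
  qed
  then show ?thesis by (rule finite_subset) simp
qed

lemma has_real_derivative_pbern_exp:
  assumes "X * exp (l * u) \<notin> \<int>"
  shows "((\<lambda>u. pbern (Suc k) (X * exp (l * u))) has_real_derivative pbern k (X * exp (l * u)) * (X * l * exp (l * u))) (at u)"
proof -
  have "((\<lambda>u. X * exp (l * u)) has_real_derivative (X * l * exp (l * u))) (at u)"
    by (auto intro!: derivative_eq_intros)
  from DERIV_chain2[OF has_real_derivative_pbern[OF assms] this] show ?thesis .
qed

text \<open>Since \<open>k \<ge> 1\<close>, the antiderivative \<open>pbern (Suc k)\<close> is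
  continuous also at the integers, so the jumps of the sawtooth cause no boundary terms.\<close>

lemma pbern_exp_by_parts:
  fixes h h' :: "real \<Rightarrow> 'a::euclidean_space"
  assumes k: "k \<ge> 1" and X: "X > 0" and l: "l \<noteq> 0" and ab: "a \<le> b"
    and h: "\<And>u. u \<in> {a..b} \<Longrightarrow> (h has_vector_derivative h' u) (at u within {a..b})"
    and h': "continuous_on {a..b} h'"
  shows "((\<lambda>u. (pbern k (X * exp (l * u)) * (X * l * exp (l * u))) *\<^sub>R h u) has_integral
    (pbern (Suc k) (X * exp (l * b)) *\<^sub>R h b - pbern (Suc k) (X * exp (l * a)) *\<^sub>R h a
      - integral {a..b} (\<lambda>u. pbern (Suc k) (X * exp (l * u)) *\<^sub>R h' u))) {a..b}"
proof -
  let ?V = "\<lambda>u. pbern (Suc k) (X * exp (l * u))"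
  let ?V' = "\<lambda>u. pbern k (X * exp (l * u)) * (X * l * exp (l * u))"
  have hc: "continuous_on {a..b} h"
    using h by (meson continuous_on_eq_continuous_within has_vector_derivative_continuous)
  have Vc: "continuous_on {a..b} ?V" using k by (intro continuous_on_pbern continuous_intros) auto
  have "((\<lambda>u. ?V u *\<^sub>R h' u + ?V' u *\<^sub>R h u) has_integral (?V b *\<^sub>R h b - ?V a *\<^sub>R h a)) {a..b}"
  proof (rule fundamental_theorem_of_calculus_interior_strong[OF finite_exp_Ints[OF X l, of a b] ab])
    fix u assume u: "u \<in> {a<..<b} - {u \<in> {a..b}. X * exp (l * u) \<in> \<int>}"
    then have "(h has_vector_derivative h' u) (at u)"
      using h[of u] at_within_interior[of u "{a..b}"] by auto
    moreover have "(?V has_real_derivative ?V' u) (at u)"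
      using u by (intro has_real_derivative_pbern_exp) auto
    ultimately show "((\<lambda>u. ?V u *\<^sub>R h u) has_vector_derivative (?V u *\<^sub>R h' u + ?V' u *\<^sub>R h u)) (at u)"
      by (intro has_vector_derivative_scaleR)
  qed (intro continuous_intros Vc hc)
  moreover have "(\<lambda>u. ?V u *\<^sub>R h' u) integrable_on {a..b}"
    by (intro integrable_continuous_interval continuous_intros Vc h')
  ultimately have "((\<lambda>u. (?V u *\<^sub>R h' u + ?V' u *\<^sub>R h u) - ?V u *\<^sub>R h' u) has_integral
      ((?V b *\<^sub>R h b - ?V a *\<^sub>R h a) - integral {a..b} (\<lambda>u. ?V u *\<^sub>R h' u))) {a..b}"
    by (intro has_integral_diff integrable_integral)
  then show ?thesis by simp
qed

text \<open>The argument moves with a speed of order \<open>X\<close>. Dividing by this speed and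
  integrating \<open>pbern k\<close> gains a factor \<open>1 / X\<close>, at the price of the size
  and the total variation of \<open>g\<close>.\<close>

lemma norm_integral_pbern_exp_le:
  fixes g g' :: "real \<Rightarrow> 'a::euclidean_space"
  assumes k: "k \<ge> 1" and X: "X > 0" and l: "l > 0"
    and g: "\<And>u. (g has_vector_derivative g' u) (at u within {-(1/2)..1/2})"
    and g': "continuous_on {-(1/2)..1/2} g'"
    and G: "\<And>u. u \<in> {-(1/2)..1/2} \<Longrightarrow> norm (g u) \<le> G"
    and G': "integral {-(1/2)..1/2} (\<lambda>u. norm (g' u)) \<le> G'"
  shows "norm (integral {-(1/2)..1/2} (\<lambda>u. pbern k (X * exp (l * u)) *\<^sub>R g u))
    \<le> pbern_bound (Suc k) * exp (l / 2) / (l * X) * (2 * G + G' + l * G)"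
proof -
  let ?J = "{-(1/2)..1/2::real}"
  let ?B = "pbern_bound (Suc k)"
  let ?V = "\<lambda>u. pbern (Suc k) (X * exp (l * u))"
  define h where "h u = (exp (- (l * u)) / (X * l)) *\<^sub>R g u" for u
  define h' where "h' u = (exp (- (l * u)) / (X * l)) *\<^sub>R (g' u - l *\<^sub>R g u)" for u
  define E where "E = exp (l / 2) / (l * X)"
  have E0: "E \<ge> 0" using l X by (simp add: E_def)
  have gc: "continuous_on ?J g"
    using g by (meson continuous_on_eq_continuous_within has_vector_derivative_continuous)
  have hd: "(h has_vector_derivative h' u) (at u within ?J)" for u
  proof -
    have "((\<lambda>u. exp (- (l * u)) / (X * l)) has_real_derivative (- l * exp (- (l * u)) / (X * l))) (at u within ?J)"
      using X l by (auto intro!: derivative_eq_intros)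
    from has_vector_derivative_scaleR[OF this g[of u]] show ?thesis
      unfolding h_def[abs_def] h'_def by (simp add: algebra_simps)
  qed
  have hc: "continuous_on ?J h'" unfolding h'_def using X l by (intro continuous_intros g' gc) auto
  have e: "exp (- (l * u)) / (X * l) \<le> E" "exp (- (l * u)) / (X * l) \<ge> 0" if "u \<in> ?J" for u
  proof -
    have "l * (- (1/2)) \<le> l * u" using that l by (intro mult_left_mono) auto
    then have "exp (- (l * u)) \<le> exp (l / 2)" by simp
    then have "exp (- (l * u)) / (l * X) \<le> E" unfolding E_def using X l by (intro divide_right_mono) auto
    then show "exp (- (l * u)) / (X * l) \<le> E" by (simp only: mult.commute)
  qed (use X l in auto)
  have "integral ?J (\<lambda>u. pbern k (X * exp (l * u)) *\<^sub>R g u) = integral ?J (\<lambda>u. (pbern k (X * exp (l * u)) * (X * l * exp (l * u))) *\<^sub>R h u)"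
  proof (rule integral_cong)
    fix u
    have "(pbern k (X * exp (l * u)) * (X * l * exp (l * u))) * (exp (- (l * u)) / (X * l)) = pbern k (X * exp (l * u))"
      using X l by (simp add: exp_minus)
    then show "pbern k (X * exp (l * u)) *\<^sub>R g u = (pbern k (X * exp (l * u)) * (X * l * exp (l * u))) *\<^sub>R h u"
      by (simp only: h_def scaleR_scaleR)
  qed
  also have "\<dots> = ?V (1/2) *\<^sub>R h (1/2) - ?V (-(1/2)) *\<^sub>R h (-(1/2)) - integral ?J (\<lambda>u. ?V u *\<^sub>R h' u)"
    by (rule integral_unique[OF pbern_exp_by_parts[OF k X _ _ hd hc]]) (use l in auto)
  also have "norm \<dots> \<le> ?B * (E * G) + ?B * (E * G) + ?B * E * (G' + l * G)"
  proof -
    have hb: "norm (?V u *\<^sub>R h u) \<le> ?B * (E * G)" if "u \<in> ?J" for u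
      using pbern_bound[of "Suc k"] e[OF that] G[OF that] E0 X l unfolding h_def norm_scaleR abs_mult
      by (intro mult_mono) (auto simp: less_imp_le abs_of_nonneg intro!: mult_nonneg_nonneg order_trans[OF norm_ge_zero G[OF that]])
    have ng: "(\<lambda>u. norm (g' u)) integrable_on ?J" by (intro integrable_continuous_interval continuous_intros g')
    have "((\<lambda>u. ?B * E * (norm (g' u) + l * G)) has_integral (?B * E * (integral ?J (\<lambda>u. norm (g' u)) + l * G))) ?J"
      using has_integral_mult_right[OF has_integral_add[OF integrable_integral[OF ng] has_integral_const_real[of "l * G" "-(1/2)" "1/2"]], of "?B * E"]
      by simp
    note hi = this
    have "norm (integral ?J (\<lambda>u. ?V u *\<^sub>R h' u)) \<le> integral ?J (\<lambda>u. ?B * E * (norm (g' u) + l * G))"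
    proof (rule integral_norm_bound_integral)
      show "(\<lambda>u. ?V u *\<^sub>R h' u) integrable_on ?J"
        using k by (intro integrable_continuous_interval continuous_intros hc continuous_on_pbern) auto
      fix u assume u: "u \<in> ?J"
      have "norm (g' u - l *\<^sub>R g u) \<le> norm (g' u) + l * norm (g u)" using norm_triangle_ineq4[of "g' u" "l *\<^sub>R g u"] l by simp
      also have "\<dots> \<le> norm (g' u) + l * G" using G[OF u] l by simp
      finally have "norm (h' u) \<le> E * (norm (g' u) + l * G)"
        using e[OF u] E0 unfolding h'_def norm_scaleR by (intro mult_mono) auto
      then show "norm (?V u *\<^sub>R h' u) \<le> ?B * E * (norm (g' u) + l * G)"
        using pbern_bound[of "Suc k"] unfolding norm_scaleR mult.assoc by (intro mult_mono) (auto simp: less_imp_le)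
    qed (use hi in blast)
    also have "\<dots> = ?B * E * (integral ?J (\<lambda>u. norm (g' u)) + l * G)" using hi by (rule integral_unique)
    also have "\<dots> \<le> ?B * E * (G' + l * G)"
      using G' E0 pbern_bound(1)[of "Suc k"] by (intro mult_left_mono) auto
    finally have "norm (integral ?J (\<lambda>u. ?V u *\<^sub>R h' u)) \<le> ?B * E * (G' + l * G)" .
    then show ?thesis
      by (intro order_trans[OF norm_triangle_ineq4] add_mono hb) auto
  qed
  also have "\<dots> = ?B * E * (2 * G + G' + l * G)" by (simp add: algebra_simps)
  finally show ?thesis by (simp add: E_def)
qed

section \<open>Derivative and primitive of the Dirichlet kernel\<close>

definition dker' :: "nat \<Rightarrow> real \<Rightarrow> real" where
  "dker' N u = - (\<Sum>n=1..N. 4 * pi * real n * sin (2 * pi * real n * u))"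

lemma has_real_derivative_dker: "(dker N has_real_derivative dker' N u) (at u within S)"
proof -
  have "(dker N has_real_derivative (0 + 2 * (\<Sum>n=1..N. - sin (2 * pi * real n * u) * (2 * pi * real n)))) (at u within S)"
    unfolding dker_def[abs_def]
    by (intro DERIV_add DERIV_const DERIV_cmult DERIV_sum) (auto intro!: derivative_eq_intros)
  then show ?thesis by (simp add: dker'_def sum_distrib_left sum_negf algebra_simps)
qed

lemma continuous_on_dker' [continuous_intros]: "continuous_on S (dker' N)"
  unfolding dker'_def by (intro continuous_intros)

lemma dker'_minus [simp]: "dker' N (- u) = - dker' N u"
  by (simp add: dker'_def sum_negf)

lemma abs_dker'_le: "\<bar>dker' N u\<bar> \<le> pi * (2 * real N + 1)\<^sup>2"
proof -
  have "\<bar>dker' N u\<bar> \<le> (\<Sum>n=1..N. 4 * pi * real N)"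
    unfolding dker'_def abs_minus_cancel
    by (rule order_trans[OF sum_abs], rule sum_mono) (use mult_mono[OF _ abs_sin_le_one] in \<open>fastforce simp: abs_mult\<close>)
  also have "\<dots> = 4 * pi * (real N)\<^sup>2" by (simp add: power2_eq_square)
  also have "\<dots> \<le> pi * (2 * real N + 1)\<^sup>2" by (simp add: power2_eq_square algebra_simps)
  finally show ?thesis .
qed

text \<open>The identity \<open>sin_mult_dker\<close> is differentiated and solved for
  \<open>dker'\<close>; the term with \<open>dker\<close> itself is bounded by
  \<open>2 * real N + 1\<close>, and Jordan's inequality handles the sine.\<close>

lemma abs_dker'_le_inverse:
  assumes "0 < u" "u \<le> 1/2"
  shows "\<bar>dker' N u\<bar> \<le> pi * (2 * real N + 1) / u"
proof -
  let ?M = "(2 * real N + 1) * pi"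
  have "((\<lambda>u. sin (pi * u) * dker N u) has_real_derivative (pi * cos (pi * u) * dker N u + sin (pi * u) * dker' N u)) (at u)"
    by (auto intro!: derivative_eq_intros has_real_derivative_dker)
  moreover have "((\<lambda>u. sin (?M * u)) has_real_derivative (?M * cos (?M * u))) (at u)"
    by (auto intro!: derivative_eq_intros)
  ultimately have e: "pi * cos (pi * u) * dker N u + sin (pi * u) * dker' N u = ?M * cos (?M * u)"
    unfolding sin_mult_dker by (rule DERIV_unique)
  have s: "2 * u \<le> sin (pi * u)" using sin_pi_ge[of u] assms by simp
  have "sin (pi * u) * \<bar>dker' N u\<bar> = \<bar>?M * cos (?M * u) - pi * cos (pi * u) * dker N u\<bar>"
    using e s assms by (simp add: abs_mult flip: e)
  also have "\<dots> \<le> \<bar>?M * cos (?M * u)\<bar> + \<bar>pi * cos (pi * u) * dker N u\<bar>" by (rule abs_triangle_ineq4)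
  also have "\<dots> \<le> ?M * 1 + (pi * 1) * (2 * real N + 1)"
    unfolding abs_mult using abs_dker_le[of N u] by (intro add_mono mult_mono) auto
  finally have "sin (pi * u) * \<bar>dker' N u\<bar> \<le> 2 * ?M" by (simp add: mult.commute)
  moreover have "2 * u * \<bar>dker' N u\<bar> \<le> sin (pi * u) * \<bar>dker' N u\<bar>" using s by (intro mult_right_mono) auto
  ultimately have "2 * u * \<bar>dker' N u\<bar> \<le> 2 * ?M" by linarith
  then show ?thesis using assms by (simp add: field_simps)
qed

text \<open>The cap \<open>A * M\<close> is used up to \<open>1 / M\<close>, the decay
  \<open>A / u\<close> beyond it.\<close>

lemma integral_le_log:
  fixes f :: "real \<Rightarrow> real"
  assumes M: "M \<ge> 2" and f: "f integrable_on {0..1/2}"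
    and A: "\<And>u. 0 \<le> u \<Longrightarrow> u \<le> 1/2 \<Longrightarrow> f u \<le> A * M" "\<And>u. 0 < u \<Longrightarrow> u \<le> 1/2 \<Longrightarrow> f u \<le> A / u" and A0: "A \<ge> 0"
  shows "integral {0..1/2} f \<le> A * (1 + ln M)"
proof -
  let ?p = "1 / M"
  have p: "?p > 0" "?p \<le> 1/2" using M by (auto simp: field_simps)
  have fi: "f integrable_on {0..?p}" "f integrable_on {?p..1/2}"
    by (rule integrable_on_subinterval[OF f]; use p in auto)+
  have "integral {0..?p} f \<le> integral {0..?p} (\<lambda>_. A * M)"
  proof (rule integral_le[OF fi(1)])
    show "f u \<le> A * M" if "u \<in> {0..?p}" for u
    proof (rule A(1))
      show "u \<le> 1/2" using that p(2) unfolding atLeastAtMost_iff by linarith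
    qed (use that in auto)
  qed (auto simp: integrable_const_ivl)
  also have "\<dots> = A" using M by simp
  finally have 1: "integral {0..?p} f \<le> A" .
  have hi: "((\<lambda>u. A / u) has_integral (A * ln (1/2) - A * ln ?p)) {?p..1/2}"
  proof (rule fundamental_theorem_of_calculus)
    fix u assume "u \<in> {?p..1/2}"
    then have "u > 0" using p(1) unfolding atLeastAtMost_iff by linarith
    then show "((\<lambda>u. A * ln u) has_vector_derivative A / u) (at u within {?p..1/2})"
      unfolding has_real_derivative_iff_has_vector_derivative[symmetric]
      by (auto intro!: derivative_eq_intros)
  qed (use p in simp)
  have "integral {?p..1/2} f \<le> integral {?p..1/2} (\<lambda>u. A / u)"
  proof (rule integral_le[OF fi(2)])
    show "f u \<le> A / u" if "u \<in> {?p..1/2}" for u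
    proof (rule A(2))
      show "0 < u" using that p(1) unfolding atLeastAtMost_iff by linarith
    qed (use that in auto)
  qed (use hi in blast)
  also have "\<dots> = A * ln M + A * ln (1/2)" using integral_unique[OF hi] M by (simp add: ln_div)
  also have "\<dots> \<le> A * ln M" using A0 by (simp add: ln_div mult_le_0_iff)
  finally have 2: "integral {?p..1/2} f \<le> A * ln M" .
  have "integral {0..1/2} f = integral {0..?p} f + integral {?p..1/2} f"
    using p by (intro Henstock_Kurzweil_Integration.integral_combine[symmetric] f) auto
  with 1 2 show ?thesis by (simp add: algebra_simps)
qed

lemma integral_abs_dker'_le:
  assumes "N \<ge> 1"
  shows "integral {-(1/2)..1/2} (\<lambda>u. \<bar>dker' N u\<bar>) \<le> 2 * (pi * (2 * real N + 1) * (1 + ln (2 * real N + 1)))"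
proof -
  have i: "(\<lambda>u. \<bar>dker' N u\<bar>) integrable_on {a..b}" for a b
    by (intro integrable_continuous_interval continuous_intros)
  have "integral {-(1/2)..1/2} (\<lambda>u. \<bar>dker' N u\<bar>) = integral {0..1/2} (\<lambda>u. \<bar>dker' N u\<bar> + \<bar>dker' N (- u)\<bar>)"
    by (intro integral_symmetric_interval i) auto
  also have "\<dots> = 2 * integral {0..1/2} (\<lambda>u. \<bar>dker' N u\<bar>)"
    by (simp flip: mult_2)
  also have "integral {0..1/2} (\<lambda>u. \<bar>dker' N u\<bar>) \<le> pi * (2 * real N + 1) * (1 + ln (2 * real N + 1))"
    using assms abs_dker'_le[of N] abs_dker'_le_inverse[of _ N]
    by (intro integral_le_log i) (auto simp: power2_eq_square mult.assoc)
  finally show ?thesis by simp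
qed

lemma integral_dker_cont: "continuous_on {0..1/2} (\<lambda>u. integral {u..1/2} (dker N))"
  by (intro indefinite_integral_continuous_1' dker_integrable)

lemma integral_abs_integral_dker_le:
  assumes "N \<ge> 1"
  shows "integral {0..1/2} (\<lambda>u. \<bar>integral {u..1/2} (dker N)\<bar>) \<le> 3 / 2 * (1 + ln (2 * real N + 1)) / (2 * real N + 1)"
proof -
  have "integral {0..1/2} (\<lambda>u. \<bar>integral {u..1/2} (dker N)\<bar>) \<le> (3/2 / (2 * real N + 1)) * (1 + ln (2 * real N + 1))"
  proof (rule integral_le_log)
    show "(\<lambda>u. \<bar>integral {u..1/2} (dker N)\<bar>) integrable_on {0..1/2}"
      by (intro integrable_continuous_interval continuous_intros integral_dker_cont)
    show "\<bar>integral {u..1/2} (dker N)\<bar> \<le> 3/2 / (2 * real N + 1) * (2 * real N + 1)" if "0 \<le> u" "u \<le> 1/2" for u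
    proof -
      have "a / c * c = a" if "c > 0" for a c :: real using that by simp
      from this[of "2 * real N + 1" "3/2"] have "3/2 / (2 * real N + 1) * (2 * real N + 1) = 3/2" by simp
      then show ?thesis using integral_dker_zero_le[OF that, of N] by (simp only:)
    qed
    show "\<bar>integral {u..1/2} (dker N)\<bar> \<le> 3/2 / (2 * real N + 1) / u" if "0 < u" "u \<le> 1/2" for u
    proof -
      have "1 / ((2 * real N + 1) * u) \<le> 3/2 / ((2 * real N + 1) * u)" using that by (intro divide_right_mono) auto
      also have "\<dots> = 3/2 / (2 * real N + 1) / u" by (simp only: divide_divide_eq_left)
      finally show ?thesis using abs_integral_dker_le_inverse[OF that, of N] by linarith
    qed
  qed (use assms in auto)
  then show ?thesis by simp
qed


text \<open>Partial integration against the tail primitive of the kernel, which is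
  \<open>1 / 2\<close> at \<open>0\<close> and vanishes at \<open>1 / 2\<close>. It reproduces half
  the central value, and the error is \<open>K\<close> times the integral of the modulus of the
  tail, of order \<open>ln N / N\<close>.\<close>

lemma abs_integral_dker_half_le:
  fixes V V' :: "real \<Rightarrow> real"
  assumes N: "N \<ge> 1" and S: "finite S" and Vc: "continuous_on {0..1/2} V"
    and V: "\<And>u. u \<in> {0<..<1/2} - S \<Longrightarrow> (V has_real_derivative V' u) (at u)"
    and K: "\<And>u. u \<in> {0..1/2} \<Longrightarrow> \<bar>V' u\<bar> \<le> K"
  shows "\<bar>integral {0..1/2} (\<lambda>u. V u * dker N u) - V 0 / 2\<bar> \<le> K * (3 / 2 * (1 + ln (2 * real N + 1)) / (2 * real N + 1))"
proof -
  let ?h = "\<lambda>u. integral {u..1/2} (dker N)"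
  have hd: "(?h has_vector_derivative (- dker N u)) (at u within {0..1/2})" if "u \<in> {0..1/2}" for u
    using integral_has_vector_derivative'[OF continuous_on_dker that] by simp
  have ftc: "((\<lambda>u. V u * (- dker N u) + V' u * ?h u) has_integral (V (1/2) * ?h (1/2) - V 0 * ?h 0)) {0..1/2}"
  proof (rule fundamental_theorem_of_calculus_interior_strong[OF S])
    fix u :: real assume u: "u \<in> {0<..<1/2} - S"
    have "(?h has_vector_derivative (- dker N u)) (at u)"
      using hd[of u] u at_within_interior[of u "{0..1/2}"] by auto
    then have "(?h has_real_derivative (- dker N u)) (at u)"
      by (simp only: has_real_derivative_iff_has_vector_derivative)
    from DERIV_mult[OF V[OF u] this]
    have "((\<lambda>u. V u * ?h u) has_real_derivative (V u * (- dker N u) + V' u * ?h u)) (at u)" by (simp add: algebra_simps)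
    then show "((\<lambda>u. V u * ?h u) has_vector_derivative (V u * (- dker N u) + V' u * ?h u)) (at u)"
      by (simp only: has_real_derivative_iff_has_vector_derivative)
  qed (auto intro!: continuous_intros Vc integral_dker_cont)
  have VD: "(\<lambda>u. V u * dker N u) integrable_on {0..1/2}"
    by (intro integrable_continuous_interval continuous_intros Vc)
  have "((\<lambda>u. V' u * ?h u) has_integral (integral {0..1/2} (\<lambda>u. V u * dker N u) - V 0 / 2)) {0..1/2}"
    using has_integral_add[OF ftc integrable_integral[OF VD]] by (simp add: integral_dker_half)
  note hi = this
  have "norm (integral {0..1/2} (\<lambda>u. V' u * ?h u)) \<le> integral {0..1/2} (\<lambda>u. K * \<bar>?h u\<bar>)"
  proof (rule integral_norm_bound_integral)
    show "(\<lambda>u. K * \<bar>?h u\<bar>) integrable_on {0..1/2}"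
      by (intro integrable_continuous_interval continuous_intros integral_dker_cont)
    show "norm (V' u * ?h u) \<le> K * \<bar>?h u\<bar>" if "u \<in> {0..1/2}" for u
      using K[OF that] by (simp add: abs_mult mult_right_mono)
  qed (use hi in blast)
  also have "\<dots> = K * integral {0..1/2} (\<lambda>u. \<bar>?h u\<bar>)" by simp
  also have "\<dots> \<le> K * (3 / 2 * (1 + ln (2 * real N + 1)) / (2 * real N + 1))"
    using K[of 0] by (intro mult_left_mono integral_abs_integral_dker_le N) auto
  finally show ?thesis using integral_unique[OF hi] by simp
qed

lemma abs_integral_dker_minus_le:
  fixes V V' :: "real \<Rightarrow> real"
  assumes N: "N \<ge> 1" and S: "finite S" and Vc: "continuous_on {-(1/2)..1/2} V"
    and V: "\<And>u. u \<in> {-(1/2)<..<1/2} - S \<Longrightarrow> (V has_real_derivative V' u) (at u)"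
    and K: "\<And>u. u \<in> {-(1/2)..1/2} \<Longrightarrow> \<bar>V' u\<bar> \<le> K"
  shows "\<bar>integral {-(1/2)..1/2} (\<lambda>u. V u * dker N u) - V 0\<bar> \<le> K * (3 * (1 + ln (2 * real N + 1)) / (2 * real N + 1))"
proof -
  let ?f = "\<lambda>u. V u * dker N u"
  let ?g = "\<lambda>u. V (- u) * dker N u"
  have Vc': "continuous_on {0..1/2} (\<lambda>u. V (- u))"
    by (rule continuous_on_compose2[OF Vc]) (auto intro!: continuous_intros)
  have Vc0: "continuous_on {0..1/2} V" by (rule continuous_on_subset[OF Vc]) auto
  have 1: "\<bar>integral {0..1/2} ?f - V 0 / 2\<bar> \<le> K * (3 / 2 * (1 + ln (2 * real N + 1)) / (2 * real N + 1))"
    by (rule abs_integral_dker_half_le[OF N S Vc0 V K]) auto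
  have 2: "\<bar>integral {0..1/2} ?g - V (- 0) / 2\<bar> \<le> K * (3 / 2 * (1 + ln (2 * real N + 1)) / (2 * real N + 1))"
  proof (rule abs_integral_dker_half_le[OF N _ Vc', where V' = "\<lambda>u. - V' (- u)" and S = "uminus ` S"])
    show "finite (uminus ` S)" using S by simp
    fix u assume u: "u \<in> {0<..<1/2} - uminus ` S"
    have "- u \<notin> S" using u by force
    then have "(V has_real_derivative V' (- u)) (at (- u))" using u by (intro V) auto
    then show "((\<lambda>u. V (- u)) has_real_derivative - V' (- u)) (at u)" by (simp add: DERIV_mirror)
  next
    show "\<bar>- V' (- u)\<bar> \<le> K" if "u \<in> {0..1/2}" for u using K[of "- u"] that by simp
  qed
  have fi: "?f integrable_on {-(1/2)..1/2}" by (intro integrable_continuous_interval continuous_intros Vc)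
  have "integral {-(1/2)..1/2} ?f = integral {0..1/2} (\<lambda>u. ?f u + ?f (- u))"
    by (intro integral_symmetric_interval fi) auto
  also have "\<dots> = integral {0..1/2} (\<lambda>u. ?f u + ?g u)" by simp
  also have "\<dots> = integral {0..1/2} ?f + integral {0..1/2} ?g"
    by (intro Henstock_Kurzweil_Integration.integral_add integrable_continuous_interval continuous_intros Vc' Vc0)
  finally have "\<bar>integral {-(1/2)..1/2} ?f - V 0\<bar> \<le> \<bar>integral {0..1/2} ?f - V 0 / 2\<bar> + \<bar>integral {0..1/2} ?g - V (- 0) / 2\<bar>"
    by simp
  also have "\<dots> \<le> K * (3 / 2 * (1 + ln (2 * real N + 1)) / (2 * real N + 1)) + K * (3 / 2 * (1 + ln (2 * real N + 1)) / (2 * real N + 1))"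
    by (rule add_mono[OF 1 2])
  also have "K * (3 / 2 * x / m) + K * (3 / 2 * x / m) = K * (3 * x / m)" for x m :: real
    by simp
  finally show ?thesis .
qed

section \<open>Estimates at low and high scales\<close>

lemma exp_le_half:
  fixes l u :: real
  assumes "l > 0" "u \<in> {-(1/2)..1/2}"
  shows "exp (l * u) \<le> exp (l / 2)"
  using mult_left_mono[of u "1/2" l] assms by auto

text \<open>At scale \<open>X\<close> the derivative has size \<open>O(X)\<close>, so the central
  value is recovered up to \<open>O(X * ln N / N)\<close>, which is small as long as
  \<open>X\<close> is well below \<open>N / ln N\<close>.\<close>

lemma pbern_Suc_dker_low:
  assumes k: "k \<ge> 1" and N: "N \<ge> 1" and X: "X > 0" and l: "l > 0"
  shows "\<bar>integral {-(1/2)..1/2} (\<lambda>u. pbern (Suc k) (X * exp (l * u)) * dker N u) - pbern (Suc k) X\<bar>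
    \<le> pbern_bound k * (X * l * exp (l / 2)) * (3 * (1 + ln (2 * real N + 1)) / (2 * real N + 1))"
proof -
  have "\<bar>integral {-(1/2)..1/2} (\<lambda>u. pbern (Suc k) (X * exp (l * u)) * dker N u) - pbern (Suc k) (X * exp (l * 0))\<bar>
    \<le> pbern_bound k * (X * l * exp (l / 2)) * (3 * (1 + ln (2 * real N + 1)) / (2 * real N + 1))"
  proof (rule abs_integral_dker_minus_le[OF N finite_exp_Ints[OF X, of l "-(1/2)" "1/2"]])
    show "continuous_on {-(1/2)..1/2} (\<lambda>u. pbern (Suc k) (X * exp (l * u)))"
      using k by (intro continuous_on_pbern continuous_intros) auto
    show "((\<lambda>u. pbern (Suc k) (X * exp (l * u))) has_real_derivative pbern k (X * exp (l * u)) * (X * l * exp (l * u))) (at u)"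
      if "u \<in> {-(1/2)<..<1/2} - {u \<in> {-(1/2)..1/2}. X * exp (l * u) \<in> \<int>}" for u
      using that by (intro has_real_derivative_pbern_exp) auto
    show "\<bar>pbern k (X * exp (l * u)) * (X * l * exp (l * u))\<bar> \<le> pbern_bound k * (X * l * exp (l / 2))" if "u \<in> {-(1/2)..1/2}" for u
      using exp_le_half[OF l that] pbern_bound[of k] X l unfolding abs_mult by (intro mult_mono) (auto simp: less_imp_le)
  qed (use l in auto)
  then show ?thesis by simp
qed

text \<open>The kernel has size \<open>O(N)\<close> and total variation \<open>O(N * ln N)\<close>;
  the gain \<open>1 / X\<close> from partial integration outweighs both once \<open>X\<close> is
  well above \<open>N * ln N\<close>.\<close>

lemma pbern_dker_high:
  assumes k: "k \<ge> 1" and N: "N \<ge> 1" and X: "X > 0" and l: "l > 0"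
  shows "\<bar>integral {-(1/2)..1/2} (\<lambda>u. pbern k (X * exp (l * u)) * dker N u)\<bar>
    \<le> pbern_bound (Suc k) * exp (l / 2) / (l * X) * ((2 + 2 * pi + l) * (2 * real N + 1) * (1 + ln (2 * real N + 1)))"
proof -
  let ?G = "2 * real N + 1"
  have "norm (integral {-(1/2)..1/2} (\<lambda>u. pbern k (X * exp (l * u)) *\<^sub>R dker N u))
    \<le> pbern_bound (Suc k) * exp (l / 2) / (l * X) * (2 * ?G + 2 * (pi * ?G * (1 + ln ?G)) + l * ?G)"
    using integral_abs_dker'_le[OF N] abs_dker_le[of N]
    by (intro norm_integral_pbern_exp_le[OF k X l, where g' = "dker' N"])
       (auto simp: continuous_on_dker' has_real_derivative_dker simp flip: has_real_derivative_iff_has_vector_derivative)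
  also have "\<dots> \<le> pbern_bound (Suc k) * exp (l / 2) / (l * X) * ((2 + 2 * pi + l) * ?G * (1 + ln ?G))"
  proof (rule mult_left_mono)
    have "(2 + l) * ?G * 1 \<le> (2 + l) * ?G * (1 + ln ?G)" using l by (intro mult_left_mono) auto
    then show "2 * ?G + 2 * (pi * ?G * (1 + ln ?G)) + l * ?G \<le> (2 + 2 * pi + l) * ?G * (1 + ln ?G)"
      by (simp add: algebra_simps)
  qed (use pbern_bound(1)[of "Suc k"] l X in auto)
  finally show ?thesis by simp
qed

lemma pbern_cis_high:
  assumes k: "k \<ge> 1" and X: "X > 0" and l: "l > 0"
  shows "norm (integral {-(1/2)..1/2} (\<lambda>u. pbern k (X * exp (l * u)) *\<^sub>R cis (A * u)))
    \<le> pbern_bound (Suc k) * exp (l / 2) / (l * X) * (2 + \<bar>A\<bar> + l)"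
proof -
  have "norm (integral {-(1/2)..1/2} (\<lambda>u. pbern k (X * exp (l * u)) *\<^sub>R cis (A * u)))
    \<le> pbern_bound (Suc k) * exp (l / 2) / (l * X) * (2 * 1 + \<bar>A\<bar> + l * 1)"
  proof (rule norm_integral_pbern_exp_le[OF k X l, where g' = "\<lambda>u. of_real A * \<i> * cis (A * u)"])
    show "((\<lambda>u. cis (A * u)) has_vector_derivative of_real A * \<i> * cis (A * u)) (at u within {-(1/2)..1/2})" for u
      by (rule has_vector_derivative_cis) (auto intro!: derivative_eq_intros)
  qed (auto intro!: continuous_intros simp: norm_mult)
  then show ?thesis by simp
qed

text \<open>Partial integration the other way round: the character is integrated and the Bernoulli
  function differentiated. It is effective while \<open>X\<close> is small compared with
  \<open>\<bar>A\<bar>\<close> and so complements \<open>pbern_cis_high\<close>.\<close>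

lemma pbern_Suc_cis_low:
  assumes k: "k \<ge> 1" and X: "X > 0" and l: "l > 0" and A: "A \<noteq> 0"
  shows "norm (integral {-(1/2)..1/2} (\<lambda>u. pbern (Suc k) (X * exp (l * u)) *\<^sub>R cis (A * u)))
    \<le> (2 * pbern_bound (Suc k) + pbern_bound k * (X * l * exp (l / 2))) / \<bar>A\<bar>"
proof -
  let ?J = "{-(1/2)..1/2::real}"
  let ?V = "\<lambda>u. pbern (Suc k) (X * exp (l * u))"
  define h where "h u = (1 / (of_real A * \<i>)) * cis (A * u)" for u
  have hn: "norm (h u) = 1 / \<bar>A\<bar>" for u by (simp add: h_def norm_mult norm_divide)
  have hd: "(h has_vector_derivative cis (A * u)) (at u within ?J)" for u
  proof -
    have "((\<lambda>u. A * u) has_real_derivative A) (at u within ?J)" by (auto intro!: derivative_eq_intros)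
    from has_vector_derivative_mult_right[OF has_vector_derivative_cis[OF this], of "1 / (of_real A * \<i>)"]
    show ?thesis unfolding h_def[abs_def] using A by simp
  qed
  have hi: "((\<lambda>u. (pbern k (X * exp (l * u)) * (X * l * exp (l * u))) *\<^sub>R h u) has_integral
    (?V (1/2) *\<^sub>R h (1/2) - ?V (-(1/2)) *\<^sub>R h (-(1/2)) - integral ?J (\<lambda>u. ?V u *\<^sub>R cis (A * u)))) ?J"
    using l by (intro pbern_exp_by_parts[OF k X] hd continuous_intros) auto
  have "norm (integral ?J (\<lambda>u. (pbern k (X * exp (l * u)) * (X * l * exp (l * u))) *\<^sub>R h u)) \<le> (pbern_bound k * (X * l * exp (l / 2)) / \<bar>A\<bar>) * (1/2 - (-(1/2)))"
  proof (rule norm_integral_le_length)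
    fix u assume u: "u \<in> ?J"
    have "\<bar>pbern k (X * exp (l * u)) * (X * l * exp (l * u))\<bar> \<le> pbern_bound k * (X * l * exp (l / 2))"
      using exp_le_half[OF l u] pbern_bound[of k] X l unfolding abs_mult by (intro mult_mono) (auto simp: less_imp_le)
    then show "norm ((pbern k (X * exp (l * u)) * (X * l * exp (l * u))) *\<^sub>R h u) \<le> pbern_bound k * (X * l * exp (l / 2)) / \<bar>A\<bar>"
      unfolding norm_scaleR hn by (simp add: divide_right_mono)
  qed (use hi in auto)
  then have 1: "norm (?V (1/2) *\<^sub>R h (1/2) - ?V (-(1/2)) *\<^sub>R h (-(1/2)) - integral ?J (\<lambda>u. ?V u *\<^sub>R cis (A * u))) \<le> pbern_bound k * (X * l * exp (l / 2)) / \<bar>A\<bar>"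
    using integral_unique[OF hi] by simp
  have hb: "norm (?V u *\<^sub>R h u) \<le> pbern_bound (Suc k) / \<bar>A\<bar>" for u
  proof -
    have "\<bar>?V u\<bar> * (1 / \<bar>A\<bar>) \<le> pbern_bound (Suc k) * (1 / \<bar>A\<bar>)"
      by (intro mult_right_mono pbern_bound(2)) simp
    then show ?thesis unfolding norm_scaleR hn by simp
  qed
  have "norm (integral ?J (\<lambda>u. ?V u *\<^sub>R cis (A * u))) \<le> norm (?V (1/2) *\<^sub>R h (1/2) - ?V (-(1/2)) *\<^sub>R h (-(1/2)))
      + norm (?V (1/2) *\<^sub>R h (1/2) - ?V (-(1/2)) *\<^sub>R h (-(1/2)) - integral ?J (\<lambda>u. ?V u *\<^sub>R cis (A * u)))"
    using norm_triangle_sub[of "integral ?J (\<lambda>u. ?V u *\<^sub>R cis (A * u))"] by (simp only: norm_minus_commute[of "integral ?J _"])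
  also have "\<dots> \<le> (pbern_bound (Suc k) / \<bar>A\<bar> + pbern_bound (Suc k) / \<bar>A\<bar>) + pbern_bound k * (X * l * exp (l / 2)) / \<bar>A\<bar>"
    by (intro add_mono 1 order_trans[OF norm_triangle_ineq4] hb)
  also have "\<dots> = (2 * pbern_bound (Suc k) + pbern_bound k * (X * l * exp (l / 2))) / \<bar>A\<bar>"
    by (simp add: add_divide_distrib)
  finally show ?thesis .
qed

section \<open>The sawtooth as a superposition of unit steps\<close>

lemma integral_dker_full: "integral {-(1/2)..1/2} (dker N) = 1"
proof -
  have "integral {-(1/2)..1/2} (dker N) = integral {0..1/2} (\<lambda>u. dker N u + dker N (- u))"
    by (intro integral_symmetric_interval dker_integrable) simp
  also have "\<dots> = 2 * integral {0..1/2} (dker N)" by (simp flip: mult_2)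
  finally show ?thesis by (simp add: integral_dker_half)
qed

text \<open>Evenness and total mass \<open>1\<close> of the kernel turn the discrepancy from the
  value of the step at \<open>0\<close> into the tail integral from \<open>\<bar>t\<bar>\<close> on,
  whatever the sign of \<open>t\<close>. A step left of the interval is constant on it and
  reproduced exactly.\<close>

lemma has_integral_dker_step:
  assumes "t \<noteq> 0" "t \<le> 1/2"
  obtains I where "((\<lambda>u. dker N u * (if t \<le> u then 1 else 0)) has_integral I) {-(1/2)..1/2}"
    "\<bar>I - (if t \<le> 0 then 1 else 0)\<bar> \<le> 3/2"
    "\<bar>I - (if t \<le> 0 then 1 else 0)\<bar> \<le> 1 / ((2 * real N + 1) * \<bar>t\<bar>)"
proof (cases "t < - (1/2)")
  case True
  have "((\<lambda>u. dker N u * (if t \<le> u then 1 else 0)) has_integral 1) {-(1/2)..1/2}"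
  proof (rule has_integral_eq)
    show "(dker N has_integral 1) {-(1/2)..1/2}"
      using integrable_integral[OF dker_integrable[of N "-(1/2)" "1/2"]] by (simp add: integral_dker_full)
  qed (use True in auto)
  then show ?thesis using True by (intro that) (auto simp: mult_nonneg_nonpos)
next
  case False
  have "((\<lambda>u. if u \<in> {t..1/2} then dker N u else 0) has_integral (integral {t..1/2} (dker N))) {-(1/2)..1/2}"
    using False assms by (subst has_integral_restrict) (auto intro!: integrable_integral dker_integrable)
  then have hi: "((\<lambda>u. dker N u * (if t \<le> u then 1 else 0)) has_integral (integral {t..1/2} (dker N))) {-(1/2)..1/2}"
    by (rule has_integral_eq[rotated]) auto
  have e: "\<bar>integral {t..1/2} (dker N) - (if t \<le> 0 then 1 else 0)\<bar> = \<bar>integral {\<bar>t\<bar>..1/2} (dker N)\<bar>"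
  proof (cases "t > 0")
    case nt: False
    have "integral {-(1/2)..1/2} (dker N) = integral {-(1/2)..t} (dker N) + integral {t..1/2} (dker N)"
      using False assms by (intro Henstock_Kurzweil_Integration.integral_combine[symmetric] dker_integrable) auto
    moreover have "integral {-(1/2)..t} (dker N) = integral {-t..1/2} (dker N)"
      using Henstock_Kurzweil_Integration.integral_reflect_real[of "1/2" "-t" "dker N"] by simp
    ultimately show ?thesis using nt by (simp add: integral_dker_full)
  qed (use assms in auto)
  show ?thesis
    by (rule that[OF hi]; unfold e; rule abs_integral_dker_le abs_integral_dker_le_inverse) (use False assms in auto)
qed

lemma floor_eq_sum:
  fixes y :: real
  assumes "0 \<le> y" "y \<le> real I"
  shows "of_int \<lfloor>y\<rfloor> = (\<Sum>i=1..I. if real i \<le> y then 1 else (0::real))"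
proof -
  have "{i \<in> {1..I}. real i \<le> y} = {1..nat \<lfloor>y\<rfloor>}" using assms by (auto simp: le_nat_floor nat_le_iff le_floor_iff) linarith+
  then have "(\<Sum>i=1..I. if real i \<le> y then 1 else (0::real)) = real (nat \<lfloor>y\<rfloor>)"
    by (subst sum.inter_filter[symmetric]) auto
  then show ?thesis using assms by simp
qed

text \<open>The integers on either side of \<open>X\<close> are compared with harmonic sums. The two
  neighbours of \<open>X\<close>, where \<open>\<kappa> / \<bar>real i - X\<bar>\<close> may be
  arbitrarily large, are covered by \<open>B\<close> instead.\<close>

lemma sum_near_inverse_le:
  fixes X :: real and g :: "nat \<Rightarrow> real"
  assumes \<kappa>: "\<kappa> \<ge> 0" and X: "X > 0" and B: "B \<ge> 0"
    and g1: "\<And>i. 1 \<le> i \<Longrightarrow> i \<le> I \<Longrightarrow> real i \<noteq> X \<Longrightarrow> g i \<le> \<kappa> / \<bar>real i - X\<bar>"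
    and g2: "\<And>i. 1 \<le> i \<Longrightarrow> i \<le> I \<Longrightarrow> i = nat \<lfloor>X\<rfloor> \<or> i = nat \<lfloor>X\<rfloor> + 1 \<Longrightarrow> g i \<le> B"
    and XI: "X \<le> real I + 1"
  shows "(\<Sum>i=1..I. g i) \<le> 2 * \<kappa> * (1 + ln (real I + 1)) + 2 * B"
proof -
  define i0 where "i0 = nat \<lfloor>X\<rfloor>"
  have i0: "real i0 \<le> X" "X < real i0 + 1" using X by (auto simp: i0_def)
  have i0I: "i0 \<le> I + 1" using i0 XI by linarith
  define c where "c i = (if i < i0 then \<kappa> / (real i0 - real i) else if i \<le> i0 + 1 then B else \<kappa> / (real i - real i0 - 1))" for i
  have gc: "g i \<le> c i" if i: "i \<in> {1..I}" for i
  proof -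
    consider "i < i0" | "i = i0 \<or> i = i0 + 1" | "i > i0 + 1" by linarith
    then show ?thesis
    proof cases
      case 1
      then have r: "real i + 1 \<le> real i0" by linarith
      have "g i \<le> \<kappa> / \<bar>real i - X\<bar>" using i i0 r by (intro g1) auto
      also have "\<dots> \<le> \<kappa> / (real i0 - real i)" using i0 r \<kappa> by (intro divide_left_mono) auto
      finally show ?thesis using 1 by (simp add: c_def)
    next
      case 2 then show ?thesis using g2[of i] i by (auto simp: c_def i0_def)
    next
      case 3
      then have r: "real i \<ge> real i0 + 2" by linarith
      have "g i \<le> \<kappa> / \<bar>real i - X\<bar>" using i i0 r by (intro g1) auto
      also have "\<dots> \<le> \<kappa> / (real i - real i0 - 1)" using i0 r \<kappa> by (intro divide_left_mono) auto
      finally show ?thesis using 3 by (simp add: c_def)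
    qed
  qed
  have c0: "c i \<ge> 0" for i using \<kappa> B by (auto simp: c_def)
  have har: "(\<Sum>i=1..I. 1 / real i) \<le> 1 + ln (real I + 1)"
  proof -
    have "(\<Sum>i=1..I. 1 / real i) \<le> (\<Sum>i=1..Suc I. 1 / real i)" by simp
    also note sum_inverse_le_ln[of I]
    finally show ?thesis by (simp add: add.commute)
  qed
  have "(\<Sum>i=1..I. g i) \<le> (\<Sum>i=1..I. c i)" by (intro sum_mono gc)
  also have "\<dots> \<le> sum c ({1..<i0} \<union> ({i0, i0 + 1} \<union> {i0+2..<i0+2+I}))"
    using c0 by (intro sum_mono2) auto
  also have "\<dots> = sum c {1..<i0} + (sum c {i0, i0 + 1} + sum c {i0+2..<i0+2+I})"
    by (subst sum.union_disjoint; (auto)?)+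
  also have "sum c {i0, i0 + 1} = 2 * B" by (simp add: c_def)
  also have "sum c {i0+2..<i0+2+I} = (\<Sum>i=1..I. \<kappa> / real i)"
    by (rule sum.reindex_bij_witness[where i = "\<lambda>i. i + i0 + 1" and j = "\<lambda>i. i - i0 - 1"]) (auto simp: c_def of_nat_diff)
  also have "sum c {1..<i0} = (\<Sum>i=1..<i0. \<kappa> / real i)"
    by (rule sum.reindex_bij_witness[where i = "\<lambda>i. i0 - i" and j = "\<lambda>i. i0 - i"]) (auto simp: c_def of_nat_diff)
  also have "\<dots> \<le> (\<Sum>i=1..I. \<kappa> / real i)"
    using i0I \<kappa> by (intro sum_mono2) auto
  also have "(\<Sum>i=1..I. \<kappa> / real i) = \<kappa> * (\<Sum>i=1..I. 1 / real i)" by (simp add: sum_distrib_left)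
  also have "\<kappa> * (\<Sum>i=1..I. 1 / real i) \<le> \<kappa> * (1 + ln (real I + 1))" using \<kappa> har by (intro mult_left_mono)
  finally show ?thesis by (simp add: algebra_simps)
qed

lemma abs_ln_ratio_ge:
  fixes x y R :: real
  assumes "x > 0" "y > 0" "x \<le> R" "y \<le> R"
  shows "\<bar>x - y\<bar> / R \<le> \<bar>ln (x / y)\<bar>"
proof -
  have *: "(x - y) / R \<le> \<bar>ln (x / y)\<bar>" if "x > 0" "y > 0" "x \<le> R" "y \<le> x" for x y
  proof -
    have "(x - y) / R \<le> (x - y) / x" using that by (intro divide_left_mono) auto
    also have "\<dots> = 1 - y / x" using that by (simp add: diff_divide_distrib)
    also have "\<dots> \<le> - ln (y / x)" using ln_le_minus_one[of "y / x"] that by simp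
    also have "\<dots> = ln (x / y)" using that by (simp add: ln_div)
    finally show ?thesis by linarith
  qed
  have "\<bar>ln (y / x)\<bar> = \<bar>ln (x / y)\<bar>" using assms by (simp add: ln_div abs_minus_commute)
  then show ?thesis using *[of x y] *[of y x] assms by (cases "y \<le> x") (auto simp: abs_if)
qed

text \<open>Along \<open>u \<mapsto> X * exp (l * u)\<close> the sawtooth is a smooth function minus
  one unit step per integer reached. The step for \<open>i\<close> lies at a distance of order at
  least \<open>\<bar>real i - X\<bar> / X\<close> from the centre, so the errors form a harmonic
  sum. \<open>B\<close> covers the two integers next to \<open>X\<close>: through their distance
  \<open>d\<close> from \<open>X\<close> when that is available, otherwise through the trivial bound
  \<open>3/2\<close>.\<close>

lemma pbern_1_dker_low:
  assumes N: "N \<ge> 1" and X: "X > 0" "X \<notin> \<int>" "X \<le> 2 * real N + 1" and l: "l > 0"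
    and d: "d > 0" "d \<le> frac X \<and> d \<le> 1 - frac X \<or> B \<ge> 3/2"
    and B: "B \<ge> X * l * exp (l / 2) / ((2 * real N + 1) * d) \<or> B \<ge> 3/2" "B \<ge> 0"
  shows "\<bar>integral {-(1/2)..1/2} (\<lambda>u. pbern 1 (X * exp (l * u)) * dker N u) - pbern 1 X\<bar>
    \<le> (7 + l) * (X * l * exp (l / 2)) * (1 + ln (2 * real N + 1)) / (2 * real N + 1) + 2 * B"
proof -
  let ?J = "{-(1/2)..1/2::real}"
  let ?M = "2 * real N + 1"
  \<comment> \<open>The largest integer that the argument reaches on the interval, at
    \<open>u = 1 / 2\<close>.\<close>
  define I where "I = nat \<lfloor>X * exp (l / 2)\<rfloor>"
  have XeX: "X \<le> X * exp (l / 2)" using X l by simp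
  have I: "real I \<le> X * exp (l / 2)" "X * exp (l / 2) \<le> real I + 1" using X unfolding I_def by (auto simp: of_nat_nat)
  define t where "t i = ln (real i / X) / l" for i
  have step: "real i \<le> X * exp (l * u) \<longleftrightarrow> t i \<le> u" if "i \<ge> 1" for i u
  proof -
    have "real i \<le> X * exp (l * u) \<longleftrightarrow> real i / X \<le> exp (l * u)" using X by (simp add: field_simps)
    also have "\<dots> \<longleftrightarrow> exp (ln (real i / X)) \<le> exp (l * u)" using X that by simp
    also have "\<dots> \<longleftrightarrow> ln (real i / X) \<le> l * u" by (rule exp_le_cancel_iff)
    also have "\<dots> \<longleftrightarrow> t i \<le> u" using l by (simp add: t_def field_simps)
    finally show ?thesis .
  qed
  have rep: "pbern 1 (X * exp (l * u)) = (X * exp (l * u) - 1/2) - (\<Sum>i=1..I. if t i \<le> u then 1 else 0)" if u: "u \<in> ?J" for u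
  proof -
    have y: "0 \<le> X * exp (l * u)" using X by simp
    have le: "X * exp (l * u) \<le> X * exp (l / 2)" using exp_le_half[OF l u] X by simp
    have "\<lfloor>X * exp (l * u)\<rfloor> \<le> \<lfloor>X * exp (l / 2)\<rfloor>" using le by (rule floor_mono)
    have fl: "of_int \<lfloor>X * exp (l * u)\<rfloor> = (\<Sum>i=1..Suc I. if real i \<le> X * exp (l * u) then 1 else (0::real))"
      using y le I by (intro floor_eq_sum) auto
    moreover have "(\<Sum>i=1..Suc I. if real i \<le> X * exp (l * u) then 1 else (0::real)) = (\<Sum>i=1..I. if real i \<le> X * exp (l * u) then 1 else 0)"
    proof -
      have "real (Suc I) > X * exp (l / 2)" using X unfolding I_def by (auto simp: of_nat_nat) linarith
      then show ?thesis using le by simp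
    qed
    ultimately have "of_int \<lfloor>X * exp (l * u)\<rfloor> = (\<Sum>i=1..I. if real i \<le> X * exp (l * u) then 1 else (0::real))" by simp
    also have "\<dots> = (\<Sum>i=1..I. if t i \<le> u then 1 else 0)" by (intro sum.cong) (auto simp: step)
    finally show ?thesis by (simp add: pbern_def bern_1 frac_def)
  qed
  have t0: "t i \<noteq> 0" "t i \<le> 1/2" if i: "i \<in> {1..I}" for i
  proof -
    have iX: "real i \<noteq> X" using X(2) Ints_of_nat[of i] by auto
    have "real i / X > 0" "real i / X \<noteq> 1" using iX X(1) i by auto
    then have "ln (real i / X) \<noteq> 0" using ln_eq_zero_iff by blast
    then show "t i \<noteq> 0" using l by (simp add: t_def)
    have "real i \<le> real I" using i by simp
    also have "\<dots> \<le> X * exp (l * (1/2))" using I(1) by simp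
    finally show "t i \<le> 1/2" using step[of i "1/2"] i by simp
  qed
  define Q where "Q i E \<longleftrightarrow> ((\<lambda>u. dker N u * (if t i \<le> u then 1 else 0)) has_integral E) ?J \<and> \<bar>E - (if t i \<le> 0 then 1 else 0)\<bar> \<le> 3/2
      \<and> \<bar>E - (if t i \<le> 0 then 1 else 0)\<bar> \<le> 1 / (?M * \<bar>t i\<bar>)" for i E
  have "\<forall>i\<in>{1..I}. \<exists>E. Q i E"
  proof
    fix i assume "i \<in> {1..I}"
    from t0[OF this] show "\<exists>E. Q i E"
      by (rule has_integral_dker_step[of _ N]) (auto simp: Q_def)
  qed
  from bchoice[OF this] obtain E where "\<forall>i\<in>{1..I}. Q i (E i)" by (elim exE)
  then have E: "\<And>i. i \<in> {1..I} \<Longrightarrow> ((\<lambda>u. dker N u * (if t i \<le> u then 1 else 0)) has_integral E i) ?J"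
    "\<And>i. i \<in> {1..I} \<Longrightarrow> \<bar>E i - (if t i \<le> 0 then 1 else 0)\<bar> \<le> 3/2"
    "\<And>i. i \<in> {1..I} \<Longrightarrow> \<bar>E i - (if t i \<le> 0 then 1 else 0)\<bar> \<le> 1 / (?M * \<bar>t i\<bar>)"
    by (simp_all add: Q_def)
  define g where "g i = \<bar>E i - (if t i \<le> 0 then 1 else 0)\<bar>" for i
  let ?S = "integral ?J (\<lambda>u. (X * exp (l * u) - 1/2) * dker N u)"
  have smooth: "\<bar>?S - (X * exp (l * 0) - 1/2)\<bar> \<le> (X * l * exp (l / 2)) * (3 * (1 + ln ?M) / ?M)"
  proof (rule abs_integral_dker_minus_le[OF N finite.emptyI])
    show "((\<lambda>u. X * exp (l * u) - 1/2) has_real_derivative X * l * exp (l * u)) (at u)" for u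
      by (auto intro!: derivative_eq_intros)
    show "\<bar>X * l * exp (l * u)\<bar> \<le> X * l * exp (l / 2)" if "u \<in> ?J" for u
      using exp_le_half[OF l that] X l by simp
  qed (intro continuous_intros)
  have "((\<lambda>u. (X * exp (l * u) - 1/2) * dker N u - (\<Sum>i=1..I. dker N u * (if t i \<le> u then 1 else 0))) has_integral (?S - (\<Sum>i=1..I. E i))) ?J"
    by (intro has_integral_diff has_integral_sum E integrable_integral integrable_continuous_interval continuous_intros) auto
  then have "((\<lambda>u. pbern 1 (X * exp (l * u)) * dker N u) has_integral (?S - (\<Sum>i=1..I. E i))) ?J"
  proof (rule has_integral_eq[rotated])
    fix u assume u: "u \<in> ?J"
    have "(\<Sum>i=1..I. if t i \<le> u then 1 else 0) * dker N u = (\<Sum>i=1..I. dker N u * (if t i \<le> u then 1 else 0))"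
      by (subst mult.commute, rule sum_distrib_left)
    then show "(X * exp (l * u) - 1/2) * dker N u - (\<Sum>i=1..I. dker N u * (if t i \<le> u then 1 else 0)) = pbern 1 (X * exp (l * u)) * dker N u"
      by (simp only: rep[OF u] left_diff_distrib)
  qed
  then have "integral ?J (\<lambda>u. pbern 1 (X * exp (l * u)) * dker N u) - pbern 1 (X * exp (l * 0)) = ?S - (\<Sum>i=1..I. E i) - pbern 1 (X * exp (l * 0))"
    by (simp add: integral_unique)
  also have "\<dots> = (?S - (X * exp (l * 0) - 1/2)) - (\<Sum>i=1..I. E i - (if t i \<le> 0 then 1 else 0))"
    by (subst rep) (auto simp: sum_subtractf)
  finally have "\<bar>integral ?J (\<lambda>u. pbern 1 (X * exp (l * u)) * dker N u) - pbern 1 X\<bar> \<le>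
      \<bar>?S - (X * exp (l * 0) - 1/2)\<bar> + \<bar>\<Sum>i=1..I. E i - (if t i \<le> 0 then 1 else 0)\<bar>" by simp
  also have "\<bar>\<Sum>i=1..I. E i - (if t i \<le> 0 then 1 else 0)\<bar> \<le> (\<Sum>i=1..I. g i)" unfolding g_def by (rule sum_abs)
  also have "(\<Sum>i=1..I. g i) \<le> 2 * (X * l * exp (l / 2) / ?M) * (1 + ln (real I + 1)) + 2 * B"
  proof (rule sum_near_inverse_le[OF _ X(1) B(2)])
    show inv: "g i \<le> X * l * exp (l / 2) / ?M / \<bar>real i - X\<bar>" if i: "1 \<le> i" "i \<le> I" "real i \<noteq> X" for i
    proof -
      have ix: "\<bar>real i - X\<bar> > 0" using i by simp
      have "\<bar>real i - X\<bar> / (X * exp (l / 2)) \<le> \<bar>ln (real i / X)\<bar>"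
        using i I X XeX by (intro abs_ln_ratio_ge) auto
      from divide_right_mono[OF this, of l]
      have "\<bar>real i - X\<bar> / (X * exp (l / 2)) / l \<le> \<bar>t i\<bar>" using l by (simp only: t_def abs_divide abs_of_pos)
      then have ti: "\<bar>real i - X\<bar> / (X * l * exp (l / 2)) \<le> \<bar>t i\<bar>" by (simp add: mult_ac)
      have "g i \<le> 1 / (?M * \<bar>t i\<bar>)" using E(3)[of i] i by (simp add: g_def)
      also have "\<dots> \<le> 1 / (?M * (\<bar>real i - X\<bar> / (X * l * exp (l / 2))))"
        using ti ix X l by (intro divide_left_mono mult_left_mono mult_pos_pos divide_pos_pos order.strict_trans2[OF _ ti]) auto
      finally show ?thesis by (simp add: divide_simps)
    qed
    show "g i \<le> B" if i: "1 \<le> i" "i \<le> I" "i = nat \<lfloor>X\<rfloor> \<or> i = nat \<lfloor>X\<rfloor> + 1" for i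
    proof (cases "B \<ge> 3/2")
      case True then show ?thesis using E(2)[of i] i by (simp add: g_def)
    next
      case False
      then have dd: "d \<le> frac X" "d \<le> 1 - frac X" using d by auto
      have fl: "real (nat \<lfloor>X\<rfloor>) = X - frac X" using X by (simp add: frac_def)
      have ix: "\<bar>real i - X\<bar> \<ge> d" using i(3) fl dd by auto
      then have "real i \<noteq> X" using d(1) by auto
      from inv[OF i(1,2) this] have "g i \<le> X * l * exp (l / 2) / ?M / \<bar>real i - X\<bar>" .
      also have "\<dots> \<le> X * l * exp (l / 2) / ?M / d" using ix d(1) X l by (intro divide_left_mono) auto
      also have "\<dots> = X * l * exp (l / 2) / (?M * d)" by simp
      also have "\<dots> \<le> B" using B(1) False by simp
      finally show ?thesis .
    qed
    show "X \<le> real I + 1" using XeX I by linarith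
  qed (use X l in auto)
  also have "\<bar>?S - (X * exp (l * 0) - 1/2)\<bar> + (2 * (X * l * exp (l / 2) / ?M) * (1 + ln (real I + 1)) + 2 * B) \<le>
      (X * l * exp (l / 2)) * (3 * (1 + ln ?M) / ?M) + (2 * (X * l * exp (l / 2) / ?M) * ((2 + l / 2) * (1 + ln ?M)) + 2 * B)"
  proof (intro add_mono smooth order_refl mult_left_mono)
    have e2: "1 + exp (l / 2) \<le> exp (1 + l / 2)"
    proof -
      have "2 \<le> exp (1::real)" using exp_ge_add_one_self[of "1::real"] by simp
      then have "2 * exp (l / 2) \<le> exp 1 * exp (l / 2)" by (intro mult_right_mono) auto
      moreover have "1 \<le> exp (l / 2)" using l by simp
      ultimately show ?thesis unfolding exp_add by linarith
    qed
    have "real I + 1 \<le> ?M * exp (l / 2) + ?M"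
      using I mult_right_mono[OF X(3) exp_ge_zero[of "l / 2"]] by linarith
    also have "\<dots> = ?M * (1 + exp (l / 2))" by (simp add: algebra_simps)
    also have "\<dots> \<le> ?M * exp (1 + l / 2)" using e2 by (intro mult_left_mono) auto
    finally have "ln (real I + 1) \<le> ln (?M * exp (1 + l / 2))" by (intro ln_mono) auto
    also have "\<dots> = ln ?M + (1 + l / 2)" by (simp add: ln_mult)
    finally have "1 + ln (real I + 1) \<le> (2 + l / 2) * 1 + 1 * ln ?M" by simp
    also have "\<dots> \<le> (2 + l / 2) * 1 + (2 + l / 2) * ln ?M" using l by (intro add_left_mono mult_right_mono) auto
    finally show "1 + ln (real I + 1) \<le> (2 + l / 2) * (1 + ln ?M)" by (simp only: distrib_left)
  qed (use X l in auto)
  also have "\<dots> = (7 + l) * (X * l * exp (l / 2)) * (1 + ln ?M) / ?M + 2 * B"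
  proof -
    have "Y * (3 * L / m) + (2 * (Y / m) * ((2 + l / 2) * L) + 2 * B) = (7 + l) * Y * L / m + 2 * B" for Y L m :: real
    proof -
      have "(7 + l) * Y * L / m = (3 + (4 + l)) * (Y * L / m)" by simp
      also have "\<dots> = 3 * (Y * L / m) + (4 + l) * (Y * L / m)" by (rule distrib_right)
      finally show ?thesis by (simp add: algebra_simps)
    qed
    then show ?thesis .
  qed
  finally show ?thesis by simp
qed


section \<open>Summation over the scales\<close>

lemma power_ge_Suc:
  fixes b :: real assumes "b \<ge> 2" shows "real j + 1 \<le> b ^ j"
proof (induction j)
  case (Suc j)
  have "real (Suc j) + 1 \<le> 2 * (real j + 1)" by simp
  also have "\<dots> \<le> b * b ^ j" using Suc assms by (intro mult_mono) auto
  finally show ?case by simp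
qed simp

lemma finite_power_le:
  fixes b :: real assumes "b \<ge> 2" shows "finite {j. b ^ j \<le> R}"
proof (rule finite_subset)
  show "{j. b ^ j \<le> R} \<subseteq> {..nat \<lceil>R\<rceil>}"
  proof
    fix j assume "j \<in> {j. b ^ j \<le> R}"
    then have "real j \<le> R" using power_ge_Suc[OF assms, of j] by simp
    then show "j \<in> {..nat \<lceil>R\<rceil>}" by (simp add: le_nat_iff) linarith
  qed
qed simp

lemma sum_power_le:
  fixes b :: real
  assumes b: "b \<ge> 2" and R: "R \<ge> 0" and S: "finite S" "\<And>j. j \<in> S \<Longrightarrow> b ^ j \<le> R"
  shows "(\<Sum>j\<in>S. b ^ j) \<le> 2 * R"
proof (cases "S = {}")
  case False
  have *: "(\<Sum>j\<le>m. b ^ j) \<le> 2 * b ^ m" for m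
  proof (induction m)
    case (Suc m)
    have "2 * b ^ m \<le> b * b ^ m" using b by (intro mult_right_mono) auto
    then show ?case using Suc by simp
  qed simp
  have "(\<Sum>j\<in>S. b ^ j) \<le> (\<Sum>j\<le>Max S. b ^ j)" using S b by (intro sum_mono2) auto
  also have "\<dots> \<le> 2 * b ^ Max S" by (rule *)
  also have "\<dots> \<le> 2 * R" using S(2)[OF Max_in[OF S(1) False]] by simp
  finally show ?thesis .
qed (use R in simp)

text \<open>For the sawtooth \<open>pbern 1\<close> the errors \<open>e j\<close> account for the scales at which the point is close to an
  integer, where the partial Fourier sums do not converge uniformly.\<close>
lemma regime_sum_le:
  fixes b M L C Z :: real and F P e :: "nat \<Rightarrow> real"
  assumes b: "b \<ge> 2" and L: "L \<ge> 1" and M: "M \<ge> 1" and C: "C \<ge> 0" and Z: "Z \<ge> 0"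
    and NL: "M / L \<le> R" "R < M * L"
    and low: "\<And>j. b ^ j \<le> M / L \<Longrightarrow> \<bar>F j - P j\<bar> \<le> C * b ^ j * L / M + e j"
    and e: "\<And>j. 0 \<le> e j"
    and high: "\<And>j. \<bar>F j\<bar> \<le> C * M * L / b ^ j"
    and mid: "\<And>j. M / L < b ^ j \<Longrightarrow> \<bar>F j\<bar> \<le> Z"
    and P: "\<And>j. \<bar>P j\<bar> \<le> C"
  shows "summable F"
    "\<bar>(\<Sum>j. F j) - (\<Sum>j\<in>{j. b ^ j \<le> R}. P j)\<bar> \<le> 4 * C + (\<Sum>j\<in>{j. b ^ j \<le> R}. e j) + (2 * ln L / ln b + 1) * (Z + C)"
proof -
  have geo: "summable (\<lambda>j. (1 / b) ^ j)" using b by (intro summable_geometric) auto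
  have hb: "norm (F j) \<le> C * M * L * (1 / b) ^ j" for j using high[of j] by (simp add: power_divide)
  show sF: "summable F"
    by (rule summable_comparison_test'[OF summable_mult[OF geo, of "C * M * L"], of 0]) (use hb in auto)
  \<comment> \<open>The first scale above the transition range; from here on the \<open>high\<close>
    bounds decay geometrically.\<close>
  define m where "m = (LEAST j. b ^ j \<ge> M * L)"
  have ML1: "M * L \<ge> 1" using M L mult_mono[of 1 M 1 L] by simp
  have "\<exists>j. b ^ j \<ge> M * L"
  proof
    show "M * L \<le> b ^ nat \<lceil>M * L\<rceil>" using power_ge_Suc[OF b, of "nat \<lceil>M * L\<rceil>"] ML1 by linarith
  qed
  then have m: "b ^ m \<ge> M * L" unfolding m_def by (rule LeastI_ex)
  have less: "b ^ j < M * L" if "j < m" for j using not_less_Least[of j "\<lambda>j. b ^ j \<ge> M * L"] that by (simp add: m_def)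
  have ge: "j < m" if "b ^ j \<le> R" for j
  proof (rule ccontr)
    assume "\<not> j < m"
    then have "b ^ m \<le> b ^ j" using b by (intro power_increasing) auto
    then show False using m that NL by linarith
  qed
  \<comment> \<open>The scales below the transition range and inside it. The cut-off
    \<open>R\<close> lies between the two ends of that range, so the sum of \<open>P\<close> runs
    over all of \<open>lo\<close> and possibly part of \<open>mi\<close>.\<close>
  define lo mi where "lo = {j. b ^ j \<le> M / L}" and "mi = {j. j < m \<and> M / L < b ^ j}"
  have MLle: "M / L \<le> M * L"
  proof -
    have "M / L \<le> M / 1" using L M by (intro divide_left_mono) auto
    also have "\<dots> \<le> M * L" using L M by simp
    finally show ?thesis .
  qed
  have lom: "lo \<subseteq> {..<m}" using ge NL by (auto simp: lo_def)
  have un: "{..<m} = lo \<union> mi" "lo \<inter> mi = {}" using lom by (auto simp: lo_def mi_def)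
  have fin: "finite lo" "finite mi" by (auto simp: lo_def mi_def finite_power_le[OF b])
  have Rlo: "{j. b ^ j \<le> R} = lo \<union> (mi \<inter> {j. b ^ j \<le> R})"
    using ge NL by (force simp: lo_def mi_def)
  \<comment> \<open>The transition range spans a factor \<open>L * L\<close>, whence the
    count.\<close>
  have cardmi: "real (card mi) \<le> 2 * ln L / ln b + 1"
  proof (cases "mi = {}")
    case False
    let ?p = "Min mi" and ?q = "Max mi"
    have pq: "?p \<in> mi" "?q \<in> mi" using False fin by auto
    have le: "?p \<le> ?q" using Max_ge[OF fin(2) pq(1)] .
    have "mi \<subseteq> {?p..?q}" using fin by auto
    then have "card mi \<le> card {?p..?q}" by (intro card_mono) auto
    then have c: "real (card mi) \<le> real (?q - ?p) + 1" using le by simp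
    have "b ^ (?q - ?p) * (M / L) \<le> b ^ (?q - ?p) * b ^ ?p" using pq b by (intro mult_left_mono) (auto simp: mi_def)
    also have "\<dots> = b ^ ?q" using le by (simp flip: power_add)
    also have "\<dots> \<le> M * L" using pq less by (auto simp: mi_def less_imp_le)
    finally have "b ^ (?q - ?p) \<le> L * L" using M L by (simp add: field_simps)
    then have "ln (b ^ (?q - ?p)) \<le> ln (L * L)" using b by (intro ln_mono) auto
    then have "real (?q - ?p) * ln b \<le> 2 * ln L" using b L by (simp add: ln_realpow ln_mult)
    then have "real (?q - ?p) \<le> 2 * ln L / ln b" using b by (simp add: field_simps)
    with c show ?thesis by simp
  qed (use b L in auto)
  have tail: "\<bar>\<Sum>j. F (j + m)\<bar> \<le> 2 * C"
  proof -
    have bnd: "norm (F (j + m)) \<le> C * (1 / b) ^ j" for j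
    proof -
      have "norm (F (j + m)) \<le> C * M * L / (b ^ j * b ^ m)" using high[of "j + m"] by (simp add: power_add)
      also have "\<dots> \<le> C * M * L / (b ^ j * (M * L))"
        using m b C M L ML1 by (intro divide_left_mono mult_left_mono mult_nonneg_nonneg mult_pos_pos) auto
      also have "\<dots> = C * (1 / b) ^ j" using M L by (simp add: power_divide)
      finally show ?thesis .
    qed
    have "norm (\<Sum>j. F (j + m)) \<le> (\<Sum>j. C * (1 / b) ^ j)"
      by (intro norm_suminf_le[OF bnd] summable_mult geo)
    also have "\<dots> = C * (1 / (1 - 1 / b))" using b by (simp add: suminf_mult geo suminf_geometric)
    also have "1 / (1 - 1 / b) \<le> 2" using b by (simp add: field_simps)
    then have "C * (1 / (1 - 1 / b)) \<le> C * 2" using C by (rule mult_left_mono)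
    finally show ?thesis by simp
  qed
  have lowsum: "\<bar>(\<Sum>j\<in>lo. F j) - (\<Sum>j\<in>lo. P j)\<bar> \<le> 2 * C + (\<Sum>j\<in>{j. b ^ j \<le> R}. e j)"
  proof -
    have "\<bar>(\<Sum>j\<in>lo. F j) - (\<Sum>j\<in>lo. P j)\<bar> \<le> (\<Sum>j\<in>lo. \<bar>F j - P j\<bar>)"
      unfolding sum_subtractf[symmetric] by (rule sum_abs)
    also have "\<dots> \<le> (\<Sum>j\<in>lo. C * L / M * b ^ j + e j)"
      using low by (intro sum_mono) (auto simp: lo_def mult_ac)
    also have "\<dots> = C * L / M * (\<Sum>j\<in>lo. b ^ j) + (\<Sum>j\<in>lo. e j)" by (simp add: sum.distrib sum_distrib_left)
    also have "\<dots> \<le> C * L / M * (2 * (M / L)) + (\<Sum>j\<in>{j. b ^ j \<le> R}. e j)"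
      using C L M e Rlo by (intro add_mono mult_left_mono sum_power_le b fin sum_mono2 finite_power_le) (auto simp: lo_def)
    also have "C * L / M * (2 * (M / L)) = 2 * C" using L M by simp
    finally show ?thesis .
  qed
  have "(\<Sum>j. F j) = (\<Sum>j. F (j + m)) + (\<Sum>j<m. F j)" using suminf_split_initial_segment[OF sF, of m] by simp
  also have "(\<Sum>j<m. F j) = (\<Sum>j\<in>lo. F j) + (\<Sum>j\<in>mi. F j)" unfolding un(1) using un(2) fin by (intro sum.union_disjoint) auto
  finally have eF: "(\<Sum>j. F j) = (\<Sum>j. F (j + m)) + ((\<Sum>j\<in>lo. F j) + (\<Sum>j\<in>mi. F j))" .
  have eP: "(\<Sum>j\<in>{j. b ^ j \<le> R}. P j) = (\<Sum>j\<in>lo. P j) + (\<Sum>j\<in>mi \<inter> {j. b ^ j \<le> R}. P j)"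
    by (subst Rlo, rule sum.union_disjoint) (use un fin in auto)
  have m1: "\<bar>\<Sum>j\<in>mi. F j\<bar> \<le> real (card mi) * Z"
    using mid by (intro order_trans[OF sum_abs] sum_bounded_above) (auto simp: mi_def)
  have m2: "\<bar>\<Sum>j\<in>mi \<inter> {j. b ^ j \<le> R}. P j\<bar> \<le> real (card mi) * C"
  proof -
    have "\<bar>\<Sum>j\<in>mi \<inter> {j. b ^ j \<le> R}. P j\<bar> \<le> real (card (mi \<inter> {j. b ^ j \<le> R})) * C"
      using P by (intro order_trans[OF sum_abs] sum_bounded_above) auto
    also have "\<dots> \<le> real (card mi) * C" using C fin by (intro mult_right_mono) (auto intro!: card_mono)
    finally show ?thesis .
  qed
  have "\<bar>(\<Sum>j. F j) - (\<Sum>j\<in>{j. b ^ j \<le> R}. P j)\<bar> \<le> 2 * C + (2 * C + (\<Sum>j\<in>{j. b ^ j \<le> R}. e j)) + real (card mi) * (Z + C)"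
    using tail lowsum m1 m2 unfolding eF eP by (simp add: distrib_left)
  also have "real (card mi) * (Z + C) \<le> (2 * ln L / ln b + 1) * (Z + C)" using cardmi Z C by (intro mult_right_mono) auto
  finally show "\<bar>(\<Sum>j. F j) - (\<Sum>j\<in>{j. b ^ j \<le> R}. P j)\<bar> \<le> 4 * C + (\<Sum>j\<in>{j. b ^ j \<le> R}. e j) + (2 * ln L / ln b + 1) * (Z + C)"
    by simp
qed


section \<open>Partial Fourier sums at a single scale and their total\<close>

text \<open>As \<open>exp (ln b * u)\<close> is \<open>b powr u\<close>, this is the symmetric
  partial sum of order \<open>N\<close>, constant term included, at \<open>u = 0\<close> of the
  Fourier series of \<open>u \<mapsto> pbern k (a * b powr (j + u))\<close> on
  \<open>[-1/2, 1/2]\<close>.\<close>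

definition dker_term :: "nat \<Rightarrow> real \<Rightarrow> real \<Rightarrow> nat \<Rightarrow> nat \<Rightarrow> real" where
  "dker_term k b a N j = integral {-(1/2)..1/2} (\<lambda>u. pbern k (a * b ^ j * exp (ln b * u)) * dker N u)"

lemma dker_term_mid:
  fixes a b L :: real
  assumes b: "b \<ge> 2" and a: "a > 0" and k: "k \<ge> 1" and L: "L = 1 + ln (2 * real N + 1)"
    and j: "(2 * real N + 1) / L < b ^ j" and big: "4 \<le> a * ((2 * real N + 1) / L)"
  shows "\<bar>dker_term k b a N j\<bar> \<le> (4 * mode_const (ln b) + 4 * expave_const (ln b) * (1 + 2 / a)) * L powr (3/4)"
proof -
  let ?M = "2 * real N + 1"
  define X where "X = a * b ^ j"
  \<comment> \<open>With \<open>H\<close> of order \<open>sqrt L\<close> the modes cost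
    \<open>L powr (1/2)\<close> in total, and the remainder costs \<open>L / sqrt (real H)\<close>,
    that is \<open>L powr (3/4)\<close>, which dominates.\<close>
  define H where "H = nat \<lceil>sqrt L\<rceil>"
  have l: "ln b > 0" using b by simp
  have L1: "L \<ge> 1" using L by simp
  have sL: "sqrt L \<ge> 1" using L1 by simp
  have H: "sqrt L \<le> real H" "real H \<le> 2 * sqrt L" "H \<ge> 1" using sL unfolding H_def by linarith+
  have aX: "a * (?M / L) \<le> X" unfolding X_def using j a by (intro mult_left_mono) auto
  have X: "X \<ge> 4" using aX big by linarith
  have m0: "mode_const (ln b) \<ge> 0" by (simp add: mode_const_def vdC_const_def)
  have e0: "expave_const (ln b) \<ge> 0" using l by (simp add: expave_const_def)
  have gen: "(2 * m) / (a * (m / L)) = 2 / a * L" if "m > 0" for m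
    using a L1 that by (simp add: field_simps)
  have "(2 * real N + 2) / X \<le> (2 * ?M) / (a * (?M / L))"
    using X aX a L1 by (intro frac_le mult_pos_pos divide_pos_pos) auto
  also have "\<dots> = 2 / a * L" by (rule gen) simp
  finally have q: "1 + ln ?M + (2 * real N + 2) / X \<le> L * (1 + 2 / a)" using L by (simp add: algebra_simps)
  have rH: "L powr (1/4) \<le> sqrt (real H)"
  proof -
    have "L powr (1/4) = sqrt (sqrt L)" using L1 by (simp add: powr_half_sqrt[symmetric] powr_powr)
    also have "\<dots> \<le> sqrt (real H)" using H by simp
    finally show ?thesis .
  qed
  have "\<bar>dker_term k b a N j\<bar> \<le> 2 * real H * mode_const (ln b) + expave_const (ln b) * (1 + ln ?M + (2 * real N + 2) / X) * (4 / sqrt (real H))"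
    unfolding dker_term_def X_def[symmetric] by (rule abs_integral_pbern_dker_le[OF k H(3) X l])
  also have "\<dots> \<le> 2 * (2 * sqrt L) * mode_const (ln b) + expave_const (ln b) * (L * (1 + 2 / a)) * (4 / L powr (1/4))"
    using H m0 e0 q rH L1 a by (intro add_mono mult_mono mult_left_mono divide_left_mono) auto
  also have "sqrt L = L powr (1/2)" using L1 by (simp add: powr_half_sqrt)
  also have "2 * (2 * L powr (1/2)) * mode_const (ln b) + expave_const (ln b) * (L * (1 + 2 / a)) * (4 / L powr (1/4))
      = 4 * mode_const (ln b) * L powr (1/2) + 4 * expave_const (ln b) * (1 + 2 / a) * (L / L powr (1/4))"
    by simp
  also have "L / L powr (1/4) = L powr (3/4)" using L1 powr_diff[of L 1 "1/4"] by simp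
  also have "4 * mode_const (ln b) * L powr (1/2) \<le> 4 * mode_const (ln b) * L powr (3/4)"
    using m0 L1 by (intro mult_left_mono powr_mono) auto
  finally show ?thesis by (simp add: distrib_right)
qed

text \<open>The three regimes enter \<open>regime_sum_le\<close> with
  \<open>M = 2 * real N + 1\<close> and \<open>L = 1 + ln M\<close>. For \<open>k = 1\<close> the
  scales whose point comes closer than \<open>d\<close> to an integer are charged \<open>3\<close>
  each, all others together \<open>C / d\<close>.\<close>

lemma dker_term_sum:
  fixes a b d :: real
  assumes b: "b \<ge> 2" and a: "0 < a" "a \<le> 1" and k: "k \<ge> 1" and d: "d > 0"
    and irr: "k = 1 \<Longrightarrow> (\<And>j. a * b ^ j \<notin> \<int>)"
  obtains C where "C \<ge> 0"
    "\<forall>\<^sub>F N in sequentially. summable (dker_term k b a N) \<and>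
      \<bar>(\<Sum>j. dker_term k b a N j) - (\<Sum>j\<in>{j. b ^ j \<le> real N}. pbern k (a * b ^ j))\<bar>
      \<le> C * ((1 + ln (1 + ln (2 * real N + 1))) * (1 + ln (2 * real N + 1)) powr (3/4))
        + (if k = 1 then C / d + 3 * real (card {j. b ^ j \<le> real N \<and> \<not> (d \<le> frac (a * b ^ j) \<and> d \<le> 1 - frac (a * b ^ j))}) else 0)"
proof -
  define l where "l = ln b"
  have l: "l > 0" using b by (simp add: l_def)
  define C1 where "C1 = (if k = 1 then (7 + l) * l * exp (l / 2) else pbern_bound (k - 1) * l * exp (l / 2) * 3)"
  define C2 where "C2 = pbern_bound (Suc k) * exp (l / 2) / (l * a) * (2 + 2 * pi + l)"
  define C where "C = C1 + C2 + pbern_bound k"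
  define C3 where "C3 = 4 * mode_const l + 4 * expave_const l * (1 + 2 / a)"
  define D where "D = 4 * C + (2 / l + 1) * (C3 + C) + 2 * l * exp (l / 2)"
  have C1: "C1 \<ge> 0" using l pbern_bound(1)[of "k - 1"] by (auto simp: C1_def)
  have C2: "C2 \<ge> 0" using l a pbern_bound(1)[of "Suc k"] by (auto simp: C2_def)
  have CC: "C1 \<le> C" "C2 \<le> C" "pbern_bound k \<le> C" "C \<ge> 0" using C1 C2 pbern_bound(1)[of k] by (auto simp: C_def)
  have C3: "C3 \<ge> 0" using l a by (auto simp: C3_def mode_const_def vdC_const_def expave_const_def)
  have D: "D \<ge> 0" using CC C3 l by (auto simp: D_def)
  have main: "summable (dker_term k b a N) \<and>
      \<bar>(\<Sum>j. dker_term k b a N j) - (\<Sum>j\<in>{j. b ^ j \<le> real N}. pbern k (a * b ^ j))\<bar>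
      \<le> D * ((1 + ln (1 + ln (2 * real N + 1))) * (1 + ln (2 * real N + 1)) powr (3/4))
        + (if k = 1 then D / d + 3 * real (card {j. b ^ j \<le> real N \<and> \<not> (d \<le> frac (a * b ^ j) \<and> d \<le> 1 - frac (a * b ^ j))}) else 0)"
    if N: "N \<ge> 1" and c1: "4 \<le> a * ((2 * real N + 1) / (1 + ln (2 * real N + 1)))"
      and c2: "(2 * real N + 1) / (1 + ln (2 * real N + 1)) \<le> real N" for N
  proof -
    define M where "M = 2 * real N + 1"
    define L where "L = 1 + ln M"
    have M: "M \<ge> 1" by (simp add: M_def)
    have L: "L \<ge> 1" using M by (simp add: L_def)
    define bad where "bad j \<longleftrightarrow> \<not> (d \<le> frac (a * b ^ j) \<and> d \<le> 1 - frac (a * b ^ j))" for j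
    \<comment> \<open>The allowance for each of the two integers next to \<open>a * b ^ j\<close>:
      trivial if one of them is close, otherwise a multiple of \<open>b ^ j / (M * d)\<close>, which
      sums geometrically.\<close>
    define B where "B j = (if bad j then 3/2 else b ^ j * l * exp (l / 2) / (M * d))" for j
    define e where "e j = (if k = 1 then 2 * B j else 0)" for j
    have B0: "B j \<ge> 0" for j using b l M d by (auto simp: B_def)
    have X: "a * b ^ j > 0" "a * b ^ j \<le> b ^ j" for j using a b by auto
    have low: "\<bar>dker_term k b a N j - pbern k (a * b ^ j)\<bar> \<le> C * b ^ j * L / M + e j" if j: "b ^ j \<le> M / L" for j
    proof (cases "k = 1")
      case True
      have "M / L \<le> M / 1" using L M by (intro divide_left_mono) auto
      then have XM: "a * b ^ j \<le> 2 * real N + 1" using X(2)[of j] j by (simp add: M_def)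
      have BB: "a * b ^ j * l * exp (l / 2) / ((2 * real N + 1) * d) \<le> B j \<or> B j \<ge> 3/2"
        unfolding B_def M_def using X(2)[of j] l d by (auto intro!: divide_right_mono mult_right_mono)
      have "\<bar>dker_term k b a N j - pbern k (a * b ^ j)\<bar> \<le> (7 + l) * (a * b ^ j * l * exp (l / 2)) * (1 + ln (2 * real N + 1)) / (2 * real N + 1) + 2 * B j"
        unfolding dker_term_def l_def[symmetric] True
        by (rule pbern_1_dker_low[OF N X(1) irr[OF True] XM l d _ BB B0]) (auto simp: B_def bad_def)
      also have "(7 + l) * (a * b ^ j * l * exp (l / 2)) * (1 + ln (2 * real N + 1)) / (2 * real N + 1) = C1 * (a * b ^ j) * L / M"
        by (simp add: C1_def True L_def M_def mult_ac)
      also have "\<dots> \<le> C * b ^ j * L / M"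
        using CC C1 X[of j] L M by (intro divide_right_mono mult_right_mono mult_mono) (auto simp: less_imp_le)
      finally show ?thesis by (simp add: e_def True)
    next
      case False
      then have k': "k = Suc (k - 1)" "k - 1 \<ge> 1" using k by auto
      have "\<bar>dker_term k b a N j - pbern k (a * b ^ j)\<bar> \<le> pbern_bound (k - 1) * (a * b ^ j * l * exp (l / 2)) * (3 * (1 + ln (2 * real N + 1)) / (2 * real N + 1))"
        unfolding dker_term_def l_def[symmetric] using pbern_Suc_dker_low[OF k'(2) N X(1) l] k'(1) by simp
      also have "\<dots> = C1 * (a * b ^ j) * L / M"
        using False by (simp add: C1_def L_def M_def mult_ac)
      also have "\<dots> \<le> C * b ^ j * L / M"
        using CC C1 X[of j] L M by (intro divide_right_mono mult_right_mono mult_mono) (auto simp: less_imp_le)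
      finally show ?thesis using False unfolding e_def by simp
    qed
    have high: "\<bar>dker_term k b a N j\<bar> \<le> C * M * L / b ^ j" for j
    proof -
      have "\<bar>dker_term k b a N j\<bar> \<le> pbern_bound (Suc k) * exp (l / 2) / (l * (a * b ^ j)) * ((2 + 2 * pi + l) * (2 * real N + 1) * (1 + ln (2 * real N + 1)))"
        unfolding dker_term_def l_def[symmetric] by (rule pbern_dker_high[OF k N X(1) l])
      also have "\<dots> = C2 * M * L / b ^ j" by (simp add: C2_def M_def L_def mult_ac)
      also have "\<dots> \<le> C * M * L / b ^ j" using CC b M L by (intro divide_right_mono mult_right_mono) auto
      finally show ?thesis .
    qed
    have mid: "\<bar>dker_term k b a N j\<bar> \<le> C3 * L powr (3/4)" if "M / L < b ^ j" for j
      unfolding C3_def l_def using that c1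
      by (intro dker_term_mid[OF b a(1) k]) (auto simp: L_def M_def)
    have NL: "M / L \<le> real N" "real N < M * L"
    proof -
      have "real N < M * 1" by (simp add: M_def)
      also have "\<dots> \<le> M * L" using M L by (intro mult_left_mono) auto
      finally show "real N < M * L" .
    qed (use c2 in \<open>simp add: M_def L_def\<close>)
    have P: "\<bar>pbern k (a * b ^ j)\<bar> \<le> C" for j using pbern_bound(2)[of k] CC(3) by (rule order_trans)
    have e0: "0 \<le> e j" for j using B0 by (simp add: e_def)
    have Z0: "C3 * L powr (3/4) \<ge> 0" using C3 by simp
    note R = regime_sum_le[OF b L M CC(4) Z0 NL low e0 high mid P]
    have "4 * C + (2 * ln L / ln b + 1) * (C3 * L powr (3/4) + C) \<le> (4 * C + (2 / l + 1) * (C3 + C)) * ((1 + ln L) * L powr (3/4))"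
    proof -
      have p1: "L powr (3/4) \<ge> 1" using L by (simp add: ge_one_powr_ge_zero)
      have q1: "(1 + ln L) * L powr (3/4) \<ge> 1" using p1 L mult_mono[of 1 "1 + ln L" 1 "L powr (3/4)"] by simp
      have "C * 1 \<le> C * L powr (3/4)" using CC p1 by (intro mult_left_mono) auto
      then have "C3 * L powr (3/4) + C \<le> (C3 + C) * L powr (3/4)" by (simp add: algebra_simps)
      moreover have "2 * ln L / ln b + 1 \<le> (2 / l + 1) * (1 + ln L)"
      proof -
        have "(2 / l + 1) * (1 + ln L) = 2 * ln L / l + 1 + (2 / l + ln L)" by (simp add: algebra_simps add_divide_distrib)
        moreover have "0 \<le> 2 / l" "0 \<le> ln L" using l L by auto
        ultimately show ?thesis unfolding l_def[symmetric] by linarith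
      qed
      ultimately have "(2 * ln L / ln b + 1) * (C3 * L powr (3/4) + C) \<le> ((2 / l + 1) * (1 + ln L)) * ((C3 + C) * L powr (3/4))"
        using C3 CC l L b by (intro mult_mono) auto
      moreover have "4 * C * 1 \<le> 4 * C * ((1 + ln L) * L powr (3/4))" using CC q1 by (intro mult_left_mono) auto
      moreover have "(c + s * t) * (w * p) = c * (w * p) + (s * w) * (t * p)" for c s t w p :: real
        by (simp add: algebra_simps)
      ultimately show ?thesis by (simp only: mult_1_right)
    qed
    also have "\<dots> \<le> D * ((1 + ln L) * L powr (3/4))"
      using l L unfolding D_def by (intro mult_right_mono) auto
    finally have 1: "4 * C + (2 * ln L / ln b + 1) * (C3 * L powr (3/4) + C) \<le> D * ((1 + ln L) * L powr (3/4))" .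
    have 2: "(\<Sum>j\<in>{j. b ^ j \<le> real N}. e j) \<le> (if k = 1 then D / d + 3 * real (card {j. b ^ j \<le> real N \<and> bad j}) else 0)"
    proof (cases "k = 1")
      case True
      have fin: "finite {j. b ^ j \<le> real N}" by (rule finite_power_le[OF b])
      have "(\<Sum>j\<in>{j. b ^ j \<le> real N}. e j) \<le> (\<Sum>j\<in>{j. b ^ j \<le> real N}. (if bad j then 3 else 0) + 2 * l * exp (l / 2) / (M * d) * b ^ j)"
        using b l M d by (intro sum_mono) (auto simp: e_def True B_def mult_ac)
      also have "\<dots> = 3 * real (card {j. b ^ j \<le> real N \<and> bad j}) + 2 * l * exp (l / 2) / (M * d) * (\<Sum>j\<in>{j. b ^ j \<le> real N}. b ^ j)"
        by (simp add: sum.distrib sum_distrib_left sum.inter_filter[OF fin, symmetric] Collect_conj_eq)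
      also have "2 * l * exp (l / 2) / (M * d) * (\<Sum>j\<in>{j. b ^ j \<le> real N}. b ^ j) \<le> 2 * l * exp (l / 2) / (M * d) * (2 * real N)"
        using l M d fin b by (intro mult_left_mono sum_power_le) auto
      also have "\<dots> \<le> 2 * l * exp (l / 2) / (M * d) * M"
        using l M d by (intro mult_left_mono) (auto simp: M_def)
      also have "\<dots> = 2 * l * exp (l / 2) / d" using M by simp
      also have "\<dots> \<le> D / d" using CC C3 l d by (intro divide_right_mono) (auto simp: D_def)
      finally show ?thesis using True by simp
    qed (simp add: e_def)
    show ?thesis using R(1) R(2) 1 2 unfolding L_def M_def bad_def by auto
  qed
  \<comment> \<open>This threshold puts every transition scale at \<open>X \<ge> 4\<close>, as the
    mode estimate demands.\<close>
  have "eventually (\<lambda>N::nat. 4 \<le> a * ((2 * real N + 1) / (1 + ln (2 * real N + 1)))) sequentially"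
  proof -
    have "filterlim (\<lambda>N::nat. (2 * real N + 1) / (1 + ln (2 * real N + 1))) at_top sequentially" by real_asymp
    then have "eventually (\<lambda>N::nat. (2 * real N + 1) / (1 + ln (2 * real N + 1)) \<ge> 4 / a) sequentially"
      by (simp only: filterlim_at_top)
    then show ?thesis by eventually_elim (use a in \<open>simp add: field_simps\<close>)
  qed
  moreover have "eventually (\<lambda>N::nat. (2 * real N + 1) / (1 + ln (2 * real N + 1)) \<le> real N) sequentially" by real_asymp
  moreover have "eventually (\<lambda>N::nat. N \<ge> 1) sequentially" by (rule eventually_ge_at_top)
  ultimately have "\<forall>\<^sub>F N in sequentially. summable (dker_term k b a N) \<and>
      \<bar>(\<Sum>j. dker_term k b a N j) - (\<Sum>j\<in>{j. b ^ j \<le> real N}. pbern k (a * b ^ j))\<bar>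
      \<le> D * ((1 + ln (1 + ln (2 * real N + 1))) * (1 + ln (2 * real N + 1)) powr (3/4))
        + (if k = 1 then D / d + 3 * real (card {j. b ^ j \<le> real N \<and> \<not> (d \<le> frac (a * b ^ j) \<and> d \<le> 1 - frac (a * b ^ j))}) else 0)"
    by eventually_elim (rule main)
  then show ?thesis by (rule that[OF D])
qed

section \<open>The zeta function as a Mellin transform of periodic Bernoulli functions\<close>

text \<open>The integral of \<open>pbern r x * x powr (- s - r)\<close> in the logarithmic variable
  \<open>x = exp v\<close>; the \<open>- 1\<close> in the exponent comes from
  \<open>dx = exp v dv\<close>.\<close>

definition bern_int :: "nat \<Rightarrow> complex \<Rightarrow> real \<Rightarrow> real \<Rightarrow> complex" where
  "bern_int r s p q = integral {p..q} (\<lambda>v. of_real (pbern r (exp v)) * exp (- (s + of_nat r - 1) * of_real v))"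

lemma norm_exp_mult_real [simp]: "norm (exp (c * complex_of_real v)) = exp (Re c * v)"
  by (simp add: norm_exp_eq_Re)

lemma pbern_exp_integrable: "(\<lambda>v. of_real (pbern r (exp v)) * exp (c * complex_of_real v)) integrable_on {p..q}"
proof (rule integrable_bounded_borel)
  have "(\<lambda>v. exp (c * complex_of_real v)) \<in> borel_measurable borel"
    by (intro borel_measurable_continuous_onI continuous_intros)
  then show "(\<lambda>v. of_real (pbern r (exp v)) * exp (c * complex_of_real v)) \<in> borel_measurable borel"
    by measurable
  fix v assume v: "v \<in> {p..q}"
  have "Re c * v \<le> \<bar>Re c\<bar> * \<bar>v\<bar>" using abs_ge_self[of "Re c * v"] by (simp only: abs_mult)
  also have "\<dots> \<le> \<bar>Re c\<bar> * (\<bar>p\<bar> + \<bar>q\<bar>)" using v by (intro mult_left_mono) auto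
  finally show "norm (of_real (pbern r (exp v)) * exp (c * complex_of_real v)) \<le> pbern_bound r * exp (\<bar>Re c\<bar> * (\<bar>p\<bar> + \<bar>q\<bar>))"
    unfolding norm_mult norm_of_real norm_exp_mult_real using pbern_bound[of r]
    by (intro mult_mono) (auto simp: less_imp_le)
qed

lemma bern_int_combine:
  assumes "p \<le> q" "q \<le> q'"
  shows "bern_int r s p q' = bern_int r s p q + bern_int r s q q'"
  unfolding bern_int_def
  by (rule Henstock_Kurzweil_Integration.integral_combine[symmetric, OF assms pbern_exp_integrable])

lemma has_integral_exp_real:
  fixes c :: real
  assumes "c \<noteq> 0" "p \<le> q"
  shows "((\<lambda>v. exp (c * v)) has_integral (exp (c * q) / c - exp (c * p) / c)) {p..q}"
  using assms by (intro fundamental_theorem_of_calculus)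
    (auto intro!: derivative_eq_intros simp flip: has_real_derivative_iff_has_vector_derivative)

lemma norm_bern_int_le:
  assumes pq: "p \<le> q" and \<sigma>: "\<sigma> > 0" "\<sigma> \<le> Re s + real r - 1" and p: "p \<ge> 0"
  shows "norm (bern_int r s p q) \<le> pbern_bound r * exp (- \<sigma> * p) / \<sigma>"
proof -
  have hi: "((\<lambda>v. pbern_bound r * exp (- \<sigma> * v)) has_integral (pbern_bound r * (exp (- \<sigma> * q) / (- \<sigma>) - exp (- \<sigma> * p) / (- \<sigma>)))) {p..q}"
    using \<sigma> pq by (intro has_integral_mult_right has_integral_exp_real) auto
  have "norm (bern_int r s p q) \<le> integral {p..q} (\<lambda>v. pbern_bound r * exp (- \<sigma> * v))"
    unfolding bern_int_def
  proof (rule integral_norm_bound_integral[OF pbern_exp_integrable])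
    fix v assume v: "v \<in> {p..q}"
    have "\<sigma> * v \<le> (Re s + real r - 1) * v" using \<sigma> v p by (intro mult_right_mono) auto
    then have "Re (- (s + of_nat r - 1)) * v \<le> - \<sigma> * v" by (simp add: algebra_simps)
    then show "norm (of_real (pbern r (exp v)) * exp (- (s + of_nat r - 1) * complex_of_real v)) \<le> pbern_bound r * exp (- \<sigma> * v)"
      unfolding norm_mult norm_of_real norm_exp_mult_real using pbern_bound[of r]
      by (intro mult_mono) (auto simp: less_imp_le)
  qed (use hi in blast)
  also have "\<dots> = pbern_bound r * (exp (- \<sigma> * q) / (- \<sigma>) - exp (- \<sigma> * p) / (- \<sigma>))" using hi by (rule integral_unique)
  also have "\<dots> \<le> pbern_bound r * (exp (- \<sigma> * p) / \<sigma>)"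
    using \<sigma> pbern_bound(1)[of r] by (intro mult_left_mono) auto
  finally show ?thesis by simp
qed

definition bern_int_lim :: "nat \<Rightarrow> complex \<Rightarrow> real \<Rightarrow> complex" where
  "bern_int_lim r s p = lim (\<lambda>n. bern_int r s p (real n))"

lemma tendsto_exp_minus_nat: "\<sigma> > 0 \<Longrightarrow> (\<lambda>n. K * exp (- \<sigma> * real n)) \<longlonglongrightarrow> 0" for \<sigma> K :: real
  by real_asymp

text \<open>The integrand decays at least like \<open>exp (- \<sigma> * v)\<close>, so the finite
  integrals form a Cauchy sequence. The error depends on \<open>s\<close> only through
  \<open>\<sigma>\<close>, which later yields locally uniform convergence.\<close>

lemma norm_bern_int_lim_le:
  assumes \<sigma>: "\<sigma> > 0" "\<sigma> \<le> Re s + real r - 1" and q: "p \<le> q" "q \<ge> 0"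
  shows "norm (bern_int r s p q - bern_int_lim r s p) \<le> pbern_bound r * exp (- \<sigma> * q) / \<sigma>"
proof -
  let ?J = "\<lambda>n. bern_int r s p (real n)"
  have d: "norm (bern_int r s p u - bern_int r s p v) \<le> pbern_bound r * exp (- \<sigma> * v) / \<sigma>" if "p \<le> v" "0 \<le> v" "v \<le> u" for u v
    using bern_int_combine[of p v u r s] norm_bern_int_le[OF that(3) \<sigma> that(2)] that by simp
  have "Cauchy ?J"
  proof (rule CauchyI')
    fix e :: real assume e: "e > 0"
    have "(\<lambda>n. (pbern_bound r / \<sigma>) * exp (- \<sigma> * real n)) \<longlonglongrightarrow> 0" using \<sigma> by (intro tendsto_exp_minus_nat)
    from order_tendstoD(2)[OF this e] obtain M where M: "\<And>n. n \<ge> M \<Longrightarrow> pbern_bound r / \<sigma> * exp (- \<sigma> * real n) < e"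
      by (auto simp: eventually_sequentially)
    have "dist (?J m) (?J n) < e" if "m \<ge> max M (nat \<lceil>p\<rceil>)" "n > m" for m n
    proof -
      have "p \<le> real m" using that by linarith
      then have "norm (?J n - ?J m) \<le> pbern_bound r * exp (- \<sigma> * real m) / \<sigma>" using that by (intro d) auto
      also have "\<dots> < e" using M[of m] that by simp
      finally show ?thesis by (simp add: dist_norm norm_minus_commute)
    qed
    then show "\<exists>M. \<forall>m\<ge>M. \<forall>n>m. dist (?J m) (?J n) < e" by blast
  qed
  then have lim: "?J \<longlonglongrightarrow> bern_int_lim r s p"
    unfolding bern_int_lim_def by (simp add: Cauchy_convergent_iff convergent_LIMSEQ_iff)
  have "(\<lambda>n. norm (?J n - bern_int r s p q)) \<longlonglongrightarrow> norm (bern_int_lim r s p - bern_int r s p q)"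
    by (intro tendsto_intros lim)
  moreover have "eventually (\<lambda>n. norm (?J n - bern_int r s p q) \<le> pbern_bound r * exp (- \<sigma> * q) / \<sigma>) sequentially"
    using eventually_ge_at_top[of "nat \<lceil>q\<rceil>"]
  proof eventually_elim
    case (elim n)
    then have "q \<le> real n" by linarith
    then show ?case using q by (intro d) auto
  qed
  ultimately have "norm (bern_int_lim r s p - bern_int r s p q) \<le> pbern_bound r * exp (- \<sigma> * q) / \<sigma>"
    by (rule tendsto_upperbound) simp
  then show ?thesis by (simp add: norm_minus_commute)
qed

lemma bern_int_tendsto:
  assumes s: "Re s > 1 - real r" and R: "filterlim R at_top sequentially"
  shows "(\<lambda>n. bern_int r s p (R n)) \<longlonglongrightarrow> bern_int_lim r s p"
proof -
  define \<sigma> where "\<sigma> = Re s + real r - 1"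
  have \<sigma>: "\<sigma> > 0" "\<sigma> \<le> Re s + real r - 1" using s by (auto simp: \<sigma>_def)
  have "((\<lambda>x. pbern_bound r * exp (- \<sigma> * x) / \<sigma>) \<longlongrightarrow> 0) at_top" using \<sigma> by real_asymp
  from filterlim_compose[OF this R] have z: "(\<lambda>n. pbern_bound r * exp (- \<sigma> * R n) / \<sigma>) \<longlonglongrightarrow> 0" .
  have "eventually (\<lambda>n. R n \<ge> max p 0) sequentially" using R unfolding filterlim_at_top by blast
  then have "eventually (\<lambda>n. norm (bern_int r s p (R n) - bern_int_lim r s p) \<le> pbern_bound r * exp (- \<sigma> * R n) / \<sigma>) sequentially"
    by eventually_elim (rule norm_bern_int_lim_le[OF \<sigma>], auto)
  from Lim_null_comparison[OF this z] show ?thesis by (simp add: LIM_zero_iff)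
qed

text \<open>Differentiation under the integral sign is applied with joint continuity in
  \<open>s\<close> and \<open>v\<close>; hence \<open>r \<ge> 2\<close>, where
  \<open>pbern r\<close> is continuous.\<close>

lemma holomorphic_bern_int:
  assumes r: "r \<ge> 2"
  shows "(\<lambda>s. bern_int r s p q) holomorphic_on UNIV"
proof -
  have "(\<lambda>s. integral (cbox p q) (\<lambda>v. of_real (pbern r (exp v)) * exp (- (s + of_nat r - 1) * of_real v))) holomorphic_on UNIV"
  proof (rule leibniz_rule_holomorphic[where fx = "\<lambda>s v. of_real (pbern r (exp v)) * (- of_real v * exp (- (s + of_nat r - 1) * of_real v))"])
    show "((\<lambda>s. of_real (pbern r (exp v)) * exp (- (s + of_nat r - 1) * of_real v)) has_field_derivative
        of_real (pbern r (exp v)) * (- of_real v * exp (- (s + of_nat r - 1) * of_real v))) (at s within UNIV)" for s v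
      by (auto intro!: derivative_eq_intros)
    show "(\<lambda>v. of_real (pbern r (exp v)) * exp (- (s + of_nat r - 1) * complex_of_real v)) integrable_on cbox p q" for s
      using pbern_exp_integrable[of r "- (s + of_nat r - 1)" p q] by simp
    show "continuous_on ((UNIV :: complex set) \<times> cbox p q) (\<lambda>(s, v). of_real (pbern r (exp v)) * (- of_real v * exp (- (s + of_nat r - 1) * of_real v)))"
      unfolding case_prod_unfold using r by (intro continuous_intros continuous_on_pbern) auto
  qed auto
  then show ?thesis by (simp add: bern_int_def)
qed

lemma holomorphic_bern_int_lim:
  assumes r: "r \<ge> 2"
  shows "(\<lambda>s. bern_int_lim r s p) holomorphic_on {s. Re s > 1 - real r}"
proof (rule holomorphic_uniform_sequence)
  show "open {s. Re s > 1 - real r}" by (rule open_halfspace_Re_gt)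
  show "(\<lambda>s. bern_int r s p (real n)) holomorphic_on {s. Re s > 1 - real r}" for n
    using holomorphic_bern_int[OF r] by (rule holomorphic_on_subset) auto
  fix s assume "s \<in> {s. Re s > 1 - real r}"
  then have s: "Re s > 1 - real r" by simp
  \<comment> \<open>Half the distance of \<open>s\<close> to the boundary line, so that one decay
    rate serves the whole closed ball of this radius.\<close>
  define \<sigma> where "\<sigma> = (Re s + real r - 1) / 2"
  have \<sigma>: "\<sigma> > 0" using s by (simp add: \<sigma>_def)
  have cb: "\<sigma> \<le> Re z + real r - 1" if "z \<in> cball s \<sigma>" for z
  proof -
    have "\<bar>Re (s - z)\<bar> \<le> \<sigma>" using that abs_Re_le_cmod[of "s - z"] by (simp add: dist_norm)
    then have "Re s - Re z \<le> \<sigma>" by simp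
    then show ?thesis unfolding \<sigma>_def by (simp add: field_simps)
  qed
  show "\<exists>d>0. cball s d \<subseteq> {s. Re s > 1 - real r} \<and> uniform_limit (cball s d) (\<lambda>n s. bern_int r s p (real n)) (\<lambda>s. bern_int_lim r s p) sequentially"
  proof (intro exI[of _ \<sigma>] conjI)
    show "cball s \<sigma> \<subseteq> {s. Re s > 1 - real r}" using cb \<sigma> by fastforce
    show "uniform_limit (cball s \<sigma>) (\<lambda>n s. bern_int r s p (real n)) (\<lambda>s. bern_int_lim r s p) sequentially"
    proof (rule uniform_limitI)
      fix e :: real assume e: "e > 0"
      have "(\<lambda>n. (pbern_bound r / \<sigma>) * exp (- \<sigma> * real n)) \<longlonglongrightarrow> 0" using \<sigma> by (intro tendsto_exp_minus_nat)
      from order_tendstoD(2)[OF this e] eventually_ge_at_top[of "nat \<lceil>p\<rceil>"]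
      show "\<forall>\<^sub>F n in sequentially. \<forall>z\<in>cball s \<sigma>. dist (bern_int r z p (real n)) (bern_int_lim r z p) < e"
      proof eventually_elim
        case (elim n)
        have "p \<le> real n" using elim(2) by linarith
        show ?case
        proof
          fix z assume z: "z \<in> cball s \<sigma>"
          have "norm (bern_int r z p (real n) - bern_int_lim r z p) \<le> pbern_bound r * exp (- \<sigma> * real n) / \<sigma>"
            using \<open>p \<le> real n\<close> by (intro norm_bern_int_lim_le[OF \<sigma> cb[OF z]]) auto
          also have "\<dots> < e" using elim(1) by simp
          finally show "dist (bern_int r z p (real n)) (bern_int_lim r z p) < e" by (simp add: dist_norm)
        qed
      qed
    qed
  qed (rule \<sigma>)
qed

section \<open>Euler-Maclaurin summation\<close>

text \<open>At the cost of two boundary terms and a factor \<open>s + r\<close> the order rises by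
  one, and with it the half plane of absolute convergence grows by one unit.\<close>

lemma bern_int_by_parts:
  assumes r: "r \<ge> 1" and pq: "p \<le> q"
  shows "bern_int r s p q = of_real (pbern (Suc r) (exp q)) * exp (- (s + of_nat r) * of_real q)
    - of_real (pbern (Suc r) (exp p)) * exp (- (s + of_nat r) * of_real p) + (s + of_nat r) * bern_int (Suc r) s p q"
proof -
  define c where "c = - (s + of_nat r)"
  have d: "((\<lambda>v. exp (c * complex_of_real v)) has_vector_derivative c * exp (c * complex_of_real v)) (at v within {p..q})" for v
  proof -
    have "((\<lambda>v. c * complex_of_real v) has_vector_derivative c * of_real 1) (at v within {p..q})"
      by (intro has_vector_derivative_mult_right has_vector_derivative_of_real)
        (auto intro!: derivative_eq_intros simp flip: has_real_derivative_iff_has_vector_derivative)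
    from field_vector_diff_chain_within[OF this DERIV_exp[THEN has_field_derivative_at_within]]
    show ?thesis by (simp add: o_def mult.commute)
  qed
  have "((\<lambda>v. (pbern r (1 * exp (1 * v)) * (1 * 1 * exp (1 * v))) *\<^sub>R exp (c * complex_of_real v)) has_integral
    (pbern (Suc r) (1 * exp (1 * q)) *\<^sub>R exp (c * complex_of_real q) - pbern (Suc r) (1 * exp (1 * p)) *\<^sub>R exp (c * complex_of_real p)
      - integral {p..q} (\<lambda>u. pbern (Suc r) (1 * exp (1 * u)) *\<^sub>R (c * exp (c * complex_of_real u))))) {p..q}"
    by (intro pbern_exp_by_parts[OF r _ _ pq d] continuous_intros) auto
  then have "((\<lambda>v. (pbern r (exp v) * exp v) *\<^sub>R exp (c * complex_of_real v)) has_integral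
    (pbern (Suc r) (exp q) *\<^sub>R exp (c * complex_of_real q) - pbern (Suc r) (exp p) *\<^sub>R exp (c * complex_of_real p)
      - integral {p..q} (\<lambda>u. pbern (Suc r) (exp u) *\<^sub>R (c * exp (c * complex_of_real u))))) {p..q}"
    by (simp only: mult_1_left)
  moreover have "(\<lambda>v. (pbern r (exp v) * exp v) *\<^sub>R exp (c * complex_of_real v)) =
      (\<lambda>v. of_real (pbern r (exp v)) * exp (- (s + of_nat r - 1) * of_real v))"
  proof
    fix v
    have "exp (- (s + of_nat r - 1) * of_real v) = exp (of_real v + c * of_real v)"
      by (simp add: c_def algebra_simps)
    then show "(pbern r (exp v) * exp v) *\<^sub>R exp (c * complex_of_real v) = of_real (pbern r (exp v)) * exp (- (s + of_nat r - 1) * of_real v)"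
      by (simp add: exp_add scaleR_conv_of_real exp_of_real)
  qed
  moreover have "integral {p..q} (\<lambda>u. pbern (Suc r) (exp u) *\<^sub>R (c * exp (c * complex_of_real u))) = c * bern_int (Suc r) s p q"
  proof -
    have "(\<lambda>u. pbern (Suc r) (exp u) *\<^sub>R (c * exp (c * complex_of_real u))) =
        (\<lambda>u. c * (of_real (pbern (Suc r) (exp u)) * exp (- (s + of_nat (Suc r) - 1) * of_real u)))"
      by (auto simp: fun_eq_iff scaleR_conv_of_real c_def)
    then show ?thesis by (simp only: bern_int_def integral_mult_right)
  qed
  ultimately have "((\<lambda>v. of_real (pbern r (exp v)) * exp (- (s + of_nat r - 1) * of_real v)) has_integral
    (pbern (Suc r) (exp q) *\<^sub>R exp (c * complex_of_real q) - pbern (Suc r) (exp p) *\<^sub>R exp (c * complex_of_real p)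
      - c * bern_int (Suc r) s p q)) {p..q}" by simp
  then have "bern_int r s p q = pbern (Suc r) (exp q) *\<^sub>R exp (c * complex_of_real q) - pbern (Suc r) (exp p) *\<^sub>R exp (c * complex_of_real p)
      - c * bern_int (Suc r) s p q" unfolding bern_int_def[of r] by (rule integral_unique)
  moreover have "- (c * x) = (s + of_nat r) * x" for x by (simp add: c_def algebra_simps)
  ultimately show ?thesis by (simp add: scaleR_conv_of_real c_def)
qed


text \<open>The regularised value of the integral of \<open>poly (bern r) (exp v) * exp (- (s + r - 1) * v)\<close> up to \<open>p\<close>.\<close>
definition bern_head :: "nat \<Rightarrow> complex \<Rightarrow> real \<Rightarrow> complex" where
  "bern_head r s p = (\<Sum>i\<le>r. of_real (coeff (bern r) i) * exp ((of_nat i - of_nat r + 1 - s) * of_real p) / (of_nat i - of_nat r + 1 - s))"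

lemma degree_bern_le: "degree (bern r) \<le> r"
proof (induction r)
  case (Suc r)
  have "coeff (bern (Suc r)) n = 0" if n: "n > Suc r" for n
  proof -
    obtain m where m: "n = Suc m" using n by (cases n) auto
    have "coeff (pderiv (bern (Suc r))) m = real (Suc m) * coeff (bern (Suc r)) (Suc m)" by (rule coeff_pderiv)
    moreover have "coeff (bern r) m = 0" using n m Suc by (intro coeff_eq_0) auto
    ultimately show ?thesis by (simp add: m)
  qed
  then show ?case by (intro degree_le) auto
qed simp

lemma poly_bern_eq: "poly (bern r) x = (\<Sum>i\<le>r. coeff (bern r) i * x ^ i)"
proof -
  have "poly (bern r) x = (\<Sum>i\<le>degree (bern r). coeff (bern r) i * x ^ i)" by (rule poly_altdef)
  also have "\<dots> = (\<Sum>i\<le>r. coeff (bern r) i * x ^ i)"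
    using degree_bern_le[of r] by (intro sum.mono_neutral_left) (auto simp: coeff_eq_0)
  finally show ?thesis .
qed

lemma coeff_bern_Suc: "coeff (bern r) i = real (Suc i) * coeff (bern (Suc r)) (Suc i)"
  using coeff_pderiv[of "bern (Suc r)" i] by simp

text \<open>The regularised head obeys the same partial integration as \<open>bern_int\<close>, but
  with a boundary term at \<open>p\<close> alone: regularisation assigns the value zero to the one
  at the origin. The exclusions on \<open>s\<close> keep all denominators nonzero.\<close>

lemma bern_head_Suc:
  assumes ne: "\<And>i. i \<le> Suc r \<Longrightarrow> s \<noteq> of_nat i - of_nat r"
  shows "bern_head r s p = (s + of_nat r) * bern_head (Suc r) s p + of_real (poly (bern (Suc r)) (exp p)) * exp (- (s + of_nat r) * of_real p)"
proof -
  let ?c = "\<lambda>i. complex_of_real (coeff (bern (Suc r)) i)"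
  let ?e = "\<lambda>i. exp ((of_nat i - of_nat r - s) * of_real p)"
  have 1: "(s + of_nat r) * bern_head (Suc r) s p = (\<Sum>i\<le>Suc r. (s + of_nat r) * (?c i * ?e i / (of_nat i - of_nat r - s)))"
    by (simp only: bern_head_def sum_distrib_left) (simp add: algebra_simps)
  have 2: "of_real (poly (bern (Suc r)) (exp p)) * exp (- (s + of_nat r) * of_real p) = (\<Sum>i\<le>Suc r. ?c i * ?e i)"
  proof -
    have "of_real (exp p ^ i) * exp (- (s + of_nat r) * of_real p) = ?e i" for i
    proof -
      have "of_real (exp p ^ i) * exp (- (s + of_nat r) * of_real p) = exp (of_nat i * of_real p) * exp (- (s + of_nat r) * of_real p)"
        by (simp add: exp_of_nat_mult exp_of_real)
      also have "\<dots> = ?e i" unfolding exp_add[symmetric] by (simp add: algebra_simps)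
      finally show ?thesis .
    qed
    then show ?thesis unfolding poly_bern_eq of_real_sum of_real_mult sum_distrib_right
      by (simp only: mult.assoc)
  qed
  have "(s + of_nat r) * bern_head (Suc r) s p + of_real (poly (bern (Suc r)) (exp p)) * exp (- (s + of_nat r) * of_real p)
      = (\<Sum>i\<le>Suc r. of_nat i * ?c i * ?e i / (of_nat i - of_nat r - s))"
    unfolding 1 2 sum.distrib[symmetric]
  proof (intro sum.cong refl)
    fix i assume "i \<in> {..Suc r}"
    then have n: "of_nat i - of_nat r - s \<noteq> 0" using ne[of i] by auto
    have "(s + of_nat r) * (x / y) + x = of_nat i * x / y" if "y = of_nat i - of_nat r - s" "y \<noteq> 0" for x y
    proof -
      have e: "s + of_nat r = of_nat i - y" using that by simp
      show ?thesis unfolding e using that(2) by (simp add: left_diff_distrib diff_divide_distrib)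
    qed
    from this[OF refl n, of "?c i * ?e i"]
    show "(s + of_nat r) * (?c i * ?e i / (of_nat i - of_nat r - s)) + ?c i * ?e i = of_nat i * ?c i * ?e i / (of_nat i - of_nat r - s)"
      by (simp only: mult.assoc)
  qed
  also have "\<dots> = (\<Sum>i\<le>r. of_nat (Suc i) * ?c (Suc i) * ?e (Suc i) / (of_nat (Suc i) - of_nat r - s))"
    by (subst sum.atMost_Suc_shift) simp
  also have "\<dots> = bern_head r s p"
    unfolding bern_head_def
  proof (intro sum.cong refl)
    fix i
    have "of_nat (Suc i) * ?c (Suc i) = complex_of_real (coeff (bern r) i)"
      unfolding coeff_bern_Suc[of r i] by (simp del: of_nat_Suc)
    then show "of_nat (Suc i) * ?c (Suc i) * ?e (Suc i) / (of_nat (Suc i) - of_nat r - s)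
        = complex_of_real (coeff (bern r) i) * exp ((of_nat i - of_nat r + 1 - s) * of_real p) / (of_nat i - of_nat r + 1 - s)"
      by (simp add: algebra_simps)
  qed
  finally show ?thesis ..
qed

lemma has_integral_exp_complex:
  assumes "c \<noteq> 0" "p \<le> q"
  shows "((\<lambda>v. exp (c * complex_of_real v)) has_integral (exp (c * of_real q) / c - exp (c * of_real p) / c)) {p..q}"
proof (rule fundamental_theorem_of_calculus[OF assms(2)])
  fix v
  have "((\<lambda>v. c * complex_of_real v) has_vector_derivative c * of_real 1) (at v within {p..q})"
    by (intro has_vector_derivative_mult_right has_vector_derivative_of_real)
      (auto intro!: derivative_eq_intros simp flip: has_real_derivative_iff_has_vector_derivative)
  from field_vector_diff_chain_within[OF this DERIV_exp[THEN has_field_derivative_at_within]]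
  have "((\<lambda>v. exp (c * complex_of_real v)) has_vector_derivative c * exp (c * of_real v)) (at v within {p..q})"
    by (simp add: o_def mult.commute)
  from has_vector_derivative_divide[OF this, of c] assms(1)
  show "((\<lambda>v. exp (c * complex_of_real v) / c) has_vector_derivative exp (c * of_real v)) (at v within {p..q})"
    by simp
qed

lemma bern_int_1_piece:
  assumes s: "s \<noteq> 0" "s \<noteq> 1" and pq: "p \<le> q" and fl: "\<And>v. v \<in> {p<..<q} \<Longrightarrow> \<lfloor>exp v\<rfloor> = int m"
  shows "bern_int 1 s p q = (exp ((1 - s) * of_real q) / (1 - s) - exp ((1 - s) * of_real p) / (1 - s))
    + (1/2 + of_nat m) * (exp (- s * of_real q) / s - exp (- s * of_real p) / s)"
proof -
  have "((\<lambda>v. exp ((1 - s) * complex_of_real v) - (1/2 + of_nat m) * exp (- s * of_real v)) has_integral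
    ((exp ((1 - s) * of_real q) / (1 - s) - exp ((1 - s) * of_real p) / (1 - s)) -
     (1/2 + of_nat m) * (exp (- s * of_real q) / (- s) - exp (- s * of_real p) / (- s)))) {p..q}"
    using s pq by (intro has_integral_diff has_integral_mult_right has_integral_exp_complex) auto
  then have "((\<lambda>v. of_real (pbern 1 (exp v)) * exp (- (s + of_nat 1 - 1) * complex_of_real v)) has_integral
    ((exp ((1 - s) * of_real q) / (1 - s) - exp ((1 - s) * of_real p) / (1 - s)) -
     (1/2 + of_nat m) * (exp (- s * of_real q) / (- s) - exp (- s * of_real p) / (- s)))) {p..q}"
  proof (rule has_integral_spike_finite[rotated 2])
    fix v assume v: "v \<in> {p..q} - {p, q}"
    have e1: "complex_of_real (pbern 1 (exp v)) = of_real (exp v) - of_nat m - 1/2"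
      using fl[of v] v by (simp add: pbern_def bern_1 frac_def)
    have e2: "exp ((1 - s) * complex_of_real v) = of_real (exp v) * exp (- s * of_real v)"
    proof -
      have "exp ((1 - s) * complex_of_real v) = exp (of_real v + (- s * of_real v))" by (simp add: algebra_simps)
      then show ?thesis unfolding exp_add by (simp add: exp_of_real)
    qed
    show "of_real (pbern 1 (exp v)) * exp (- (s + of_nat 1 - 1) * complex_of_real v)
      = exp ((1 - s) * complex_of_real v) - (1/2 + of_nat m) * exp (- s * of_real v)"
      unfolding e1 e2 by (simp add: algebra_simps)
  qed simp
  then have "bern_int 1 s p q = (exp ((1 - s) * of_real q) / (1 - s) - exp ((1 - s) * of_real p) / (1 - s)) -
     (1/2 + of_nat m) * (exp (- s * of_real q) / (- s) - exp (- s * of_real p) / (- s))"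
    unfolding bern_int_def by (rule integral_unique)
  then show ?thesis by (simp add: algebra_simps)
qed

text \<open>Abel summation in exact form, by induction over the cells between integers. Since
  \<open>p < 0\<close>, the first cell is \<open>exp v < 1\<close>, where the head cancels the lower
  boundary terms; every further cell adds one term of the Dirichlet series.\<close>

lemma bern_int_1_ln:
  assumes s: "s \<noteq> 0" "s \<noteq> 1" and p: "p < 0"
  shows "bern_head 1 s p + bern_int 1 s p (ln (real (Suc m))) =
    exp ((1 - s) * of_real (ln (real (Suc m)))) / (1 - s) + (1/2 + of_nat (Suc m)) * exp (- s * of_real (ln (real (Suc m)))) / s
      - (\<Sum>i\<le>m. exp (- s * of_real (ln (real (Suc i))))) / s"
proof (induction m)
  case 0
  have b1: "bern_int 1 s p 0 = (exp ((1 - s) * of_real 0) / (1 - s) - exp ((1 - s) * of_real p) / (1 - s))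
    + (1/2 + of_nat 0) * (exp (- s * of_real 0) / s - exp (- s * of_real p) / s)"
  proof (rule bern_int_1_piece[OF s])
    show "\<lfloor>exp v\<rfloor> = int 0" if "v \<in> {p<..<0}" for v using that by (simp add: floor_eq_iff)
  qed (use p in simp)
  have b2: "bern_head 1 s p = exp ((1 - s) * of_real p) / (1 - s) + (1/2) * exp (- s * of_real p) / s"
    by (simp add: bern_head_def bern_1)
  have l0: "ln (real (Suc 0)) = 0" by simp
  show ?case unfolding l0 b1 b2
    by (simp add: add_divide_distrib diff_divide_distrib algebra_simps)
next
  case (Suc m)
  let ?p = "ln (real (Suc m))" and ?q = "ln (real (Suc (Suc m)))"
  have le: "p \<le> ?p" using p ln_ge_zero[of "real (Suc m)"] by linarith
  have pq: "?p \<le> ?q" by simp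
  have "bern_int 1 s ?p ?q = (exp ((1 - s) * of_real ?q) / (1 - s) - exp ((1 - s) * of_real ?p) / (1 - s))
    + (1/2 + of_nat (Suc m)) * (exp (- s * of_real ?q) / s - exp (- s * of_real ?p) / s)"
  proof (rule bern_int_1_piece[OF s pq])
    fix v assume "v \<in> {?p<..<?q}"
    then have "exp ?p < exp v" "exp v < exp ?q" by (simp_all only: exp_less_cancel_iff greaterThanLessThan_iff)
    then show "\<lfloor>exp v\<rfloor> = int (Suc m)" by (simp add: floor_eq_iff)
  qed
  then have "bern_head 1 s p + bern_int 1 s p ?q = (bern_head 1 s p + bern_int 1 s p ?p) +
    ((exp ((1 - s) * of_real ?q) / (1 - s) - exp ((1 - s) * of_real ?p) / (1 - s))
    + (1/2 + of_nat (Suc m)) * (exp (- s * of_real ?q) / s - exp (- s * of_real ?p) / s))"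
    unfolding bern_int_combine[OF le pq] by simp
  also note Suc
  finally show ?case by (simp add: algebra_simps add_divide_distrib diff_divide_distrib)
qed


text \<open>For \<open>p < 0\<close> the point \<open>exp p\<close> lies in the cell where
  \<open>pbern\<close> is the polynomial itself, so the boundary terms of head and integral at
  \<open>p\<close> cancel and only the one at \<open>R\<close> is left.\<close>

lemma bern_step:
  assumes r: "r \<ge> 1" and p: "p < 0" "p \<le> R" and ne: "\<And>i. i \<le> Suc r \<Longrightarrow> s \<noteq> of_nat i - of_nat r"
  shows "bern_head r s p + bern_int r s p R = (s + of_nat r) * (bern_head (Suc r) s p + bern_int (Suc r) s p R)
    + of_real (pbern (Suc r) (exp R)) * exp (- (s + of_nat r) * of_real R)"
proof -
  have "frac (exp p) = exp p" using p by (simp add: frac_eq)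
  then have e: "pbern (Suc r) (exp p) = poly (bern (Suc r)) (exp p)" by (simp add: pbern_def)
  have H: "bern_head r s p = (s + of_nat r) * bern_head (Suc r) s p + of_real (poly (bern (Suc r)) (exp p)) * exp (- (s + of_nat r) * of_real p)"
    by (rule bern_head_Suc) (rule ne)
  have "(q * x + y) + (z - y + q * w) = q * (x + w) + z" for q x y z w :: complex by (simp add: algebra_simps)
  then show ?thesis unfolding bern_int_by_parts[OF r p(2)] H e .
qed

lemma pbern_boundary_tendsto:
  assumes "Re c < 0" and R: "filterlim R at_top sequentially"
  shows "(\<lambda>n. of_real (pbern r (exp (R n))) * exp (c * complex_of_real (R n))) \<longlonglongrightarrow> 0"
proof -
  have "((\<lambda>x. pbern_bound r * exp (Re c * x)) \<longlongrightarrow> 0) at_top" using assms(1) by real_asymp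
  from filterlim_compose[OF this R] have z: "(\<lambda>n. pbern_bound r * exp (Re c * R n)) \<longlonglongrightarrow> 0" .
  have "eventually (\<lambda>n. norm (of_real (pbern r (exp (R n))) * exp (c * complex_of_real (R n))) \<le> pbern_bound r * exp (Re c * R n)) sequentially"
    unfolding norm_mult norm_of_real norm_exp_mult_real using pbern_bound(2)[of r]
    by (intro always_eventually allI mult_right_mono) auto
  from Lim_null_comparison[OF this z] show ?thesis .
qed

lemma filterlim_ln_Suc: "filterlim (\<lambda>m. ln (real (Suc m))) at_top sequentially"
  by real_asymp

lemma exp_mult_ln_tendsto:
  assumes "Re c < 0"
  shows "(\<lambda>m. exp (c * complex_of_real (ln (real (Suc m))))) \<longlonglongrightarrow> 0"
proof (rule tendsto_norm_zero_cancel)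
  have "((\<lambda>x. exp (Re c * x)) \<longlongrightarrow> 0) at_top" using assms by real_asymp
  from filterlim_compose[OF this filterlim_ln_Suc]
  show "(\<lambda>m. norm (exp (c * complex_of_real (ln (real (Suc m)))))) \<longlonglongrightarrow> 0" by simp
qed

text \<open>The case \<open>r = 1\<close> is Abel summation. Every further partial integration
  contributes the next factor \<open>s + r\<close> of the Pochhammer symbol and a boundary term that
  vanishes at infinity.\<close>

lemma dirichlet_tendsto:
  assumes s: "Re s > 1" and p: "p < 0" and S: "(\<lambda>n. 1 / of_nat (Suc n) powr s) sums S" and r: "r \<ge> 1"
  shows "(\<lambda>m. - (pochhammer s r * (bern_head r s p + bern_int r s p (ln (real (Suc m)))))) \<longlonglongrightarrow> S"
  using r
proof (induction r rule: dec_induct)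
  case base
  have s0: "s \<noteq> 0" "s \<noteq> 1" using s by auto
  let ?L = "\<lambda>m. complex_of_real (ln (real (Suc m)))"
  have pw: "exp (- s * ?L i) = 1 / of_nat (Suc i) powr s" for i
  proof -
    have "Ln (of_nat (Suc i)) = ?L i" using Ln_of_nat[of "Suc i"] by simp
    then show ?thesis by (simp add: powr_def exp_minus inverse_eq_divide del: of_nat_Suc)
  qed
  have ps: "(\<lambda>m. \<Sum>i\<le>m. exp (- s * ?L i)) \<longlonglongrightarrow> S"
    unfolding pw using S by (simp add: sums_def_le)
  have ee: "of_nat (Suc m) * exp (- s * ?L m) = exp ((1 - s) * ?L m)" for m
  proof -
    have "exp ((1 - s) * ?L m) = exp (?L m) * exp (- s * ?L m)" unfolding exp_add[symmetric] by (simp add: algebra_simps)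
    also have "exp (?L m) = of_nat (Suc m)" by (simp add: exp_of_real del: of_nat_Suc)
    finally show ?thesis by simp
  qed
  have "(\<lambda>m. - (s * (exp ((1 - s) * ?L m) / (1 - s) + ((1/2) * exp (- s * ?L m) + exp ((1 - s) * ?L m)) / s - (\<Sum>i\<le>m. exp (- s * ?L i)) / s)))
    \<longlonglongrightarrow> - (s * (0 / (1 - s) + ((1/2) * 0 + 0) / s - S / s))"
    using s by (intro tendsto_intros exp_mult_ln_tendsto ps) (auto simp: s0)
  moreover have "- (s * (0 / (1 - s) + ((1/2) * 0 + 0) / s - S / s)) = S" using s0 by simp
  ultimately show ?case
    unfolding bern_int_1_ln[OF s0 p] distrib_right[of "1/2"] ee by (simp add: pochhammer_rec)
next
  case (step r)
  have ne: "s \<noteq> of_nat i - of_nat r" if "i \<le> Suc r" for i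
  proof
    assume "s = of_nat i - of_nat r"
    then have "Re s = real i - real r" by simp
    then show False using that s by linarith
  qed
  have "Re (- (s + of_nat r)) < 0" using s by simp
  from pbern_boundary_tendsto[OF this filterlim_ln_Suc, of "Suc r"]
  have b: "(\<lambda>m. of_real (pbern (Suc r) (exp (ln (real (Suc m))))) * exp (- (s + of_nat r) * complex_of_real (ln (real (Suc m))))) \<longlonglongrightarrow> 0" .
  have le: "p \<le> ln (real (Suc m))" for m using p ln_ge_zero[of "real (Suc m)"] by linarith
  have "(\<lambda>m. - (pochhammer s r * (bern_head r s p + bern_int r s p (ln (real (Suc m)))))
     + pochhammer s r * (of_real (pbern (Suc r) (exp (ln (real (Suc m))))) * exp (- (s + of_nat r) * complex_of_real (ln (real (Suc m)))))) \<longlonglongrightarrow> S + pochhammer s r * 0"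
    by (intro tendsto_add tendsto_mult_left step.IH b)
  moreover have "- (pochhammer s r * (bern_head r s p + bern_int r s p (ln (real (Suc m)))))
     + pochhammer s r * (of_real (pbern (Suc r) (exp (ln (real (Suc m))))) * exp (- (s + of_nat r) * complex_of_real (ln (real (Suc m)))))
     = - (pochhammer s (Suc r) * (bern_head (Suc r) s p + bern_int (Suc r) s p (ln (real (Suc m)))))" for m
  proof -
    have "- (P * (q * x + y)) + P * y = - (P * q * x)" for P q x y :: complex
      by (simp add: algebra_simps)
    moreover have "bern_head r s p + bern_int r s p (ln (real (Suc m))) = (s + of_nat r) * (bern_head (Suc r) s p + bern_int (Suc r) s p (ln (real (Suc m))))
      + of_real (pbern (Suc r) (exp (ln (real (Suc m))))) * exp (- (s + of_nat r) * of_real (ln (real (Suc m))))"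
      by (rule bern_step[OF step.hyps(1) p le]) (rule ne)
    ultimately show ?thesis unfolding pochhammer_Suc by (simp only:)
  qed
  ultimately show ?case by (simp only: mult_zero_right add_0_right)
qed

section \<open>Analytic continuation and the values on the lines \<open>Re s = - k\<close>\<close>

text \<open>This is \<open>- (pochhammer s r * (bern_head r s p + bern_int_lim r s p))\<close> with
  the removable singularities removed: for \<open>i < r\<close> the denominator in the head cancels
  the factor \<open>s + (r - 1 - i)\<close> of the Pochhammer symbol, and only \<open>i = r\<close>
  keeps its pole, at \<open>s = 1\<close>.\<close>

definition zeta_ext :: "nat \<Rightarrow> real \<Rightarrow> complex \<Rightarrow> complex" where
  "zeta_ext r p s = - ((\<Sum>i\<le>r. of_real (coeff (bern r) i) * exp ((of_nat i - of_nat r + 1 - s) * of_real p) *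
      (if i < r then - (\<Prod>j\<in>{..<r} - {r - 1 - i}. s + of_nat j) else pochhammer s r / (1 - s)))
    + pochhammer s r * bern_int_lim r s p)"

lemma zeta_ext_eq:
  assumes ne: "\<And>i. i \<le> r \<Longrightarrow> s \<noteq> of_nat i - of_nat r + 1"
  shows "zeta_ext r p s = - (pochhammer s r * (bern_head r s p + bern_int_lim r s p))"
proof -
  have q: "(if i < r then - (\<Prod>j\<in>{..<r} - {r - 1 - i}. s + of_nat j) else pochhammer s r / (1 - s)) = pochhammer s r / (of_nat i - of_nat r + 1 - s)"
    if i: "i \<le> r" for i
  proof (cases "i < r")
    case True
    have "pochhammer s r = (\<Prod>j<r. s + of_nat j)" by (simp add: pochhammer_prod lessThan_atLeast0)
    also have "\<dots> = (s + of_nat (r - 1 - i)) * (\<Prod>j\<in>{..<r} - {r - 1 - i}. s + of_nat j)"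
      using True by (intro prod.remove) auto
    also have "s + of_nat (r - 1 - i) = - (of_nat i - of_nat r + 1 - s)" using True by (simp add: of_nat_diff)
    finally have P: "pochhammer s r = - (of_nat i - of_nat r + 1 - s) * (\<Prod>j\<in>{..<r} - {r - 1 - i}. s + of_nat j)" .
    have y: "of_nat i - of_nat r + 1 - s \<noteq> 0" using ne[OF i] by auto
    have "- Q = P / y" if "P = - y * Q" "y \<noteq> 0" for P Q y :: complex using that by simp
    from this[OF P y] show ?thesis unfolding if_P[OF True] .
  qed (use i in simp)
  show ?thesis
    unfolding zeta_ext_def bern_head_def distrib_left sum_distrib_left
    by (intro arg_cong[where f = uminus] arg_cong2[where f = "(+)"] sum.cong refl) (simp add: q)
qed

lemma holomorphic_zeta_ext:
  assumes "r \<ge> 2"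
  shows "zeta_ext r p holomorphic_on ({s. Re s > 1 - real r} - {1})"
proof -
  have b: "(\<lambda>s. bern_int_lim r s p) holomorphic_on ({s. Re s > 1 - real r} - {1})"
    using holomorphic_bern_int_lim[OF assms] by (rule holomorphic_on_subset) auto
  have c: "(\<lambda>s. if i < r then - (\<Prod>j\<in>{..<r} - {r - 1 - i}. s + of_nat j) else pochhammer s r / (1 - s)) holomorphic_on ({s. Re s > 1 - real r} - {1})" for i
    unfolding pochhammer_prod by (cases "i < r") (auto intro!: holomorphic_intros)
  show ?thesis
    unfolding zeta_ext_def[abs_def] by (intro holomorphic_intros b c)
qed

lemma zeta_ext_dirichlet:
  assumes s: "Re s > 1" and p: "p < 0" and S: "(\<lambda>n. 1 / of_nat (Suc n) powr s) sums S" and r: "r \<ge> 1"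
  shows "zeta_ext r p s = S"
proof -
  have ne: "s \<noteq> of_nat i - of_nat r + 1" if "i \<le> r" for i
  proof
    assume "s = of_nat i - of_nat r + 1"
    then have "Re s = real i - real r + 1" by simp
    then show False using that s by linarith
  qed
  have "Re s > 1 - real r" using s by simp
  then have "(\<lambda>m. - (pochhammer s r * (bern_head r s p + bern_int r s p (ln (real (Suc m)))))) \<longlonglongrightarrow> - (pochhammer s r * (bern_head r s p + bern_int_lim r s p))"
    by (intro tendsto_intros bern_int_tendsto filterlim_ln_Suc)
  with dirichlet_tendsto[OF s p S r] show ?thesis
    using LIMSEQ_unique zeta_ext_eq[OF ne] by metis
qed

lemma connected_punctured: "connected ({s::complex. Re s > c} - {1})"
  by (intro connected_open_delete open_halfspace_Re_gt convex_connected convex_halfspace_Re_gt) simp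

lemma summable_dirichlet:
  assumes "Re s > 1"
  shows "summable (\<lambda>n. 1 / of_nat (Suc n) powr s :: complex)"
proof (rule summable_comparison_test')
  have "summable (\<lambda>n. real n powr (- Re s))" using assms by (subst summable_real_powr_iff) simp
  then show "summable (\<lambda>n. real (Suc n) powr (- Re s))" by (subst summable_Suc_iff)
  show "norm (1 / of_nat (Suc n) powr s :: complex) \<le> real (Suc n) powr (- Re s)" if "n \<ge> 0" for n
  proof -
    have "norm (of_nat (Suc n) powr s :: complex) = real (Suc n) powr Re s"
      using norm_powr_real_powr[of "of_nat (Suc n)" s] by simp
    then show ?thesis by (simp add: norm_divide powr_minus inverse_eq_divide del: of_nat_Suc)
  qed
qed

lemma zeta_ext_agree:
  assumes r: "2 \<le> r" "r \<le> r'" and p: "p < 0" and s: "Re s > 1 - real r" "s \<noteq> 1"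
  shows "zeta_ext r p s = zeta_ext r' p s"
proof (rule analytic_continuation_open[where s = "{s. Re s > 1}" and s' = "{s. Re s > 1 - real r} - {1}" and f = "zeta_ext r p" and g = "zeta_ext r' p" and z = s])
  show "open {s. Re s > 1}" by (rule open_halfspace_Re_gt)
  show "open ({s. Re s > 1 - real r} - {1})" by (intro open_delete open_halfspace_Re_gt)
  have "(2::complex) \<in> {s. Re s > 1}" by simp
  then show "{s. Re s > 1} \<noteq> {}" by blast
  show "zeta_ext r' p holomorphic_on ({s. Re s > 1 - real r} - {1})"
    using holomorphic_zeta_ext[of r' p] r by (rule_tac holomorphic_on_subset[of _ "{s. Re s > 1 - real r'} - {1}"]) auto
  show "zeta_ext r p z = zeta_ext r' p z" if "z \<in> {s. Re s > 1}" for z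
    using summable_sums[OF summable_dirichlet] zeta_ext_dirichlet[OF _ p] that r by (metis le_trans mem_Collect_eq one_le_numeral)
qed (use r s in \<open>auto simp: holomorphic_zeta_ext connected_punctured\<close>)

text \<open>The choice operator in \<open>zeta\<close> yields these properties once a continuation
  exists. It is glued from the functions \<open>zeta_ext r\<close> with \<open>r\<close> growing
  with \<open>\<bar>Re s\<bar>\<close>; near each point one fixed order works, because different
  orders agree where both are valid.\<close>

lemma zeta_properties:
  "zeta holomorphic_on (- {1}) \<and> (\<forall>s. 1 < Re s \<longrightarrow> (\<lambda>n. 1 / of_nat (Suc n) powr s) sums zeta s)"
proof -
  define f where "f s = zeta_ext (nat \<lceil>\<bar>Re s\<bar>\<rceil> + 2) (-1) s" for s
  have r: "Re s > 1 - real (nat \<lceil>\<bar>Re s\<bar>\<rceil> + 2)" for s by simp linarith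
  have eq: "f s = zeta_ext R (-1) s" if "R \<ge> nat \<lceil>\<bar>Re s\<bar>\<rceil> + 2" "s \<noteq> 1" for s R
    unfolding f_def using that r[of s] by (intro zeta_ext_agree) auto
  have op1: "open (- {1 :: complex})" by (rule open_Compl) simp
  have "f holomorphic_on (- {1})"
    unfolding holomorphic_on_open[OF op1]
  proof
    fix z :: complex assume z: "z \<in> - {1}"
    define R where "R = nat \<lceil>\<bar>Re z\<bar>\<rceil> + 3"
    have R2: "R \<ge> 2" by (simp add: R_def)
    let ?U = "ball z 1 \<inter> ({s. Re s > 1 - real R} - {1})"
    have zR: "z \<in> ?U" using z r[of z] by (auto simp: R_def)
    have op: "open ?U" by (intro open_Int open_ball open_delete open_halfspace_Re_gt)
    have "zeta_ext R (-1) holomorphic_on ?U"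
      using holomorphic_zeta_ext[OF R2] by (rule holomorphic_on_subset) auto
    then obtain d where d: "(zeta_ext R (-1) has_field_derivative d) (at z)"
      using holomorphic_on_open[OF op] zR by blast
    have "(f has_field_derivative d) (at z)"
    proof (rule has_field_derivative_transform_within_open[OF d op zR])
      fix w assume w: "w \<in> ?U"
      have "\<bar>Re (z - w)\<bar> < 1" using w abs_Re_le_cmod[of "z - w"] by (simp add: dist_norm)
      then have "\<bar>Re w\<bar> \<le> \<bar>Re z\<bar> + 1" by simp
      then have "nat \<lceil>\<bar>Re w\<bar>\<rceil> + 2 \<le> R" unfolding R_def by linarith
      then show "zeta_ext R (-1) w = f w" using w by (subst eq) auto
    qed
    then show "\<exists>f'. (f has_field_derivative f') (at z)" by blast
  qed
  moreover have "(\<lambda>n. 1 / of_nat (Suc n) powr s) sums f s" if s: "1 < Re s" for s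
  proof -
    have "f s = (\<Sum>n. 1 / of_nat (Suc n) powr s)"
      unfolding f_def by (intro zeta_ext_dirichlet[OF s] summable_sums summable_dirichlet s) auto
    then show ?thesis using summable_sums[OF summable_dirichlet[OF s]] by simp
  qed
  ultimately have "f holomorphic_on (- {1}) \<and> (\<forall>s. 1 < Re s \<longrightarrow> (\<lambda>n. 1 / of_nat (Suc n) powr s) sums f s)"
    by (intro conjI allI impI)
  from someI[where P = "\<lambda>f. f holomorphic_on (- {1}) \<and> (\<forall>s. 1 < Re s \<longrightarrow> (\<lambda>n. 1 / of_nat (Suc n) powr s) sums f s)", OF this]
  show ?thesis unfolding zeta_def .
qed

lemma zeta_eq_zeta_ext:
  assumes r: "2 \<le> r" and p: "p < 0" and s: "Re s > 1 - real r" "s \<noteq> 1"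
  shows "zeta s = zeta_ext r p s"
proof (rule analytic_continuation_open[where s = "{s. Re s > 1}" and s' = "{s. Re s > 1 - real r} - {1}" and f = zeta and g = "zeta_ext r p" and z = s])
  show "open {s. Re s > 1}" by (rule open_halfspace_Re_gt)
  show "open ({s. Re s > 1 - real r} - {1})" by (intro open_delete open_halfspace_Re_gt)
  have "(2::complex) \<in> {s. Re s > 1}" by simp
  then show "{s. Re s > 1} \<noteq> {}" by blast
  show "zeta holomorphic_on ({s. Re s > 1 - real r} - {1})"
    using zeta_properties by (auto intro: holomorphic_on_subset)
  show "zeta z = zeta_ext r p z" if z: "z \<in> {s. Re s > 1}" for z
  proof -
    have z1: "Re z > 1" using z by simp
    have "(\<lambda>n. 1 / of_nat (Suc n) powr z) sums zeta z" using zeta_properties z1 by blast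
    from zeta_ext_dirichlet[OF z1 p this, of r] r show ?thesis by simp
  qed
qed (use r s in \<open>auto simp: holomorphic_zeta_ext connected_punctured\<close>)

text \<open>On the line \<open>Re s = - k\<close> the integrand of order \<open>k + 1\<close> does
  not decay. One partial integration leads to order \<open>k + 2\<close>, where convergence is
  absolute, and the boundary term between the two orders decays like
  \<open>exp (- R n)\<close>.\<close>

lemma zeta_tendsto:
  assumes p: "p < 0" and t: "t \<noteq> 0" and s: "s = - of_nat k + \<i> * of_real t"
    and R: "filterlim R at_top sequentially"
  shows "(\<lambda>n. - (pochhammer s (Suc k) * (bern_head (Suc k) s p + bern_int (Suc k) s p (R n)))) \<longlonglongrightarrow> zeta s"
proof -
  have im: "Im s \<noteq> 0" using t s by simp
  have ne: "s \<noteq> of_nat i - of_nat j + 1" "s \<noteq> of_nat i - of_nat j" "s \<noteq> 1" for i j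
    using im by auto
  have re: "Re s = - real k" using s by simp
  have "zeta s = zeta_ext (Suc (Suc k)) p s" using re ne by (intro zeta_eq_zeta_ext p) auto
  also have "\<dots> = - (pochhammer s (Suc (Suc k)) * (bern_head (Suc (Suc k)) s p + bern_int_lim (Suc (Suc k)) s p))"
    by (rule zeta_ext_eq) (rule ne)
  finally have z: "zeta s = \<dots>" .
  have i: "(\<lambda>n. bern_int (Suc (Suc k)) s p (R n)) \<longlonglongrightarrow> bern_int_lim (Suc (Suc k)) s p"
    using re by (intro bern_int_tendsto R) auto
  have "Re (- (s + of_nat (Suc k))) < 0" using re by simp
  from pbern_boundary_tendsto[OF this R, of "Suc (Suc k)"]
  have b: "(\<lambda>n. of_real (pbern (Suc (Suc k)) (exp (R n))) * exp (- (s + of_nat (Suc k)) * complex_of_real (R n))) \<longlonglongrightarrow> 0" .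
  have "(\<lambda>n. - (pochhammer s (Suc (Suc k)) * (bern_head (Suc (Suc k)) s p + bern_int (Suc (Suc k)) s p (R n)))
    - pochhammer s (Suc k) * (of_real (pbern (Suc (Suc k)) (exp (R n))) * exp (- (s + of_nat (Suc k)) * complex_of_real (R n))))
    \<longlonglongrightarrow> zeta s - pochhammer s (Suc k) * 0"
    unfolding z by (intro tendsto_intros i b)
  then have lim: "(\<lambda>n. - (pochhammer s (Suc (Suc k)) * (bern_head (Suc (Suc k)) s p + bern_int (Suc (Suc k)) s p (R n)))
    - pochhammer s (Suc k) * (of_real (pbern (Suc (Suc k)) (exp (R n))) * exp (- (s + of_nat (Suc k)) * complex_of_real (R n))))
    \<longlonglongrightarrow> zeta s" by simp
  have "eventually (\<lambda>n. R n \<ge> p) sequentially" using R unfolding filterlim_at_top by blast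
  then have "eventually (\<lambda>n. - (pochhammer s (Suc (Suc k)) * (bern_head (Suc (Suc k)) s p + bern_int (Suc (Suc k)) s p (R n)))
    - pochhammer s (Suc k) * (of_real (pbern (Suc (Suc k)) (exp (R n))) * exp (- (s + of_nat (Suc k)) * complex_of_real (R n)))
    = - (pochhammer s (Suc k) * (bern_head (Suc k) s p + bern_int (Suc k) s p (R n)))) sequentially"
  proof eventually_elim
    case (elim n)
    have E: "bern_head (Suc k) s p + bern_int (Suc k) s p (R n) = (s + of_nat (Suc k)) * (bern_head (Suc (Suc k)) s p + bern_int (Suc (Suc k)) s p (R n))
      + of_real (pbern (Suc (Suc k)) (exp (R n))) * exp (- (s + of_nat (Suc k)) * of_real (R n))"
    proof (rule bern_step)
      show "s \<noteq> of_nat i - of_nat (Suc k)" for i by (rule ne(2))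
    qed (use p elim in auto)
    have "- (P * q * x) - P * y = - (P * (q * x + y))" for P q x y :: complex
      by (simp add: algebra_simps)
    then show ?case unfolding E pochhammer_Suc[of s "Suc k"] .
  qed
  from Lim_transform_eventually[OF lim this] show ?thesis .
qed

section \<open>From the zeta values to the sums over scales\<close>

definition scale_coeff :: "nat \<Rightarrow> real \<Rightarrow> real \<Rightarrow> int \<Rightarrow> nat \<Rightarrow> complex" where
  "scale_coeff k b a n j = integral {-(1/2)..1/2} (\<lambda>u. pbern k (a * b ^ j * exp (ln b * u)) *\<^sub>R cis (- (2 * pi * of_int n) * u))"

lemma scale_coeff_integrable:
  "(\<lambda>u. pbern k (X * exp (l * u)) *\<^sub>R cis (A * u)) integrable_on {p..q}"
proof (rule integrable_bounded_borel[where B = "pbern_bound k"])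
  have [measurable]: "(\<lambda>u. cis (A * u)) \<in> borel_measurable borel"
    by (intro borel_measurable_continuous_onI continuous_intros)
  show "(\<lambda>u. pbern k (X * exp (l * u)) *\<^sub>R cis (A * u)) \<in> borel_measurable borel" by measurable
qed (use pbern_bound(2) in simp)

lemma norm_scale_coeff_high:
  assumes b: "b \<ge> 2" and a: "a > 0" and k: "k \<ge> 1"
  shows "norm (scale_coeff k b a n j) \<le> (pbern_bound (Suc k) * exp (ln b / 2) / (ln b * a) * (2 + 2 * pi * \<bar>of_int n\<bar> + ln b)) * (1 / b) ^ j"
proof -
  have "norm (scale_coeff k b a n j) \<le> pbern_bound (Suc k) * exp (ln b / 2) / (ln b * (a * b ^ j)) * (2 + \<bar>- (2 * pi * of_int n)\<bar> + ln b)"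
    unfolding scale_coeff_def using a b by (intro pbern_cis_high[OF k]) auto
  also have "\<dots> = (pbern_bound (Suc k) * exp (ln b / 2) / (ln b * a) * (2 + 2 * pi * \<bar>of_int n\<bar> + ln b)) * (1 / b) ^ j"
    by (simp add: abs_mult power_divide mult_ac)
  finally show ?thesis .
qed

lemma summable_norm_scale_coeff:
  assumes b: "b \<ge> 2" and a: "a > 0" and k: "k \<ge> 1"
  shows "summable (\<lambda>j. norm (scale_coeff k b a n j))"
proof (rule summable_comparison_test')
  show "summable (\<lambda>j. (pbern_bound (Suc k) * exp (ln b / 2) / (ln b * a) * (2 + 2 * pi * \<bar>of_int n\<bar> + ln b)) * (1 / b) ^ j)"
    using b by (intro summable_mult summable_geometric) auto
  show "norm (norm (scale_coeff k b a n j)) \<le> (pbern_bound (Suc k) * exp (ln b / 2) / (ln b * a) * (2 + 2 * pi * \<bar>of_int n\<bar> + ln b)) * (1 / b) ^ j" if "j \<ge> 0" for j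
    using norm_scale_coeff_high[OF assms, of n j] by simp
qed

lemma sum_cis_dker: "(\<Sum>n\<in>{- int N..int N} - {0}. cis (- (2 * pi * of_int n) * u)) = of_real (dker N u) - 1"
proof -
  have "cis (- (2 * pi * of_int (int n)) * u) + cis (- (2 * pi * of_int (- int n)) * u) = of_real (2 * cos (2 * pi * real n * u))" for n
    by (simp add: complex_eq_iff)
  then show ?thesis unfolding sum_symmetric_int dker_def by (simp add: sum_distrib_left)
qed

lemma sum_scale_coeff:
  "(\<Sum>n\<in>{- int N..int N} - {0}. scale_coeff k b a n j) = of_real (dker_term k b a N j) - scale_coeff k b a 0 j"
proof -
  let ?J = "{-(1/2)..1/2::real}"
  let ?P = "\<lambda>u. pbern k (a * b ^ j * exp (ln b * u))"
  have "((\<lambda>u. \<Sum>n\<in>{- int N..int N} - {0}. ?P u *\<^sub>R cis (- (2 * pi * of_int n) * u)) has_integral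
      (\<Sum>n\<in>{- int N..int N} - {0}. scale_coeff k b a n j)) ?J"
    unfolding scale_coeff_def by (intro has_integral_sum integrable_integral scale_coeff_integrable) auto
  moreover have "(\<Sum>n\<in>{- int N..int N} - {0}. ?P u *\<^sub>R cis (- (2 * pi * of_int n) * u)) = of_real (?P u * dker N u) - ?P u *\<^sub>R cis (- (2 * pi * of_int 0) * u)" for u
    unfolding scaleR_sum_right[symmetric] sum_cis_dker by (simp add: scaleR_conv_of_real right_diff_distrib)
  ultimately have "((\<lambda>u. of_real (?P u * dker N u) - ?P u *\<^sub>R cis (- (2 * pi * of_int 0) * u)) has_integral
      (\<Sum>n\<in>{- int N..int N} - {0}. scale_coeff k b a n j)) ?J" by simp
  moreover have "((\<lambda>u. of_real (?P u * dker N u) - ?P u *\<^sub>R cis (- (2 * pi * of_int 0) * u)) has_integral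
      (of_real (dker_term k b a N j) - scale_coeff k b a 0 j)) ?J"
    unfolding scale_coeff_def dker_term_def
    by (intro has_integral_diff has_integral_of_real integrable_integral scale_coeff_integrable pbern_dker_integrable)
  ultimately show ?thesis by (rule has_integral_unique)
qed

text \<open>\<open>bern_head (Suc k) s p\<close> at \<open>p = ln a - ln b / 2\<close>, multiplied
  by \<open>exp (\<i> * t * ln a)\<close>: what remains of the imaginary exponents is
  \<open>cis (pi * n)\<close>.\<close>

definition zeta_head :: "nat \<Rightarrow> real \<Rightarrow> real \<Rightarrow> int \<Rightarrow> complex" where
  "zeta_head k b a n = (\<Sum>i\<le>Suc k. of_real (coeff (bern (Suc k)) i * exp (real i * (ln a - ln b / 2))) * cis (pi * of_int n) /
     (of_nat i - \<i> * of_real (2 * pi * of_int n / ln b)))"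

text \<open>The cofactor of the Pochhammer symbol in the zeta value times its character, up to
  sign.\<close>

definition zeta_inner :: "nat \<Rightarrow> real \<Rightarrow> real \<Rightarrow> int \<Rightarrow> complex" where
  "zeta_inner k b a n = zeta_head k b a n + of_real (ln b) * (\<Sum>j. scale_coeff (Suc k) b a n j)"

lemma integral_affine:
  fixes f :: "real \<Rightarrow> complex"
  assumes l: "l > 0" and f: "f integrable_on {c - l / 2..c + l / 2}"
  shows "integral {c - l / 2..c + l / 2} f = of_real l * integral {-(1/2)..1/2} (\<lambda>u. f (l * u + c))"
proof -
  have "((\<lambda>x. f (l *\<^sub>R x + c)) has_integral (integral {c - l / 2..c + l / 2} f /\<^sub>R l ^ DIM(real))) (cbox ((c - l / 2 - c) /\<^sub>R l) ((c + l / 2 - c) /\<^sub>R l))"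
    using integrable_integral[OF f] l by (intro has_integral_affinity') auto
  then have "((\<lambda>x. f (l * x + c)) has_integral (integral {c - l / 2..c + l / 2} f /\<^sub>R l)) {-(1/2)..1/2}"
    using l by simp
  then have "integral {-(1/2)..1/2} (\<lambda>u. f (l * u + c)) = integral {c - l / 2..c + l / 2} f /\<^sub>R l" by (rule integral_unique)
  then show ?thesis using l by (simp add: scaleR_conv_of_real)
qed

text \<open>Since \<open>t * ln b = 2 * pi * n\<close>, a shift of the logarithmic variable by
  \<open>ln b\<close> leaves the character unchanged, and the factor
  \<open>exp (\<i> * t * ln a)\<close> removes its phase at the centre \<open>a\<close>. Each piece
  of the integral thereby becomes a plain Fourier coefficient.\<close>

lemma zeta_eq_inner:
  assumes b: "b \<ge> 2" and a: "0 < a" "a \<le> 1" and n: "n \<noteq> 0"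
    and t: "t = 2 * pi * of_int n / ln b" and s: "s = - of_nat k + \<i> * of_real t"
  shows "zeta s * exp (\<i> * of_real (t * ln a)) = - (pochhammer s (Suc k) * zeta_inner k b a n)"
proof -
  define l where "l = ln b"
  have l: "l > 0" using b by (simp add: l_def)
  \<comment> \<open>Half a scale below \<open>ln a\<close>, so that the pieces are centred at the
    points \<open>a * b ^ j\<close>, where the Dirichlet kernel will peak. Negative because
    \<open>a \<le> 1\<close>.\<close>
  define p where "p = ln a - l / 2"
  have p: "p < 0" using a l by (simp add: p_def) (smt (verit) ln_le_zero_iff)
  have t0: "t \<noteq> 0" using n l by (simp add: t l_def)
  have tl: "t * l = 2 * pi * of_int n" using l by (simp add: t l_def)
  let ?E = "exp (\<i> * of_real (t * ln a))"
  define R where "R j = p + real j * l" for j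
  have R: "filterlim R at_top sequentially" unfolding R_def using l by real_asymp
  have piece: "?E * bern_int (Suc k) s (R j) (R (Suc j)) = of_real l * scale_coeff (Suc k) b a n j" for j
  proof -
    let ?c = "ln a + real j * l"
    let ?f = "\<lambda>v. of_real (pbern (Suc k) (exp v)) * exp (- (\<i> * of_real t) * of_real v)"
    have Rj: "R j = ?c - l / 2" "R (Suc j) = ?c + l / 2" by (simp_all add: R_def p_def algebra_simps)
    have "- (s + of_nat (Suc k) - 1) = - (\<i> * of_real t)" by (simp add: s)
    then have "bern_int (Suc k) s (R j) (R (Suc j)) = integral {?c - l / 2..?c + l / 2} ?f"
      unfolding bern_int_def Rj by (simp only:)
    also have "\<dots> = of_real l * integral {-(1/2)..1/2} (\<lambda>u. ?f (l * u + ?c))"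
      by (rule integral_affine[OF l pbern_exp_integrable])
    finally have "?E * bern_int (Suc k) s (R j) (R (Suc j)) = of_real l * (?E * integral {-(1/2)..1/2} (\<lambda>u. ?f (l * u + ?c)))"
      by simp
    also have "?E * integral {-(1/2)..1/2} (\<lambda>u. ?f (l * u + ?c)) = integral {-(1/2)..1/2} (\<lambda>u. ?E * ?f (l * u + ?c))"
      by simp
    also have "\<dots> = scale_coeff (Suc k) b a n j"
      unfolding scale_coeff_def
    proof (rule integral_cong)
      fix u
      have "exp (l * u + ?c) = a * b ^ j * exp (ln b * u)"
        using a b by (simp add: exp_add l_def exp_of_nat_mult)
      moreover have "?E * exp (- (\<i> * of_real t) * of_real (l * u + ?c)) = cis (- (2 * pi * of_int n) * u)"
      proof -
        have "?E * exp (- (\<i> * of_real t) * of_real (l * u + ?c)) = exp (\<i> * of_real (- (t * l) * u - (t * l) * real j))"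
          unfolding exp_add[symmetric] by (rule arg_cong[where f = exp]) (simp add: complex_eq_iff algebra_simps)
        also have "\<dots> = cis (- (t * l) * u - (t * l) * real j)" by (simp add: cis_conv_exp)
        also have "- (t * l) * u - (t * l) * real j = - (2 * pi * of_int n) * u + 2 * pi * of_int (- n * int j)"
          unfolding tl by (simp add: algebra_simps)
        also have "cis \<dots> = cis (- (2 * pi * of_int n) * u) * cis (2 * pi * of_int (- n * int j))"
          by (simp only: cis_mult)
        also have "cis (2 * pi * of_int (- n * int j)) = 1" by (rule cis_multiple_2pi) simp
        finally show ?thesis by simp
      qed
      ultimately show "?E * ?f (l * u + ?c) = pbern (Suc k) (a * b ^ j * exp (ln b * u)) *\<^sub>R cis (- (2 * pi * of_int n) * u)"
        by (simp add: scaleR_conv_of_real mult.left_commute)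
    qed
    finally show ?thesis .
  qed
  have sum: "?E * bern_int (Suc k) s p (R J) = of_real l * (\<Sum>j<J. scale_coeff (Suc k) b a n j)" for J
  proof (induction J)
    case 0 show ?case by (simp add: R_def bern_int_def)
  next
    case (Suc J)
    have "p \<le> R J" "R J \<le> R (Suc J)" using l by (auto simp: R_def algebra_simps)
    then show ?case using Suc piece[of J] by (simp add: bern_int_combine[of p "R J" "R (Suc J)"] distrib_left)
  qed
  have head: "?E * bern_head (Suc k) s p = zeta_head k b a n"
    unfolding bern_head_def zeta_head_def sum_distrib_left
  proof (intro sum.cong refl)
    fix i
    have e: "of_nat i - of_nat (Suc k) + 1 - s = of_nat i - \<i> * of_real t" by (simp add: s)
    have "?E * exp ((of_nat i - \<i> * of_real t) * of_real p) = exp (of_real (real i * p) + \<i> * of_real (t * l / 2))"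
      unfolding exp_add[symmetric] by (simp add: p_def algebra_simps)
    also have "t * l / 2 = pi * of_int n" by (simp add: tl)
    also have "exp (of_real (real i * p) + \<i> * of_real (pi * of_int n)) = of_real (exp (real i * p)) * cis (pi * of_int n)"
      unfolding exp_add cis_conv_exp exp_of_real by simp
    finally have x: "?E * exp ((of_nat i - \<i> * of_real t) * of_real p) = of_real (exp (real i * p)) * cis (pi * of_int n)" .
    have "?E * (of_real (coeff (bern (Suc k)) i) * exp ((of_nat i - of_nat (Suc k) + 1 - s) * of_real p) / (of_nat i - of_nat (Suc k) + 1 - s))
      = of_real (coeff (bern (Suc k)) i) * (?E * exp ((of_nat i - \<i> * of_real t) * of_real p)) / (of_nat i - \<i> * of_real t)"
      unfolding e by simp
    also have "\<dots> = of_real (coeff (bern (Suc k)) i * exp (real i * p)) * cis (pi * of_int n) / (of_nat i - \<i> * of_real t)"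
      unfolding x by simp
    finally show "?E * (of_real (coeff (bern (Suc k)) i) * exp ((of_nat i - of_nat (Suc k) + 1 - s) * of_real p) / (of_nat i - of_nat (Suc k) + 1 - s))
      = of_real (coeff (bern (Suc k)) i * exp (real i * (ln a - ln b / 2))) * cis (pi * of_int n) / (of_nat i - \<i> * of_real (2 * pi * of_int n / ln b))"
      by (simp only: p_def l_def t)
  qed
  have "summable (\<lambda>j. scale_coeff (Suc k) b a n j)"
    by (rule summable_norm_cancel) (rule summable_norm_scale_coeff, use b a in auto)
  then have "(\<lambda>J. \<Sum>j<J. scale_coeff (Suc k) b a n j) \<longlonglongrightarrow> (\<Sum>j. scale_coeff (Suc k) b a n j)"
    by (rule summable_LIMSEQ)
  then have "(\<lambda>J. - (pochhammer s (Suc k) * (zeta_head k b a n + of_real l * (\<Sum>j<J. scale_coeff (Suc k) b a n j))))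
    \<longlonglongrightarrow> - (pochhammer s (Suc k) * (zeta_head k b a n + of_real l * (\<Sum>j. scale_coeff (Suc k) b a n j)))"
    by (intro tendsto_intros)
  moreover have "(\<lambda>J. - (pochhammer s (Suc k) * (bern_head (Suc k) s p + bern_int (Suc k) s p (R J))) * ?E) \<longlonglongrightarrow> zeta s * ?E"
    by (intro tendsto_mult_right zeta_tendsto[OF p t0 s R])
  moreover have "- (pochhammer s (Suc k) * (bern_head (Suc k) s p + bern_int (Suc k) s p (R J))) * ?E =
      - (pochhammer s (Suc k) * (zeta_head k b a n + of_real l * (\<Sum>j<J. scale_coeff (Suc k) b a n j)))" for J
    unfolding head[symmetric] sum[symmetric] by (simp add: algebra_simps)
  ultimately show ?thesis unfolding zeta_inner_def l_def[symmetric] using LIMSEQ_unique by (simp only:)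
qed


section \<open>The contribution of the origin and the sum over n\<close>

lemma cis_pi_int: "cis (pi * of_int (- n)) = cis (pi * of_int n)"
proof -
  have "cis (pi * of_int n) = cis (pi * of_int (- n)) * cis (2 * pi * of_int n)"
    by (simp add: cis_mult algebra_simps)
  also have "cis (2 * pi * of_int n) = 1" by (rule cis_multiple_2pi) simp
  finally show ?thesis by simp
qed

text \<open>A single head is only \<open>O(1 / n)\<close>, but for \<open>n\<close> and
  \<open>- n\<close> together the denominators combine to
  \<open>2 * i / (i\<^sup>2 + \<tau>\<^sup>2)\<close>; this gains a further power and makes the
  symmetric sums bounded.\<close>

lemma zeta_head_bounds:
  assumes b: "b \<ge> 2"
  obtains C where "C \<ge> 0" "\<And>n. n \<noteq> 0 \<Longrightarrow> norm (zeta_head k b a n) \<le> C / \<bar>of_int n\<bar>"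
    "\<And>n. n \<noteq> 0 \<Longrightarrow> norm (zeta_head k b a n + zeta_head k b a (- n)) \<le> C / (of_int n)\<^sup>2"
proof -
  define l where "l = ln b"
  have l: "l > 0" using b by (simp add: l_def)
  define c where "c i = coeff (bern (Suc k)) i * exp (real i * (ln a - l / 2))" for i
  define C1 where "C1 = (\<Sum>i\<le>Suc k. \<bar>c i\<bar> * l)"
  define C2 where "C2 = (\<Sum>i\<le>Suc k. \<bar>c i\<bar> * (2 * real i * l\<^sup>2))"
  have C: "C1 \<ge> 0" unfolding C1_def using l by (intro sum_nonneg mult_nonneg_nonneg) auto
  have C': "C2 \<ge> 0" unfolding C2_def by (intro sum_nonneg mult_nonneg_nonneg) auto
  have \<tau>: "\<bar>of_int n\<bar> / l \<le> \<bar>2 * pi * of_int n / l\<bar>" for n :: int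
  proof -
    have "1 * \<bar>real_of_int n\<bar> \<le> 2 * pi * \<bar>real_of_int n\<bar>" using pi_ge_two by (intro mult_right_mono) auto
    then show ?thesis using l by (simp add: abs_mult abs_divide divide_right_mono)
  qed
  have 1: "norm (zeta_head k b a n) \<le> C1 / \<bar>of_int n\<bar>" if n: "n \<noteq> 0" for n
  proof -
    have "norm (zeta_head k b a n) \<le> (\<Sum>i\<le>Suc k. \<bar>c i\<bar> * l / \<bar>of_int n\<bar>)"
      unfolding zeta_head_def l_def[symmetric] c_def[symmetric]
    proof (rule sum_norm_le)
      fix i
      have "\<bar>of_int n\<bar> / l \<le> \<bar>Im (of_nat i - \<i> * of_real (2 * pi * of_int n / l))\<bar>" using \<tau>[of n] by simp
      also have "\<dots> \<le> norm (of_nat i - \<i> * of_real (2 * pi * of_int n / l))" by (rule abs_Im_le_cmod)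
      finally have le: "\<bar>of_int n\<bar> / l \<le> norm (of_nat i - \<i> * of_real (2 * pi * of_int n / l))" .
      have pos: "\<bar>of_int n\<bar> / l > 0" using n l by simp
      have "norm (of_real (c i) * cis (pi * of_int n) / (of_nat i - \<i> * of_real (2 * pi * of_int n / l))) = \<bar>c i\<bar> / norm (of_nat i - \<i> * of_real (2 * pi * of_int n / l))"
        by (simp only: norm_divide norm_mult norm_of_real norm_cis mult_1_right)
      also have "\<dots> \<le> \<bar>c i\<bar> / (\<bar>of_int n\<bar> / l)"
        using le pos by (intro divide_left_mono mult_pos_pos) auto
      also have "\<dots> = \<bar>c i\<bar> * l / \<bar>of_int n\<bar>" by simp
      finally show "norm (of_real (c i) * cis (pi * of_int n) / (of_nat i - \<i> * of_real (2 * pi * of_int n / l))) \<le> \<bar>c i\<bar> * l / \<bar>of_int n\<bar>" .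
    qed
    then show ?thesis unfolding C1_def sum_divide_distrib .
  qed
  have 2: "norm (zeta_head k b a n + zeta_head k b a (- n)) \<le> C2 / (of_int n)\<^sup>2" if n: "n \<noteq> 0" for n
  proof -
    have "norm (zeta_head k b a n + zeta_head k b a (- n)) \<le> (\<Sum>i\<le>Suc k. \<bar>c i\<bar> * (2 * real i * l\<^sup>2) / (of_int n)\<^sup>2)"
      unfolding zeta_head_def l_def[symmetric] c_def[symmetric] sum.distrib[symmetric]
    proof (rule sum_norm_le)
      fix i
      define \<tau> where "\<tau> = 2 * pi * of_int n / l"
      have \<tau>0: "\<tau> \<noteq> 0" using n l by (simp add: \<tau>_def)
      have nz: "of_nat i - \<i> * of_real \<tau> \<noteq> 0" "of_nat i + \<i> * of_real \<tau> \<noteq> 0" using \<tau>0 by (auto simp: complex_eq_iff)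
      have prod: "(of_nat i - \<i> * of_real \<tau>) * (of_nat i + \<i> * of_real \<tau>) = of_real ((real i)\<^sup>2 + \<tau>\<^sup>2)"
        by (simp add: complex_eq_iff power2_eq_square)
      have "1 / (of_nat i - \<i> * of_real \<tau>) + 1 / (of_nat i + \<i> * of_real \<tau>) = of_real (2 * real i) / of_real ((real i)\<^sup>2 + \<tau>\<^sup>2)"
        unfolding prod[symmetric] using nz by (simp add: field_simps)
      then have sum: "of_real (c i) * cis (pi * of_int n) / (of_nat i - \<i> * of_real \<tau>) + of_real (c i) * cis (pi * of_int n) / (of_nat i + \<i> * of_real \<tau>)
          = of_real (c i) * cis (pi * of_int n) * (of_real (2 * real i) / of_real ((real i)\<^sup>2 + \<tau>\<^sup>2))"
        by (simp add: distrib_left[symmetric] divide_inverse mult.assoc)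
      have "(of_int n / l)\<^sup>2 \<le> \<tau>\<^sup>2"
        using \<tau>[of n] l unfolding \<tau>_def by (simp add: abs_le_square_iff[symmetric] abs_divide)
      then have le: "(of_int n / l)\<^sup>2 \<le> (real i)\<^sup>2 + \<tau>\<^sup>2" by (simp add: add_increasing)
      have pos: "(of_int n / l)\<^sup>2 > 0" using n l by simp
      have "norm (of_real (c i) * cis (pi * of_int n) / (of_nat i - \<i> * of_real \<tau>) + of_real (c i) * cis (pi * of_int n) / (of_nat i + \<i> * of_real \<tau>))
         = \<bar>c i\<bar> * (2 * real i / ((real i)\<^sup>2 + \<tau>\<^sup>2))"
        unfolding sum norm_mult norm_divide norm_of_real norm_cis by simp
      also have "\<dots> \<le> \<bar>c i\<bar> * (2 * real i / (of_int n / l)\<^sup>2)"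
        using le pos less_le_trans[OF pos le] by (intro mult_left_mono divide_left_mono mult_pos_pos) auto
      also have "\<dots> = \<bar>c i\<bar> * (2 * real i * l\<^sup>2) / (of_int n)\<^sup>2" by (simp add: power_divide)
      finally have fin: "norm (of_real (c i) * cis (pi * of_int n) / (of_nat i - \<i> * of_real \<tau>) + of_real (c i) * cis (pi * of_int n) / (of_nat i + \<i> * of_real \<tau>)) \<le> \<bar>c i\<bar> * (2 * real i * l\<^sup>2) / (of_int n)\<^sup>2" .
      have m: "2 * pi * of_int (- n) / l = - \<tau>" by (simp add: \<tau>_def)
      show "norm (of_real (c i) * cis (pi * of_int n) / (of_nat i - \<i> * of_real (2 * pi * of_int n / l))
        + of_real (c i) * cis (pi * of_int (- n)) / (of_nat i - \<i> * of_real (2 * pi * of_int (- n) / l))) \<le> \<bar>c i\<bar> * (2 * real i * l\<^sup>2) / (of_int n)\<^sup>2"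
        unfolding cis_pi_int m \<tau>_def[symmetric] using fin by simp
    qed
    then show ?thesis unfolding C2_def sum_divide_distrib .
  qed
  show ?thesis
  proof (rule that[of "C1 + C2"])
    show "norm (zeta_head k b a n) \<le> (C1 + C2) / \<bar>of_int n\<bar>" if "n \<noteq> 0" for n
      using C C' by (intro order_trans[OF 1[OF that]] divide_right_mono) auto
    show "norm (zeta_head k b a n + zeta_head k b a (- n)) \<le> (C1 + C2) / (of_int n)\<^sup>2" if "n \<noteq> 0" for n
      using C C' by (intro order_trans[OF 2[OF that]] divide_right_mono) auto
  qed (use C C' in auto)
qed

text \<open>The heads are summable in pairs, and the characters add up to the Dirichlet kernel minus
  the mode \<open>n = 0\<close>. That mode does not depend on \<open>N\<close> and goes into
  \<open>K\<close>.\<close>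

lemma sum_zeta_inner:
  assumes b: "b \<ge> 2" and a: "a > 0"
  obtains K where "\<And>N. norm ((\<Sum>n\<in>{- int N..int N} - {0}. zeta_inner k b a n) - of_real (ln b * (\<Sum>j. dker_term (Suc k) b a N j))) \<le> K"
proof -
  have k: "Suc k \<ge> 1" by simp
  have sm: "summable (\<lambda>j. scale_coeff (Suc k) b a n j)" for n
    by (rule summable_norm_cancel) (rule summable_norm_scale_coeff[OF b a k])
  obtain C where C: "C \<ge> 0" "\<And>n. n \<noteq> 0 \<Longrightarrow> norm (zeta_head k b a n + zeta_head k b a (- n)) \<le> C / (of_int n)\<^sup>2"
    using zeta_head_bounds[OF b, of k a] by metis
  have sq: "summable (\<lambda>n. inverse ((real n)\<^sup>2))" by (rule inverse_power_summable) simp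
  define K1 where "K1 = C * (\<Sum>n. inverse ((real n)\<^sup>2))"
  have heads: "norm (\<Sum>n\<in>{- int N..int N} - {0}. zeta_head k b a n) \<le> K1" for N
  proof -
    have "norm (\<Sum>n\<in>{- int N..int N} - {0}. zeta_head k b a n) \<le> (\<Sum>n=1..N. C * inverse ((real n)\<^sup>2))"
      unfolding sum_symmetric_int
    proof (rule sum_norm_le)
      fix n assume "n \<in> {1..N}"
      then show "norm (zeta_head k b a (int n) + zeta_head k b a (- int n)) \<le> C * inverse ((real n)\<^sup>2)"
        using C(2)[of "int n"] by (simp add: divide_inverse)
    qed
    also have "\<dots> = C * (\<Sum>n=1..N. inverse ((real n)\<^sup>2))" by (simp add: sum_distrib_left)
    also have "\<dots> \<le> K1" unfolding K1_def using C(1) by (intro mult_left_mono sum_le_suminf sq) auto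
    finally show ?thesis .
  qed
  define S0 where "S0 = (\<Sum>j. scale_coeff (Suc k) b a 0 j)"
  have tails: "(\<Sum>n\<in>{- int N..int N} - {0}. \<Sum>j. scale_coeff (Suc k) b a n j) = of_real (\<Sum>j. dker_term (Suc k) b a N j) - S0" for N
  proof -
    have "(\<lambda>j. \<Sum>n\<in>{- int N..int N} - {0}. scale_coeff (Suc k) b a n j) sums (\<Sum>n\<in>{- int N..int N} - {0}. \<Sum>j. scale_coeff (Suc k) b a n j)"
      by (intro sums_sum summable_sums sm)
    then have 1: "(\<lambda>j. of_real (dker_term (Suc k) b a N j) - scale_coeff (Suc k) b a 0 j) sums (\<Sum>n\<in>{- int N..int N} - {0}. \<Sum>j. scale_coeff (Suc k) b a n j)"
      unfolding sum_scale_coeff .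
    from sums_add[OF this summable_sums[OF sm[of 0]]]
    have 2: "(\<lambda>j. complex_of_real (dker_term (Suc k) b a N j)) sums ((\<Sum>n\<in>{- int N..int N} - {0}. \<Sum>j. scale_coeff (Suc k) b a n j) + S0)"
      by (simp add: S0_def)
    then have "summable (\<lambda>j. complex_of_real (dker_term (Suc k) b a N j))" by (rule sums_summable)
    then have "summable (dker_term (Suc k) b a N)" by (simp add: summable_complex_of_real)
    then have "(\<lambda>j. complex_of_real (dker_term (Suc k) b a N j)) sums of_real (\<Sum>j. dker_term (Suc k) b a N j)"
      by (intro sums_of_real summable_sums)
    from sums_unique2[OF this 2] show ?thesis by simp
  qed
  have "norm ((\<Sum>n\<in>{- int N..int N} - {0}. zeta_inner k b a n) - of_real (ln b * (\<Sum>j. dker_term (Suc k) b a N j))) \<le> K1 + norm (of_real (ln b) * S0)" for N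
  proof -
    have "(\<Sum>n\<in>{- int N..int N} - {0}. zeta_inner k b a n) - of_real (ln b * (\<Sum>j. dker_term (Suc k) b a N j)) =
        (\<Sum>n\<in>{- int N..int N} - {0}. zeta_head k b a n) - of_real (ln b) * S0"
      unfolding zeta_inner_def sum.distrib sum_distrib_left[symmetric] tails by (simp add: right_diff_distrib)
    then show ?thesis using heads[of N] norm_triangle_ineq4[of "\<Sum>n\<in>{- int N..int N} - {0}. zeta_head k b a n" "of_real (ln b) * S0"] by simp
  qed
  then show ?thesis by (rule that)
qed

section \<open>Replacing the Pochhammer factor by its leading term\<close>

text \<open>With \<open>x = 1 / n\<close> the product is the Pochhammer symbol divided by
  \<open>n ^ (k + 1)\<close>. Each factor deviates from \<open>c\<close> by
  \<open>O(\<bar>x\<bar>)\<close>; for \<open>k = 0\<close> the only factor is \<open>c\<close>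
  itself.\<close>

lemma pochhammer_ratio_bound:
  fixes c :: complex
  obtains C where "C \<ge> 0" "\<And>x::real. \<bar>x\<bar> \<le> 1 \<Longrightarrow> norm ((\<Prod>i\<le>k. c - of_nat i * of_real x) - c ^ Suc k) \<le> (if k = 0 then 0 else C * \<bar>x\<bar>)"
proof -
  have "\<exists>C\<ge>0. \<forall>x::real. \<bar>x\<bar> \<le> 1 \<longrightarrow> norm ((\<Prod>i\<le>k. c - of_nat i * of_real x) - c ^ Suc k) \<le> C * \<bar>x\<bar>"
  proof (induction k)
    case 0 show ?case by (intro exI[of _ 0]) auto
  next
    case (Suc k)
    then obtain C where C: "C \<ge> 0" "\<And>x::real. \<bar>x\<bar> \<le> 1 \<Longrightarrow> norm ((\<Prod>i\<le>k. c - of_nat i * of_real x) - c ^ Suc k) \<le> C * \<bar>x\<bar>" by blast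
    have "norm ((\<Prod>i\<le>Suc k. c - of_nat i * of_real x) - c ^ Suc (Suc k)) \<le> (C * (norm c + real (Suc k)) + norm c ^ Suc k * real (Suc k)) * \<bar>x\<bar>"
      if x: "\<bar>x\<bar> \<le> 1" for x :: real
    proof -
      have "(\<Prod>i\<le>Suc k. c - of_nat i * of_real x) - c ^ Suc (Suc k) =
          ((\<Prod>i\<le>k. c - of_nat i * of_real x) - c ^ Suc k) * (c - of_nat (Suc k) * of_real x) - c ^ Suc k * (of_nat (Suc k) * of_real x)"
        by (simp add: algebra_simps)
      also have "norm \<dots> \<le> norm ((\<Prod>i\<le>k. c - of_nat i * of_real x) - c ^ Suc k) * norm (c - of_nat (Suc k) * of_real x) + norm c ^ Suc k * (real (Suc k) * \<bar>x\<bar>)"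
        by (rule order_trans[OF norm_triangle_ineq4]) (simp only: norm_mult norm_power norm_of_nat norm_of_real order_refl)
      also have "\<dots> \<le> (C * \<bar>x\<bar>) * (norm c + real (Suc k)) + norm c ^ Suc k * (real (Suc k) * \<bar>x\<bar>)"
      proof (intro add_mono mult_mono C(2) x order_refl)
        have "norm (c - of_nat (Suc k) * of_real x) \<le> norm c + real (Suc k) * \<bar>x\<bar>"
          by (rule order_trans[OF norm_triangle_ineq4]) (simp only: norm_mult norm_of_nat norm_of_real order_refl)
        also have "\<dots> \<le> norm c + real (Suc k) * 1" using x by (intro add_left_mono mult_left_mono) auto
        finally show "norm (c - of_nat (Suc k) * of_real x) \<le> norm c + real (Suc k)" by simp
      qed (use C in auto)
      finally show ?thesis by (simp add: algebra_simps)
    qed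
    moreover have "C * (norm c + real (Suc k)) + norm c ^ Suc k * real (Suc k) \<ge> 0" using C by simp
    ultimately show ?case by blast
  qed
  then obtain C where C: "C \<ge> 0" "\<And>x::real. \<bar>x\<bar> \<le> 1 \<Longrightarrow> norm ((\<Prod>i\<le>k. c - of_nat i * of_real x) - c ^ Suc k) \<le> C * \<bar>x\<bar>" by blast
  show ?thesis by (rule that[OF C(1)]) (use C(2) in auto)
qed


text \<open>Regularity of logarithmic means: finitely many terms are bounded, the others are
  compared with the harmonic sum.\<close>

lemma tendsto_sum_over_log:
  fixes u :: "nat \<Rightarrow> real"
  assumes u: "u \<longlonglongrightarrow> 0"
  shows "(\<lambda>N. (\<Sum>n=1..N. u n / real n) / ln (real N)) \<longlonglongrightarrow> 0"
proof (rule LIMSEQ_I)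
  fix e :: real assume e: "e > 0"
  obtain M where M: "\<And>n. n \<ge> M \<Longrightarrow> norm (u n - 0) < e / 4"
    using LIMSEQ_D[OF u, of "e / 4"] e by auto
  define K where "K = (\<Sum>n=1..M. \<bar>u n\<bar> / real n)"
  have bound: "\<bar>\<Sum>n=1..N. u n / real n\<bar> \<le> K + e / 4 * (1 + ln (real N))" if N: "N \<ge> 1" for N
  proof -
    have "\<bar>\<Sum>n=1..N. u n / real n\<bar> \<le> (\<Sum>n=1..N. \<bar>u n\<bar> / real n)"
      by (rule order_trans[OF sum_abs]) (simp add: abs_divide)
    also have "\<dots> \<le> (\<Sum>n=1..N. (if n \<le> M then \<bar>u n\<bar> / real n else 0) + e / 4 * (1 / real n))"
    proof (rule sum_mono)
      fix n assume n: "n \<in> {1..N}"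
      show "\<bar>u n\<bar> / real n \<le> (if n \<le> M then \<bar>u n\<bar> / real n else 0) + e / 4 * (1 / real n)"
      proof (cases "n \<le> M")
        case False
        then have "\<bar>u n\<bar> \<le> e / 4" using M[of n] by simp
        then have "\<bar>u n\<bar> / real n \<le> e / 4 / real n" by (rule divide_right_mono) simp
        then show ?thesis using False by simp
      qed (use e in simp)
    qed
    also have "\<dots> = (\<Sum>n=1..N. (if n \<le> M then \<bar>u n\<bar> / real n else 0)) + e / 4 * (\<Sum>n=1..N. 1 / real n)"
      by (simp add: sum.distrib sum_distrib_left)
    also have "(\<Sum>n=1..N. (if n \<le> M then \<bar>u n\<bar> / real n else 0)) = (\<Sum>n\<in>{n\<in>{1..N}. n \<le> M}. \<bar>u n\<bar> / real n)"
      by (rule sum.inter_filter[symmetric]) simp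
    also have "\<dots> \<le> K" unfolding K_def by (intro sum_mono2) auto
    also have "(\<Sum>n=1..N. 1 / real n) \<le> 1 + ln (real N)"
      using sum_inverse_le_ln[of "N - 1"] N by simp
    finally show ?thesis using e by (simp add: mult_left_mono)
  qed
  have "eventually (\<lambda>N::nat. K + e / 4 * (1 + ln (real N)) < e * ln (real N)) sequentially"
    using e by real_asymp
  moreover have "eventually (\<lambda>N::nat. N \<ge> 2) sequentially" by (rule eventually_ge_at_top)
  ultimately have "eventually (\<lambda>N. norm ((\<Sum>n=1..N. u n / real n) / ln (real N) - 0) < e) sequentially"
  proof eventually_elim
    case (elim N)
    have ln: "ln (real N) > 0" using elim by simp
    have "\<bar>\<Sum>n=1..N. u n / real n\<bar> < e * ln (real N)" using bound[of N] elim by linarith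
    then show ?case using ln by (simp add: abs_divide field_simps)
  qed
  then show "\<exists>N0. \<forall>N\<ge>N0. norm ((\<Sum>n=1..N. u n / real n) / ln (real N) - 0) < e"
    by (simp add: eventually_sequentially)
qed

lemma card_power_le:
  fixes b R :: real
  assumes b: "b \<ge> 2" and R: "R \<ge> 1"
  shows "real (card {j. b ^ j \<le> R}) \<le> ln R / ln b + 1"
proof -
  define m where "m = nat \<lfloor>ln R / ln b\<rfloor>"
  have l: "ln b > 0" using b by simp
  have nn: "ln R / ln b \<ge> 0" using R l by simp
  have "{j. b ^ j \<le> R} \<subseteq> {..m}"
  proof
    fix j assume "j \<in> {j. b ^ j \<le> R}"
    then have "ln (b ^ j) \<le> ln R" using b by (intro ln_mono) auto
    then have "real j \<le> ln R / ln b" using l b by (simp add: ln_realpow field_simps)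
    then show "j \<in> {..m}" unfolding m_def by (simp add: le_nat_floor)
  qed
  then have "card {j. b ^ j \<le> R} \<le> card {..m}" by (intro card_mono) auto
  then have "real (card {j. b ^ j \<le> R}) \<le> real m + 1" by simp
  also have "real m \<le> ln R / ln b" unfolding m_def using nn by simp
  finally show ?thesis by simp
qed

text \<open>A Riemann-Lebesgue argument uniform over all scales. In \<open>regime_sum_le\<close> the
  place of \<open>M\<close> is taken by \<open>\<bar>n\<bar>\<close>, while \<open>L\<close> is a
  large constant: the geometric parts are then \<open>O(C / L)\<close>, and the transition range has
  a bounded number of scales, on each of which the truncated Fourier series makes the coefficient
  small.\<close>

lemma sum_scale_coeff_small:
  assumes b: "b \<ge> 2" and a: "0 < a" "a \<le> 1" and k: "k \<ge> 1" and e: "e > 0"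
  shows "\<exists>N0. \<forall>n::int. \<bar>n\<bar> \<ge> N0 \<longrightarrow> (\<Sum>j. norm (scale_coeff (Suc k) b a n j)) \<le> e"
proof -
  define l where "l = ln b"
  have l: "l > 0" using b by (simp add: l_def)
  define Ca where "Ca = pbern_bound (Suc (Suc k)) * exp (l / 2) / (l * a) * (2 + 2 * pi + l)"
  define Cb where "Cb = 2 * pbern_bound (Suc k)"
  define Cc where "Cc = pbern_bound k * (l * exp (l / 2))"
  define C where "C = Ca + Cc"
  have C: "Ca \<ge> 0" "Cb \<ge> 0" "Cc \<ge> 0" "Ca \<le> C" "Cc \<le> C" "C \<ge> 0"
    using l a pbern_bound(1)[of k] pbern_bound(1)[of "Suc k"] pbern_bound(1)[of "Suc (Suc k)"]
    by (auto simp: Ca_def Cb_def Cc_def C_def)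
  have "((\<lambda>L. 4 * (C / L) + (2 * ln L / l + 1) * (C / L)) \<longlongrightarrow> 0) at_top" using l by real_asymp
  then have "eventually (\<lambda>L. 4 * (C / L) + (2 * ln L / l + 1) * (C / L) < e / 4) at_top"
    using e by (intro order_tendstoD(2)) auto
  then have "eventually (\<lambda>L. L \<ge> 2 \<and> 4 * (C / L) + (2 * ln L / l + 1) * (C / L) < e / 4) at_top"
    using eventually_ge_at_top[of "2::real"] by eventually_elim auto
  \<comment> \<open>\<open>L\<close> is fixed before everything else, so that the geometric
    contributions stay below \<open>e / 4\<close>; \<open>Z\<close>, \<open>H\<close> and the
    thresholds on \<open>n\<close> depend on it.\<close>
  then obtain L :: real where L: "L \<ge> 2" "4 * (C / L) + (2 * ln L / l + 1) * (C / L) < e / 4"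
    by (auto simp: eventually_at_top_linorder)
  \<comment> \<open>A bound for the number of transition scales; \<open>Z\<close> is the share of
    \<open>e / 4\<close> granted to each of them.\<close>
  define q where "q = 2 * ln L / l + 1"
  have q: "q \<ge> 1" using L l by (simp add: q_def)
  define Z where "Z = e / (4 * q)"
  have Z: "Z > 0" using e q by (simp add: Z_def)
  have "((\<lambda>H::nat. expave_const l * (3/2) * (4 / sqrt (real H))) \<longlonglongrightarrow> 0)" by real_asymp
  then have "eventually (\<lambda>H::nat. expave_const l * (3/2) * (4 / sqrt (real H)) < Z / 2) sequentially"
    using Z by (intro order_tendstoD(2)) auto
  then have "eventually (\<lambda>H::nat. H \<ge> 1 \<and> expave_const l * (3/2) * (4 / sqrt (real H)) < Z / 2) sequentially"
    using eventually_ge_at_top[of "1::nat"] by eventually_elim auto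
  then obtain H :: nat where H: "H \<ge> 1" "expave_const l * (3/2) * (4 / sqrt (real H)) < Z / 2"
    by (auto simp: eventually_sequentially)
  have "((\<lambda>X. 2 * real H * (vdC_const l / sqrt X)) \<longlongrightarrow> 0) at_top" by real_asymp
  then have "eventually (\<lambda>X. 2 * real H * (vdC_const l / sqrt X) < Z / 2) at_top"
    using Z by (intro order_tendstoD(2)) auto
  then obtain X0 where X0: "\<And>X. X \<ge> X0 \<Longrightarrow> 2 * real H * (vdC_const l / sqrt X) < Z / 2"
    by (auto simp: eventually_at_top_linorder)
  have "((\<lambda>x. Cb / x * (ln x / l + 1)) \<longlongrightarrow> 0) at_top" using l by real_asymp
  then have "eventually (\<lambda>x. Cb / x * (ln x / l + 1) < e / 4) at_top"
    using e by (intro order_tendstoD(2)) auto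
  then obtain x0 where x0: "\<And>x. x \<ge> x0 \<Longrightarrow> Cb / x * (ln x / l + 1) < e / 4"
    by (auto simp: eventually_at_top_linorder)
  have main: "(\<Sum>j. norm (scale_coeff (Suc k) b a n j)) \<le> e"
    if n1: "\<bar>n\<bar> \<ge> 1" and n2: "real_of_int \<bar>n\<bar> \<ge> x0" and n3: "real_of_int \<bar>n\<bar> \<ge> max X0 1 * L / a" for n :: int
  proof -
    define M where "M = real_of_int \<bar>n\<bar>"
    have M: "M \<ge> 1" using n1 by (simp add: M_def)
    let ?F = "\<lambda>j. norm (scale_coeff (Suc k) b a n j)"
    have pb: "a * b ^ j > 0" "a * b ^ j \<le> b ^ j" for j using a b by auto
    have A: "\<bar>- (2 * pi * of_int n)\<bar> = 2 * pi * M" by (simp add: M_def abs_mult)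
    have A1: "M \<le> 2 * pi * M" using pi_ge_two M mult_right_mono[of 1 "2 * pi" M] by simp
    \<comment> \<open>\<open>C / L\<close> cancels the factor \<open>L\<close> in the general bound,
      so the geometric sums carry a small constant. The extra \<open>Cb / M\<close> comes from the
      boundary terms of the partial integration and plays the part of the errors
      \<open>e j\<close>.\<close>
    have low: "\<bar>?F j - 0\<bar> \<le> (C / L) * b ^ j * L / M + Cb / M" for j
    proof -
      have "?F j \<le> (2 * pbern_bound (Suc k) + pbern_bound k * (a * b ^ j * ln b * exp (ln b / 2))) / \<bar>- (2 * pi * of_int n)\<bar>"
        unfolding scale_coeff_def using n1 l by (intro pbern_Suc_cis_low k pb) (auto simp: l_def)
      also have "\<dots> = (Cb + Cc * (a * b ^ j)) / (2 * pi * M)"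
        unfolding A by (simp add: Cb_def Cc_def l_def mult_ac)
      also have "\<dots> \<le> (Cb + C * b ^ j) / M"
        using C M A1 pb[of j] by (intro frac_le add_left_mono mult_mono) (auto simp: less_imp_le)
      also have "\<dots> = (C / L) * b ^ j * L / M + Cb / M" using L by (simp add: add_divide_distrib)
      finally show ?thesis by simp
    qed
    have high: "\<bar>?F j\<bar> \<le> (C / L) * M * L / b ^ j" for j
    proof -
      have "?F j \<le> (pbern_bound (Suc (Suc k)) * exp (ln b / 2) / (ln b * a) * (2 + 2 * pi * \<bar>of_int n\<bar> + ln b)) * (1 / b) ^ j"
        using b a by (intro norm_scale_coeff_high) auto
      also have "\<dots> \<le> (Ca * M) * (1 / b) ^ j"
      proof (rule mult_right_mono)
        have "2 + 2 * pi * M + l \<le> (2 + 2 * pi + l) * M" using M l mult_left_mono[of 1 M "2 + l"] by (simp add: algebra_simps)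
        then show "pbern_bound (Suc (Suc k)) * exp (ln b / 2) / (ln b * a) * (2 + 2 * pi * \<bar>of_int n\<bar> + ln b) \<le> Ca * M"
          unfolding Ca_def l_def[symmetric] M_def[symmetric] mult.assoc of_int_abs[symmetric]
          using l a pbern_bound(1)[of "Suc (Suc k)"] by (intro mult_left_mono) (auto simp: M_def)
      qed (use b in simp)
      also have "\<dots> \<le> (C * M) * (1 / b) ^ j" using C M b by (intro mult_right_mono) auto
      also have "\<dots> = (C / L) * M * L / b ^ j" using L by (simp add: power_divide)
      finally show ?thesis by simp
    qed
    have mid: "\<bar>?F j\<bar> \<le> Z" if j: "M / L < b ^ j" for j
    proof -
      have "max X0 1 * L / a \<le> M" using n3 by (simp add: M_def)
      moreover have "x \<le> a * (M / L)" if "x * L / a \<le> M" for x using that L a by (simp add: field_simps)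
      ultimately have "max X0 1 \<le> a * (M / L)" by blast
      also have "\<dots> \<le> a * b ^ j" using j a by (intro mult_left_mono) auto
      finally have X: "a * b ^ j \<ge> X0" "a * b ^ j \<ge> 1" by auto
      have "?F j = norm (integral {-(1/2)..1/2} (\<lambda>u. cis (- (2 * pi * of_int n) * u) * of_real (pbern (Suc k) (a * b ^ j * exp (l * u)))))"
        unfolding scale_coeff_def l_def by (simp add: scaleR_conv_of_real mult.commute)
      also have "\<dots> \<le> 2 * real H * (vdC_const l / sqrt (a * b ^ j)) + expave_const l * (3/2) * (4 / sqrt (real H))"
        by (rule norm_integral_pbern_cis_le[OF _ H(1) X(2) l]) simp
      also have "\<dots> \<le> Z" using H(2) X0[OF X(1)] by linarith
      finally show ?thesis by simp
    qed
    have ML1: "M / L \<le> M" "M < M * L" using M L by (auto simp: field_simps)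
    have L1: "L \<ge> 1" "C / L \<ge> 0" using L C by auto
    have "\<bar>(\<Sum>j. ?F j) - (\<Sum>j\<in>{j. b ^ j \<le> M}. 0)\<bar> \<le> 4 * (C / L) + (\<Sum>j\<in>{j. b ^ j \<le> M}. Cb / M) + (2 * ln L / ln b + 1) * (Z + C / L)"
      by (rule regime_sum_le(2)[OF b L1(1) M L1(2) less_imp_le[OF Z] ML1 low _ high mid])
        (use C M L1 in auto)
    also have "(\<Sum>j\<in>{j. b ^ j \<le> M}. Cb / M) = Cb / M * real (card {j. b ^ j \<le> M})" by simp
    also have "\<dots> \<le> Cb / M * (ln M / l + 1)"
      using card_power_le[OF b M] C M unfolding l_def by (intro mult_left_mono) auto
    also have "\<dots> < e / 4" using n2 by (intro x0) (simp add: M_def)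
    also have "4 * (C / L) + e / 4 + (2 * ln L / ln b + 1) * (Z + C / L) = (4 * (C / L) + q * (C / L)) + e / 4 + q * Z"
      by (simp add: q_def l_def distrib_left)
    also have "q * Z = e / 4" using q by (simp add: Z_def)
    also have "(4 * (C / L) + q * (C / L)) + e / 4 + e / 4 \<le> e"
      using L(2) e unfolding q_def by linarith
    finally show ?thesis by simp
  qed
  show ?thesis
  proof (intro exI allI impI)
    fix n :: int assume n: "\<bar>n\<bar> \<ge> max 1 (\<lceil>max x0 (max X0 1 * L / a)\<rceil>)"
    then have "max x0 (max X0 1 * L / a) \<le> real_of_int \<bar>n\<bar>" by linarith
    then show "(\<Sum>j. norm (scale_coeff (Suc k) b a n j)) \<le> e" using n by (intro main) auto
  qed
qed


lemma norm_zeta_inner_tendsto: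
  assumes b: "b \<ge> 2" and a: "0 < a" "a \<le> 1" and k: "k \<ge> 1"
  shows "(\<lambda>n. norm (zeta_inner k b a (int n)) + norm (zeta_inner k b a (- int n))) \<longlonglongrightarrow> 0"
proof -
  obtain C where C: "C \<ge> 0" "\<And>n. n \<noteq> 0 \<Longrightarrow> norm (zeta_head k b a n) \<le> C / \<bar>of_int n\<bar>"
    using zeta_head_bounds[OF b, of k a] by metis
  have l: "ln b > 0" using b by simp
  have inner: "norm (zeta_inner k b a n) \<le> C / \<bar>of_int n\<bar> + ln b * (\<Sum>j. norm (scale_coeff (Suc k) b a n j))" if n: "n \<noteq> 0" for n
  proof -
    have "norm (zeta_inner k b a n) \<le> norm (zeta_head k b a n) + norm (of_real (ln b) * (\<Sum>j. scale_coeff (Suc k) b a n j))"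
      unfolding zeta_inner_def by (rule norm_triangle_ineq)
    also have "norm (of_real (ln b) * (\<Sum>j. scale_coeff (Suc k) b a n j)) \<le> ln b * (\<Sum>j. norm (scale_coeff (Suc k) b a n j))"
      unfolding norm_mult using l b a
      by (simp, intro mult_left_mono summable_norm summable_norm_scale_coeff) auto
    finally show ?thesis using C(2)[OF n] by linarith
  qed
  have one: "(\<lambda>n. norm (zeta_inner k b a (s * int n))) \<longlonglongrightarrow> 0" if s: "\<bar>s\<bar> = 1" for s
  proof (rule LIMSEQ_I)
    fix e :: real assume e: "e > 0"
    obtain N0 where N0: "\<And>n::int. \<bar>n\<bar> \<ge> N0 \<Longrightarrow> (\<Sum>j. norm (scale_coeff (Suc k) b a n j)) \<le> e / (4 * ln b)"
      using sum_scale_coeff_small[OF b a k, of "e / (4 * ln b)"] e l by auto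
    have "norm (norm (zeta_inner k b a (s * int n)) - 0) < e" if n: "n \<ge> max 1 (max (nat N0) (nat \<lceil>4 * C / e\<rceil>))" for n
    proof -
      have sn: "\<bar>s * int n\<bar> = int n" using s by (simp add: abs_mult)
      have "norm (zeta_inner k b a (s * int n)) \<le> C / \<bar>of_int (s * int n)\<bar> + ln b * (\<Sum>j. norm (scale_coeff (Suc k) b a (s * int n) j))"
        using sn n by (intro inner) auto
      also have "\<bar>real_of_int (s * int n)\<bar> = real n" using sn by (metis of_int_abs of_int_of_nat_eq)
      also have "(\<Sum>j. norm (scale_coeff (Suc k) b a (s * int n) j)) \<le> e / (4 * ln b)" using n sn by (intro N0) (simp add: nat_le_iff)
      then have "ln b * (\<Sum>j. norm (scale_coeff (Suc k) b a (s * int n) j)) \<le> ln b * (e / (4 * ln b))"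
        using l by (intro mult_left_mono) auto
      also have "ln b * (e / (4 * ln b)) = e / 4" using l by simp
      also have "C / real n \<le> e / 4"
      proof -
        have "4 * C / e \<le> real n" using n by linarith
        then show ?thesis using e n by (simp add: field_simps)
      qed
      finally show ?thesis using e by simp
    qed
    then show "\<exists>N. \<forall>n\<ge>N. norm (norm (zeta_inner k b a (s * int n)) - 0) < e" by blast
  qed
  from tendsto_add[OF one[of 1] one[of "-1"]] show ?thesis by simp
qed

text \<open>Each summand is \<open>- \<phi> (1 / n) * zeta_inner k b a n\<close> with the normalised
  Pochhammer symbol \<open>\<phi>\<close>. Freezing \<open>\<phi>\<close> at its limit
  \<open>c ^ Suc k\<close> costs at most a null sequence divided by \<open>n\<close>, whose sums are
  \<open>o(ln N)\<close>.\<close>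

lemma zeta_series_asymp:
  fixes b :: nat and a \<alpha> :: real
  assumes b: "b \<ge> 2" and a: "0 < a" "a \<le> 1" and \<alpha>: "\<alpha> = a * real b ^ r"
  shows "(\<lambda>N::nat. 1 / complex_of_real (ln (real N)) *
        (\<Sum>n\<in>{n::int. 1 \<le> \<bar>n\<bar> \<and> \<bar>n\<bar> \<le> int N}.
           zeta (- of_nat k + 2 * of_real pi * \<i> * of_int n / of_real (ln (real b))) *
           (exp (2 * of_real pi * \<i> * of_int n * of_real (ln \<alpha>) / of_real (ln (real b))) /
            of_int n ^ (k + 1)))
     + (2 * of_real pi * \<i> / of_real (ln (real b))) ^ Suc k * of_real (ln (real b)) *
         of_real ((\<Sum>j. dker_term (Suc k) (real b) a N j) / ln (real N))) \<longlonglongrightarrow> 0"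
proof -
  define l where "l = ln (real b)"
  have b': "real b \<ge> 2" using b by simp
  have l: "l > 0" using b by (simp add: l_def)
  define c where "c = 2 * complex_of_real pi * \<i> / of_real l"
  let ?W = "zeta_inner k (real b) a"
  let ?I = "\<lambda>N. {- int N..int N} - {0}"
  define \<phi> where "\<phi> x = (\<Prod>i\<le>k. c - of_nat i * of_real x)" for x :: real
  obtain C where C: "C \<ge> 0" "\<And>x::real. \<bar>x\<bar> \<le> 1 \<Longrightarrow> norm (\<phi> x - c ^ Suc k) \<le> (if k = 0 then 0 else C * \<bar>x\<bar>)"
    using pochhammer_ratio_bound[of c k] unfolding \<phi>_def by metis
  have term_eq: "zeta (- of_nat k + 2 * of_real pi * \<i> * of_int n / of_real l) *
           (exp (2 * of_real pi * \<i> * of_int n * of_real (ln \<alpha>) / of_real l) / of_int n ^ (k + 1)) = - (\<phi> (1 / of_int n) * ?W n)"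
    if n: "n \<noteq> 0" for n
  proof -
    define t where "t = 2 * pi * of_int n / l"
    define s where "s = - of_nat k + \<i> * complex_of_real t"
    have s': "- of_nat k + 2 * of_real pi * \<i> * of_int n / of_real l = s"
      by (simp add: s_def t_def)
    \<comment> \<open>Multiplication by \<open>b ^ r\<close> adds \<open>r\<close> full periods to
      the logarithm, so the character does not distinguish \<open>\<alpha>\<close> from
      \<open>a\<close>.\<close>
    have "ln \<alpha> = ln a + real r * l" using a b unfolding \<alpha> by (simp add: ln_mult ln_realpow l_def)
    then have "2 * of_real pi * \<i> * of_int n * of_real (ln \<alpha>) / of_real l = \<i> * of_real (t * ln a) + \<i> * of_real (2 * pi * of_int (n * int r))"
      using l by (simp add: t_def field_simps)
    moreover have "exp (\<i> * of_real (2 * pi * of_int (n * int r))) = 1"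
      unfolding cis_conv_exp[symmetric] by (rule cis_multiple_2pi) simp
    ultimately have e: "exp (2 * of_real pi * \<i> * of_int n * of_real (ln \<alpha>) / of_real l) = exp (\<i> * of_real (t * ln a))"
      by (simp add: exp_add)
    have "pochhammer s (Suc k) = (\<Prod>i\<le>k. s + of_nat (k - i))"
      unfolding pochhammer_Suc_prod_rev atLeast0AtMost ..
    also have "\<dots> = (\<Prod>i\<le>k. of_int n * (c - of_nat i * of_real (1 / of_int n)))"
    proof (intro prod.cong refl)
      fix i assume "i \<in> {..k}"
      then have "s + of_nat (k - i) = \<i> * of_real t - of_nat i" by (simp add: s_def of_nat_diff)
      also have "\<i> * of_real t = of_int n * c" by (simp add: t_def c_def)
      finally show "s + of_nat (k - i) = of_int n * (c - of_nat i * of_real (1 / of_int n))"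
        using n by (simp add: right_diff_distrib)
    qed
    also have "\<dots> = of_int n ^ Suc k * \<phi> (1 / of_int n)" unfolding \<phi>_def prod.distrib by simp
    finally have p: "pochhammer s (Suc k) = of_int n ^ Suc k * \<phi> (1 / of_int n)" .
    have "zeta s * exp (\<i> * of_real (t * ln a)) = - (pochhammer s (Suc k) * ?W n)"
      using b' a n by (intro zeta_eq_inner) (auto simp: t_def l_def s_def)
    then have "zeta s * (exp (\<i> * of_real (t * ln a)) / of_int n ^ (k + 1)) = - (of_int n ^ Suc k * \<phi> (1 / of_int n) * ?W n) / of_int n ^ Suc k"
      unfolding p by simp
    also have "\<dots> = - (\<phi> (1 / of_int n) * ?W n)" using n by simp
    finally show ?thesis unfolding s' e .
  qed
  have set: "{n::int. 1 \<le> \<bar>n\<bar> \<and> \<bar>n\<bar> \<le> int N} = ?I N" for N by auto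
  obtain K where K: "\<And>N. norm ((\<Sum>n\<in>?I N. ?W n) - of_real (l * (\<Sum>j. dker_term (Suc k) (real b) a N j))) \<le> K"
    using sum_zeta_inner[OF b' a(1), of k] unfolding l_def by metis
  define u where "u n = (if k = 0 then 0 else C * (norm (?W (int n)) + norm (?W (- int n))))" for n
  have u: "u \<longlonglongrightarrow> 0"
  proof (cases "k = 0")
    case False
    then have "(\<lambda>n. C * (norm (?W (int n)) + norm (?W (- int n)))) \<longlonglongrightarrow> C * 0"
      using b' a by (intro tendsto_mult_left norm_zeta_inner_tendsto) auto
    then show ?thesis using False by (simp add: u_def[abs_def])
  qed (simp add: u_def[abs_def])
  have bound: "norm ((\<Sum>n\<in>?I N. - (\<phi> (1 / of_int n) * ?W n)) + c ^ Suc k * of_real l * of_real (\<Sum>j. dker_term (Suc k) (real b) a N j))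
      \<le> (\<Sum>n=1..N. u n / real n) + norm c ^ Suc k * K" for N
  proof -
    let ?D = "of_real (l * (\<Sum>j. dker_term (Suc k) (real b) a N j)) :: complex"
    have "(\<Sum>n\<in>?I N. - (\<phi> (1 / of_int n) * ?W n)) + c ^ Suc k * of_real l * of_real (\<Sum>j. dker_term (Suc k) (real b) a N j)
      = - (\<Sum>n\<in>?I N. (\<phi> (1 / of_int n) - c ^ Suc k) * ?W n) - c ^ Suc k * ((\<Sum>n\<in>?I N. ?W n) - ?D)"
      by (simp add: sum_negf sum_subtractf sum_distrib_left algebra_simps)
    also have "norm \<dots> \<le> norm (\<Sum>n\<in>?I N. (\<phi> (1 / of_int n) - c ^ Suc k) * ?W n) + norm (c ^ Suc k * ((\<Sum>n\<in>?I N. ?W n) - ?D))"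
      by (rule order_trans[OF norm_triangle_ineq4]) simp
    also have "norm (c ^ Suc k * ((\<Sum>n\<in>?I N. ?W n) - ?D)) \<le> norm c ^ Suc k * K"
      unfolding norm_mult norm_power using K[of N] by (intro mult_left_mono) auto
    also have "norm (\<Sum>n\<in>?I N. (\<phi> (1 / of_int n) - c ^ Suc k) * ?W n) \<le> (\<Sum>n=1..N. u n / real n)"
      unfolding sum_symmetric_int
    proof (rule sum_norm_le)
      fix n assume n: "n \<in> {1..N}"
      have x: "\<bar>1 / real_of_int (int n)\<bar> \<le> 1" "\<bar>1 / real_of_int (- int n)\<bar> \<le> 1" using n by auto
      have "norm ((\<phi> (1 / of_int (int n)) - c ^ Suc k) * ?W (int n) + (\<phi> (1 / of_int (- int n)) - c ^ Suc k) * ?W (- int n))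
        \<le> norm (\<phi> (1 / of_int (int n)) - c ^ Suc k) * norm (?W (int n)) + norm (\<phi> (1 / of_int (- int n)) - c ^ Suc k) * norm (?W (- int n))"
        by (rule order_trans[OF norm_triangle_ineq]) (simp only: norm_mult order_refl)
      also have "\<dots> \<le> (if k = 0 then 0 else C * \<bar>1 / real_of_int (int n)\<bar>) * norm (?W (int n)) + (if k = 0 then 0 else C * \<bar>1 / real_of_int (- int n)\<bar>) * norm (?W (- int n))"
        by (intro add_mono mult_right_mono C(2) x norm_ge_zero)
      also have "\<dots> = u n / real n" using n by (simp add: u_def field_simps)
      finally show "norm ((\<phi> (1 / of_int (int n)) - c ^ Suc k) * ?W (int n) + (\<phi> (1 / of_int (- int n)) - c ^ Suc k) * ?W (- int n)) \<le> u n / real n" .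
    qed
    finally show ?thesis by simp
  qed
  have lim: "(\<lambda>N. (\<Sum>n=1..N. u n / real n) / ln (real N) + norm c ^ Suc k * K * (1 / ln (real N))) \<longlonglongrightarrow> 0 + norm c ^ Suc k * K * 0"
    by (intro tendsto_add tendsto_mult_left tendsto_sum_over_log u) real_asymp
  have "(\<lambda>N::nat. 1 / complex_of_real (ln (real N)) * (\<Sum>n\<in>?I N. - (\<phi> (1 / of_int n) * ?W n))
     + c ^ Suc k * of_real l * of_real ((\<Sum>j. dker_term (Suc k) (real b) a N j) / ln (real N))) \<longlonglongrightarrow> 0"
  proof (rule Lim_null_comparison)
    show "(\<lambda>N. (\<Sum>n=1..N. u n / real n) / ln (real N) + norm c ^ Suc k * K * (1 / ln (real N))) \<longlonglongrightarrow> 0" using lim by simp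
    show "\<forall>\<^sub>F N in sequentially. norm (1 / complex_of_real (ln (real N)) * (\<Sum>n\<in>?I N. - (\<phi> (1 / of_int n) * ?W n))
     + c ^ Suc k * of_real l * of_real ((\<Sum>j. dker_term (Suc k) (real b) a N j) / ln (real N)))
      \<le> (\<Sum>n=1..N. u n / real n) / ln (real N) + norm c ^ Suc k * K * (1 / ln (real N))"
      using eventually_ge_at_top[of "2::nat"]
    proof eventually_elim
      case (elim N)
      then have ln: "ln (real N) > 0" by simp
      have "1 / complex_of_real (ln (real N)) * (\<Sum>n\<in>?I N. - (\<phi> (1 / of_int n) * ?W n))
         + c ^ Suc k * of_real l * of_real ((\<Sum>j. dker_term (Suc k) (real b) a N j) / ln (real N))
        = ((\<Sum>n\<in>?I N. - (\<phi> (1 / of_int n) * ?W n)) + c ^ Suc k * of_real l * of_real (\<Sum>j. dker_term (Suc k) (real b) a N j)) / of_real (ln (real N))"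
        by (simp add: add_divide_distrib)
      also have "norm \<dots> \<le> ((\<Sum>n=1..N. u n / real n) + norm c ^ Suc k * K) / ln (real N)"
        unfolding norm_divide using bound[of N] ln by (simp add: divide_right_mono)
      finally show ?case by (simp add: add_divide_distrib)
    qed
  qed
  moreover have "(\<Sum>n\<in>?I N. - (\<phi> (1 / of_int n) * ?W n)) = (\<Sum>n\<in>?I N. zeta (- of_nat k + 2 * of_real pi * \<i> * of_int n / of_real l) *
           (exp (2 * of_real pi * \<i> * of_int n * of_real (ln \<alpha>) / of_real l) / of_int n ^ (k + 1)))" for N
    by (intro sum.cong refl term_eq[symmetric]) auto
  ultimately show ?thesis unfolding set l_def[symmetric] c_def[symmetric] by simp
qed

section \<open>Averages along sequences\<close>

definition mean_tendsto :: "(nat \<Rightarrow> 'a::real_normed_vector) \<Rightarrow> 'a \<Rightarrow> bool" where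
  "mean_tendsto f L \<longleftrightarrow> (\<lambda>n. (\<Sum>i<n. f i) /\<^sub>R real n) \<longlonglongrightarrow> L"

lemma mean_tendsto_const: "mean_tendsto (\<lambda>_. c) c"
proof -
  have "eventually (\<lambda>n::nat. c = (\<Sum>i<n. c) /\<^sub>R real n) sequentially"
    using eventually_gt_at_top[of 0] by eventually_elim (simp add: scaleR_conv_of_real sum_constant_scaleR)
  then show ?thesis unfolding mean_tendsto_def by (rule Lim_transform_eventually[OF tendsto_const])
qed

lemma mean_tendsto_add: "mean_tendsto f L \<Longrightarrow> mean_tendsto g M \<Longrightarrow> mean_tendsto (\<lambda>i. f i + g i) (L + M)"
  unfolding mean_tendsto_def sum.distrib scaleR_add_right by (rule tendsto_add)

lemma mean_tendsto_linear:
  assumes "bounded_linear h" "mean_tendsto f L"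
  shows "mean_tendsto (\<lambda>i. h (f i)) (h L)"
proof -
  interpret bounded_linear h by fact
  have "(\<lambda>n. h ((\<Sum>i<n. f i) /\<^sub>R real n)) \<longlonglongrightarrow> h L"
    using assms(2) unfolding mean_tendsto_def by (rule tendsto)
  then show ?thesis by (simp add: mean_tendsto_def scaleR sum)
qed

lemma mean_tendsto_sum: "finite A \<Longrightarrow> (\<And>a. a \<in> A \<Longrightarrow> mean_tendsto (f a) (L a)) \<Longrightarrow> mean_tendsto (\<lambda>i. \<Sum>a\<in>A. f a i) (\<Sum>a\<in>A. L a)"
  by (induction A rule: finite_induct) (auto intro: mean_tendsto_add mean_tendsto_const)

text \<open>This and its converse restate convergence without a division by \<open>n\<close>, the
  form in which errors of partial sums are added up below.\<close>

lemma mean_tendsto_approx: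
  fixes f :: "nat \<Rightarrow> 'a::real_normed_vector"
  assumes "\<And>e. e > 0 \<Longrightarrow> \<exists>N. \<forall>n\<ge>N. norm ((\<Sum>i<n. f i) - real n *\<^sub>R L) \<le> e * real n"
  shows "mean_tendsto f L"
  unfolding mean_tendsto_def
proof (rule LIMSEQ_I)
  fix e :: real assume e: "e > 0"
  then obtain N where N: "\<And>n. n \<ge> N \<Longrightarrow> norm ((\<Sum>i<n. f i) - real n *\<^sub>R L) \<le> e / 2 * real n"
    using assms[of "e / 2"] by auto
  have "norm ((\<Sum>i<n. f i) /\<^sub>R real n - L) < e" if n: "n \<ge> max N 1" for n
  proof -
    have "(\<Sum>i<n. f i) /\<^sub>R real n - L = ((\<Sum>i<n. f i) - real n *\<^sub>R L) /\<^sub>R real n"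
      using n by (simp add: scaleR_diff_right)
    then have "norm ((\<Sum>i<n. f i) /\<^sub>R real n - L) = norm ((\<Sum>i<n. f i) - real n *\<^sub>R L) / real n"
      by (simp add: divide_inverse mult.commute)
    also have "\<dots> \<le> e / 2" using N[of n] n by (simp add: field_simps)
    finally show ?thesis using e by simp
  qed
  then show "\<exists>N. \<forall>n\<ge>N. norm ((\<Sum>i<n. f i) /\<^sub>R real n - L) < e" by blast
qed

lemma mean_tendstoD:
  fixes f :: "nat \<Rightarrow> 'a::real_normed_vector"
  assumes "mean_tendsto f L" "e > 0"
  shows "\<exists>N. \<forall>n\<ge>N. norm ((\<Sum>i<n. f i) - real n *\<^sub>R L) \<le> e * real n"
proof -
  obtain N where N: "\<And>n. n \<ge> N \<Longrightarrow> norm ((\<Sum>i<n. f i) /\<^sub>R real n - L) < e"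
    using LIMSEQ_D[OF assms(1)[unfolded mean_tendsto_def] assms(2)] by auto
  have "norm ((\<Sum>i<n. f i) - real n *\<^sub>R L) \<le> e * real n" if n: "n \<ge> N" for n
  proof (cases "n = 0")
    case False
    then have "(\<Sum>i<n. f i) - real n *\<^sub>R L = real n *\<^sub>R ((\<Sum>i<n. f i) /\<^sub>R real n - L)"
      by (simp add: scaleR_diff_right)
    then have "norm ((\<Sum>i<n. f i) - real n *\<^sub>R L) = real n * norm ((\<Sum>i<n. f i) /\<^sub>R real n - L)" by simp
    also have "\<dots> \<le> real n * e" using N[OF n] by (intro mult_left_mono) auto
    finally show ?thesis by (simp add: mult.commute)
  qed simp
  then show ?thesis by blast
qed

lemma mean_tendsto_shift:
  fixes f :: "nat \<Rightarrow> 'a::real_normed_vector"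
  assumes M: "\<And>i. norm (f i) \<le> M"
  shows "mean_tendsto (\<lambda>i. f (i + r)) L \<longleftrightarrow> mean_tendsto f L"
proof -
  have d: "norm ((\<Sum>i<n. f (i + r)) - (\<Sum>i<n. f i)) \<le> 2 * M * real r" for n
  proof -
    have s: "(\<Sum>i<n + r. f i) = (\<Sum>i<m. f i) + (\<Sum>i<k. f (i + m))" if "n + r = m + k" for m k
    proof -
      have "(\<Sum>i<m + k. f i) = (\<Sum>i<m. f i) + (\<Sum>i\<in>{m..<m + k}. f i)"
        using sum.atLeastLessThan_concat[of 0 m "m + k" f] by (simp add: lessThan_atLeast0)
      also have "(\<Sum>i\<in>{m..<m + k}. f i) = (\<Sum>i<k. f (i + m))"
        using sum.shift_bounds_nat_ivl[of f 0 m k] by (simp add: lessThan_atLeast0 add.commute)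
      finally show ?thesis using that by simp
    qed
    have "(\<Sum>i<n. f (i + r)) - (\<Sum>i<n. f i) = (\<Sum>i<r. f (i + n)) - (\<Sum>i<r. f i)"
      using s[of r n] s[of n r] by (simp add: add.commute algebra_simps)
    also have "norm \<dots> \<le> norm (\<Sum>i<r. f (i + n)) + norm (\<Sum>i<r. f i)" by (rule norm_triangle_ineq4)
    also have "\<dots> \<le> (\<Sum>i<r. M) + (\<Sum>i<r. M)" by (intro add_mono sum_norm_le M)
    finally show ?thesis by simp
  qed
  have lim: "(\<lambda>n. (\<Sum>i<n. f (i + r)) /\<^sub>R real n - (\<Sum>i<n. f i) /\<^sub>R real n) \<longlonglongrightarrow> 0"
  proof (rule Lim_null_comparison)
    show "(\<lambda>n. 2 * M * real r / real n) \<longlonglongrightarrow> 0" by real_asymp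
    have "norm ((\<Sum>i<n. f (i + r)) /\<^sub>R real n - (\<Sum>i<n. f i) /\<^sub>R real n) \<le> 2 * M * real r / real n" for n
      using d[of n] by (simp flip: scaleR_diff_right add: divide_inverse mult.commute mult_left_mono)
    then show "\<forall>\<^sub>F n in sequentially. norm ((\<Sum>i<n. f (i + r)) /\<^sub>R real n - (\<Sum>i<n. f i) /\<^sub>R real n) \<le> 2 * M * real r / real n"
      by (intro always_eventually allI)
  qed
  show ?thesis unfolding mean_tendsto_def using Lim_transform[OF _ lim] Lim_transform2[OF _ lim] by blast
qed

section \<open>Digits and orbits\<close>

text \<open>Irrationality excludes a tail of digits all equal to \<open>B - 1\<close>, so the floor
  of \<open>B ^ n * x\<close> is the integer \<open>I n\<close> formed by the digits up to position
  \<open>n\<close>. The recursion for \<open>I\<close> then reads off the next digit; in particular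
  the digits at positive positions are determined by \<open>x\<close>.\<close>

lemma adic_digit:
  assumes B: "B \<ge> 2" and E: "adic_expansion B x m c" and x: "x \<notin> \<rat>"
  shows "int (c (int (Suc n))) = \<lfloor>real B * frac (real B ^ n * x)\<rfloor>"
proof -
  define d where "d j = real (c (int j - int m)) * real B powi (- (int j - int m))" for j
  have dig: "c (int j - int m) < B" for j using E by (simp add: adic_expansion_def)
  have ds: "d sums x" using E unfolding adic_expansion_def d_def by blast
  have B0: "real B > 0" "real B \<noteq> 0" using B by auto
  define I where "I n = (\<Sum>j<Suc (n + m). int (c (int j - int m)) * int B ^ (n + m - j))" for n
  have fl: "\<lfloor>real B ^ n * x\<rfloor> = I n" for n
  proof -
    have pw: "real B ^ n * real B powi (- (int j - int m)) = real B powi (int (n + m) - int j)" for j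
      using power_int_add[of "real B" "int n" "- (int j - int m)"] B0 by (simp add: power_int_of_nat algebra_simps)
    have head: "real B ^ n * d j = real_of_int (int (c (int j - int m)) * int B ^ (n + m - j))" if "j < Suc (n + m)" for j
    proof -
      have "int (n + m) - int j = int (n + m - j)" using that by linarith
      then have "real B ^ n * real B powi (- (int j - int m)) = real B ^ (n + m - j)"
        unfolding pw by (simp only: power_int_of_nat)
      then show ?thesis by (simp add: d_def mult.left_commute)
    qed
    have tl: "real B ^ n * d (i + Suc (n + m)) = real (c (int (i + Suc (n + m)) - int m)) * (1 / real B) ^ Suc i" for i
    proof -
      have e: "int (n + m) - int (i + Suc (n + m)) = - int (Suc i)" by simp
      have pe: "real B ^ n * real B powi (- (int (i + Suc (n + m)) - int m)) = (1 / real B) ^ Suc i"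
        unfolding pw e by (simp only: power_int_minus power_int_of_nat) (simp add: power_divide inverse_eq_divide)
      show ?thesis unfolding d_def mult.left_commute[of "real B ^ n"] pe ..
    qed
    have sm: "(\<lambda>j. real B ^ n * d j) sums (real B ^ n * x)" by (intro sums_mult ds)
    define T where "T = (\<Sum>i. real B ^ n * d (i + Suc (n + m)))"
    have eq: "real B ^ n * x = T + of_int (I n)"
    proof -
      have "real B ^ n * x = T + (\<Sum>j<Suc (n + m). real B ^ n * d j)"
        unfolding T_def using suminf_split_initial_segment[OF sums_summable[OF sm], of "Suc (n + m)"] sums_unique[OF sm] by simp
      also have "(\<Sum>j<Suc (n + m). real B ^ n * d j) = of_int (I n)"
        unfolding I_def of_int_sum by (intro sum.cong refl head) auto
      finally show ?thesis .
    qed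
    have st: "summable (\<lambda>i. real B ^ n * d (i + Suc (n + m)))"
      using summable_iff_shift[of "\<lambda>j. real B ^ n * d j" "Suc (n + m)"] sums_summable[OF sm] by blast
    have geo: "(\<lambda>i. (real B - 1) * ((1 / real B) * (1 / real B) ^ i)) sums ((real B - 1) * ((1 / real B) * (1 / (1 - 1 / real B))))"
      using B by (intro sums_mult geometric_sums) auto
    have geo1: "(real B - 1) * ((1 / real B) * (1 / (1 - 1 / real B))) = 1" using B by (simp add: field_simps)
    have T0: "T \<ge> 0" unfolding T_def
    proof (rule suminf_nonneg[OF st])
      show "0 \<le> real B ^ n * d (i + Suc (n + m))" for i unfolding tl by simp
    qed
    have "T \<le> (\<Sum>i. (real B - 1) * ((1 / real B) * (1 / real B) ^ i))"
      unfolding T_def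
    proof (rule suminf_le[OF _ st sums_summable[OF geo]])
      fix i
      have "real (c (int (i + Suc (n + m)) - int m)) \<le> real B - 1" using dig[of "i + Suc (n + m)"] by linarith
      then show "real B ^ n * d (i + Suc (n + m)) \<le> (real B - 1) * ((1 / real B) * (1 / real B) ^ i)"
        unfolding tl power_Suc by (intro mult_right_mono) auto
    qed
    then have T1: "T \<le> 1" using sums_unique[OF geo] geo1 by simp
    \<comment> \<open>The tail is at most \<open>1\<close>, and equality would make \<open>x\<close>
      rational.\<close>
    have "T \<noteq> 1"
    proof
      assume "T = 1"
      then have "real B ^ n * x = of_int (1 + I n)" using eq by simp
      then have "x = of_int (1 + I n) / real B ^ n" using B0 by (simp add: field_simps)
      then show False using x by (metis Rats_divide Rats_of_int Rats_of_nat Rats_power)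
    qed
    then show ?thesis using T0 T1 eq by (intro floor_unique) auto
  qed
  have step: "I (Suc n) = int B * I n + int (c (int (Suc n)))"
  proof -
    have "I (Suc n) = (\<Sum>j<Suc (n + m). int (c (int j - int m)) * int B ^ (Suc n + m - j)) + int (c (int (Suc (n + m)) - int m))"
      by (simp add: I_def)
    also have "(\<Sum>j<Suc (n + m). int (c (int j - int m)) * int B ^ (Suc n + m - j)) = int B * I n"
      unfolding I_def sum_distrib_left by (intro sum.cong refl) (simp add: Suc_diff_le mult_ac)
    also have "int (Suc (n + m)) - int m = int (Suc n)" by simp
    finally show ?thesis .
  qed
  have "real B * frac (real B ^ n * x) = real B ^ Suc n * x - of_int (int B * I n)"
    unfolding frac_def fl by (simp add: algebra_simps)
  then have "\<lfloor>real B * frac (real B ^ n * x)\<rfloor> = \<lfloor>real B ^ Suc n * x\<rfloor> - int B * I n"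
    by (simp only: floor_diff_of_int)
  then show ?thesis unfolding fl step by simp
qed

text \<open>Shifting the point by \<open>Suc m\<close> places brings \<open>x\<close> into the unit
  interval. There the digits are the increments
  \<open>\<lfloor>y (Suc j)\<rfloor> - B * \<lfloor>y j\<rfloor>\<close>, and the partial sums
  telescope to truncations of \<open>z\<close>.\<close>

lemma adic_expansion_exists:
  assumes B: "B \<ge> 2" and x: "x > 0"
  shows "\<exists>m c. adic_expansion B x m c"
proof -
  have B0: "real B > 0" "real B \<ge> 2" using B by auto
  define m where "m = nat \<lceil>x\<rceil>"
  have xm: "x < real B ^ Suc m"
  proof -
    have "x \<le> real m" using x by (simp add: m_def)
    also have "\<dots> < real m + 1" by simp
    also have "\<dots> \<le> real B ^ m" by (rule power_ge_Suc) (rule B0)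
    also have "\<dots> \<le> real B ^ Suc m" using B by (intro power_increasing) auto
    finally show ?thesis .
  qed
  define z where "z = x / real B ^ Suc m"
  have z: "0 < z" "z < 1" using x xm B0 by (auto simp: z_def)
  define y where "y j = real B ^ j * z" for j
  have y0: "y j \<ge> 0" for j using z B0 by (simp add: y_def)
  have yS: "y (Suc j) = real B * y j" for j by (simp add: y_def)
  define e where "e j = \<lfloor>y (Suc j)\<rfloor> - int B * \<lfloor>y j\<rfloor>" for j
  have ee: "e j = \<lfloor>real B * frac (y j)\<rfloor>" for j
  proof -
    have "real B * frac (y j) = y (Suc j) - of_int (int B * \<lfloor>y j\<rfloor>)" by (simp add: frac_def yS algebra_simps)
    then show ?thesis unfolding e_def by (simp only: floor_diff_of_int)
  qed
  have e0: "0 \<le> e j" "e j < int B" for j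
  proof -
    show "0 \<le> e j" unfolding ee using B0 by simp
    have "real B * frac (y j) < real B" using frac_lt_1[of "y j"] B0 by simp
    then show "e j < int B" unfolding ee by (simp add: floor_less_iff)
  qed
  define c where "c i = nat (e (nat (i + int m)))" for i
  have cj: "c (int j - int m) = nat (e j)" for j by (simp add: c_def)
  have part: "(\<Sum>j<n. real (nat (e j)) * (1 / real B) ^ Suc j) = of_int \<lfloor>y n\<rfloor> * (1 / real B) ^ n" for n
  proof (induction n)
    case 0 show ?case using z by (simp add: y_def floor_eq_iff)
  next
    case (Suc n)
    have en: "real (nat (e n)) = of_int \<lfloor>y (Suc n)\<rfloor> - real B * of_int \<lfloor>y n\<rfloor>" using e0(1)[of n] by (simp add: e_def)
    have "u * W + (v - real B * u) * ((1 / real B) * W) = v * ((1 / real B) * W)" for u v W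
      using B0 by (simp add: left_diff_distrib diff_divide_distrib)
    then show ?case unfolding sum.lessThan_Suc Suc en unfolding power_Suc .
  qed
  have "(\<lambda>n. \<Sum>j<n. real (nat (e j)) * (1 / real B) ^ Suc j) \<longlonglongrightarrow> z"
    unfolding part
  proof (rule LIMSEQ_I)
    fix \<epsilon> :: real assume \<epsilon>: "\<epsilon> > 0"
    have "(\<lambda>n. (1 / real B) ^ n) \<longlonglongrightarrow> 0" using B by (intro LIMSEQ_power_zero) auto
    then obtain N where N: "\<And>n. n \<ge> N \<Longrightarrow> norm ((1 / real B) ^ n - 0) < \<epsilon>" using LIMSEQ_D[OF _ \<epsilon>] by blast
    have "norm (of_int \<lfloor>y n\<rfloor> * (1 / real B) ^ n - z) < \<epsilon>" if n: "n \<ge> N" for n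
    proof -
      have "z = y n * (1 / real B) ^ n" using B0 by (simp add: y_def power_divide)
      then have "of_int \<lfloor>y n\<rfloor> * (1 / real B) ^ n - z = - (frac (y n) * (1 / real B) ^ n)" by (simp add: frac_def algebra_simps)
      then have "norm (of_int \<lfloor>y n\<rfloor> * (1 / real B) ^ n - z) = frac (y n) * (1 / real B) ^ n" using B0 by (simp add: abs_mult)
      also have "\<dots> \<le> 1 * (1 / real B) ^ n" using frac_lt_1[of "y n"] B0 by (intro mult_right_mono) auto
      also have "\<dots> < \<epsilon>" using N[OF n] B0 by simp
      finally show ?thesis .
    qed
    then show "\<exists>N. \<forall>n\<ge>N. norm (of_int \<lfloor>y n\<rfloor> * (1 / real B) ^ n - z) < \<epsilon>" by blast
  qed
  then have "(\<lambda>j. real (nat (e j)) * (1 / real B) ^ Suc j) sums z" by (simp add: sums_def)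
  then have "(\<lambda>j. real B ^ Suc m * (real (nat (e j)) * (1 / real B) ^ Suc j)) sums (real B ^ Suc m * z)" by (rule sums_mult)
  moreover have "real B ^ Suc m * z = x" using B0 by (simp add: z_def)
  moreover have "real B ^ Suc m * (real (nat (e j)) * (1 / real B) ^ Suc j) = real (c (int j - int m)) * real B powi (- (int j - int m))" for j
  proof -
    have "real B powi (- (int j - int m)) = real B powi (int (Suc m) - int (Suc j))" by simp
    also have "\<dots> = real B ^ Suc m * (1 / real B) ^ Suc j"
      using B0 power_int_diff[of "real B" "int (Suc m)" "int (Suc j)"] by (simp only: power_int_of_nat) (simp add: power_divide)
    finally show ?thesis unfolding cj by (simp only: mult_ac)
  qed
  ultimately have "(\<lambda>j. real (c (int j - int m)) * real B powi (- (int j - int m))) sums x" by simp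
  moreover have "\<forall>i\<ge>- int m. c i < B" using e0 B by (auto simp: c_def) (metis nat_less_iff)
  ultimately show ?thesis unfolding adic_expansion_def by blast
qed


text \<open>The digit at position \<open>i + 1\<close> is read off from the orbit point at time
  \<open>i\<close>. The count over the positions \<open>0\<close> to \<open>l\<close> is therefore a
  sum over the first \<open>l\<close> orbit points plus the digit at \<open>0\<close>, which
  disappears after division by \<open>l\<close>.\<close>

lemma simply_normal_iff:
  assumes B: "B \<ge> 2" and x: "x > 0" "x \<notin> \<rat>"
  shows "simply_normal B x \<longleftrightarrow>
    (\<forall>a<B. mean_tendsto (\<lambda>i. if \<lfloor>real B * frac (real B ^ i * x)\<rfloor> = int a then 1 else 0) (1 / real B))"
proof -
  have eq: "(\<lambda>l. real (digit_count c l a) / real l) \<longlonglongrightarrow> 1 / real B \<longleftrightarrow>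
      mean_tendsto (\<lambda>i. if \<lfloor>real B * frac (real B ^ i * x)\<rfloor> = int a then 1 else 0) (1 / real B)"
    if E: "adic_expansion B x m c" for m c a
  proof -
    let ?g = "\<lambda>i. if \<lfloor>real B * frac (real B ^ i * x)\<rfloor> = int a then 1 else (0::real)"
    have cnt: "real (digit_count c l a) = (if c 0 = a then 1 else 0) + (\<Sum>i<l. ?g i)" for l
    proof -
      have "{0..int l} = int ` {..<Suc l}"
      proof (intro equalityI subsetI)
        fix i assume "i \<in> {0..int l}"
        then show "i \<in> int ` {..<Suc l}" by (intro image_eqI[of _ _ "nat i"]) auto
      qed auto
      then have "{i \<in> {0..int l}. c i = a} = int ` {i \<in> {..<Suc l}. c (int i) = a}" by auto
      then have "digit_count c l a = card {i \<in> {..<Suc l}. c (int i) = a}"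
        unfolding digit_count_def by (simp add: card_image)
      then have "real (digit_count c l a) = (\<Sum>i<Suc l. if c (int i) = a then 1 else 0)"
        by (simp only: sum.inter_filter[symmetric] finite_lessThan) simp
      also have "\<dots> = (if c 0 = a then 1 else 0) + (\<Sum>i<l. if c (int (Suc i)) = a then 1 else 0)"
        by (subst sum.lessThan_Suc_shift) simp
      also have "(\<Sum>i<l. if c (int (Suc i)) = a then 1 else 0) = (\<Sum>i<l. ?g i)"
        by (intro sum.cong refl) (simp only: adic_digit[OF B E x(2), symmetric] of_nat_eq_iff)
      finally show ?thesis .
    qed
    have "(\<lambda>l. real (digit_count c l a) / real l - (\<Sum>i<l. ?g i) /\<^sub>R real l) \<longlonglongrightarrow> 0"
    proof (rule Lim_null_comparison)
      show "(\<lambda>l. 1 / real l) \<longlonglongrightarrow> 0" by real_asymp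
      have "norm (real (digit_count c l a) / real l - (\<Sum>i<l. ?g i) /\<^sub>R real l) \<le> 1 / real l" for l
      proof -
        have "(\<delta> + S) / L - inverse L * S = \<delta> / L" for \<delta> S L :: real
          by (simp add: divide_inverse algebra_simps)
        then have "real (digit_count c l a) / real l - (\<Sum>i<l. ?g i) /\<^sub>R real l = (if c 0 = a then 1 else 0) / real l"
          unfolding cnt real_scaleR_def .
        then show ?thesis by (simp only:) (simp add: divide_right_mono)
      qed
      then show "\<forall>\<^sub>F l in sequentially. norm (real (digit_count c l a) / real l - (\<Sum>i<l. ?g i) /\<^sub>R real l) \<le> 1 / real l"
        by (intro always_eventually allI)
    qed
    note lim = this
    show ?thesis unfolding mean_tendsto_def using Lim_transform[OF _ lim] Lim_transform2[OF _ lim] by blast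
  qed
  obtain m c where E: "adic_expansion B x m c" using adic_expansion_exists[OF B x(1)] by blast
  show ?thesis unfolding simply_normal_def using eq E by blast
qed

section \<open>Normality and averages of polynomials\<close>

lemma riemann_sum_le:
  fixes p P :: "real poly"
  assumes P: "pderiv P = p" and D: "D \<ge> 1"
    and K: "\<And>x y. x \<in> {0..1} \<Longrightarrow> y \<in> {0..1} \<Longrightarrow> \<bar>poly p x - poly p y\<bar> \<le> K * \<bar>x - y\<bar>"
  shows "\<bar>(\<Sum>c<D. poly p (real c / real D)) / real D - (poly P 1 - poly P 0)\<bar> \<le> K / real D"
proof -
  have K0: "K \<ge> 0" using order_trans[OF abs_ge_zero K[of 0 1]] by simp
  have tel: "poly P 1 - poly P 0 = (\<Sum>c<D. poly P (real (Suc c) / real D) - poly P (real c / real D))"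
    using D by (subst sum_lessThan_telescope) simp
  have one: "\<bar>poly p (real c / real D) / real D - (poly P (real (Suc c) / real D) - poly P (real c / real D))\<bar> \<le> K / real D / real D" if c: "c < D" for c
  proof -
    have lt: "real c / real D < real (Suc c) / real D" using D by (intro divide_strict_right_mono) auto
    obtain z where z: "real c / real D < z" "z < real (Suc c) / real D"
      "poly P (real (Suc c) / real D) - poly P (real c / real D) = (real (Suc c) / real D - real c / real D) * poly (pderiv P) z"
      using poly_MVT[OF lt] by blast
    have step: "real (Suc c) / real D - real c / real D = 1 / real D" by (simp add: diff_divide_distrib[symmetric])
    have c1: "0 \<le> real c / real D" "real (Suc c) / real D \<le> 1" using c D by auto
    have "poly p (real c / real D) / real D - (poly P (real (Suc c) / real D) - poly P (real c / real D)) = (poly p (real c / real D) - poly p z) / real D"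
      unfolding z(3) step P by (simp add: diff_divide_distrib)
    also have "\<bar>\<dots>\<bar> \<le> (K * \<bar>real c / real D - z\<bar>) / real D"
    proof -
      have "\<bar>poly p (real c / real D) - poly p z\<bar> \<le> K * \<bar>real c / real D - z\<bar>"
        using c1 z(1,2) unfolding atLeastAtMost_iff by (intro K) (unfold atLeastAtMost_iff, linarith+)
      then show ?thesis unfolding abs_divide abs_of_nat by (rule divide_right_mono) simp
    qed
    also have "\<dots> \<le> (K * (1 / real D)) / real D"
      using z step K0 by (intro divide_right_mono mult_left_mono) auto
    finally show ?thesis by simp
  qed
  have "(\<Sum>c<D. poly p (real c / real D)) / real D - (poly P 1 - poly P 0) =
      (\<Sum>c<D. poly p (real c / real D) / real D - (poly P (real (Suc c) / real D) - poly P (real c / real D)))"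
    unfolding tel by (simp only: sum_subtractf sum_divide_distrib)
  also have "\<bar>\<dots>\<bar> \<le> (\<Sum>c<D. K / real D / real D)"
    by (rule order_trans[OF sum_abs], rule sum_mono, rule one) simp
  also have "\<dots> = K / real D" using D by simp
  finally show ?thesis .
qed

lemma poly_lipschitz_unit:
  fixes p :: "real poly"
  obtains K where "K \<ge> 0" "\<And>x y. x \<in> {0..1} \<Longrightarrow> y \<in> {0..1} \<Longrightarrow> \<bar>poly p x - poly p y\<bar> \<le> K * \<bar>x - y\<bar>"
    "\<And>x. x \<in> {0..1} \<Longrightarrow> \<bar>poly p x\<bar> \<le> K"
proof -
  have bd: "\<exists>C. \<forall>x\<in>{0..1}. \<bar>poly q x\<bar> \<le> C" for q :: "real poly"
  proof -
    have "compact (poly q ` {0..1})" by (intro compact_continuous_image continuous_intros) auto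
    then obtain C where "\<forall>y\<in>poly q ` {0..1}. norm y \<le> C" using compact_imp_bounded bounded_iff by metis
    then show ?thesis by (intro exI[of _ C]) auto
  qed
  obtain C1 where C1': "\<forall>x\<in>{0..1}. \<bar>poly p x\<bar> \<le> C1" using bd[of p] by (elim exE)
  obtain C2 where C2': "\<forall>x\<in>{0..1}. \<bar>poly (pderiv p) x\<bar> \<le> C2" using bd[of "pderiv p"] by (elim exE)
  note C1 = bspec[OF C1'] and C2 = bspec[OF C2']
  have pos: "C1 \<ge> 0" "C2 \<ge> 0" using order_trans[OF abs_ge_zero C1[of 0]] order_trans[OF abs_ge_zero C2[of 0]] by auto
  show ?thesis
  proof (rule that[of "C1 + C2"])
    fix x y :: real assume xy: "x \<in> {0..1}" "y \<in> {0..1}"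
    have "norm (poly p x - poly p y) \<le> C2 * norm (x - y)"
    proof (rule field_differentiable_bound[where S = "{0..1}" and f' = "poly (pderiv p)"])
      show "(poly p has_field_derivative poly (pderiv p) z) (at z within {0..1})" for z
        using poly_DERIV[of p z] by (rule has_field_derivative_at_within)
    qed (use C2 xy in auto)
    also have "\<dots> \<le> (C1 + C2) * norm (x - y)" using pos by (intro mult_right_mono) auto
    finally show "\<bar>poly p x - poly p y\<bar> \<le> (C1 + C2) * \<bar>x - y\<bar>" by simp
  next
    show "\<bar>poly p x\<bar> \<le> C1 + C2" if "x \<in> {0..1}" for x using C1[OF that] pos by simp
  qed (use pos in simp)
qed

lemma sum_mod_period: "(\<Sum>a<E * D. f (a mod D)) = of_nat E * (\<Sum>c<D. f c)" for f :: "nat \<Rightarrow> real"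
proof (induction E)
  case (Suc E)
  have "(\<Sum>a<Suc E * D. f (a mod D)) = (\<Sum>a\<in>{0..<E * D}. f (a mod D)) + (\<Sum>a\<in>{E * D..<E * D + D}. f (a mod D))"
    using sum.atLeastLessThan_concat[of 0 "E * D" "E * D + D" "\<lambda>a. f (a mod D)"] by (simp add: lessThan_atLeast0 add.commute)
  also have "(\<Sum>a\<in>{E * D..<E * D + D}. f (a mod D)) = (\<Sum>c\<in>{0..<D}. f ((c + E * D) mod D))"
    using sum.shift_bounds_nat_ivl[of "\<lambda>a. f (a mod D)" 0 "E * D" D] by (simp add: add.commute)
  also have "\<dots> = (\<Sum>c<D. f c)" unfolding lessThan_atLeast0 by (intro sum.cong refl) simp
  also have "(\<Sum>a\<in>{0..<E * D}. f (a mod D)) = (\<Sum>a<E * D. f (a mod D))" unfolding lessThan_atLeast0 ..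
  finally show ?case using Suc by (simp add: distrib_right)
qed simp

text \<open>Averages over the residue classes modulo \<open>r\<close> are put together. The errors
  \<open>\<delta> q\<close> may be large for some classes, since only \<open>\<Delta> / r\<close>
  enters.\<close>

lemma mean_blocks:
  fixes f :: "nat \<Rightarrow> real"
  assumes r: "r \<ge> 1" and M: "\<And>i. \<bar>f i - \<mu>\<bar> \<le> M"
    and blocks: "\<And>q e. q < r \<Longrightarrow> e > 0 \<Longrightarrow> \<exists>N. \<forall>n\<ge>N. \<bar>(\<Sum>i<n. f (i * r + q)) - real n * \<mu>\<bar> \<le> (\<delta> q + e) * real n"
    and \<Delta>: "(\<Sum>q<r. \<delta> q) \<le> \<Delta>" "\<Delta> \<ge> 0" and e: "e > 0"
  shows "\<exists>N. \<forall>n\<ge>N. \<bar>(\<Sum>j<n. f j) - real n * \<mu>\<bar> \<le> (\<Delta> / real r + e) * real n"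
proof -
  have M0: "M \<ge> 0" using order_trans[OF abs_ge_zero M[of 0]] .
  have "\<forall>q\<in>{..<r}. \<exists>N. \<forall>n\<ge>N. \<bar>(\<Sum>i<n. f (i * r + q)) - real n * \<mu>\<bar> \<le> (\<delta> q + e / 2) * real n"
    using blocks[of _ "e / 2"] e by auto
  from bchoice[OF this] obtain N where N: "\<forall>q\<in>{..<r}. \<forall>n\<ge>N q. \<bar>(\<Sum>i<n. f (i * r + q)) - real n * \<mu>\<bar> \<le> (\<delta> q + e / 2) * real n"
    by (elim exE)
  define N1 where "N1 = Max (N ` {..<r})"
  have N1: "N q \<le> N1" if "q < r" for q unfolding N1_def using that by (intro Max_ge) auto
  have main: "\<bar>(\<Sum>j<n. f j) - real n * \<mu>\<bar> \<le> (\<Delta> / real r + e) * real n"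
    if n: "n \<ge> N1 * r" "real n \<ge> 2 * M * real r / e" for n
  proof -
    define I s where "I = n div r" and "s = n mod r"
    have ns: "n = I * r + s" "s < r" using r by (auto simp: I_def s_def)
    have I: "I \<ge> N1" unfolding I_def using n r by (simp add: less_eq_div_iff_mult_less_eq)
    have "(\<Sum>j<I * r. f j) = (\<Sum>m<I. \<Sum>j\<in>{m * r..<m * r + r}. f j)" by (rule sum.nat_group[symmetric])
    also have "\<dots> = (\<Sum>m<I. \<Sum>q<r. f (m * r + q))"
    proof (rule sum.cong[OF refl])
      fix m
      show "(\<Sum>j\<in>{m * r..<m * r + r}. f j) = (\<Sum>q<r. f (m * r + q))"
        using sum.shift_bounds_nat_ivl[of f 0 "m * r" r] by (simp add: lessThan_atLeast0 add.commute)
    qed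
    also have "\<dots> = (\<Sum>q<r. \<Sum>m<I. f (m * r + q))" by (rule sum.swap)
    finally have grp: "(\<Sum>j<I * r. f j) = (\<Sum>q<r. \<Sum>m<I. f (m * r + q))" .
    have "\<bar>(\<Sum>j<I * r. f j) - real (I * r) * \<mu>\<bar> = \<bar>\<Sum>q<r. (\<Sum>m<I. f (m * r + q)) - real I * \<mu>\<bar>"
      unfolding grp by (simp add: sum_subtractf mult_ac)
    also have "\<dots> \<le> (\<Sum>q<r. (\<delta> q + e / 2) * real I)"
    proof (rule order_trans[OF sum_abs], rule sum_mono)
      fix q assume "q \<in> {..<r}"
      then show "\<bar>(\<Sum>m<I. f (m * r + q)) - real I * \<mu>\<bar> \<le> (\<delta> q + e / 2) * real I"
        using N N1[of q] I by auto
    qed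
    also have "\<dots> = ((\<Sum>q<r. \<delta> q) + real r * (e / 2)) * real I"
      by (simp add: sum_distrib_right[symmetric] sum.distrib)
    also have "\<dots> \<le> (\<Delta> + real r * (e / 2)) * real I" using \<Delta> by (intro mult_right_mono) auto
    also have "\<dots> = (\<Delta> / real r + e / 2) * (real r * real I)" using r by (simp add: field_simps)
    also have "\<dots> \<le> (\<Delta> / real r + e / 2) * real n"
      using \<Delta> e ns(1) by (intro mult_left_mono) (auto simp: mult.commute simp flip: of_nat_mult intro!: add_nonneg_nonneg)
    finally have 1: "\<bar>(\<Sum>j<I * r. f j) - real (I * r) * \<mu>\<bar> \<le> (\<Delta> / real r + e / 2) * real n" .
    have "(\<Sum>j<n. f j) = (\<Sum>j<I * r. f j) + (\<Sum>j\<in>{I * r..<n}. f j)"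
      using sum.atLeastLessThan_concat[of 0 "I * r" n f] ns by (simp add: lessThan_atLeast0)
    then have "(\<Sum>j<n. f j) - real n * \<mu> = ((\<Sum>j<I * r. f j) - real (I * r) * \<mu>) + (\<Sum>j\<in>{I * r..<n}. f j - \<mu>)"
      using ns(1) by (simp add: sum_subtractf algebra_simps)
    moreover have "\<bar>\<Sum>j\<in>{I * r..<n}. f j - \<mu>\<bar> \<le> M * real r"
    proof -
      have "\<bar>\<Sum>j\<in>{I * r..<n}. f j - \<mu>\<bar> \<le> (\<Sum>j\<in>{I * r..<n}. M)" by (rule order_trans[OF sum_abs], rule sum_mono, rule M)
      also have "\<dots> = real s * M" using ns(1) by simp
      also have "\<dots> \<le> real r * M" using ns(2) M0 by (intro mult_right_mono) auto
      finally show ?thesis by (simp add: mult.commute)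
    qed
    moreover have "M * real r \<le> e / 2 * real n" using n(2) e by (simp add: field_simps)
    ultimately have "\<bar>(\<Sum>j<n. f j) - real n * \<mu>\<bar> \<le> (\<Delta> / real r + e / 2) * real n + e / 2 * real n" using 1 by linarith
    then show ?thesis by (simp add: algebra_simps)
  qed
  show ?thesis
  proof (intro exI allI impI)
    fix n assume "n \<ge> max (N1 * r) (nat \<lceil>2 * M * real r / e\<rceil>)"
    then show "\<bar>(\<Sum>j<n. f j) - real n * \<mu>\<bar> \<le> (\<Delta> / real r + e) * real n" by (intro main) (simp, linarith)
  qed
qed

text \<open>In a block of \<open>r\<close> base-\<open>b\<close> digits a shift by \<open>q\<close>
  leaves the last \<open>r - q\<close> of them known; they form \<open>a mod b ^ (r - q)\<close> and
  fix the shifted point up to \<open>1 / b ^ (r - q)\<close>.\<close>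

lemma frac_power_digit:
  fixes b q r a :: nat and y :: real
  assumes b: "b \<ge> 2" and q: "q \<le> r" and y: "0 \<le> y" and a: "\<lfloor>real (b ^ r) * y\<rfloor> = int a"
  shows "real (a mod b ^ (r - q)) / real (b ^ (r - q)) \<le> frac (real b ^ q * y)"
    "frac (real b ^ q * y) < (real (a mod b ^ (r - q)) + 1) / real (b ^ (r - q))"
proof -
  define D where "D = b ^ (r - q)"
  have D: "D \<ge> 1" using b by (simp add: D_def)
  have BD: "b ^ r = b ^ q * D" using q by (simp add: D_def flip: power_add)
  have "real a \<le> real (b ^ r) * y" "real (b ^ r) * y < real a + 1" using a by linarith+
  then have ay: "real a \<le> real D * (real b ^ q * y)" "real D * (real b ^ q * y) < real a + 1"
    unfolding BD by (simp_all add: mult_ac)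
  define e c where "e = a div D" and "c = a mod D"
  have ac: "a = D * e + c" "c < D" using D by (auto simp: e_def c_def)
  have lo: "real c / real D \<le> real b ^ q * y - real e" and hi: "real b ^ q * y - real e < (real c + 1) / real D"
    using ay D unfolding ac(1) by (simp_all add: field_simps)
  have "0 \<le> real b ^ q * y - real e" using lo by (rule order_trans[rotated]) simp
  moreover have "(real c + 1) / real D \<le> 1" using ac(2) D by simp
  then have "real b ^ q * y - real e < 1" using hi by linarith
  ultimately have "frac (real b ^ q * y) = real b ^ q * y - real e" unfolding frac_unique_iff by simp
  with lo hi show "real (a mod b ^ (r - q)) / real (b ^ (r - q)) \<le> frac (real b ^ q * y)"
    "frac (real b ^ q * y) < (real (a mod b ^ (r - q)) + 1) / real (b ^ (r - q))"
    by (simp_all add: c_def D_def)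
qed

text \<open>Simple normality to base \<open>b ^ r\<close> controls the digit blocks that start at
  multiples of \<open>r\<close>. A time \<open>q\<close> inside a block is handled with the
  \<open>r - q\<close> digits still known. This is imprecise for \<open>q\<close> near
  \<open>r\<close>, but the errors form a geometric series bounded independently of
  \<open>r\<close>, and averaging over \<open>q\<close> divides it by \<open>r\<close>.\<close>

theorem normal_mean_poly:
  fixes p P :: "real poly"
  assumes b: "b \<ge> 2" and x: "x > 0" "x \<notin> \<rat>" and nb: "normal_to_base b x" and P: "pderiv P = p"
  shows "mean_tendsto (\<lambda>j. poly p (frac (real b ^ j * x))) (poly P 1 - poly P 0)"
proof (rule mean_tendsto_approx)
  fix e :: real assume e: "e > 0"
  obtain K where K: "K \<ge> 0" "\<And>x y. x \<in> {0..1} \<Longrightarrow> y \<in> {0..1} \<Longrightarrow> \<bar>poly p x - poly p y\<bar> \<le> K * \<bar>x - y\<bar>"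
    "\<And>x. x \<in> {0..1} \<Longrightarrow> \<bar>poly p x\<bar> \<le> K" using poly_lipschitz_unit[of p] by metis
  define \<mu> where "\<mu> = poly P 1 - poly P 0"
  \<comment> \<open>Large enough for the accumulated error \<open>2 * K\<close>, spread over a block
    of length \<open>r\<close>, to be at most \<open>e / 2\<close>.\<close>
  define r where "r = nat \<lceil>4 * K / e\<rceil> + 1"
  have r: "r \<ge> 1" "4 * K / e \<le> real r" unfolding r_def by linarith+
  define f where "f j = poly p (frac (real b ^ j * x))" for j
  have fr: "frac z \<in> {0..1}" for z :: real using frac_lt_1[of z] by simp
  define B where "B = b ^ r"
  have "b ^ 1 \<le> b ^ r" using b r by (intro power_increasing) auto
  then have B: "B \<ge> 2" using b by (simp add: B_def)
  have dig: "mean_tendsto (\<lambda>i. if \<lfloor>real B * frac (real B ^ i * x)\<rfloor> = int a then 1 else 0) (1 / real B)" if "a < B" for a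
    using nb r B that simply_normal_iff[OF B x] unfolding normal_to_base_def B_def by blast
  \<comment> \<open>One half is for replacing a point by its known digits, the other for the Riemann
    sum.\<close>
  define \<delta> where "\<delta> q = 2 * K / real (b ^ (r - q))" for q
  have blocks: "\<exists>N. \<forall>n\<ge>N. \<bar>(\<Sum>i<n. f (i * r + q)) - real n * \<mu>\<bar> \<le> (\<delta> q + e') * real n"
    if q: "q < r" and e': "e' > 0" for q e'
  proof -
    define D where "D = b ^ (r - q)"
    have D: "D \<ge> 1" using b by (simp add: D_def)
    have BD: "B = b ^ q * D" using q by (simp add: B_def D_def flip: power_add)
    define g where "g a = poly p (real (a mod D) / real D)" for a :: nat
    define d where "d i = nat \<lfloor>real B * frac (real B ^ i * x)\<rfloor>" for i
    have dd: "\<lfloor>real B * frac (real B ^ i * x)\<rfloor> = int (d i)" for i using B by (simp add: d_def)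
    have dB: "d i < B" for i
    proof -
      have "real B * frac (real B ^ i * x) < real B" using frac_lt_1[of "real B ^ i * x"] B by simp
      then have "\<lfloor>real B * frac (real B ^ i * x)\<rfloor> < int B" by (simp add: floor_less_iff)
      then show ?thesis unfolding dd by simp
    qed
    have gm: "mean_tendsto (\<lambda>i. g (d i)) ((\<Sum>c<D. poly p (real c / real D)) / real D)"
    proof -
      have "mean_tendsto (\<lambda>i. \<Sum>a<B. g a * (if \<lfloor>real B * frac (real B ^ i * x)\<rfloor> = int a then 1 else 0)) (\<Sum>a<B. g a * (1 / real B))"
        by (intro mean_tendsto_sum mean_tendsto_linear[OF bounded_linear_mult_right] dig) auto
      moreover have "(\<Sum>a<B. g a * (if \<lfloor>real B * frac (real B ^ i * x)\<rfloor> = int a then 1 else 0)) = g (d i)" for i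
      proof -
        have "(\<Sum>a<B. g a * (if \<lfloor>real B * frac (real B ^ i * x)\<rfloor> = int a then 1 else 0)) = (\<Sum>a<B. if a = d i then g a else 0)"
          unfolding dd by (intro sum.cong) auto
        then show ?thesis using dB by simp
      qed
      moreover have "(\<Sum>a<B. g a * (1 / real B)) = (\<Sum>c<D. poly p (real c / real D)) / real D"
      proof -
        have "(\<Sum>a<B. g a) = real (b ^ q) * (\<Sum>c<D. poly p (real c / real D))"
          unfolding BD g_def using sum_mod_period[of "\<lambda>c. poly p (real c / real D)" D "b ^ q"] by simp
        then show ?thesis using b unfolding sum_divide_distrib[symmetric] BD by (simp flip: sum_divide_distrib)
      qed
      ultimately show ?thesis by simp
    qed
    have fa: "frac (u + of_int k) = frac u" for u :: real and k by (simp add: frac_def)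
    have fg: "\<bar>f (i * r + q) - g (d i)\<bar> \<le> K / real D" for i
    proof -
      have "real b ^ (i * r + q) * x = real b ^ q * (real B ^ i * x)"
        by (simp add: B_def power_add power_mult mult_ac flip: power_mult)
      also have "\<dots> = real b ^ q * frac (real B ^ i * x) + of_int (int b ^ q * \<lfloor>real B ^ i * x\<rfloor>)"
        by (simp add: frac_def algebra_simps)
      finally have fx: "frac (real b ^ (i * r + q) * x) = frac (real b ^ q * frac (real B ^ i * x))"
        by (simp only: fa)
      have q': "q \<le> r" using q by simp
      note F = frac_power_digit[OF b q' frac_ge_0 dd[unfolded B_def], folded D_def]
      have cD: "real (d i mod D) / real D \<in> {0..1}" using D by (simp add: less_imp_le)
      have "\<bar>f (i * r + q) - g (d i)\<bar> \<le> K * \<bar>frac (real b ^ (i * r + q) * x) - real (d i mod D) / real D\<bar>"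
        unfolding f_def g_def by (rule K(2)[OF fr cD])
      also have "\<dots> \<le> K * (1 / real D)"
        unfolding fx using F[of i] K(1) D by (intro mult_left_mono) (auto simp: B_def add_divide_distrib)
      finally show ?thesis by simp
    qed
    obtain N where N: "\<And>n. n \<ge> N \<Longrightarrow> norm ((\<Sum>i<n. g (d i)) - real n *\<^sub>R ((\<Sum>c<D. poly p (real c / real D)) / real D)) \<le> e' * real n"
      using mean_tendstoD[OF gm e'] by auto
    have "\<bar>(\<Sum>i<n. f (i * r + q)) - real n * \<mu>\<bar> \<le> (\<delta> q + e') * real n" if n: "n \<ge> N" for n
    proof -
      let ?m = "(\<Sum>c<D. poly p (real c / real D)) / real D"
      have 1: "\<bar>(\<Sum>i<n. f (i * r + q)) - (\<Sum>i<n. g (d i))\<bar> \<le> real n * (K / real D)"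
      proof -
        have "\<bar>(\<Sum>i<n. f (i * r + q)) - (\<Sum>i<n. g (d i))\<bar> \<le> (\<Sum>i<n. K / real D)"
          unfolding sum_subtractf[symmetric] by (rule order_trans[OF sum_abs], rule sum_mono, rule fg)
        then show ?thesis by simp
      qed
      have 2: "\<bar>(\<Sum>i<n. g (d i)) - real n * ?m\<bar> \<le> e' * real n" using N[OF n] by simp
      have "\<bar>?m - \<mu>\<bar> \<le> K / real D" unfolding \<mu>_def by (rule riemann_sum_le[OF P D K(2)])
      then have "real n * \<bar>?m - \<mu>\<bar> \<le> real n * (K / real D)" by (intro mult_left_mono) auto
      then have 3: "\<bar>real n * ?m - real n * \<mu>\<bar> \<le> real n * (K / real D)"
        by (simp only: right_diff_distrib[symmetric] abs_mult abs_of_nat)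
      have tri: "\<bar>u - w\<bar> \<le> x + y + z" if "\<bar>u - v\<bar> \<le> x" "\<bar>v - t\<bar> \<le> y" "\<bar>t - w\<bar> \<le> z" for u v w t x y z :: real
        using that by linarith
      have "(\<delta> q + e') * real n = real n * (K / real D) + e' * real n + real n * (K / real D)"
        by (simp add: \<delta>_def D_def algebra_simps)
      then show ?thesis using tri[OF 1 2 3] by simp
    qed
    then show ?thesis by blast
  qed
  have geo: "(\<Sum>q<n. 1 / real (b ^ (n - q))) \<le> 1" for n
  proof (induction n)
    case (Suc n)
    have "(\<Sum>q<Suc n. 1 / real (b ^ (Suc n - q))) = (\<Sum>q<n. (1 / real b) * (1 / real (b ^ (n - q)))) + 1 / real b"
      by (simp add: Suc_diff_le)
    also have "\<dots> = (1 / real b) * (\<Sum>q<n. 1 / real (b ^ (n - q))) + 1 / real b" by (simp only: sum_distrib_left)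
    also have "\<dots> \<le> (1 / real b) * 1 + 1 / real b" using Suc by (intro add_right_mono mult_left_mono) auto
    also have "\<dots> \<le> 1" using b by (simp add: field_simps)
    finally show ?case .
  qed simp
  have \<Delta>: "(\<Sum>q<r. \<delta> q) \<le> 2 * K"
  proof -
    have "(\<Sum>q<r. \<delta> q) = 2 * K * (\<Sum>q<r. 1 / real (b ^ (r - q)))" by (simp add: \<delta>_def sum_distrib_left)
    also have "\<dots> \<le> 2 * K * 1" using geo K(1) by (intro mult_left_mono) auto
    finally show ?thesis by simp
  qed
  have "\<bar>f i - \<mu>\<bar> \<le> K + \<bar>\<mu>\<bar>" for i using K(3)[OF fr, of "real b ^ i * x"] unfolding f_def by linarith
  from mean_blocks[OF r(1) this blocks \<Delta>, of "e / 2"] e K(1)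
  obtain N where N: "\<And>n. n \<ge> N \<Longrightarrow> \<bar>(\<Sum>j<n. f j) - real n * \<mu>\<bar> \<le> (2 * K / real r + e / 2) * real n" by auto
  have "2 * K / real r + e / 2 \<le> e" using r e by (simp add: field_simps)
  then have "(2 * K / real r + e / 2) * real n \<le> e * real n" for n by (intro mult_right_mono) auto
  then show "\<exists>N. \<forall>n\<ge>N. norm ((\<Sum>i<n. poly p (frac (real b ^ i * x))) - real n *\<^sub>R (poly P 1 - poly P 0)) \<le> e * real n"
    using N unfolding f_def \<mu>_def by (intro exI[of _ N] allI impI) (simp, meson order_trans)
qed

text \<open>An even power of \<open>1 - 2 * y\<close> dominates, up to a factor \<open>2\<close>,
  the indicator of the points near the ends: its mean \<open>1 / (2 * real m + 1)\<close> is small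
  for large \<open>m\<close>, while at distance less than \<open>d\<close> from \<open>0\<close> or
  \<open>1\<close> it is still at least \<open>1 / 2\<close>.\<close>

lemma normal_near_integers:
  assumes b: "b \<ge> 2" and x: "x > 0" "x \<notin> \<rat>" and nb: "normal_to_base b x" and e: "e > 0"
  obtains d N where "d > 0" "\<And>n. n \<ge> N \<Longrightarrow>
    real (card {j. j < n \<and> \<not> (d \<le> frac (real b ^ j * x) \<and> d \<le> 1 - frac (real b ^ j * x))}) \<le> e * real n"
proof -
  define m where "m = nat \<lceil>4 / e\<rceil> + 1"
  have m: "m \<ge> 1" "4 / e \<le> real m" unfolding m_def by linarith+
  \<comment> \<open>Chosen so that Bernoulli's inequality for the exponent \<open>2 * m\<close>
    gives \<open>1 - 2 * m * (2 * d) = 1 / 2\<close>.\<close>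
  define d where "d = 1 / (8 * real m)"
  have d: "d > 0" "d \<le> 1/8" using m by (auto simp: d_def field_simps)
  define p where "p = [:1, -2 :: real:] ^ (2 * m)"
  define P where "P = smult (- 1 / (2 * (2 * real m + 1))) ([:1, -2:] ^ Suc (2 * m))"
  have P: "pderiv P = p"
    unfolding P_def pderiv_smult pderiv_power_Suc by (simp add: p_def pderiv_pCons field_simps)
  have mean: "poly P 1 - poly P 0 = 1 / (2 * real m + 1)"
    by (simp add: P_def poly_power field_simps)
  from normal_mean_poly[OF b x nb P]
  have "mean_tendsto (\<lambda>j. poly p (frac (real b ^ j * x))) (1 / (2 * real m + 1))" unfolding mean .
  from mean_tendstoD[OF this, of "e / 4"] e obtain N where
    N: "\<And>n. n \<ge> N \<Longrightarrow> \<bar>(\<Sum>i<n. poly p (frac (real b ^ i * x))) - real n * (1 / (2 * real m + 1))\<bar> \<le> e / 4 * real n" by auto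
  have pp: "poly p y = ((1 - 2 * y)\<^sup>2) ^ m" for y
  proof -
    have "poly p y = (1 - 2 * y) ^ (2 * m)" by (simp add: p_def poly_power mult.commute)
    then show ?thesis by (simp only: power_mult)
  qed
  have p0: "poly p y \<ge> 0" for y unfolding pp by simp
  have ph: "poly p y \<ge> 1/2" if y: "0 \<le> y" "y < 1" "\<not> (d \<le> y \<and> d \<le> 1 - y)" for y
  proof -
    have "1 - 2 * d \<le> \<bar>1 - 2 * y\<bar>" using y by linarith
    then have "(1 - 2 * d)\<^sup>2 \<le> \<bar>1 - 2 * y\<bar>\<^sup>2" using d by (intro power_mono) auto
    then have sq: "(1 - 2 * d)\<^sup>2 \<le> (1 - 2 * y)\<^sup>2" by (simp only: power2_abs)
    have "((1 - 2 * d)\<^sup>2) ^ m \<le> poly p y" unfolding pp by (rule power_mono[OF sq]) simp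
    moreover have "1/2 \<le> (1 + (- (2 * d))) ^ (2 * m)"
      using Bernoulli_inequality[of "- (2 * d)" "2 * m"] d m by (simp add: d_def)
    ultimately show ?thesis by (simp add: power_mult)
  qed
  have "real (card {j. j < n \<and> \<not> (d \<le> frac (real b ^ j * x) \<and> d \<le> 1 - frac (real b ^ j * x))}) \<le> e * real n"
    if n: "n \<ge> N" for n
  proof -
    let ?bad = "\<lambda>j. \<not> (d \<le> frac (real b ^ j * x) \<and> d \<le> 1 - frac (real b ^ j * x))"
    have "real (card {j. j < n \<and> ?bad j}) = (\<Sum>j\<in>{j. j < n \<and> ?bad j}. 1)" by simp
    also have "\<dots> \<le> (\<Sum>j\<in>{j. j < n \<and> ?bad j}. 2 * poly p (frac (real b ^ j * x)))"
    proof (rule sum_mono)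
      fix j assume "j \<in> {j. j < n \<and> ?bad j}"
      then have "poly p (frac (real b ^ j * x)) \<ge> 1/2" by (intro ph frac_ge_0 frac_lt_1) simp
      then show "1 \<le> 2 * poly p (frac (real b ^ j * x))" by simp
    qed
    also have "\<dots> \<le> (\<Sum>j<n. 2 * poly p (frac (real b ^ j * x)))" using p0 by (intro sum_mono2) auto
    also have "\<dots> = 2 * (\<Sum>j<n. poly p (frac (real b ^ j * x)))" by (simp only: sum_distrib_left)
    also have "\<dots> \<le> 2 * (real n * (1 / (2 * real m + 1)) + e / 4 * real n)"
      using N[OF n] by (intro mult_left_mono) linarith+
    also have "1 / (2 * real m + 1) \<le> e / 4" using m e by (simp add: field_simps)
    then have "2 * (real n * (1 / (2 * real m + 1)) + e / 4 * real n) \<le> 2 * (real n * (e / 4) + e / 4 * real n)"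
      by (intro mult_left_mono add_right_mono) auto
    also have "\<dots> = e * real n" by simp
    finally show ?thesis .
  qed
  then show ?thesis using that d(1) by blast
qed

section \<open>From averages of Bernoulli functions to normality\<close>

lemma bern_decomposition: "degree p \<le> n \<Longrightarrow> \<exists>c. p = (\<Sum>k\<le>n. smult (c k) (bern k))"
proof (induction n arbitrary: p)
  case 0
  then have "degree p = 0" by simp
  then obtain a where "p = [:a:]" by (elim degree_eq_zeroE)
  then show ?case by (intro exI[of _ "\<lambda>_. a"]) (simp add: one_pCons)
next
  case (Suc n)
  have "degree (pderiv p) \<le> n" using Suc.prems by (simp add: degree_pderiv)
  from Suc.IH[OF this] obtain c where c: "pderiv p = (\<Sum>k\<le>n. smult (c k) (bern k))" by blast
  define q where "q = (\<Sum>k\<le>n. smult (c k) (bern (Suc k)))"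
  have "pderiv (p - q) = 0" unfolding q_def pderiv_diff pderiv_sum c by (simp add: pderiv_smult)
  then have "degree (p - q) = 0" by (simp add: pderiv_eq_0_iff)
  then obtain d where d: "p - q = [:d:]" by (elim degree_eq_zeroE)
  have "p = q + [:d:]" using d by (simp add: algebra_simps)
  also have "\<dots> = (\<Sum>k\<le>Suc n. smult (case k of 0 \<Rightarrow> d | Suc j \<Rightarrow> c j) (bern k))"
    by (subst sum.atMost_Suc_shift) (simp add: q_def one_pCons add.commute)
  finally show ?case by blast
qed

lemma bern_increment: "poly (bern (Suc k)) 1 - poly (bern (Suc k)) 0 = (if k = 0 then 1 else 0)"
  using bern_0_eq_bern_1[of "Suc k"] by (auto simp: bern_1)

text \<open>Among the Bernoulli polynomials only that of index \<open>1\<close> has different values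
  at the two ends, so equal end values of \<open>p\<close> kill its coefficient; the terms of higher
  index have vanishing averages by assumption.\<close>

lemma mean_poly_periodic:
  assumes m: "\<And>k. k \<ge> 2 \<Longrightarrow> mean_tendsto (\<lambda>j. pbern k (x j)) 0"
    and P: "pderiv P = p" and per: "poly p 0 = poly p 1"
  shows "mean_tendsto (\<lambda>j. poly p (frac (x j))) (poly P 1 - poly P 0)"
proof -
  define n where "n = Suc (degree p)"
  have "degree p \<le> n" by (simp add: n_def)
  from bern_decomposition[OF this] obtain c where c: "p = (\<Sum>k\<le>n. smult (c k) (bern k))" by blast
  have ev: "poly p y = (\<Sum>k\<le>n. c k * poly (bern k) y)" for y
    by (subst c) (simp add: poly_sum)
  have "0 = (\<Sum>k\<le>n. c k * (poly (bern k) 1 - poly (bern k) 0))"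
    using per unfolding ev by (simp add: right_diff_distrib sum_subtractf)
  also have "\<dots> = (\<Sum>k\<le>degree p. c (Suc k) * (if k = 0 then 1 else 0))"
    unfolding n_def by (subst sum.atMost_Suc_shift) (simp only: bern_increment, simp)
  also have "\<dots> = c 1" by (simp add: if_distrib cong: if_cong)
  finally have c1: "c 1 = 0" ..
  have lim: "mean_tendsto (\<lambda>j. \<Sum>k\<le>n. c k * pbern k (x j)) (\<Sum>k\<le>n. if k = 0 then c 0 else 0)"
  proof (rule mean_tendsto_sum)
    fix k assume "k \<in> {..n}"
    consider "k = 0" | "k = 1" | "k \<ge> 2" by linarith
    then show "mean_tendsto (\<lambda>j. c k * pbern k (x j)) (if k = 0 then c 0 else 0)"
    proof cases
      case 1 then show ?thesis using mean_tendsto_const[of "c 0"] by (simp add: pbern_def)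
    next
      case 2 then show ?thesis using mean_tendsto_const[of "0::real"] c1 by simp
    next
      case 3
      then show ?thesis using mean_tendsto_linear[OF bounded_linear_mult_right[of "c k"] m[OF 3]] by simp
    qed
  qed simp
  define Q where "Q = (\<Sum>k\<le>n. smult (c k) (bern (Suc k)))"
  have "pderiv Q = p" unfolding Q_def pderiv_sum by (subst c) (simp add: pderiv_smult)
  then have "degree (P - Q) = 0" using P by (simp add: pderiv_eq_0_iff[symmetric] pderiv_diff)
  then obtain d where "P - Q = [:d:]" by (elim degree_eq_zeroE)
  then have "P = Q + [:d:]" by (simp add: algebra_simps)
  then have "poly P 1 - poly P 0 = poly Q 1 - poly Q 0" by simp
  also have "\<dots> = (\<Sum>k\<le>n. c k * (poly (bern (Suc k)) 1 - poly (bern (Suc k)) 0))"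
    by (simp add: Q_def poly_sum right_diff_distrib sum_subtractf)
  also have "\<dots> = (\<Sum>k\<le>n. if k = 0 then c 0 else 0)"
    unfolding bern_increment by (intro sum.cong) auto
  finally show ?thesis using lim unfolding ev by (simp only: pbern_def)
qed

lemma mean_continuous_periodic:
  fixes f :: "real \<Rightarrow> real"
  assumes m: "\<And>k. k \<ge> 2 \<Longrightarrow> mean_tendsto (\<lambda>j. pbern k (x j)) 0"
    and f: "continuous_on {0..1} f" "f 0 = f 1" and I: "(f has_integral I) {0..1}"
  shows "mean_tendsto (\<lambda>j. f (frac (x j))) I"
proof (rule mean_tendsto_approx)
  fix e :: real assume e: "e > 0"
  have "compact {0..1::real}" by simp
  from Stone_Weierstrass_real_polynomial_function[OF this f(1), of "e / 9"] e
  obtain g where g: "real_polynomial_function g" "\<And>y. y \<in> {0..1} \<Longrightarrow> \<bar>f y - g y\<bar> < e / 9" by auto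
  from g(1) obtain a n where an: "g = (\<lambda>y. \<Sum>i\<le>n. a i * y ^ i)"
    unfolding real_polynomial_function_iff_sum by blast
  define q where "q = (\<Sum>i\<le>n. monom (a i) i)"
  have q: "poly q y = g y" for y by (simp add: q_def an poly_sum poly_monom)
  \<comment> \<open>The defect of periodicity of the approximating polynomial. Subtracting
    \<open>s * y\<close> repairs it at the price of a further \<open>2 * e / 9\<close>.\<close>
  define s where "s = poly q 1 - poly q 0"
  define p where "p = q - [:0, s:]"
  have "\<bar>f 0 - g 0\<bar> < e / 9" "\<bar>f 1 - g 1\<bar> < e / 9" by (intro g(2); simp)+
  then have s: "\<bar>s\<bar> \<le> 2 * e / 9" using f(2) unfolding s_def q by linarith
  have pf: "\<bar>f y - poly p y\<bar> \<le> e / 3" if y: "y \<in> {0..1}" for y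
  proof -
    have "\<bar>s * y\<bar> \<le> 2 * e / 9 * 1" unfolding abs_mult using s y by (intro mult_mono) auto
    moreover have "f y - poly p y = (f y - g y) + s * y" by (simp add: p_def q mult.commute)
    ultimately show ?thesis using g(2)[OF y] by linarith
  qed
  define P where "P = poly_primitive p"
  have P: "pderiv P = p" by (simp add: P_def)
  have "mean_tendsto (\<lambda>j. poly p (frac (x j))) (poly P 1 - poly P 0)"
    by (rule mean_poly_periodic[OF m P]) (auto simp: p_def s_def)
  from mean_tendstoD[OF this, of "e / 3"] e obtain N where
    N: "\<And>n. n \<ge> N \<Longrightarrow> \<bar>(\<Sum>i<n. poly p (frac (x i))) - real n * (poly P 1 - poly P 0)\<bar> \<le> e / 3 * real n" by auto
  have "\<bar>I - (poly P 1 - poly P 0)\<bar> \<le> e / 3"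
  proof -
    have hi: "((\<lambda>y. f y - poly p y) has_integral (I - (poly P 1 - poly P 0))) {0..1}"
      using has_integral_diff[OF I has_integral_poly_pderiv[of 0 1 P]] by (simp add: P)
    have "norm (integral {0..1} (\<lambda>y. f y - poly p y)) \<le> e / 3 * (1 - 0)"
      using hi pf by (intro norm_integral_le_length) auto
    then show ?thesis using integral_unique[OF hi] by simp
  qed
  note IP = this
  have fr: "frac z \<in> {0..1}" for z :: real using frac_lt_1[of z] by simp
  have "norm ((\<Sum>i<n. f (frac (x i))) - real n *\<^sub>R I) \<le> e * real n" if n: "n \<ge> N" for n
  proof -
    have 1: "\<bar>(\<Sum>i<n. f (frac (x i))) - (\<Sum>i<n. poly p (frac (x i)))\<bar> \<le> e / 3 * real n"
    proof -
      have "\<bar>(\<Sum>i<n. f (frac (x i))) - (\<Sum>i<n. poly p (frac (x i)))\<bar> \<le> (\<Sum>i<n. e / 3)"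
        unfolding sum_subtractf[symmetric] by (rule order_trans[OF sum_abs], rule sum_mono, rule pf, rule fr)
      then show ?thesis by (simp add: mult.commute)
    qed
    have 3: "\<bar>real n * (poly P 1 - poly P 0) - real n * I\<bar> \<le> e / 3 * real n"
    proof -
      have "\<bar>real n * (poly P 1 - poly P 0) - real n * I\<bar> = real n * \<bar>I - (poly P 1 - poly P 0)\<bar>"
        by (simp only: right_diff_distrib[symmetric] abs_mult abs_of_nat abs_minus_commute)
      also have "\<dots> \<le> real n * (e / 3)" using IP by (intro mult_left_mono) auto
      finally show ?thesis by (simp add: mult.commute)
    qed
    have tri: "\<bar>u - w\<bar> \<le> a + b + c" if "\<bar>u - v\<bar> \<le> a" "\<bar>v - t\<bar> \<le> b" "\<bar>t - w\<bar> \<le> c" for u v w t a b c :: real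
      using that by linarith
    from tri[OF 1 N[OF n] 3] show ?thesis by simp
  qed
  then show "\<exists>N. \<forall>n\<ge>N. norm ((\<Sum>i<n. f (frac (x i))) - real n *\<^sub>R I) \<le> e * real n" by blast
qed

lemma cis_int_frac: "cis (2 * pi * of_int m * frac y) = cis (2 * pi * of_int m * y)"
proof -
  have "cis (2 * pi * of_int m * y) = cis (2 * pi * of_int m * frac y) * cis (2 * pi * of_int (m * \<lfloor>y\<rfloor>))"
    by (simp add: cis_mult frac_def algebra_simps)
  also have "cis (2 * pi * of_int (m * \<lfloor>y\<rfloor>)) = 1" by (rule cis_multiple_2pi) simp
  finally show ?thesis by simp
qed

lemma mean_exponential:
  fixes m :: int
  assumes mb: "\<And>k. k \<ge> 2 \<Longrightarrow> mean_tendsto (\<lambda>j. pbern k (x j)) 0" and m: "m \<noteq> 0"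
  shows "mean_tendsto (\<lambda>j. cis (2 * pi * of_int m * x j)) 0"
proof -
  let ?w = "2 * pi * real_of_int m"
  have w: "?w \<noteq> 0" using m by simp
  have sc: "sin (?w * 1) = 0" "cos (?w * 1) = 1" using sin_int_2pin[of m] cos_int_2pin[of m] by simp_all
  have 1: "((\<lambda>y. cos (?w * y)) has_integral (sin (?w * 1) / ?w - sin (?w * 0) / ?w)) {0..1}"
    using w by (intro fundamental_theorem_of_calculus)
      (auto intro!: derivative_eq_intros simp flip: has_real_derivative_iff_has_vector_derivative)
  have 2: "((\<lambda>y. sin (?w * y)) has_integral (- cos (?w * 1) / ?w - (- cos (?w * 0) / ?w))) {0..1}"
    using w by (intro fundamental_theorem_of_calculus)
      (auto intro!: derivative_eq_intros simp flip: has_real_derivative_iff_has_vector_derivative)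
  have c: "mean_tendsto (\<lambda>j. cos (?w * frac (x j))) 0"
    using 1 sc by (intro mean_continuous_periodic[OF mb] continuous_intros) auto
  have s: "mean_tendsto (\<lambda>j. sin (?w * frac (x j))) 0"
    using 2 sc by (intro mean_continuous_periodic[OF mb] continuous_intros) auto
  have "mean_tendsto (\<lambda>j. of_real (cos (?w * frac (x j))) + \<i> * of_real (sin (?w * frac (x j)))) (of_real 0 + \<i> * of_real 0)"
    by (intro mean_tendsto_add mean_tendsto_linear[OF bounded_linear_of_real c]
        mean_tendsto_linear[OF bounded_linear_compose[OF bounded_linear_mult_right bounded_linear_of_real] s])
  moreover have "of_real (cos t) + \<i> * of_real (sin t) = cis t" for t by (simp add: complex_eq_iff)
  ultimately have "mean_tendsto (\<lambda>j. cis (?w * frac (x j))) 0" by simp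
  then show ?thesis unfolding cis_int_frac .
qed

text \<open>The orbit along \<open>b ^ r\<close> inherits the vanishing exponential averages: smoothing over \<open>K\<close> steps makes the
  mean square small along the full orbit, and the orbit along \<open>b ^ r\<close> has density \<open>1 / r\<close> in it.\<close>
lemma mean_exponential_power:
  fixes m :: int and b :: nat
  assumes b: "b \<ge> 2" and r: "r \<ge> 1" and m: "m \<noteq> 0"
    and mean: "\<And>n::int. n \<noteq> 0 \<Longrightarrow> mean_tendsto (\<lambda>j. cis (2 * pi * of_int n * (real b ^ j * x))) 0"
  shows "mean_tendsto (\<lambda>i. cis (2 * pi * of_int m * (real (b ^ r) ^ i * x))) 0"
proof (rule mean_tendsto_approx)
  fix e :: real assume e: "e > 0"
  define B where "B = b ^ r"
  have "b ^ 1 \<le> b ^ r" using b r by (intro power_increasing) auto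
  then have B: "B \<ge> 2" using b by (simp add: B_def)
  let ?E = "\<lambda>n y. cis (2 * pi * of_int n * y)"
  \<comment> \<open>This many steps bring the term \<open>6 * real r / (real K * e)\<close>, the
    cost of the mean square, down to \<open>e / 3\<close>.\<close>
  define K where "K = nat \<lceil>18 * real r / e\<^sup>2\<rceil> + 1"
  have K: "K \<ge> 1" "18 * real r / e\<^sup>2 \<le> real K" unfolding K_def by linarith+
  \<comment> \<open>The sum over the next \<open>K\<close> points of the \<open>B\<close>-orbit. Its
    mean square along the \<open>b\<close>-orbit is \<open>K\<close>, because the off-diagonal
    products are exponentials of nonzero frequency.\<close>
  define G where "G y = (\<Sum>k<K. ?E (m * int B ^ k) y)" for y :: real
  have G2: "mean_tendsto (\<lambda>j. complex_of_real ((norm (G (real b ^ j * x)))\<^sup>2)) (of_nat K)"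
  proof -
    have eq: "complex_of_real ((norm (G y))\<^sup>2) = (\<Sum>k<K. \<Sum>k'<K. ?E (m * int B ^ k - m * int B ^ k') y)" for y
    proof -
      have "complex_of_real ((norm (G y))\<^sup>2) = G y * cnj (G y)" by (rule complex_norm_square)
      also have "\<dots> = (\<Sum>k<K. \<Sum>k'<K. ?E (m * int B ^ k) y * cnj (?E (m * int B ^ k') y))"
        by (simp add: G_def sum_product)
      also have "\<dots> = (\<Sum>k<K. \<Sum>k'<K. ?E (m * int B ^ k - m * int B ^ k') y)"
        by (intro sum.cong refl) (simp add: cis_cnj cis_mult algebra_simps)
      finally show ?thesis .
    qed
    have "mean_tendsto (\<lambda>j. \<Sum>k<K. \<Sum>k'<K. ?E (m * int B ^ k - m * int B ^ k') (real b ^ j * x)) (\<Sum>k<K. \<Sum>k'<K. if k' = k then 1 else 0)"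
    proof (intro mean_tendsto_sum finite_lessThan)
      fix k k'
      show "mean_tendsto (\<lambda>j. ?E (m * int B ^ k - m * int B ^ k') (real b ^ j * x)) (if k' = k then 1 else 0)"
      proof (cases "k' = k")
        case True then show ?thesis using mean_tendsto_const[of "1::complex"] by simp
      next
        case False
        then have "int B ^ k \<noteq> int B ^ k'" using B by (simp flip: of_nat_power)
        then have "m * int B ^ k - m * int B ^ k' \<noteq> 0" using m by simp
        from mean[OF this] False show ?thesis by simp
      qed
    qed
    moreover have "(\<Sum>k<K. \<Sum>k'<K. if k' = k then 1 else 0) = (of_nat K :: complex)" by simp
    ultimately show ?thesis unfolding eq by simp
  qed
  from mean_tendsto_linear[OF bounded_linear_Re G2]
  have G2': "mean_tendsto (\<lambda>j. (norm (G (real b ^ j * x)))\<^sup>2) (real K)" by simp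
  obtain N where N: "\<And>n. n \<ge> N \<Longrightarrow> \<bar>(\<Sum>j<n. (norm (G (real b ^ j * x)))\<^sup>2) - real n * real K\<bar> \<le> real K * real n"
    using mean_tendstoD[OF G2', of "real K"] K by auto
  let ?u = "\<lambda>i. ?E m (real B ^ i * x)"
  have uk: "?E (m * int B ^ k) (real B ^ i * x) = ?u (i + k)" for i k
    by (simp add: power_add mult_ac)
  have shift: "norm ((\<Sum>i<n. ?u (i + k)) - (\<Sum>i<n. ?u i)) \<le> 2 * real k" for n k
  proof (induction k)
    case (Suc k)
    have "(\<Sum>i<n. ?u (i + Suc k)) - (\<Sum>i<n. ?u i) = ((\<Sum>i<n. ?u (i + k)) - (\<Sum>i<n. ?u i)) + (?u (n + k) - ?u k)"
      using sum.lessThan_Suc[of "\<lambda>i. ?u (i + k)" n] sum.lessThan_Suc_shift[of "\<lambda>i. ?u (i + k)" n] by (simp add: algebra_simps)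
    also have "norm \<dots> \<le> 2 * real k + (1 + 1)"
      by (intro norm_triangle_mono Suc order_trans[OF norm_triangle_ineq4]) simp
    finally show ?case by simp
  qed simp
  have main: "norm (\<Sum>i<n. ?u i) \<le> e * real n" if n: "n \<ge> N" "n \<ge> 1" "real n \<ge> 6 * real K / e" for n
  proof -
    have "(\<Sum>i<n. G (real B ^ i * x)) = (\<Sum>k<K. \<Sum>i<n. ?u (i + k))"
      unfolding G_def uk by (rule sum.swap)
    then have eq: "of_nat K * (\<Sum>i<n. ?u i) = (\<Sum>i<n. G (real B ^ i * x)) - (\<Sum>k<K. (\<Sum>i<n. ?u (i + k)) - (\<Sum>i<n. ?u i))"
      by (simp add: sum_subtractf)
    have nt: "real K * norm w \<le> norm u + norm v" if "of_nat K * w = u - v" for u v w :: complex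
    proof -
      have "real K * norm w = norm (of_nat K * w)" by (simp add: norm_mult)
      also have "\<dots> \<le> norm u + norm v" unfolding that by (rule norm_triangle_ineq4)
      finally show ?thesis .
    qed
    from nt[OF eq] have "real K * norm (\<Sum>i<n. ?u i) \<le> norm (\<Sum>i<n. G (real B ^ i * x)) + norm (\<Sum>k<K. (\<Sum>i<n. ?u (i + k)) - (\<Sum>i<n. ?u i))" .
    also have "norm (\<Sum>k<K. (\<Sum>i<n. ?u (i + k)) - (\<Sum>i<n. ?u i)) \<le> (\<Sum>k<K. 2 * real K)"
      by (rule sum_norm_le, rule order_trans[OF shift]) auto
    also have "norm (\<Sum>i<n. G (real B ^ i * x)) \<le> (\<Sum>i<n. real K * e / 3 + 3 / (real K * e) * (norm (G (real B ^ i * x)))\<^sup>2)"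
    proof (rule sum_norm_le)
      fix i
      \<comment> \<open>Used in place of the Cauchy-Schwarz inequality: a norm is bounded by its
        square at a free scale \<open>s\<close>.\<close>
      have am: "t \<le> s + t\<^sup>2 / s" if "s > 0" for s t :: real
      proof -
        have "s * s + t\<^sup>2 - t * s = (s / 2 - t)\<^sup>2 + 3 / 4 * s\<^sup>2" by (simp add: power2_eq_square field_simps)
        then have "t * s \<le> s * s + t\<^sup>2" using zero_le_power2[of "s / 2 - t"] zero_le_power2[of s] by linarith
        then show ?thesis using that by (simp add: field_simps power2_eq_square)
      qed
      have "real K * e / 3 > 0" using K e by simp
      from am[OF this, of "norm (G (real B ^ i * x))"]
      show "norm (G (real B ^ i * x)) \<le> real K * e / 3 + 3 / (real K * e) * (norm (G (real B ^ i * x)))\<^sup>2" by simp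
    qed
    also have "\<dots> = real n * (real K * e / 3) + 3 / (real K * e) * (\<Sum>i<n. (norm (G (real B ^ i * x)))\<^sup>2)"
      by (simp add: sum.distrib sum_distrib_left)
    also have "3 / (real K * e) * (\<Sum>i<n. (norm (G (real B ^ i * x)))\<^sup>2) \<le> 3 / (real K * e) * (real (n * r) * real K + real K * real (n * r))"
    proof (rule mult_left_mono)
      \<comment> \<open>The \<open>B\<close>-orbit consists of the times divisible by
        \<open>r\<close> in the \<open>b\<close>-orbit; squares are nonnegative, so the missing
        times may be added.\<close>
      have "(\<Sum>i<n. (norm (G (real B ^ i * x)))\<^sup>2) = (\<Sum>j\<in>(\<lambda>i. i * r) ` {..<n}. (norm (G (real b ^ j * x)))\<^sup>2)"
        using r by (subst sum.reindex) (auto simp: inj_on_def B_def power_mult[symmetric] mult.commute)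
      also have "\<dots> \<le> (\<Sum>j<n * r. (norm (G (real b ^ j * x)))\<^sup>2)"
        using r by (intro sum_mono2) auto
      also have "\<dots> \<le> real (n * r) * real K + real K * real (n * r)"
      proof -
        have "n * 1 \<le> n * r" using r by (intro mult_left_mono) auto
        then have "N \<le> n * r" using n(1) by linarith
        from N[OF this] show ?thesis by linarith
      qed
      finally show "(\<Sum>i<n. (norm (G (real B ^ i * x)))\<^sup>2) \<le> real (n * r) * real K + real K * real (n * r)" .
    qed (use e in simp)
    finally have "real K * norm (\<Sum>i<n. ?u i) \<le> real n * (real K * e / 3) + 3 / (real K * e) * (real (n * r) * real K + real K * real (n * r)) + real K * (2 * real K)"
      by simp
    also have "\<dots> = real K * (real n * (e / 3) + (6 * real r / (real K * e)) * real n + 2 * real K)"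
      using K e by (simp add: field_simps)
    finally have "norm (\<Sum>i<n. ?u i) \<le> real n * (e / 3) + (6 * real r / (real K * e)) * real n + 2 * real K"
      using K by simp
    also have "6 * real r / (real K * e) \<le> e / 3"
      using K e by (simp add: field_simps power2_eq_square)
    then have "(6 * real r / (real K * e)) * real n \<le> e / 3 * real n" by (rule mult_right_mono) simp
    also have "2 * real K \<le> e / 3 * real n" using n(3) e by (simp add: field_simps)
    finally show ?thesis by (simp add: field_simps)
  qed
  show "\<exists>N. \<forall>n\<ge>N. norm ((\<Sum>i<n. ?E m (real (b ^ r) ^ i * x)) - real n *\<^sub>R 0) \<le> e * real n"
  proof (intro exI allI impI)
    fix n assume "n \<ge> max N (max 1 (nat \<lceil>6 * real K / e\<rceil>))"
    then have "n \<ge> N" "n \<ge> 1" "real n \<ge> 6 * real K / e" by linarith+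
    from main[OF this] show "norm ((\<Sum>i<n. ?E m (real (b ^ r) ^ i * x)) - real n *\<^sub>R 0) \<le> e * real n"
      by (simp add: B_def)
  qed
qed

text \<open>From index \<open>2\<close> on the Fourier series converges uniformly, and a translation
  only rotates its coefficients, so vanishing exponential averages pass to every translate.\<close>

lemma mean_pbern_shift:
  assumes k: "k \<ge> 1" and mean: "\<And>n::int. n \<noteq> 0 \<Longrightarrow> mean_tendsto (\<lambda>i. cis (2 * pi * of_int n * y i)) 0"
  shows "mean_tendsto (\<lambda>i. pbern (Suc k) (y i - c)) 0"
proof -
  have modes: "mean_tendsto (\<lambda>i. bern_modes (Suc k) H (y i - c)) 0" for H
  proof -
    let ?a = "\<lambda>n. - (cis (- (2 * pi * of_int n * c)) / (2 * pi * \<i> * of_int n) ^ Suc k)"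
    have "mean_tendsto (\<lambda>i. \<Sum>n\<in>{- int H..int H} - {0}. ?a n * cis (2 * pi * of_int n * y i)) (\<Sum>n\<in>{- int H..int H} - {0}. ?a n * 0)"
      by (intro mean_tendsto_sum mean_tendsto_linear[OF bounded_linear_mult_right] mean) auto
    moreover have "(\<Sum>n\<in>{- int H..int H} - {0}. ?a n * cis (2 * pi * of_int n * y i)) = bern_modes (Suc k) H (y i - c)" for i
    proof -
      have "?a n * cis (2 * pi * of_int n * y i) = - (cis (2 * pi * of_int n * (y i - c)) / (2 * pi * \<i> * of_int n) ^ Suc k)" for n :: int
      proof -
        have "cis (2 * pi * of_int n * (y i - c)) = cis (- (2 * pi * of_int n * c)) * cis (2 * pi * of_int n * y i)"
          by (simp add: cis_mult algebra_simps)
        then show ?thesis by simp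
      qed
      then show ?thesis unfolding bern_modes_def by (simp only: sum_negf)
    qed
    ultimately show ?thesis by simp
  qed
  have "mean_tendsto (\<lambda>i. complex_of_real (pbern (Suc k) (y i - c))) 0"
  proof (rule mean_tendsto_approx)
    fix e :: real assume e: "e > 0"
    define H where "H = nat \<lceil>(8 / e)\<^sup>2\<rceil> + 1"
    have H: "H \<ge> 1" "(8 / e)\<^sup>2 \<le> real H" unfolding H_def by linarith+
    have "8 / e \<le> sqrt (real H)" using H(2) by (rule real_le_rsqrt)
    then have small: "4 / sqrt (real H) \<le> e / 2" using e H by (simp add: field_simps)
    obtain N where N: "\<And>n. n \<ge> N \<Longrightarrow> norm (\<Sum>i<n. bern_modes (Suc k) H (y i - c)) \<le> e / 2 * real n"
      using mean_tendstoD[OF modes[of H], of "e / 2"] e by auto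
    have "norm ((\<Sum>i<n. complex_of_real (pbern (Suc k) (y i - c))) - real n *\<^sub>R 0) \<le> e * real n" if n: "n \<ge> N" for n
    proof -
      have "(\<Sum>i<n. complex_of_real (pbern (Suc k) (y i - c))) = (\<Sum>i<n. bern_modes (Suc k) H (y i - c)) + (\<Sum>i<n. bern_rem (Suc k) H (y i - c))"
        unfolding sum.distrib[symmetric] by (simp add: bern_rem_def)
      also have "norm \<dots> \<le> e / 2 * real n + (\<Sum>i<n. 4 / sqrt (real H))"
        by (intro norm_triangle_mono N n sum_norm_le norm_bern_rem_Suc_le k H)
      also have "\<dots> \<le> e / 2 * real n + (\<Sum>i<n. e / 2)" using small by (intro add_left_mono sum_mono)
      also have "\<dots> = e * real n" by simp
      finally show ?thesis by simp
    qed
    then show "\<exists>N. \<forall>n\<ge>N. norm ((\<Sum>i<n. complex_of_real (pbern (Suc k) (y i - c))) - real n *\<^sub>R 0) \<le> e * real n" by blast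
  qed
  from mean_tendsto_linear[OF bounded_linear_Re this] show ?thesis by simp
qed

section \<open>Digit frequencies from exponential averages\<close>

lemma frac_shift_less: "0 < w \<Longrightarrow> w < 1 \<Longrightarrow> frac (t - w) - frac t = (if frac t < w then 1 - w else - w)"
proof -
  assume w: "0 < w" "w < 1"
  have "frac (t - w) = (if frac t < w then frac t + 1 - w else frac t - w)"
  proof (cases "frac t < w")
    case True
    have "t - w - (frac t + 1 - w) = of_int (\<lfloor>t\<rfloor> - 1)" by (simp add: frac_def)
    then have "t - w - (frac t + 1 - w) \<in> \<int>" by (simp only: Ints_of_int)
    then show ?thesis using True w frac_ge_0[of t] unfolding if_P[OF True] frac_unique_iff by (intro conjI) (assumption, linarith+)
  next
    case False
    have "t - w - (frac t - w) = of_int \<lfloor>t\<rfloor>" by (simp add: frac_def)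
    then have "t - w - (frac t - w) \<in> \<int>" by (simp only: Ints_of_int)
    then show ?thesis using False w frac_lt_1[of t] unfolding if_not_P[OF False] frac_unique_iff by (intro conjI) (assumption, linarith+)
  qed
  then show ?thesis by simp
qed

text \<open>\<open>w + pbern 1 (t - w) - pbern 1 t\<close> is the indicator of the arc
  \<open>frac t < w\<close>, and \<open>G z\<close> is its mean over \<open>[z, z + e]\<close>,
  expressed through the primitive \<open>pbern 2\<close>. The indicator of an arc is thus majorised
  by a continuous function whose orbit averages are known.\<close>

lemma window_majorant:
  assumes w: "0 < w" "w < 1" and e: "e > 0"
  defines "G \<equiv> \<lambda>z. w + (pbern 2 (z + e - w) - pbern 2 (z - w) - pbern 2 (z + e) + pbern 2 z) / e"
  shows "G z \<ge> 0" "(\<And>t. t \<in> {z..z + e} \<Longrightarrow> frac t < w) \<Longrightarrow> G z \<ge> 1"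
proof -
  let ?h = "\<lambda>t. pbern 1 (t - w) - pbern 1 t" and ?Q = "\<lambda>t. pbern 2 (t - w) - pbern 2 t"
  have h: "?h t = (if frac t < w then 1 - w else - w)" for t
    using frac_shift_less[OF w, of t] by (simp add: pbern_def bern_1)
  have fin: "finite {t \<in> {z..z + e}. t \<in> \<int> \<or> t - w \<in> \<int>}"
  proof -
    have "finite ({t \<in> \<int>. z \<le> t \<and> t \<le> z + e} \<union> (\<lambda>t. t + w) ` {t \<in> \<int>. z - w \<le> t \<and> t \<le> z + e - w})"
      by (intro finite_UnI finite_imageI finite_int_segment)
    moreover have "{t \<in> {z..z + e}. t \<in> \<int> \<or> t - w \<in> \<int>} \<subseteq>
      {t \<in> \<int>. z \<le> t \<and> t \<le> z + e} \<union> (\<lambda>t. t + w) ` {t \<in> \<int>. z - w \<le> t \<and> t \<le> z + e - w}"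
    proof
      fix t assume t: "t \<in> {t \<in> {z..z + e}. t \<in> \<int> \<or> t - w \<in> \<int>}"
      have "t = (t - w) + w" by simp
      then show "t \<in> {t \<in> \<int>. z \<le> t \<and> t \<le> z + e} \<union> (\<lambda>t. t + w) ` {t \<in> \<int>. z - w \<le> t \<and> t \<le> z + e - w}"
        using t by (cases "t \<in> \<int>") (auto intro!: image_eqI)
    qed
    ultimately show ?thesis by (rule finite_subset[rotated])
  qed
  have hi: "(?h has_integral (?Q (z + e) - ?Q z)) {z..z + e}"
  proof (rule fundamental_theorem_of_calculus_interior_strong[OF fin])
    fix t assume "t \<in> {z<..<z + e} - {t \<in> {z..z + e}. t \<in> \<int> \<or> t - w \<in> \<int>}"
    then have t: "t \<notin> \<int>" "t - w \<notin> \<int>" by auto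
    have "((\<lambda>t. t - w) has_real_derivative 1) (at t)" by (auto intro!: derivative_eq_intros)
    from DERIV_chain2[OF has_real_derivative_pbern[OF t(2)] this]
    have "((\<lambda>t. pbern 2 (t - w)) has_real_derivative pbern 1 (t - w)) (at t)" by (simp add: numeral_2_eq_2)
    moreover have "(pbern 2 has_real_derivative pbern 1 t) (at t)"
      using has_real_derivative_pbern[OF t(1), of 1] by (simp add: numeral_2_eq_2)
    ultimately show "(?Q has_vector_derivative ?h t) (at t)"
      unfolding has_real_derivative_iff_has_vector_derivative[symmetric] by (rule DERIV_diff)
  qed (use e in \<open>auto intro!: continuous_intros continuous_on_pbern\<close>)
  have G: "G z = w + (?Q (z + e) - ?Q z) / e" by (simp add: G_def algebra_simps)
  have ci: "((\<lambda>t. c) has_integral c * e) {z..z + e}" for c :: real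
    using has_integral_const_real[of c z "z + e"] e by (simp add: mult.commute)
  have "- w * e \<le> ?Q (z + e) - ?Q z"
    by (rule has_integral_le[OF ci hi]) (use h w in auto)
  then have "- w \<le> (?Q (z + e) - ?Q z) / e" using e by (simp only: pos_le_divide_eq)
  then show "G z \<ge> 0" unfolding G by linarith
  assume t: "\<And>t. t \<in> {z..z + e} \<Longrightarrow> frac t < w"
  have "(1 - w) * e \<le> ?Q (z + e) - ?Q z"
    by (rule has_integral_le[OF ci hi]) (use h t in auto)
  then have "1 - w \<le> (?Q (z + e) - ?Q z) / e" using e by (simp only: pos_le_divide_eq)
  then show "G z \<ge> 1" unfolding G by linarith
qed

text \<open>Moving the digit interval to the origin leaves a point of \<open>[0, 1 / B)\<close>
  modulo \<open>1\<close>, and a further shift by at most \<open>e\<close> cannot wrap around the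
  circle.\<close>

lemma digit_window:
  assumes B: "B \<ge> 2" and a: "\<lfloor>real B * frac y\<rfloor> = int a" and e: "1 / real B + e < 1"
    and t: "t \<in> {y - real a / real B..y - real a / real B + e}"
  shows "frac t < 1 / real B + e"
proof -
  have B0: "real B > 0" using B by simp
  have "real a \<le> real B * frac y" "real B * frac y < real a + 1" using a by linarith+
  then have y: "real a / real B \<le> frac y" "frac y < real a / real B + 1 / real B"
    using B0 by (simp_all add: field_simps)
  define s where "s = frac y - real a / real B + (t - (y - real a / real B))"
  have s: "0 \<le> s" "s < 1 / real B + e" using y t by (auto simp: s_def)
  have "t - s = of_int \<lfloor>y\<rfloor>" by (simp add: s_def frac_def)
  then have "t - s \<in> \<int>" by (simp only: Ints_of_int)
  then have "frac t = s" unfolding frac_unique_iff using s e by simp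
  then show ?thesis using s by simp
qed

text \<open>The arc is longer than the digit interval by the averaging width \<open>e\<close>, so
  the majorant is at least \<open>1\<close> on that interval while its mean is only
  \<open>1 / real B + e\<close>. The second \<open>e\<close> absorbs the convergence error.\<close>

lemma digit_frequency_le:
  assumes B: "B \<ge> 2" and e: "0 < e" "e \<le> 1 / 4"
    and mean: "\<And>n::int. n \<noteq> 0 \<Longrightarrow> mean_tendsto (\<lambda>i. cis (2 * pi * of_int n * y i)) 0"
  shows "\<exists>N. \<forall>n\<ge>N. (\<Sum>i<n. if \<lfloor>real B * frac (y i)\<rfloor> = int a then 1 else 0) \<le> (1 / real B + 2 * e) * real n"
proof -
  define w where "w = 1 / real B + e"
  have "1 / real B \<le> 1 / 2" "0 < 1 / real B" using B by (auto simp: field_simps)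
  then have w: "0 < w" "w < 1" using e unfolding w_def by linarith+
  define c where "c = real a / real B"
  let ?G = "\<lambda>z. w + (pbern 2 (z + e - w) - pbern 2 (z - w) - pbern 2 (z + e) + pbern 2 z) / e"
  have p: "mean_tendsto (\<lambda>i. u * pbern 2 (y i - s)) 0" for u s
    using mean_tendsto_linear[OF bounded_linear_mult_right mean_pbern_shift[OF order_refl mean], of u s]
    by (simp add: numeral_2_eq_2)
  have "mean_tendsto (\<lambda>i. w + (1 / e * pbern 2 (y i - (c - e + w)) + (- 1 / e) * pbern 2 (y i - (c + w))
      + ((- 1 / e) * pbern 2 (y i - (c - e)) + 1 / e * pbern 2 (y i - c)))) (w + (0 + 0 + (0 + 0)))"
    by (intro mean_tendsto_add mean_tendsto_const p)
  moreover have "w + (1 / e * pbern 2 (y i - (c - e + w)) + (- 1 / e) * pbern 2 (y i - (c + w))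
      + ((- 1 / e) * pbern 2 (y i - (c - e)) + 1 / e * pbern 2 (y i - c))) = ?G (y i - c)" for i
  proof -
    have "y i - (c - e + w) = y i - c + e - w" "y i - (c + w) = y i - c - w" "y i - (c - e) = y i - c + e" by simp_all
    then show ?thesis by (simp only:) (simp add: add_divide_distrib diff_divide_distrib)
  qed
  ultimately have "mean_tendsto (\<lambda>i. ?G (y i - c)) w" by simp
  from mean_tendstoD[OF this e(1)] obtain N where
    N: "\<And>n. n \<ge> N \<Longrightarrow> \<bar>(\<Sum>i<n. ?G (y i - c)) - real n * w\<bar> \<le> e * real n" by auto
  have "(\<Sum>i<n. if \<lfloor>real B * frac (y i)\<rfloor> = int a then 1 else 0) \<le> (1 / real B + 2 * e) * real n" if n: "n \<ge> N" for n
  proof -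
    have "(\<Sum>i<n. if \<lfloor>real B * frac (y i)\<rfloor> = int a then 1 else 0) \<le> (\<Sum>i<n. ?G (y i - c))"
    proof (rule sum_mono)
      fix i
      show "(if \<lfloor>real B * frac (y i)\<rfloor> = int a then 1 else 0) \<le> ?G (y i - c)"
      proof (cases "\<lfloor>real B * frac (y i)\<rfloor> = int a")
        case True
        have "frac t < w" if "t \<in> {y i - c..y i - c + e}" for t
          unfolding w_def using that w(2) by (intro digit_window[OF B True]) (auto simp: w_def c_def)
        from window_majorant(2)[OF w e(1) this] True show ?thesis by simp
      next
        case False then show ?thesis using window_majorant(1)[OF w e(1)] by simp
      qed
    qed
    also have "\<dots> \<le> real n * w + e * real n" using N[OF n] by linarith
    also have "\<dots> = (1 / real B + 2 * e) * real n" by (simp add: w_def algebra_simps)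
    finally show ?thesis .
  qed
  then show ?thesis by blast
qed

text \<open>Upper bounds suffice: the \<open>B\<close> digit frequencies add up to \<open>1\<close>,
  so the bounds for the other digits give a lower bound for \<open>a\<close>.\<close>

lemma mean_digit:
  assumes B: "B \<ge> 2" and a: "a < B"
    and mean: "\<And>n::int. n \<noteq> 0 \<Longrightarrow> mean_tendsto (\<lambda>i. cis (2 * pi * of_int n * y i)) 0"
  shows "mean_tendsto (\<lambda>i. if \<lfloor>real B * frac (y i)\<rfloor> = int a then 1 else 0) (1 / real B)"
proof (rule mean_tendsto_approx)
  let ?c = "\<lambda>a n. \<Sum>i<n. if \<lfloor>real B * frac (y i)\<rfloor> = int a then 1 else 0 :: real"
  fix e :: real assume e: "e > 0"
  \<comment> \<open>The other \<open>B - 1\<close> digits may each exceed their share by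
    \<open>2 * d\<close>, in total by at most \<open>e\<close>.\<close>
  define d where "d = min (1 / 4) (e / (2 * real B))"
  have B0: "real B > 0" using B by simp
  have d: "0 < d" "d \<le> 1 / 4" "2 * d * real B \<le> e" using e B0 by (auto simp: d_def min_def field_simps)
  have "\<forall>a. \<exists>N. \<forall>n\<ge>N. ?c a n \<le> (1 / real B + 2 * d) * real n"
    by (intro allI digit_frequency_le B d mean)
  from choice[OF this] obtain N where N: "\<And>a n. n \<ge> N a \<Longrightarrow> ?c a n \<le> (1 / real B + 2 * d) * real n" by blast
  have "\<bar>?c a n - real n * (1 / real B)\<bar> \<le> e * real n" if n: "n \<ge> (\<Sum>a<B. N a)" for n
  proof -
    have Na: "n \<ge> N a'" if "a' < B" for a'
      using member_le_sum[of a' "{..<B}" N] that n by simp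
    have one: "(\<Sum>a'<B. if \<lfloor>real B * frac z\<rfloor> = int a' then 1 else 0 :: real) = 1" for z
    proof -
      define k where "k = nat \<lfloor>real B * frac z\<rfloor>"
      have "real B * frac z < real B" using frac_lt_1[of z] B0 by simp
      then have "\<lfloor>real B * frac z\<rfloor> < int B" by (simp add: floor_less_iff)
      moreover have k: "\<lfloor>real B * frac z\<rfloor> = int k" by (simp add: k_def)
      ultimately have "k < B" by simp
      then show ?thesis unfolding k by simp
    qed
    have "(\<Sum>a'<B. ?c a' n) = real n" by (subst sum.swap) (simp only: one, simp)
    then have "?c a n = real n - (\<Sum>a'\<in>{..<B} - {a}. ?c a' n)"
      using sum.remove[of "{..<B}" a "\<lambda>a. ?c a n"] a by simp
    moreover have "(\<Sum>a'\<in>{..<B} - {a}. ?c a' n) \<le> (\<Sum>a'\<in>{..<B} - {a}. (1 / real B + 2 * d) * real n)"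
      by (intro sum_mono N Na) auto
    moreover have "(\<Sum>a'\<in>{..<B} - {a}. (1 / real B + 2 * d) * real n) = real n * ((real B - 1) * (1 / real B + 2 * d))"
      using a B by (simp add: of_nat_diff)
    moreover have "(real B - 1) * (1 / real B + 2 * d) \<le> 1 - 1 / real B + e"
    proof -
      have "(real B - 1) * (1 / real B + 2 * d) = 1 - 1 / real B + 2 * d * real B - 2 * d" using B0 by (simp add: field_simps)
      then show ?thesis using d by linarith
    qed
    then have "real n * ((real B - 1) * (1 / real B + 2 * d)) \<le> real n * (1 - 1 / real B + e)" by (rule mult_left_mono) simp
    ultimately have lo: "?c a n \<ge> real n - real n * (1 - 1 / real B + e)" by linarith
    have "2 * d * 1 \<le> 2 * d * real B" using d B by (intro mult_left_mono) auto
    then have "2 * d \<le> e" using d by linarith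
    then have "(1 / real B + 2 * d) * real n \<le> (1 / real B + e) * real n" by (intro mult_right_mono add_left_mono) auto
    with N[OF Na[OF a]] have hi: "?c a n \<le> (1 / real B + e) * real n" by linarith
    show ?thesis using lo hi by (simp add: algebra_simps abs_le_iff)
  qed
  then show "\<exists>N. \<forall>n\<ge>N. norm (?c a n - real n *\<^sub>R (1 / real B)) \<le> e * real n" by auto
qed

theorem normal_of_mean_pbern:
  assumes b: "b \<ge> 2" and x: "x > 0" "x \<notin> \<rat>"
    and mean: "\<And>k. k \<ge> 2 \<Longrightarrow> mean_tendsto (\<lambda>j. pbern k (real b ^ j * x)) 0"
  shows "normal_to_base b x"
  unfolding normal_to_base_def
proof (intro allI impI)
  fix r :: nat assume r: "1 \<le> r"
  have "b ^ 1 \<le> b ^ r" using b r by (intro power_increasing) auto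
  then have B: "b ^ r \<ge> 2" using b by simp
  show "simply_normal (b ^ r) x"
    unfolding simply_normal_iff[OF B x]
    by (intro allI impI mean_digit[OF B] mean_exponential_power[OF b r] mean_exponential mean)
qed

section \<open>Sums over the powers below a bound\<close>

lemma powers_below:
  assumes b: "b \<ge> (2::real)" and x: "x \<ge> 1"
  shows "{j. b ^ j \<le> x} = {..<Suc (nat \<lfloor>ln x / ln b\<rfloor>)}"
proof -
  have l: "ln b > 0" and lx: "ln x \<ge> 0" using b x by auto
  then have q: "0 \<le> ln x / ln b" by simp
  have "b ^ j \<le> x \<longleftrightarrow> j < Suc (nat \<lfloor>ln x / ln b\<rfloor>)" for j
  proof -
    have "b ^ j \<le> x \<longleftrightarrow> ln (b ^ j) \<le> ln x" using b x by (subst ln_le_cancel_iff) auto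
    also have "\<dots> \<longleftrightarrow> real j \<le> ln x / ln b" using b l by (simp add: ln_realpow field_simps)
    also have "\<dots> \<longleftrightarrow> int j \<le> \<lfloor>ln x / ln b\<rfloor>" by (simp add: le_floor_iff)
    also have "\<dots> \<longleftrightarrow> j < Suc (nat \<lfloor>ln x / ln b\<rfloor>)" using q by linarith
    finally show ?thesis .
  qed
  then show ?thesis by auto
qed

text \<open>There are about \<open>ln N / ln b\<close> powers up to \<open>N\<close>, so dividing by
  the logarithm or by the number of terms differs by a bounded factor.\<close>

lemma sum_powers_tendsto:
  fixes f :: "nat \<Rightarrow> real"
  assumes b: "b \<ge> (2::real)" and f: "mean_tendsto f 0"
  shows "(\<lambda>N. (\<Sum>j\<in>{j. b ^ j \<le> real N}. f j) / ln (real N)) \<longlonglongrightarrow> 0"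
proof -
  have l: "ln b > 0" using b by auto
  define J where "J N = Suc (nat \<lfloor>ln (real N) / ln b\<rfloor>)" for N :: nat
  have "filterlim (\<lambda>N. ln (real N) / ln b) at_top sequentially" using l by real_asymp
  then have "filterlim (\<lambda>N. real (J N)) at_top sequentially"
    by (rule filterlim_at_top_mono) (auto simp: J_def intro!: always_eventually, linarith)
  then have "filterlim J at_top sequentially" unfolding filterlim_sequentially_iff_filterlim_real .
  from filterlim_compose[OF f[unfolded mean_tendsto_def] this]
  have S: "(\<lambda>N. \<bar>(\<Sum>i<J N. f i) /\<^sub>R real (J N)\<bar> * (1 / ln b + 1)) \<longlonglongrightarrow> 0"
    by (intro tendsto_mult_left_zero tendsto_rabs_zero)
  show ?thesis
  proof (rule Lim_null_comparison[OF _ S])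
    have "eventually (\<lambda>N. ln (real N) \<ge> 1) sequentially" by real_asymp
    then show "\<forall>\<^sub>F N in sequentially. norm ((\<Sum>j\<in>{j. b ^ j \<le> real N}. f j) / ln (real N)) \<le> \<bar>(\<Sum>i<J N. f i) /\<^sub>R real (J N)\<bar> * (1 / ln b + 1)"
      using eventually_ge_at_top[of 1]
    proof eventually_elim
      case (elim N)
      have J: "J N \<ge> 1" "real (J N) \<le> ln (real N) / ln b + 1"
        using elim l by (auto simp: J_def)
      have s: "(\<Sum>j\<in>{j. b ^ j \<le> real N}. f j) = (\<Sum>i<J N. f i)"
        using powers_below[OF b, of "real N"] elim by (simp add: J_def)
      have "real (J N) / ln (real N) \<le> (ln (real N) / ln b + 1) / ln (real N)" using J elim by (intro divide_right_mono) auto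
      also have "\<dots> \<le> 1 / ln b + 1" using elim l by (simp add: add_divide_distrib divide_le_eq)
      finally have r: "real (J N) / ln (real N) \<le> 1 / ln b + 1" .
      have "norm ((\<Sum>j\<in>{j. b ^ j \<le> real N}. f j) / ln (real N)) = \<bar>(\<Sum>i<J N. f i) /\<^sub>R real (J N)\<bar> * (real (J N) / ln (real N))"
        unfolding s using J(1) elim by (simp add: abs_mult divide_inverse)
      also have "\<dots> \<le> \<bar>(\<Sum>i<J N. f i) /\<^sub>R real (J N)\<bar> * (1 / ln b + 1)" by (rule mult_left_mono[OF r]) simp
      finally show ?case .
    qed
  qed
qed

text \<open>Restricting \<open>N\<close> to the powers \<open>b ^ n\<close> recovers every nonempty
  partial sum.\<close>

lemma mean_tendsto_sum_powers:
  fixes f :: "nat \<Rightarrow> real" and b :: nat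
  assumes b: "b \<ge> 2" and f: "(\<lambda>N. (\<Sum>j\<in>{j. real b ^ j \<le> real N}. f j) / ln (real N)) \<longlonglongrightarrow> 0"
  shows "mean_tendsto f 0"
proof -
  have l: "ln (real b) > 0" using b by auto
  have "filterlim (\<lambda>n::nat. b ^ n) at_top sequentially"
    using b by (intro filterlim_subseq strict_monoI power_strict_increasing) auto
  from filterlim_compose[OF f this]
  have "(\<lambda>n. (\<Sum>j\<in>{j. real b ^ j \<le> real (b ^ n)}. f j) / ln (real (b ^ n))) \<longlonglongrightarrow> 0" .
  moreover have "{j. real b ^ j \<le> real (b ^ n)} = {..<Suc n}" for n
    using b by (auto simp: less_Suc_eq_le)
  ultimately have 1: "(\<lambda>n. (\<Sum>j<Suc n. f j) / (real n * ln (real b))) \<longlonglongrightarrow> 0"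
    using b by (simp add: ln_realpow)
  have "(\<lambda>n. real n * ln (real b) / real (Suc n)) \<longlonglongrightarrow> ln (real b)" by real_asymp
  from tendsto_mult[OF 1 this]
  have "(\<lambda>n. (\<Sum>j<Suc n. f j) / (real n * ln (real b)) * (real n * ln (real b) / real (Suc n))) \<longlonglongrightarrow> 0" by simp
  moreover have "eventually (\<lambda>n. (\<Sum>j<Suc n. f j) / (real n * ln (real b)) * (real n * ln (real b) / real (Suc n)) = (\<Sum>i<Suc n. f i) /\<^sub>R real (Suc n)) sequentially"
    using eventually_gt_at_top[of 0] by eventually_elim (use l in \<open>simp add: divide_simps\<close>)
  ultimately have "(\<lambda>n. (\<Sum>i<Suc n. f i) /\<^sub>R real (Suc n)) \<longlonglongrightarrow> 0" by (rule Lim_transform_eventually)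
  then show ?thesis unfolding mean_tendsto_def by (rule LIMSEQ_imp_Suc)
qed

lemma log_loss_tendsto:
  "(\<lambda>N. C * ((1 + ln (1 + ln (2 * real N + 1))) * (1 + ln (2 * real N + 1)) powr (3/4)) / ln (real N)) \<longlonglongrightarrow> 0"
  by real_asymp

lemma dker_term_sum_asymp:
  fixes a b :: real
  assumes b: "b \<ge> 2" and a: "0 < a" "a \<le> 1" and k: "k \<ge> 2"
  shows "(\<lambda>N. (\<Sum>j. dker_term k b a N j) / ln (real N) - (\<Sum>j\<in>{j. b ^ j \<le> real N}. pbern k (a * b ^ j)) / ln (real N)) \<longlonglongrightarrow> 0"
proof -
  let ?S = "\<lambda>N. \<Sum>j\<in>{j. b ^ j \<le> real N}. pbern k (a * b ^ j)"
  obtain C where "\<forall>\<^sub>F N in sequentially. summable (dker_term k b a N) \<and> \<bar>(\<Sum>j. dker_term k b a N j) - ?S N\<bar>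
      \<le> C * ((1 + ln (1 + ln (2 * real N + 1))) * (1 + ln (2 * real N + 1)) powr (3/4))"
    using dker_term_sum[OF b a, of k 1] k by auto
  then have "\<forall>\<^sub>F N in sequentially. norm ((\<Sum>j. dker_term k b a N j) / ln (real N) - ?S N / ln (real N))
      \<le> C * ((1 + ln (1 + ln (2 * real N + 1))) * (1 + ln (2 * real N + 1)) powr (3/4)) / ln (real N)"
    using eventually_ge_at_top[of 1]
  proof eventually_elim
    case (elim N)
    have "norm ((\<Sum>j. dker_term k b a N j) / ln (real N) - ?S N / ln (real N)) = \<bar>(\<Sum>j. dker_term k b a N j) - ?S N\<bar> / ln (real N)"
      using elim(2) by (simp flip: diff_divide_distrib)
    then show ?case using elim by (simp add: divide_right_mono)
  qed
  from Lim_null_comparison[OF this log_loss_tendsto] show ?thesis .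
qed

text \<open>Under normality the scales with a point near an integer are so rare that their cost of
  \<open>3\<close> per scale is a small multiple of \<open>ln N\<close>. The distance
  \<open>d\<close> is fixed before \<open>N\<close> grows, so \<open>C / d\<close> disappears in the
  limit.\<close>

lemma dker_term_1_sum_tendsto:
  fixes a \<alpha> :: real and b :: nat
  assumes b: "b \<ge> 2" and a: "0 < a" "a \<le> 1" and \<alpha>: "\<alpha> = a * real b ^ r" "\<alpha> \<notin> \<rat>"
    and nb: "normal_to_base b \<alpha>" and m: "mean_tendsto (\<lambda>j. pbern 1 (a * real b ^ j)) 0"
  shows "(\<lambda>N. (\<Sum>j. dker_term 1 (real b) a N j) / ln (real N)) \<longlonglongrightarrow> 0"
proof (rule tendstoI)
  fix e :: real assume e: "e > 0"
  have b': "real b \<ge> 2" using b by simp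
  have l: "ln (real b) > 0" using b by auto
  have a0: "\<alpha> > 0" using a b \<alpha> by simp
  \<comment> \<open>In the limit the bad scales contribute \<open>3 * e1 / ln b\<close>, which is
    \<open>e / 2\<close>.\<close>
  define e1 where "e1 = e * ln (real b) / 6"
  have e1: "e1 > 0" using e l by (simp add: e1_def)
  obtain d M where d: "d > 0" and M: "\<And>n. n \<ge> M \<Longrightarrow>
    real (card {j. j < n \<and> \<not> (d \<le> frac (real b ^ j * \<alpha>) \<and> d \<le> 1 - frac (real b ^ j * \<alpha>))}) \<le> e1 * real n"
    using normal_near_integers[OF b a0 \<alpha>(2) nb e1] by blast
  let ?good = "\<lambda>y. d \<le> frac y \<and> d \<le> 1 - frac y"
  let ?S = "\<lambda>N. \<Sum>j\<in>{j. real b ^ j \<le> real N}. pbern 1 (a * real b ^ j)"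
  let ?E = "\<lambda>C N. C * ((1 + ln (1 + ln (2 * real N + 1))) * (1 + ln (2 * real N + 1)) powr (3/4))"
  have irr: "a * real b ^ j \<notin> \<int>" for j
  proof
    assume "a * real b ^ j \<in> \<int>"
    then have "a * real b ^ j * real b ^ r / real b ^ j \<in> \<rat>"
      by (intro Rats_divide Rats_mult Rats_power Rats_of_nat subsetD[OF Ints_subset_Rats])
    then show False using \<alpha> b by simp
  qed
  obtain C where ev: "\<forall>\<^sub>F N in sequentially. summable (dker_term 1 (real b) a N) \<and> \<bar>(\<Sum>j. dker_term 1 (real b) a N j) - ?S N\<bar>
      \<le> ?E C N + (C / d + 3 * real (card {j. real b ^ j \<le> real N \<and> \<not> ?good (a * real b ^ j)}))"
    using dker_term_sum[OF b' a order_refl d irr] by auto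
  have "(\<lambda>N. \<bar>?S N / ln (real N)\<bar> + ?E C N / ln (real N) + (C / d + 3 * real r) / ln (real N) + 3 * e1 * (1 / ln (real b) + 1 / ln (real N)))
    \<longlonglongrightarrow> 0 + 0 + 0 + 3 * e1 * (1 / ln (real b) + 0)"
  proof (intro tendsto_add tendsto_mult tendsto_const tendsto_rabs_zero sum_powers_tendsto b' m log_loss_tendsto)
    show "(\<lambda>N. (C / d + 3 * real r) / ln (real N)) \<longlonglongrightarrow> 0" by real_asymp
    show "(\<lambda>N. 1 / ln (real N)) \<longlonglongrightarrow> 0" by real_asymp
  qed
  moreover have "0 + 0 + 0 + 3 * e1 * (1 / ln (real b) + 0) < e" using e l by (simp add: e1_def)
  ultimately have lt: "\<forall>\<^sub>F N in sequentially. \<bar>?S N / ln (real N)\<bar> + ?E C N / ln (real N) + (C / d + 3 * real r) / ln (real N)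
      + 3 * e1 * (1 / ln (real b) + 1 / ln (real N)) < e"
    by (rule order_tendstoD(2))
  have "\<forall>\<^sub>F N in sequentially. ln (real N) / ln (real b) \<ge> real M" using l by real_asymp
  moreover have "\<forall>\<^sub>F N in sequentially. ln (real N) > 0" by real_asymp
  ultimately show "\<forall>\<^sub>F N in sequentially. dist ((\<Sum>j. dker_term 1 (real b) a N j) / ln (real N)) 0 < e"
    using ev lt eventually_ge_at_top[of 1]
  proof eventually_elim
    case (elim N)
    define J where "J = Suc (nat \<lfloor>ln (real N) / ln (real b)\<rfloor>)"
    have "0 \<le> ln (real N) / ln (real b)" using elim l by simp
    then have J: "M \<le> J" "real J \<le> ln (real N) / ln (real b) + 1"
      using elim(1) unfolding J_def by linarith+
    let ?A = "{i. i < J \<and> \<not> ?good (real b ^ i * \<alpha>)}"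
    \<comment> \<open>The orbit of \<open>\<alpha>\<close> is that of \<open>a\<close> after
      \<open>r\<close> steps, so the first \<open>r\<close> scales are counted separately.\<close>
    have sub: "{j. real b ^ j \<le> real N \<and> \<not> ?good (a * real b ^ j)} \<subseteq> {..<r} \<union> (\<lambda>i. i + r) ` ?A"
    proof
      fix j assume j: "j \<in> {j. real b ^ j \<le> real N \<and> \<not> ?good (a * real b ^ j)}"
      have eq: "{j. real b ^ j \<le> real N} = {..<J}" unfolding J_def by (rule powers_below[OF b']) (use elim in simp)
      have "j \<in> {j. real b ^ j \<le> real N}" using j by simp
      then have jJ: "j < J" unfolding eq by simp
      show "j \<in> {..<r} \<union> (\<lambda>i. i + r) ` ?A"
      proof (cases "j < r")
        case False
        then have "real b ^ (j - r) * \<alpha> = a * real b ^ j" by (simp add: \<alpha>(1) mult_ac flip: power_add)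
        then have "j - r \<in> ?A" using j jJ by simp
        then have "(j - r) + r \<in> (\<lambda>i. i + r) ` ?A" by (rule imageI)
        then show ?thesis using False by simp
      qed simp
    qed
    have "card {j. real b ^ j \<le> real N \<and> \<not> ?good (a * real b ^ j)} \<le> card ({..<r} \<union> (\<lambda>i. i + r) ` ?A)"
      by (rule card_mono[OF _ sub]) simp
    also have "\<dots> \<le> card {..<r} + card ((\<lambda>i. i + r) ` ?A)" by (rule card_Un_le)
    also have "card ((\<lambda>i. i + r) ` ?A) \<le> card ?A" by (rule card_image_le) simp
    finally have "real (card {j. real b ^ j \<le> real N \<and> \<not> ?good (a * real b ^ j)}) \<le> real r + real (card ?A)" by simp
    also have "\<dots> \<le> real r + e1 * (ln (real N) / ln (real b) + 1)"
      using M[OF J(1)] mult_left_mono[OF J(2), of e1] e1 by linarith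
    finally have cd: "real (card {j. real b ^ j \<le> real N \<and> \<not> ?good (a * real b ^ j)}) \<le> real r + e1 * (ln (real N) / ln (real b) + 1)" .
    have "\<bar>\<Sum>j. dker_term 1 (real b) a N j\<bar> \<le> \<bar>?S N\<bar> + ?E C N + (C / d + 3 * (real r + e1 * (ln (real N) / ln (real b) + 1)))"
    proof -
      have "\<bar>D\<bar> \<le> \<bar>S\<bar> + E + (c + 3 * u)" if "\<bar>D - S\<bar> \<le> E + (c + 3 * t)" "t \<le> u" for D S E c t u :: real
        using that by linarith
      from this[OF conjunct2[OF elim(3)] cd] show ?thesis .
    qed
    then have "\<bar>\<Sum>j. dker_term 1 (real b) a N j\<bar> / ln (real N) \<le> (\<bar>?S N\<bar> + ?E C N + (C / d + 3 * (real r + e1 * (ln (real N) / ln (real b) + 1)))) / ln (real N)"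
      using elim(2) by (intro divide_right_mono) auto
    also have "\<dots> = \<bar>?S N / ln (real N)\<bar> + ?E C N / ln (real N) + (C / d + 3 * real r) / ln (real N)
      + 3 * e1 * (1 / ln (real b) + 1 / ln (real N))"
    proof -
      have "(s + E + (c + 3 * (r + e1 * (L / m + 1)))) / L = s / L + E / L + (c + 3 * r) / L + 3 * e1 * (1 / m + 1 / L)"
        if "L > 0" "m > 0" for s E c r L m :: real using that by (simp add: field_simps)
      from this[OF elim(2) l] show ?thesis using elim(2) by (simp only: abs_divide)
    qed
    also note elim(4)
    finally show ?case using elim(2) by simp
  qed
qed

text \<open>For \<open>k \<ge> 1\<close> the limit of the zeta sums is equivalent to a vanishing
  average of \<open>pbern (Suc k)\<close> along the orbit. For \<open>k = 0\<close> the average of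
  the sawtooth is carried over to the zeta sums under normality, which is at hand in that
  direction.\<close>

theorem corollary1p2:
  fixes \<alpha> :: real and b :: nat
  assumes "\<alpha> > 0" and "algebraic \<alpha>" and "\<alpha> \<notin> \<rat>" and "b \<ge> 2"
  shows "normal_to_base b \<alpha> \<longleftrightarrow>
    (\<forall>k::nat. (\<lambda>N::nat. 1 / complex_of_real (ln (real N)) *
        (\<Sum>n\<in>{n::int. 1 \<le> \<bar>n\<bar> \<and> \<bar>n\<bar> \<le> int N}.
           zeta (- of_nat k + 2 * of_real pi * \<i> * of_int n / of_real (ln (real b))) *
           (exp (2 * of_real pi * \<i> * of_int n * of_real (ln \<alpha>) / of_real (ln (real b))) /
            of_int n ^ (k + 1)))) \<longlonglongrightarrow> 0)"
proof -
  note b = \<open>b \<ge> 2\<close>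
  have b': "real b \<ge> 2" using b by simp
  have l: "ln (real b) > 0" using b by auto
  \<comment> \<open>Then \<open>b ^ r \<ge> r + 1 \<ge> \<alpha>\<close>, which gives
    \<open>a \<le> 1\<close>.\<close>
  define r where "r = nat \<lceil>\<alpha>\<rceil>"
  define a where "a = \<alpha> / real b ^ r"
  have "\<alpha> \<le> real r + 1" unfolding r_def by linarith
  also have "\<dots> \<le> real b ^ r" by (rule power_ge_Suc[OF b'])
  finally have a: "0 < a" "a \<le> 1" using b \<open>\<alpha> > 0\<close> by (auto simp: a_def)
  have \<alpha>: "\<alpha> = a * real b ^ r" using b by (simp add: a_def)
  let ?Z = "\<lambda>k N. 1 / complex_of_real (ln (real N)) *
        (\<Sum>n\<in>{n::int. 1 \<le> \<bar>n\<bar> \<and> \<bar>n\<bar> \<le> int N}.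
           zeta (- of_nat k + 2 * of_real pi * \<i> * of_int n / of_real (ln (real b))) *
           (exp (2 * of_real pi * \<i> * of_int n * of_real (ln \<alpha>) / of_real (ln (real b))) /
            of_int n ^ (k + 1)))"
  let ?D = "\<lambda>k N. (\<Sum>j. dker_term k (real b) a N j) / ln (real N)"
  have Z: "(?Z k \<longlonglongrightarrow> 0) \<longleftrightarrow> (?D (Suc k) \<longlonglongrightarrow> 0)" for k
  proof -
    define c where "c = (2 * of_real pi * \<i> / of_real (ln (real b))) ^ Suc k * complex_of_real (ln (real b))"
    have c: "c \<noteq> 0" using l by (simp add: c_def)
    have "(\<lambda>N. ?Z k N + c * of_real (?D (Suc k) N)) \<longlonglongrightarrow> 0"
      unfolding c_def by (rule zeta_series_asymp[OF b a \<alpha>])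
    then have asymp: "(\<lambda>N. ?Z k N - (- c * of_real (?D (Suc k) N))) \<longlonglongrightarrow> 0" by simp
    have "(?Z k \<longlonglongrightarrow> 0) \<longleftrightarrow> ((\<lambda>N. - c * of_real (?D (Suc k) N)) \<longlonglongrightarrow> 0)"
      using Lim_transform[OF _ asymp] Lim_transform2[OF _ asymp] by blast
    also have "\<dots> \<longleftrightarrow> ((\<lambda>N. complex_of_real (?D (Suc k) N)) \<longlonglongrightarrow> 0)"
      using tendsto_mult_left_iff[of "- c" "\<lambda>N. complex_of_real (?D (Suc k) N)" 0] c by simp
    also have "\<dots> \<longleftrightarrow> (?D (Suc k) \<longlonglongrightarrow> 0)"
      using tendsto_of_real_iff[of "?D (Suc k)" 0 sequentially, where 'a = complex] by simp
    finally show ?thesis .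
  qed
  have orbit: "mean_tendsto (\<lambda>j. pbern k (real b ^ j * \<alpha>)) 0 \<longleftrightarrow> mean_tendsto (\<lambda>j. pbern k (a * real b ^ j)) 0" for k
  proof -
    have "pbern k (real b ^ j * \<alpha>) = pbern k (a * real b ^ (j + r))" for j by (simp add: \<alpha> power_add mult_ac)
    moreover have "norm (pbern k (a * real b ^ j)) \<le> pbern_bound k" for j using pbern_bound(2) by simp
    ultimately show ?thesis using mean_tendsto_shift[of "\<lambda>j. pbern k (a * real b ^ j)" "pbern_bound k" r 0] by simp
  qed
  have D: "(?D k \<longlonglongrightarrow> 0) \<longleftrightarrow> mean_tendsto (\<lambda>j. pbern k (real b ^ j * \<alpha>)) 0" if k: "k \<ge> 2" for k
  proof -
    note asymp = dker_term_sum_asymp[OF b' a k]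
    have "(?D k \<longlonglongrightarrow> 0) \<longleftrightarrow> ((\<lambda>N. (\<Sum>j\<in>{j. real b ^ j \<le> real N}. pbern k (a * real b ^ j)) / ln (real N)) \<longlonglongrightarrow> 0)"
      using Lim_transform[OF _ asymp] Lim_transform2[OF _ asymp] by blast
    also have "\<dots> \<longleftrightarrow> mean_tendsto (\<lambda>j. pbern k (a * real b ^ j)) 0"
      using sum_powers_tendsto[OF b'] mean_tendsto_sum_powers[OF b] by blast
    finally show ?thesis unfolding orbit .
  qed
  show ?thesis
  proof
    assume nb: "normal_to_base b \<alpha>"
    have m: "mean_tendsto (\<lambda>j. pbern (Suc k) (real b ^ j * \<alpha>)) 0" for k
    proof -
      have "pderiv (bern (Suc (Suc k))) = bern (Suc k)" by simp
      from normal_mean_poly[OF b \<open>\<alpha> > 0\<close> \<open>\<alpha> \<notin> \<rat>\<close> nb this] show ?thesis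
        unfolding bern_increment by (simp add: pbern_def)
    qed
    show "\<forall>k. ?Z k \<longlonglongrightarrow> 0"
    proof
      fix k
      show "?Z k \<longlonglongrightarrow> 0"
      proof (cases k)
        case 0
        have "mean_tendsto (\<lambda>j. pbern 1 (a * real b ^ j)) 0" using m[of 0] unfolding orbit by simp
        from dker_term_1_sum_tendsto[OF b a \<alpha> \<open>\<alpha> \<notin> \<rat>\<close> nb this] show ?thesis unfolding Z 0 by simp
      next
        case (Suc k')
        then have "Suc k \<ge> 2" by simp
        from D[OF this] m[of k] show ?thesis unfolding Z by simp
      qed
    qed
  next
    assume "\<forall>k. ?Z k \<longlonglongrightarrow> 0"
    then have z: "?D (Suc k) \<longlonglongrightarrow> 0" for k using Z by blast
    have "mean_tendsto (\<lambda>j. pbern k (real b ^ j * \<alpha>)) 0" if k: "k \<ge> 2" for k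
      using z[of "k - 1"] D[OF k] k by simp
    then show "normal_to_base b \<alpha>" by (rule normal_of_mean_pbern[OF b \<open>\<alpha> > 0\<close> \<open>\<alpha> \<notin> \<rat>\<close>])
  qed
qed

end
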